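(* Let $E/F$ be the unramified quadratic extension of a non-Archimedean local field $F$ of odd residue characteristic, and let $\bar G=U(1,1)(F)$. Let $(\bar\pi,V)$ be a ramified supercuspidal representation of $\bar G$. Let $\bar\eta$ be any character of $\mathcal{O}_E^\times$ with $\bar\eta|_{E^1}=\omega_{\bar\pi}$ and $c(\bar\eta|_{\mathcal{O}_F^\times})\le\rho_0(\bar\pi)+1/2$. Then $c(\bar\pi)=c_{\bar\eta}(\bar\pi)=2\rho_0(\bar\pi)+2$ and, for all integers $m\ge0$, $$\dim(\bar\pi_{\bar\eta}^{\bar K_m})=\max\{m-c(\bar\pi)+1,0\}.$$
   Context: Fields. $F$ is a non-Archimedean local field of odd residue characteristic with ring of integers $\mathcal{O}_F$, maximal ideal $\mathcal{P}_F$, uniformizer $\varpi_F$. $E/F$ is the unramified quadratic extension (with $\mathcal{O}_E,\mathcal{P}_E$ similarly), $s$ is the nontrivial element of $\mathrm{Gal}(E/F)$, $E^1=\ker(N_{E/F})\subset E^*$. For a character $\chi$ of $\mathcal{O}_F^\times$, the conductor $c(\chi)$ is the least $n\ge 0$ such that $\chi$ is trivial on $U_F^n$, where $U_F^0=\mathcal{O}_F^\times$ and $U_F^n=1+\mathcal{P}_F^n$ for $n\ge1$. Groups. $\bar G=U(1,1)(F)$ is the group of $g\in GL_2(E)$ with ${}^s g\,J\,{}^t g=J$, where $J=\begin{pmatrix}0&1\\-1&0\end{pmatrix}$; its center is $\bar Z\cong E^1$, and it contains $G=SL_2(F)$. $\bar K_0=\bar K=\bar G\cap GL_2(\mathcal{O}_E)$;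 for $m\ge1$, $\bar K_m=\{\begin{pmatrix}a&b\\c&d\end{pmatrix}\in\bar K_0: c\in\mathcal{P}_E^m\}$; and $\bar K_m'=\alpha^{-1}\bar K_m\alpha$ for $m\ge0$, where $\alpha=\mathrm{diag}(\varpi_F,1)$. With $K_0=SL_2(\mathcal{O}_F)$, $K_m=\bar K_m\cap G$ and $\bar T_0=\{\mathrm{diag}(t,s(t)^{-1}):t\in\mathcal{O}_E^\times\}$, one has $\bar K_m=K_m\bar T_0$. Conductors. Let $(\bar\pi,V)$ be an irreducible admissible infinite-dimensional representation of $\bar G$ with central character $\omega_{\bar\pi}$ (a character of $E^1$), and let $\bar\eta$ be a character of $\mathcal{O}_E^\times$ with $\bar\eta|_{E^1}=\omega_{\bar\pi}$. For $\bar H=\bar K_m$ or $\bar K'_m$, $$\bar\pi_{\bar\eta}^{\bar H}=\{v\in V:\bar\pi(g)v=\bar\eta(d)v\ \text{ for all } g=\begin{pmatrix}a&b\\c&d\end{pmatrix}\in\bar H\}.$$ For $m=0$, where $d$ need not be a unit, this is understood as follows: if $\bar\eta|_{\mathcal{O}_F^\times}\ne 1$ the space is $0$; if $\bar\eta|_{\mathcal{O}_F^\times}=1$, then $\bar\eta(d)$ is replaced by the character of $\bar K_0=K_0\bar T_0$ sending $k\cdot\mathrm{diag}(t,s(t)^{-1})$ to $\bar\eta(s(t)^{-1})$ (and by its conjugate by $\alpha$ for $\bar K_0'$). Put $$c_{\bar\eta}(\bar\pi)=\min\{m\ge0:\bar\pi_{\bar\eta}^{\bar K_m}\neq0\text{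 or }\bar\pi_{\bar\eta}^{\bar K_m'}\ne0\},\qquad c(\bar\pi)=\min\{c_{\bar\eta}(\bar\pi):\bar\eta|_{E^1}=\omega_{\bar\pi}\}.$$ Ramified supercuspidals. A supercuspidal representation of $GL_2(F)$ is called unramified (resp. ramified) if it is compactly induced from a representation of $F^*GL_2(\mathcal{O}_F)$ (resp. of the normalizer in $GL_2(F)$ of the standard Iwahori subgroup $\widetilde I$) in Kutzko's construction, i.e. from a very cuspidal representation. (Let $\widetilde H$ be $F^*GL_2(\mathcal{O}_F)$ or $N_{GL_2(F)}(\widetilde I)$, and for $l\ge1$ let $\widetilde J(l)$ be $1+\mathcal{P}_F^lM_2(\mathcal{O}_F)$ or $\begin{pmatrix}1+\mathcal{P}_F^l&\mathcal{P}_F^l\\ \mathcal{P}_F^{l+1}&1+\mathcal{P}_F^l\end{pmatrix}$ respectively. An irreducible representation of $\widetilde H$ is very cuspidal of level $l$ if it is trivial on $\widetilde J(l)$ and does not contain the trivial character of $\begin{pmatrix}1&\mathcal{P}_F^{l-1}\\0&1\end{pmatrix}$.) An irreducible supercuspidal representation of $G=SL_2(F)$ is unramified (resp. ramified) if it occurs in the restriction to $G$ of such an unramified (resp. ramified) supercuspidal representation of $GL_2(F)$. An irreducible supercuspidal representation of $\bar G$ is unramified (resp. ramified) if its restriction to $G$ contains an unramified (resp. ramified) supercuspidal representation of $G$. Depth. $\rho(\cdot)$ denotes the Moy–Prasad depth, and $\rho_0(\bar\pi)=\min_\chi\rho(\bar\pi\otimes\chi)$, with $\chi$ ranging over all (one-dimensional)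 characters of $\bar G$. *)

theory Defs
  imports
    "HOL-Analysis.Analysis"
    "HOL-Library.Function_Algebras"
    "HOL-Algebra.Generated_Groups"
begin

section \<open>Local fields\<close>

text \<open>Valuations are integer valued; their value at 0 is never used (0 is treated as having
  valuation infinity).\<close>

definition pideal :: "('e::field \<Rightarrow> int) \<Rightarrow> 'e set \<Rightarrow> int \<Rightarrow> 'e set" where
  "pideal val K n = {x \<in> K. x = 0 \<or> val x \<ge> n}"

definition is_subfield :: "'e::field set \<Rightarrow> bool" where
  "is_subfield K \<longleftrightarrow> 0 \<in> K \<and> 1 \<in> K \<and>
     (\<forall>x\<in>K. \<forall>y\<in>K. x + y \<in> K \<and> x * y \<in> K) \<and> (\<forall>x\<in>K. - x \<in> K \<and> inverse x \<in> K)"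

text \<open>A field that is complete for a normalized discrete valuation with finite residue field.\<close>

definition nonarch_local_field :: "'e::field set \<Rightarrow> ('e \<Rightarrow> int) \<Rightarrow> bool" where
  "nonarch_local_field K val \<longleftrightarrow> is_subfield K \<and>
     (\<forall>x\<in>K - {0}. \<forall>y\<in>K - {0}. val (x * y) = val x + val y) \<and>
     (\<forall>x\<in>K - {0}. \<forall>y\<in>K - {0}. x + y \<noteq> 0 \<longrightarrow> val (x + y) \<ge> min (val x) (val y)) \<and>
     val ` (K - {0}) = UNIV \<and>
     (\<forall>a :: nat \<Rightarrow> 'e. range a \<subseteq> K \<and>
        (\<forall>k. \<exists>N. \<forall>i\<ge>N. \<forall>j\<ge>N. a i - a j \<in> pideal val K k) \<longrightarrow>
        (\<exists>l\<in>K. \<forall>k. \<exists>N. \<forall>i\<ge>N. a i - l \<in> pideal val K k)) \<and>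
     (\<exists>R. finite R \<and> R \<subseteq> pideal val K 0 \<and>
        (\<forall>x\<in>pideal val K 0. \<exists>r\<in>R. x - r \<in> pideal val K 1))"

definition residue_char :: "'e::field set \<Rightarrow> ('e \<Rightarrow> int) \<Rightarrow> nat" where
  "residue_char K val = (LEAST p. p > 0 \<and> of_nat p \<in> pideal val K 1)"


section \<open>Matrices\<close>

definition mat2 :: "'a \<Rightarrow> 'a \<Rightarrow> 'a \<Rightarrow> 'a \<Rightarrow> 'a::zero^2^2" where
  "mat2 a b c d = vector [vector [a, b], vector [c, d]]"

definition GL2 :: "('e::field^2^2) monoid" where
  "GL2 = \<lparr>carrier = {g. invertible g}, mult = (**), one = mat 1\<rparr>"

definition conjugate_by :: "'e::field^2^2 \<Rightarrow> ('e^2^2) set \<Rightarrow> ('e^2^2) set" where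
  "conjugate_by g H = (\<lambda>h. g ** h ** matrix_inv g) ` H"


section \<open>Representations on complex vector spaces\<close>

text \<open>A representation of a group \<open>H\<close> of matrices lives on a subspace \<open>V\<close> of a complex vector
  space with scalar multiplication \<open>sc\<close>; only the values \<open>\<pi> g v\<close> for \<open>g \<in> H\<close>, \<open>v \<in> V\<close> matter.\<close>

definition representation ::
  "('e::field^2^2) set \<Rightarrow> (complex \<Rightarrow> 'v::ab_group_add \<Rightarrow> 'v) \<Rightarrow> 'v set \<Rightarrow> ('e^2^2 \<Rightarrow> 'v \<Rightarrow> 'v) \<Rightarrow> bool"
where
  "representation H sc V \<pi> \<longleftrightarrow> module.subspace sc V \<and>
     (\<forall>g\<in>H. \<forall>v\<in>V. \<pi> g v \<in> V) \<and>
     (\<forall>g\<in>H. \<forall>v\<in>V. \<forall>w\<in>V. \<pi> g (v + w) = \<pi> g v + \<pi> g w) \<and>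
     (\<forall>g\<in>H. \<forall>c. \<forall>v\<in>V. \<pi> g (sc c v) = sc c (\<pi> g v)) \<and>
     (\<forall>v\<in>V. \<pi> (mat 1) v = v) \<and>
     (\<forall>g\<in>H. \<forall>h\<in>H. \<forall>v\<in>V. \<pi> (g ** h) v = \<pi> g (\<pi> h v))"

definition irreducible_rep ::
  "('e::field^2^2) set \<Rightarrow> (complex \<Rightarrow> 'v::ab_group_add \<Rightarrow> 'v) \<Rightarrow> 'v set \<Rightarrow> ('e^2^2 \<Rightarrow> 'v \<Rightarrow> 'v) \<Rightarrow> bool"
where
  "irreducible_rep H sc V \<pi> \<longleftrightarrow> representation H sc V \<pi> \<and> V \<noteq> {0} \<and>
     (\<forall>U. module.subspace sc U \<and> U \<subseteq> V \<and> (\<forall>g\<in>H. \<forall>u\<in>U. \<pi> g u \<in> U) \<longrightarrow> U = {0} \<or> U = V)"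

definition invariants :: "'g set \<Rightarrow> 'v set \<Rightarrow> ('g \<Rightarrow> 'v \<Rightarrow> 'v) \<Rightarrow> 'v set" where
  "invariants H V \<pi> = {v \<in> V. \<forall>g\<in>H. \<pi> g v = v}"

definition finite_dimensional :: "(complex \<Rightarrow> 'v::ab_group_add \<Rightarrow> 'v) \<Rightarrow> 'v set \<Rightarrow> bool" where
  "finite_dimensional sc U \<longleftrightarrow> (\<exists>B. finite B \<and> module.span sc B = U)"

definition embedding ::
  "'g set \<Rightarrow> (complex \<Rightarrow> 'v::ab_group_add \<Rightarrow> 'v) \<Rightarrow> 'v set \<Rightarrow> ('g \<Rightarrow> 'v \<Rightarrow> 'v) \<Rightarrow>
   (complex \<Rightarrow> 'w::ab_group_add \<Rightarrow> 'w) \<Rightarrow> 'w set \<Rightarrow> ('g \<Rightarrow> 'w \<Rightarrow> 'w) \<Rightarrow> ('v \<Rightarrow> 'w) \<Rightarrow> bool"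
where
  "embedding H sc V \<pi> sc' W \<rho> T \<longleftrightarrow> T ` V \<subseteq> W \<and> inj_on T V \<and>
     (\<forall>v\<in>V. \<forall>w\<in>V. T (v + w) = T v + T w) \<and>
     (\<forall>c. \<forall>v\<in>V. T (sc c v) = sc' c (T v)) \<and>
     (\<forall>g\<in>H. \<forall>v\<in>V. T (\<pi> g v) = \<rho> g (T v))"

definition scale_vec :: "complex \<Rightarrow> (nat \<Rightarrow> complex) \<Rightarrow> (nat \<Rightarrow> complex)" where
  "scale_vec c x = (\<lambda>i. c * x i)"

definition scale_fun :: "complex \<Rightarrow> ('g \<Rightarrow> nat \<Rightarrow> complex) \<Rightarrow> ('g \<Rightarrow> nat \<Rightarrow> complex)" where
  "scale_fun c f = (\<lambda>g. scale_vec c (f g))"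


section \<open>The unramified quadratic extension and its groups\<close>

text \<open>The field \<open>E\<close> is the whole type, \<open>F\<close> is a subfield of it. Both are local fields for the
  \<^emph>\<open>same\<close> normalized valuation, i.e. the ramification index of \<open>E/F\<close> is 1.
  The element \<open>unif\<close> is a uniformizer of \<open>F\<close>.\<close>

locale unramified_quadratic =
  fixes F :: "'e::field set" and val :: "'e \<Rightarrow> int" and s :: "'e \<Rightarrow> 'e" and unif :: 'e
  assumes F_local: "nonarch_local_field F val"
    and E_local: "nonarch_local_field (UNIV :: 'e set) val"
    and odd_residue_char: "odd (residue_char F val)"
    and quadratic: "\<exists>b. b \<notin> F \<and> (\<forall>x. \<exists>a\<in>F. \<exists>c\<in>F. x = a + c * b)"
    and s_bij: "bij s"
    and s_add: "s (x + y) = s x + s y"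
    and s_mult: "s (x * y) = s x * s y"
    and s_fixes: "x \<in> F \<Longrightarrow> s x = x"
    and s_nontrivial: "s \<noteq> id"
    and uniformizer: "unif \<in> F" "unif \<noteq> 0" "val unif = 1"
begin

abbreviation OF :: "'e set" where "OF \<equiv> pideal val F 0"
abbreviation OE :: "'e set" where "OE \<equiv> pideal val UNIV 0"
abbreviation PF :: "int \<Rightarrow> 'e set" where "PF \<equiv> pideal val F"
abbreviation PE :: "int \<Rightarrow> 'e set" where "PE \<equiv> pideal val UNIV"

definition units_F :: "'e set" where "units_F = {x \<in> F. x \<noteq> 0 \<and> val x = 0}"
definition units_E :: "'e set" where "units_E = {x. x \<noteq> 0 \<and> val x = 0}"
definition E1 :: "'e set" where "E1 = {x. x * s x = 1}"

definition U_F :: "nat \<Rightarrow> 'e set" where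
  "U_F n = (if n = 0 then units_F else {1 + y | y. y \<in> PF (int n)})"

definition U_E :: "nat \<Rightarrow> 'e set" where
  "U_E n = (if n = 0 then units_E else {1 + y | y. y \<in> PE (int n)})"

text \<open>A (continuous, hence smooth) character of the unit group of \<open>E\<close>; values of \<open>\<eta>\<close> off the
  units are irrelevant.\<close>

definition unit_char :: "('e \<Rightarrow> complex) \<Rightarrow> bool" where
  "unit_char \<eta> \<longleftrightarrow> (\<forall>x\<in>units_E. \<eta> x \<noteq> 0) \<and>
     (\<forall>x\<in>units_E. \<forall>y\<in>units_E. \<eta> (x * y) = \<eta> x * \<eta> y) \<and> (\<exists>n. \<forall>x\<in>U_E n. \<eta> x = 1)"

definition char_conductor_F :: "('e \<Rightarrow> complex) \<Rightarrow> nat" where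
  "char_conductor_F \<xi> = (LEAST n. \<forall>x\<in>U_F n. \<xi> x = 1)"

definition GL2F :: "('e^2^2) set" where
  "GL2F = {g. (\<forall>i j. g $ i $ j \<in> F) \<and> det g \<noteq> 0}"

definition SL2F :: "('e^2^2) set" where
  "SL2F = {g. (\<forall>i j. g $ i $ j \<in> F) \<and> det g = 1}"

definition GL2_OF :: "('e^2^2) set" where
  "GL2_OF = {g. (\<forall>i j. g $ i $ j \<in> OF) \<and> det g \<in> units_F}"

definition GL2_OE :: "('e^2^2) set" where
  "GL2_OE = {g. (\<forall>i j. g $ i $ j \<in> OE) \<and> det g \<in> units_E}"

definition SL2_OF :: "('e^2^2) set" where
  "SL2_OF = {g. (\<forall>i j. g $ i $ j \<in> OF) \<and> det g = 1}"

definition unipotent :: "('e^2^2) set" where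
  "unipotent = {mat2 1 b 0 1 | b. b \<in> F}"

definition J :: "'e^2^2" where "J = mat2 0 1 (-1) 0"

definition U11 :: "('e^2^2) set" where
  "U11 = {g. invertible g \<and> map_matrix s g ** J ** transpose g = J}"

definition torus_elt :: "'e \<Rightarrow> 'e^2^2" where
  "torus_elt t = mat2 t 0 0 (inverse (s t))"

definition Kbar :: "nat \<Rightarrow> ('e^2^2) set" where
  "Kbar m = {g \<in> U11 \<inter> GL2_OE. m = 0 \<or> g $ 2 $ 1 \<in> PE (int m)}"

definition \<alpha> :: "'e^2^2" where "\<alpha> = mat2 unif 0 0 1"

definition Kbar' :: "nat \<Rightarrow> ('e^2^2) set" where
  "Kbar' m = conjugate_by (matrix_inv \<alpha>) (Kbar m)"


section \<open>Smooth representations and supercuspidality\<close>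

definition open_in :: "('e^2^2) set \<Rightarrow> ('e^2^2) set \<Rightarrow> bool" where
  "open_in H U \<longleftrightarrow> U \<subseteq> H \<and>
     (\<forall>g\<in>U. \<exists>n. \<forall>h\<in>H. (\<forall>i j. h $ i $ j - g $ i $ j \<in> PE n) \<longrightarrow> h \<in> U)"

definition open_subgroup :: "('e^2^2) set \<Rightarrow> ('e^2^2) set \<Rightarrow> bool" where
  "open_subgroup H K \<longleftrightarrow> subgroup K GL2 \<and> open_in H K"

definition smooth_rep ::
  "('e^2^2) set \<Rightarrow> (complex \<Rightarrow> 'v::ab_group_add \<Rightarrow> 'v) \<Rightarrow> 'v set \<Rightarrow> ('e^2^2 \<Rightarrow> 'v \<Rightarrow> 'v) \<Rightarrow> bool"
where
  "smooth_rep H sc V \<pi> \<longleftrightarrow> representation H sc V \<pi> \<and> (\<forall>v\<in>V. open_in H {g \<in> H. \<pi> g v = v})"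

definition admissible_rep ::
  "('e^2^2) set \<Rightarrow> (complex \<Rightarrow> 'v::ab_group_add \<Rightarrow> 'v) \<Rightarrow> 'v set \<Rightarrow> ('e^2^2 \<Rightarrow> 'v \<Rightarrow> 'v) \<Rightarrow> bool"
where
  "admissible_rep H sc V \<pi> \<longleftrightarrow> smooth_rep H sc V \<pi> \<and>
     (\<forall>K. open_subgroup H K \<longrightarrow> finite_dimensional sc (invariants K V \<pi>))"

text \<open>Irreducible supercuspidal: irreducible and admissible, with vanishing Jacquet module.
  In each of \<open>GL\<^sub>2(F)\<close>, \<open>SL\<^sub>2(F)\<close> and \<open>U(1,1)(F)\<close> the proper parabolic subgroups are the conjugates
  of the upper triangular one, and its unipotent radical is the same group \<open>unipotent\<close>.\<close>

definition supercuspidal ::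
  "('e^2^2) set \<Rightarrow> (complex \<Rightarrow> 'v::ab_group_add \<Rightarrow> 'v) \<Rightarrow> 'v set \<Rightarrow> ('e^2^2 \<Rightarrow> 'v \<Rightarrow> 'v) \<Rightarrow> bool"
where
  "supercuspidal H sc V \<pi> \<longleftrightarrow> admissible_rep H sc V \<pi> \<and> irreducible_rep H sc V \<pi> \<and>
     module.span sc {\<pi> n v - v | n v. n \<in> unipotent \<and> v \<in> V} = V"


section \<open>Ramified supercuspidal representations\<close>

definition iwahori :: "('e^2^2) set" where
  "iwahori = {g \<in> GL2_OF. g $ 2 $ 1 \<in> PF 1}"

definition iwahori_normalizer :: "('e^2^2) set" where
  "iwahori_normalizer = {g \<in> GL2F. conjugate_by g iwahori = iwahori}"

definition J_ram :: "nat \<Rightarrow> ('e^2^2) set" where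
  "J_ram l = {mat2 (1 + a) b c (1 + d) | a b c d.
     a \<in> PF (int l) \<and> b \<in> PF (int l) \<and> c \<in> PF (int l + 1) \<and> d \<in> PF (int l)}"

text \<open>The representation space is taken inside \<open>nat \<Rightarrow> complex\<close>, which has room for every
  finite-dimensional space; very cuspidal representations are finite-dimensional.\<close>

definition very_cuspidal_ram ::
  "nat \<Rightarrow> (nat \<Rightarrow> complex) set \<Rightarrow> ('e^2^2 \<Rightarrow> (nat \<Rightarrow> complex) \<Rightarrow> (nat \<Rightarrow> complex)) \<Rightarrow> bool"
where
  "very_cuspidal_ram l X \<sigma> \<longleftrightarrow> l \<ge> 1 \<and> irreducible_rep iwahori_normalizer scale_vec X \<sigma> \<and>
     (\<forall>g\<in>J_ram l. \<forall>x\<in>X. \<sigma> g x = x) \<and>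
     invariants {mat2 1 b 0 1 | b. b \<in> PF (int l - 1)} X \<sigma> = {0}"

text \<open>Compact induction from an open subgroup \<open>H\<close> of \<open>G\<close>: since \<open>H\<close> is open, a support that is
  compact modulo \<open>H\<close> is a finite union of cosets \<open>H x\<close>. Functions are extended by 0 off \<open>G\<close>.\<close>

definition cInd ::
  "('e^2^2) set \<Rightarrow> ('e^2^2) set \<Rightarrow> (nat \<Rightarrow> complex) set \<Rightarrow>
   ('e^2^2 \<Rightarrow> (nat \<Rightarrow> complex) \<Rightarrow> (nat \<Rightarrow> complex)) \<Rightarrow> ('e^2^2 \<Rightarrow> nat \<Rightarrow> complex) set"
where
  "cInd G H X \<sigma> = {f. (\<forall>g. g \<notin> G \<longrightarrow> f g = 0) \<and> (\<forall>g\<in>G. f g \<in> X) \<and>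
     (\<forall>h\<in>H. \<forall>g\<in>G. f (h ** g) = \<sigma> h (f g)) \<and>
     (\<exists>K. open_subgroup G K \<and> (\<forall>g\<in>G. \<forall>k\<in>K. f (g ** k) = f g)) \<and>
     (\<exists>S. finite S \<and> S \<subseteq> G \<and> (\<forall>g\<in>G. f g \<noteq> 0 \<longrightarrow> (\<exists>h\<in>H. \<exists>x\<in>S. g = h ** x)))}"

definition right_translation ::
  "'e^2^2 \<Rightarrow> ('e^2^2 \<Rightarrow> nat \<Rightarrow> complex) \<Rightarrow> ('e^2^2 \<Rightarrow> nat \<Rightarrow> complex)" where
  "right_translation g f = (\<lambda>x. f (x ** g))"

definition ramified_GL2F ::
  "(complex \<Rightarrow> 'w::ab_group_add \<Rightarrow> 'w) \<Rightarrow> 'w set \<Rightarrow> ('e^2^2 \<Rightarrow> 'w \<Rightarrow> 'w) \<Rightarrow> bool"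
where
  "ramified_GL2F sc W \<rho> \<longleftrightarrow> supercuspidal GL2F sc W \<rho> \<and>
     (\<exists>l X \<sigma> T. very_cuspidal_ram l X \<sigma> \<and>
        embedding GL2F sc W \<rho> scale_fun (cInd GL2F iwahori_normalizer X \<sigma>) right_translation T \<and>
        T ` W = cInd GL2F iwahori_normalizer X \<sigma>)"

text \<open>The existential over representations of \<open>GL\<^sub>2(F)\<close> runs over subspaces of a type containing
  all the compactly induced ones, hence up to isomorphism over all ramified ones.\<close>

definition ramified_SL2F ::
  "(complex \<Rightarrow> 'v::ab_group_add \<Rightarrow> 'v) \<Rightarrow> 'v set \<Rightarrow> ('e^2^2 \<Rightarrow> 'v \<Rightarrow> 'v) \<Rightarrow> bool"
where
  "ramified_SL2F sc U \<tau> \<longleftrightarrow> supercuspidal SL2F sc U \<tau> \<and>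
     (\<exists>(W :: ('e^2^2 \<Rightarrow> nat \<Rightarrow> complex) set) \<rho> T.
        ramified_GL2F scale_fun W \<rho> \<and> embedding SL2F sc U \<tau> scale_fun W \<rho> T)"

definition ramified_U11 ::
  "(complex \<Rightarrow> 'v::ab_group_add \<Rightarrow> 'v) \<Rightarrow> 'v set \<Rightarrow> ('e^2^2 \<Rightarrow> 'v \<Rightarrow> 'v) \<Rightarrow> bool"
where
  "ramified_U11 sc V \<pi> \<longleftrightarrow> supercuspidal U11 sc V \<pi> \<and> (\<exists>U\<subseteq>V. ramified_SL2F sc U \<pi>)"


section \<open>Conductors\<close>

definition central_char ::
  "(complex \<Rightarrow> 'v::ab_group_add \<Rightarrow> 'v) \<Rightarrow> 'v set \<Rightarrow> ('e^2^2 \<Rightarrow> 'v \<Rightarrow> 'v) \<Rightarrow> 'e \<Rightarrow> complex"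
where
  "central_char sc V \<pi> z = (THE c. \<forall>v\<in>V. \<pi> (mat z) v = sc c v)"

text \<open>The two spaces of vectors transforming by \<open>\<eta>\<close> under \<open>Kbar m\<close> and \<open>Kbar' m\<close>. For \<open>m = 0\<close> the
  lower right entry need not be a unit, and the character is given on \<open>SL\<^sub>2(O\<^sub>F)\<close> times the
  integral torus.\<close>

definition eta_space ::
  "(complex \<Rightarrow> 'v::ab_group_add \<Rightarrow> 'v) \<Rightarrow> 'v set \<Rightarrow> ('e^2^2 \<Rightarrow> 'v \<Rightarrow> 'v) \<Rightarrow> ('e \<Rightarrow> complex) \<Rightarrow>
   nat \<Rightarrow> 'v set"
where
  "eta_space sc V \<pi> \<eta> m =
     (if m \<ge> 1 then {v \<in> V. \<forall>g\<in>Kbar m. \<pi> g v = sc (\<eta> (g $ 2 $ 2)) v}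
      else if \<forall>x\<in>units_F. \<eta> x = 1 then
        {v \<in> V. \<forall>k\<in>SL2_OF. \<forall>t\<in>units_E. \<pi> (k ** torus_elt t) v = sc (\<eta> (inverse (s t))) v}
      else {0})"

definition eta_space' ::
  "(complex \<Rightarrow> 'v::ab_group_add \<Rightarrow> 'v) \<Rightarrow> 'v set \<Rightarrow> ('e^2^2 \<Rightarrow> 'v \<Rightarrow> 'v) \<Rightarrow> ('e \<Rightarrow> complex) \<Rightarrow>
   nat \<Rightarrow> 'v set"
where
  "eta_space' sc V \<pi> \<eta> m =
     (if m \<ge> 1 then {v \<in> V. \<forall>g\<in>Kbar' m. \<pi> g v = sc (\<eta> (g $ 2 $ 2)) v}
      else if \<forall>x\<in>units_F. \<eta> x = 1 then
        {v \<in> V. \<forall>k\<in>SL2_OF. \<forall>t\<in>units_E.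
           \<pi> (matrix_inv \<alpha> ** (k ** torus_elt t) ** \<alpha>) v = sc (\<eta> (inverse (s t))) v}
      else {0})"

definition eta_conductor ::
  "(complex \<Rightarrow> 'v::ab_group_add \<Rightarrow> 'v) \<Rightarrow> 'v set \<Rightarrow> ('e^2^2 \<Rightarrow> 'v \<Rightarrow> 'v) \<Rightarrow> ('e \<Rightarrow> complex) \<Rightarrow> nat"
where
  "eta_conductor sc V \<pi> \<eta> =
     (LEAST m. eta_space sc V \<pi> \<eta> m \<noteq> {0} \<or> eta_space' sc V \<pi> \<eta> m \<noteq> {0})"

definition conductor ::
  "(complex \<Rightarrow> 'v::ab_group_add \<Rightarrow> 'v) \<Rightarrow> 'v set \<Rightarrow> ('e^2^2 \<Rightarrow> 'v \<Rightarrow> 'v) \<Rightarrow> nat"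
where
  "conductor sc V \<pi> = (LEAST n. \<exists>\<eta>. unit_char \<eta> \<and>
     (\<forall>z\<in>E1. \<eta> z = central_char sc V \<pi> z) \<and> n = eta_conductor sc V \<pi> \<eta>)"


section \<open>Moy--Prasad depth for \<open>U(1,1)\<close>\<close>

text \<open>The standard apartment is the real line, with origin the vertex fixed by \<open>Kbar 0\<close>; the affine
  roots are \<open>x \<mapsto> x + n\<close> and \<open>x \<mapsto> -x + n\<close> for integers \<open>n\<close>. For \<open>r > 0\<close> the filtration subgroup at \<open>x\<close>
  is generated by the congruence subgroup of the torus of depth \<open>r\<close> and the affine root groups
  whose affine root is at least \<open>r\<close> at \<open>x\<close>.\<close>

definition moy_prasad :: "real \<Rightarrow> real \<Rightarrow> ('e^2^2) set" where
  "moy_prasad x r = generate GL2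
     ({torus_elt t | t. t \<noteq> 0 \<and> (t = 1 \<or> of_int (val (t - 1)) \<ge> r)} \<union>
      {mat2 1 b 0 1 | b. b \<in> F \<and> (b = 0 \<or> of_int (val b) + x \<ge> r)} \<union>
      {mat2 1 0 c 1 | c. c \<in> F \<and> (c = 0 \<or> of_int (val c) - x \<ge> r)})"

definition moy_prasad_plus :: "real \<Rightarrow> real \<Rightarrow> ('e^2^2) set" where
  "moy_prasad_plus x r = (\<Union>t\<in>{r<..}. moy_prasad x t)"

text \<open>Every point of the building is a translate \<open>g \<cdot> x\<close> of a point of the standard apartment.
  The infimum is attained, by Moy and Prasad.\<close>

definition depth :: "'v set \<Rightarrow> ('e^2^2 \<Rightarrow> 'v::ab_group_add \<Rightarrow> 'v) \<Rightarrow> real" where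
  "depth V \<pi> = Inf {r. r \<ge> 0 \<and>
     (\<exists>g\<in>U11. \<exists>x. invariants (conjugate_by g (moy_prasad_plus x r)) V \<pi> \<noteq> {0})}"

definition character_U11 :: "('e^2^2 \<Rightarrow> complex) \<Rightarrow> bool" where
  "character_U11 \<xi> \<longleftrightarrow> (\<forall>g\<in>U11. \<xi> g \<noteq> 0) \<and> (\<forall>g\<in>U11. \<forall>h\<in>U11. \<xi> (g ** h) = \<xi> g * \<xi> h) \<and>
     open_in U11 {g \<in> U11. \<xi> g = 1}"

definition min_depth ::
  "(complex \<Rightarrow> 'v::ab_group_add \<Rightarrow> 'v) \<Rightarrow> 'v set \<Rightarrow> ('e^2^2 \<Rightarrow> 'v \<Rightarrow> 'v) \<Rightarrow> real"
where
  "min_depth sc V \<pi> = Inf {depth V (\<lambda>g v. sc (\<xi> g) (\<pi> g v)) | \<xi>. character_U11 \<xi>}"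

end

end

theory Submission
  imports Defs "HOL-Computational_Algebra.Fundamental_Theorem_Algebra"
begin

text \<open>Write \<open>u\<close>, \<open>lo\<close>, \<open>h\<close>, \<open>j\<close> for the operators of the upper and lower unipotent elements, the torus
  and \<open>J\<close>. A vector has level \<open>k\<close> if \<open>u\<close> is trivial on \<open>PF k\<close> and the average over \<open>PF (k - 1)\<close> kills it.
  If the inducing representation is very cuspidal of level \<open>l\<close>, then evaluation at the identity
  produces a nonzero vector in the space \<open>Y l\<close> of vectors \<open>v\<close> fixed by the torus elements of \<open>F\<close> close
  to 1 and such that \<open>v\<close> has level \<open>l\<close> and \<open>j v\<close> has level \<open>l + 1\<close>. More generally, in \<open>Y k\<close> the two
  levels are \<open>k\<close> and \<open>2 l + 1 - k\<close>, and the torus permutes the \<open>Y k\<close> by even shifts. The translates of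
  one vector of \<open>Y l\<close> span the representation, and each of them is of the form \<open>u b z\<close> with \<open>z\<close> in some
  \<open>Y k\<close>. Averaging separates levels, and so a nonzero vector fixed by \<open>u (PF m)\<close> and \<open>lo (PF n)\<close>
  has \<open>m + n > 2 l\<close>; this bounds the conductor and the depth from below.

  The same elimination applied to an \<open>\<eta>\<close>-isotypic vector leaves only the terms \<open>z\<close> in the isotypic
  parts of the \<open>Y k\<close> with \<open>2 l + 1 - m \<le> k \<le> 0\<close>. These parts are lines: for the projection \<open>A\<close> to the
  isotypic part, the operators \<open>A g\<close> with \<open>g\<close> in the Iwahori subgroup commute, because \<open>A g\<close>
  does not change under the anti-involution \<open>iota\<close> (Gelfand's trick). Counting them gives the
  dimension. The depth is minimized by twisting with a power of \<open>\<eta> \<circ> det\<close> that makes a vector of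
  \<open>Y l\<close> invariant under the one-units of the centre.\<close>

text \<open>Since the minimal depth turns out to be \<open>l - 1/2\<close>, the hypothesis on
  \<open>\<eta>\<close> says that its conductor on \<open>F\<close> is at most \<open>l\<close>.
  This is exactly compatibility with \<open>Y k\<close>: torus elements of \<open>F\<close> in
  \<open>1 + PF l\<close> fix \<open>Y k\<close>, and a unit of \<open>E\<close> with norm close to
  1 is such an element times an element of \<open>E1\<close>, which acts by the central character.
  The conductor \<open>2 l + 1\<close> is the sum of the two levels of a vector of
  \<open>Y k\<close>: the torus shifts them in opposite directions and \<open>J\<close> exchanges
  them. The obstacle is that \<open>u b z\<close> leaves \<open>Y k\<close> when \<open>b\<close> is
  outside \<open>PF (k - l)\<close>. The relation \<open>u b = lo (1/b) h b j lo (1/b)\<close> shows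
  that the level of \<open>j (u b z)\<close> can then only grow, which suffices for the lower
  bounds. For the exact dimension these terms have to disappear; averages over one-units of
  \<open>F\<close> in the torus kill them, because such a one-unit moves \<open>b\<close>. That
  \<open>E/F\<close> is unramified enters through norms: every unit of \<open>F\<close> is a norm
  modulo every power of the maximal ideal. So the torus can exchange upper and lower parameters of
  equal valuation, and this is the symmetry under \<open>iota\<close> on which Gelfand's trick
  rests.\<close>

context unramified_quadratic begin

section \<open>Arithmetic of the valuation and Hensel's lemma for squares\<close>

lemma F_zero [simp, intro]: "0 \<in> F" and F_one [simp, intro]: "1 \<in> F"
  and F_add [simp, intro]: "x \<in> F \<Longrightarrow> y \<in> F \<Longrightarrow> x + y \<in> F"
  and F_mult [simp, intro]: "x \<in> F \<Longrightarrow> y \<in> F \<Longrightarrow> x * y \<in> F"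
  and F_minus [simp, intro]: "x \<in> F \<Longrightarrow> - x \<in> F"
  and F_inverse [simp, intro]: "x \<in> F \<Longrightarrow> inverse x \<in> F"
  using F_local unfolding nonarch_local_field_def is_subfield_def by auto

lemma F_diff [simp, intro]: "x \<in> F \<Longrightarrow> y \<in> F \<Longrightarrow> x - y \<in> F"
  using F_add[of x "- y"] by simp

lemma F_divide [simp, intro]: "x \<in> F \<Longrightarrow> y \<in> F \<Longrightarrow> x / y \<in> F"
  by (simp add: divide_inverse)

lemma F_power [simp, intro]: "x \<in> F \<Longrightarrow> x ^ n \<in> F"
  by (induction n) auto

lemma F_power_int [simp, intro]: "x \<in> F \<Longrightarrow> x powi n \<in> F"
  by (simp add: power_int_def)

lemma F_of_nat [simp, intro]: "of_nat n \<in> F"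
  by (induction n) auto

lemma F_numeral [simp, intro]: "numeral n \<in> F"
  using F_of_nat[of "numeral n"] by simp

lemma F_minus_iff [simp]: "- x \<in> F \<longleftrightarrow> x \<in> F"
  using F_minus[of "- x"] by auto

lemma val_mult: "x \<noteq> 0 \<Longrightarrow> y \<noteq> 0 \<Longrightarrow> val (x * y) = val x + val y"
  using E_local unfolding nonarch_local_field_def by auto

lemma val_add: "x \<noteq> 0 \<Longrightarrow> y \<noteq> 0 \<Longrightarrow> x + y \<noteq> 0 \<Longrightarrow> val (x + y) \<ge> min (val x) (val y)"
  using E_local unfolding nonarch_local_field_def by auto

lemma val_one [simp]: "val 1 = 0"
  using val_mult[of 1 1] by simp

lemma val_minus [simp]: "val (- x) = val x"
proof (cases "x = 0")
  case False
  have "val (- 1) + val (- 1) = val ((- 1) * (- 1))"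
    by (rule val_mult[symmetric]) simp_all
  hence "val (- 1) = 0" by simp
  thus ?thesis using val_mult[of "- 1" x] False by simp
qed simp

lemma val_inverse: "x \<noteq> 0 \<Longrightarrow> val (inverse x) = - val x"
  using val_mult[of x "inverse x"] by simp

lemma val_divide: "x \<noteq> 0 \<Longrightarrow> y \<noteq> 0 \<Longrightarrow> val (x / y) = val x - val y"
  by (simp add: divide_inverse val_mult val_inverse)

lemma val_power: "x \<noteq> 0 \<Longrightarrow> val (x ^ n) = int n * val x"
  by (induction n) (simp_all add: val_mult algebra_simps)

lemma val_power_int: "x \<noteq> 0 \<Longrightarrow> val (x powi n) = n * val x"
  by (simp add: power_int_def val_power val_inverse)

lemma val_unif_power [simp]: "val (unif powi n) = n"
  by (simp add: val_power_int uniformizer)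

lemma unif_nz [simp]: "unif \<noteq> 0"
  by (rule uniformizer)

lemma unif_power_F [simp, intro]: "unif powi n \<in> F"
  by (simp add: uniformizer)

lemma PE_iff: "x \<in> PE n \<longleftrightarrow> x = 0 \<or> val x \<ge> n"
  by (simp add: pideal_def)

lemma PF_iff: "x \<in> PF n \<longleftrightarrow> x \<in> F \<and> x \<in> PE n"
  by (auto simp: pideal_def)

lemma PE_zero [simp, intro]: "0 \<in> PE n"
  by (simp add: PE_iff)

lemma PE_add [intro]: "x \<in> PE n \<Longrightarrow> y \<in> PE n \<Longrightarrow> x + y \<in> PE n"
  using val_add[of x y] by (cases "x + y = 0"; force simp: PE_iff)

lemma PE_minus_iff [simp]: "- x \<in> PE n \<longleftrightarrow> x \<in> PE n"
  by (simp add: PE_iff)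

lemma PE_diff [intro]: "x \<in> PE n \<Longrightarrow> y \<in> PE n \<Longrightarrow> x - y \<in> PE n"
  using PE_add[of x n "- y"] by simp

lemma PE_diff_commute: "x - y \<in> PE n \<longleftrightarrow> y - x \<in> PE n"
  using PE_minus_iff[of "x - y" n] by simp

lemma PE_mono: "x \<in> PE m \<Longrightarrow> n \<le> m \<Longrightarrow> x \<in> PE n"
  by (auto simp: PE_iff)

lemma PE_mult: "x \<in> PE i \<Longrightarrow> y \<in> PE j \<Longrightarrow> k \<le> i + j \<Longrightarrow> x * y \<in> PE k"
  using val_mult[of x y] by (cases "x = 0"; cases "y = 0") (auto simp: PE_iff)

lemma PE_mult_left: "x \<in> PE 0 \<Longrightarrow> y \<in> PE j \<Longrightarrow> x * y \<in> PE j"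
  and PE_mult_right: "x \<in> PE j \<Longrightarrow> y \<in> PE 0 \<Longrightarrow> x * y \<in> PE j"
  by (auto intro: PE_mult)

lemma PE_val: "val x \<ge> n \<Longrightarrow> x \<in> PE n"
  by (simp add: PE_iff)

lemma PE_one [simp]: "1 \<in> PE n \<longleftrightarrow> n \<le> 0"
  by (simp add: PE_iff)

lemma PE_sum: "(\<And>i. i \<in> I \<Longrightarrow> f i \<in> PE n) \<Longrightarrow> sum f I \<in> PE n"
  by (induction I rule: infinite_finite_induct) auto

lemma PE_of_nat [simp, intro]: "of_nat n \<in> PE 0"
  by (induction n) (auto intro: PE_add)

lemma PE_numeral [simp, intro]: "numeral n \<in> PE 0"
  using PE_of_nat[of "numeral n"] by simp

lemma PE_scale: "a \<noteq> 0 \<Longrightarrow> a * x \<in> PE n \<longleftrightarrow> x \<in> PE (n - val a)"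
  using val_mult[of a x] by (cases "x = 0") (auto simp: PE_iff)

lemma PF_add [intro]: "x \<in> PF n \<Longrightarrow> y \<in> PF n \<Longrightarrow> x + y \<in> PF n"
  and PF_diff [intro]: "x \<in> PF n \<Longrightarrow> y \<in> PF n \<Longrightarrow> x - y \<in> PF n"
  and PF_minus_iff [simp]: "- x \<in> PF n \<longleftrightarrow> x \<in> PF n"
  and PF_zero [simp, intro]: "0 \<in> PF n"
  and PF_mono: "x \<in> PF n \<Longrightarrow> m \<le> n \<Longrightarrow> x \<in> PF m"
  and PF_mult: "x \<in> PF i \<Longrightarrow> y \<in> PF j \<Longrightarrow> k \<le> i + j \<Longrightarrow> x * y \<in> PF k"
  and PF_in_F: "x \<in> PF n \<Longrightarrow> x \<in> F" and PF_in_PE: "x \<in> PF n \<Longrightarrow> x \<in> PE n"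
  by (auto simp: PF_iff intro: PE_mono PE_mult)

lemma PF_scale: "a \<noteq> 0 \<Longrightarrow> a \<in> F \<Longrightarrow> x \<in> F \<Longrightarrow> a * x \<in> PF n \<longleftrightarrow> x \<in> PF (n - val a)"
  by (simp add: PF_iff PE_scale)

lemma one_plus_unit:
  assumes "x \<in> PE n" "n \<ge> 1"
  shows "1 + x \<noteq> 0" "val (1 + x) = 0"
proof -
  have x: "x = 0 \<or> val x \<ge> 1" using assms by (auto simp: PE_iff)
  show nz: "1 + x \<noteq> 0"
  proof
    assume "1 + x = 0"
    hence "x = - 1" by (metis add.inverse_unique)
    thus False using x by simp
  qed
  show "val (1 + x) = 0"
  proof (cases "x = 0")
    case False
    have "val (1 + x) \<ge> 0" using val_add[of 1 x] False nz x by simp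
    moreover have "0 \<ge> val (1 + x)"
    proof (rule ccontr)
      assume "\<not> 0 \<ge> val (1 + x)"
      hence "1 + x \<in> PE 1" by (auto simp: PE_iff)
      moreover have "x \<in> PE 1" using x by (auto simp: PE_iff)
      ultimately have "(1 + x) - x \<in> PE 1" by (rule PE_diff)
      thus False by simp
    qed
    ultimately show ?thesis by simp
  qed simp
qed

lemma units_E_iff: "x \<in> units_E \<longleftrightarrow> x \<noteq> 0 \<and> val x = 0" by (simp add: units_E_def)
lemma units_F_iff: "x \<in> units_F \<longleftrightarrow> x \<in> F \<and> x \<in> units_E" by (auto simp: units_F_def units_E_def)

lemma units_E_closed [simp, intro]:
  "1 \<in> units_E" "x \<in> units_E \<Longrightarrow> y \<in> units_E \<Longrightarrow> x * y \<in> units_E"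
  "x \<in> units_E \<Longrightarrow> inverse x \<in> units_E" "x \<in> units_E \<Longrightarrow> y \<in> units_E \<Longrightarrow> x / y \<in> units_E"
  "x \<in> units_E \<Longrightarrow> x ^ n \<in> units_E"
  "- x \<in> units_E \<longleftrightarrow> x \<in> units_E"
  by (auto simp: units_E_iff val_mult val_inverse val_divide val_power)

lemma units_E_PE: "x \<in> units_E \<Longrightarrow> x \<in> PE 0" and units_E_nz: "x \<in> units_E \<Longrightarrow> x \<noteq> 0"
  by (auto simp: units_E_iff PE_iff)

lemma unit_iff_PE: "x \<in> units_E \<longleftrightarrow> x \<in> PE 0 \<and> x \<notin> PE 1"
  by (auto simp: units_E_iff PE_iff)

lemma units_E_add: "x \<in> units_E \<Longrightarrow> y \<in> PE n \<Longrightarrow> n \<ge> 1 \<Longrightarrow> x + y \<in> units_E"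
  unfolding unit_iff_PE using PE_diff[of "x + y" 1 y] PE_mono[of y n 1] PE_mono[of y n 0] by auto

lemma U_E_iff: "n \<ge> 1 \<Longrightarrow> x \<in> U_E n \<longleftrightarrow> x - 1 \<in> PE (int n)"
  unfolding U_E_def by (auto simp: algebra_simps) (metis add.commute diff_add_cancel)

lemma U_F_iff: "n \<ge> 1 \<Longrightarrow> x \<in> U_F n \<longleftrightarrow> x \<in> F \<and> x - 1 \<in> PE (int n)"
proof -
  assume n: "n \<ge> 1"
  have "x \<in> U_F n \<longleftrightarrow> x - 1 \<in> PF (int n)"
    unfolding U_F_def using n by (auto simp: algebra_simps) (metis add.commute diff_add_cancel)
  moreover have "x - 1 \<in> F \<longleftrightarrow> x \<in> F" using F_add[of "x - 1" 1] by auto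
  ultimately show ?thesis by (simp add: PF_iff)
qed

lemma near_one_unit: "x - 1 \<in> PE n \<Longrightarrow> n \<ge> 1 \<Longrightarrow> x \<in> units_E"
  using one_plus_unit[of "x - 1" n] by (simp add: units_E_iff)

text \<open>If 2 had positive valuation, the least positive integer in \<open>PF 1\<close> would be
  1 or 2; but 1 is a unit, and 2 contradicts \<open>odd_residue_char\<close>.\<close>

lemma two_unit: "2 \<in> units_E"
proof -
  let ?P = "\<lambda>p. p > 0 \<and> (of_nat p :: 'e) \<in> pideal val F 1"
  have "\<not> (2 \<in> PE 1)"
  proof
    assume "2 \<in> PE 1"
    hence P2: "?P 2" by (simp add: PF_iff)
    hence L: "?P (LEAST p. ?P p)" and le: "(LEAST p. ?P p) \<le> 2"
      by (rule LeastI, rule Least_le)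
    have "(LEAST p. ?P p) \<noteq> 1" using L by (auto simp: PF_iff)
    hence "(LEAST p. ?P p) = 2" using L le by linarith
    thus False using odd_residue_char by (simp add: residue_char_def)
  qed
  thus ?thesis by (simp add: unit_iff_PE)
qed

lemma two_nz [simp]: "(2 :: 'e) \<noteq> 0" and val_two [simp]: "val 2 = 0"
  using two_unit by (auto simp: units_E_iff)

lemma two_mult_PE [simp]: "2 * x \<in> PE n \<longleftrightarrow> x \<in> PE n"
  using PE_scale[of 2 x n] by simp

lemma half_PE [simp]: "x / 2 \<in> PE n \<longleftrightarrow> x \<in> PE n"
  using two_mult_PE[of "x/2" n] by simp

text \<open>Completeness with an explicit rate of convergence, as delivered by a Newton
  iteration.\<close>

lemma complete_F:
  assumes "\<And>i :: nat. a i \<in> F" and "\<And>i. a (Suc i) - a i \<in> PE (int i)"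
  obtains l where "l \<in> F" "\<And>i. a i - l \<in> PE (int i)"
proof -
  have step: "a (i + k) - a i \<in> PE (int i)" for i k
  proof (induction k)
    case (Suc k)
    have "a (i + Suc k) - a (i + k) \<in> PE (int i)"
      using assms(2)[of "i + k"] by (auto intro: PE_mono)
    from PE_add[OF this Suc] show ?case by simp
  qed simp
  have cau: "\<exists>N. \<forall>i\<ge>N. \<forall>j\<ge>N. a i - a j \<in> PF k" for k
  proof (intro exI allI impI)
    fix i j assume i: "nat k \<le> i" and j: "nat k \<le> j"
    have "a i - a (nat k) \<in> PE k" "a j - a (nat k) \<in> PE k"
      using step[of "nat k" "i - nat k"] step[of "nat k" "j - nat k"] i j by (auto intro: PE_mono)
    hence "(a i - a (nat k)) - (a j - a (nat k)) \<in> PE k" by (rule PE_diff)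
    thus "a i - a j \<in> PF k" using assms(1) by (simp add: PF_iff)
  qed
  have "\<forall>a :: nat \<Rightarrow> 'e. range a \<subseteq> F \<and>
        (\<forall>k. \<exists>N. \<forall>i\<ge>N. \<forall>j\<ge>N. a i - a j \<in> PF k) \<longrightarrow>
        (\<exists>l\<in>F. \<forall>k. \<exists>N. \<forall>i\<ge>N. a i - l \<in> PF k)"
    using F_local unfolding nonarch_local_field_def by blast
  then obtain l where l: "l \<in> F" "\<And>k. \<exists>N. \<forall>i\<ge>N. a i - l \<in> PF k"
    using cau assms(1) by (metis (no_types, lifting) image_subsetI)
  have "a i - l \<in> PE (int i)" for i
  proof -
    from l(2)[of "int i"] obtain N where N: "\<forall>j\<ge>N. a j - l \<in> PF (int i)" by blast
    have "a (i + N) - l \<in> PE (int i)" using N by (auto simp: PF_iff)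
    from PE_diff[OF this step[of i N]] show ?thesis by simp
  qed
  with l(1) that show ?thesis by blast
qed

lemma PE_all_zero: "(\<And>i :: nat. x \<in> PE (int i)) \<Longrightarrow> x = 0"
proof (rule ccontr)
  assume a: "\<And>i :: nat. x \<in> PE (int i)" and "x \<noteq> 0"
  hence "val x \<ge> int i" for i using a[of i] by (auto simp: PE_iff)
  from this[of "nat (val x + 1)"] show False by linarith
qed

text \<open>Newton iteration for the root of \<open>d\<close>: the derivative \<open>2 * x\<close>
  is a unit, the new error is the square of the correction \<open>h\<close>, and
  \<open>n \<ge> 1\<close> makes the precision grow by at least one in each step.\<close>

lemma square_lift:
  assumes d: "d \<in> F" and a: "a \<in> F" "a \<in> units_E" "a\<^sup>2 - d \<in> PE (int n)" and n: "n \<ge> 1"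
  obtains x where "x \<in> F" "x\<^sup>2 = d" "x - a \<in> PE (int n)"
proof -
  have step: "\<exists>y. (y \<in> F \<and> y \<in> units_E \<and> y\<^sup>2 - d \<in> PE (int (n + Suc i))) \<and> y - x \<in> PE (int (n + i))"
    if x: "x \<in> F \<and> x \<in> units_E \<and> x\<^sup>2 - d \<in> PE (int (n + i))" for x i
  proof -
    define h where "h = (d - x\<^sup>2) / (2 * x)"
    have xnz: "x \<noteq> 0" "val x = 0" using x by (auto simp: units_E_iff)
    have h: "h \<in> PE (int (n + i))"
    proof -
      have "inverse (2 * x) \<in> PE 0"
        using val_inverse[of "2 * x"] val_mult[of 2 x] xnz by (intro PE_val) simp
      thus ?thesis unfolding h_def divide_inverse using x PE_diff_commute[of d "x\<^sup>2"]
        by (intro PE_mult_right) auto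
    qed
    have "2 * x * h = d - x\<^sup>2" using xnz by (simp add: h_def)
    hence "(x + h)\<^sup>2 - d = h\<^sup>2" by (simp add: power2_sum)
    moreover have "h\<^sup>2 \<in> PE (int (n + Suc i))"
      unfolding power2_eq_square using n by (intro PE_mult[OF h h]) auto
    ultimately have "(x + h)\<^sup>2 - d \<in> PE (int (n + Suc i))" by simp
    moreover have "x + h \<in> units_E" using units_E_add[OF _ h] x n by auto
    moreover have "x + h \<in> F" using x d unfolding h_def by auto
    ultimately show ?thesis using h by (intro exI[of _ "x + h"]) auto
  qed
  have "\<exists>f. (\<forall>i. f i \<in> F \<and> f i \<in> units_E \<and> (f i)\<^sup>2 - d \<in> PE (int (n + i))) \<and> f 0 = a \<and>
      (\<forall>i. f (Suc i) - f i \<in> PE (int (n + i)))"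
  proof -
    \<comment> \<open>Dependent choice does not prescribe the first term, so the initial value
      \<open>a\<close> is built into the predicate at index 0.\<close>
    define P where "P = (\<lambda>i x. (x \<in> F \<and> x \<in> units_E \<and> x\<^sup>2 - d \<in> PE (int (n + i))) \<and> (i = 0 \<longrightarrow> x = a))"
    have "\<exists>f. \<forall>i. P i (f i) \<and> f (Suc i) - f i \<in> PE (int (n + i))"
    proof (rule dependent_nat_choice)
      show "\<exists>x. P 0 x" using a by (auto simp: P_def)
      show "\<exists>y. P (Suc i) y \<and> y - x \<in> PE (int (n + i))" if "P i x" for x i
        using step[of x i] that unfolding P_def by auto
    qed
    thus ?thesis unfolding P_def by blast
  qed
  then obtain f where f: "\<And>i. f i \<in> F" "\<And>i. f i \<in> units_E" "\<And>i. (f i)\<^sup>2 - d \<in> PE (int (n + i))"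
    "f 0 = a" "\<And>i. f (Suc i) - f i \<in> PE (int (n + i))" by blast
  obtain l where l: "l \<in> F" "\<And>i. f i - l \<in> PE (int i)"
  proof (rule complete_F[of f])
    show "f (Suc i) - f i \<in> PE (int i)" for i using f(5)[of i] by (rule PE_mono) simp
  qed (use f in auto)
  have fa: "f i - a \<in> PE (int n)" for i
  proof (induction i)
    case (Suc i)
    have "f (Suc i) - f i \<in> PE (int n)" using f(5)[of i] by (auto intro: PE_mono)
    from PE_add[OF this Suc] show ?case by simp
  qed (simp add: f)
  have la: "l - a \<in> PE (int n)"
    using PE_diff[OF fa[of n] l(2)[of n]] by simp
  have lO: "l \<in> PE 0" using PE_add[of "l - a" 0 a] la a(2) PE_mono units_E_PE by auto
  have "l\<^sup>2 - d = 0"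
  proof (rule PE_all_zero)
    fix i :: nat
    have "(f i - l) * (f i + l) \<in> PE (int i)"
      using l(2)[of i] lO f(2)[of i] by (intro PE_mult_right) (auto intro: units_E_PE)
    moreover have "(f i)\<^sup>2 - d \<in> PE (int i)" using f(3)[of i] by (rule PE_mono) simp
    ultimately have "((f i)\<^sup>2 - d) - (f i - l) * (f i + l) \<in> PE (int i)" by (rule PE_diff[rotated])
    thus "l\<^sup>2 - d \<in> PE (int i)" by (simp add: power2_eq_square algebra_simps)
  qed
  with l la that show ?thesis by auto
qed

lemma one_unit_square:
  assumes "v \<in> F" "v - 1 \<in> PE (int n)" "n \<ge> 1"
  obtains x where "x \<in> F" "x\<^sup>2 = v" "x - 1 \<in> PE (int n)"
  using square_lift[of v 1 n] assms PE_diff_commute[of v 1] by auto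

end

section \<open>The conjugation of \<open>E\<close> over \<open>F\<close> and the norm\<close>

context unramified_quadratic begin

lemma s_zero [simp]: "s 0 = 0"
  using s_fixes[OF F_zero] .

lemma s_one [simp]: "s 1 = 1"
  using s_fixes[OF F_one] .

lemma s_minus [simp]: "s (- x) = - s x"
  using s_add[of x "- x"] by (simp add: eq_neg_iff_add_eq_0 add.commute)

lemma s_diff: "s (x - y) = s x - s y"
  using s_add[of x "- y"] by simp

lemma s_eq_zero [simp]: "s x = 0 \<longleftrightarrow> x = 0"
  using inj_eq[OF bij_is_inj[OF s_bij], of x 0] by simp

lemma s_inverse: "s (inverse x) = inverse (s x)"
proof (cases "x = 0")
  case False
  have "s x * s (inverse x) = 1" using s_mult[of x "inverse x"] False by simp
  thus ?thesis by (simp add: inverse_unique)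
qed simp

lemma s_divide: "s (x / y) = s x / s y"
  by (simp add: divide_inverse s_mult s_inverse)

text \<open>Complete the square, then scale by a power of \<open>unif\<close> to get a unit; this
  stays within the same class modulo \<open>F\<close> because \<open>E\<close> and \<open>F\<close>
  share the valuation \<open>val\<close>. The conjugate solves the same quadratic equation, and
  fixing \<open>\<beta>\<close> would force \<open>s = id\<close>.\<close>

lemma sqrt_exists:
  obtains \<beta> where "\<beta> \<notin> F" "\<beta> * \<beta> \<in> F" "val \<beta> = 0" "s \<beta> = - \<beta>"
    "\<And>x. \<exists>a\<in>F. \<exists>c\<in>F. x = a + c * \<beta>"
proof -
  obtain b where b: "b \<notin> F" "\<And>x. \<exists>a\<in>F. \<exists>c\<in>F. x = a + c * b"
    using quadratic by blast
  obtain a c where ac: "a \<in> F" "c \<in> F" "b * b = a + c * b" using b(2) by blast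
  define \<beta>0 where "\<beta>0 = b - c / 2"
  have "b = \<beta>0 + c / 2" by (simp add: \<beta>0_def)
  hence b0F: "\<beta>0 \<notin> F" using b(1) ac(2) by auto
  hence b0nz: "\<beta>0 \<noteq> 0" by auto
  define h where "h = c / 2"
  have h: "c = 2 * h" "h \<in> F" using ac by (auto simp: h_def)
  have "\<beta>0 * \<beta>0 = b * b - c * b + h * h"
    unfolding \<beta>0_def h(1) by (simp add: algebra_simps)
  also have "\<dots> = a + h * h" using ac(3) by simp
  finally have "\<beta>0 * \<beta>0 = a + h * h" .
  hence sq0: "\<beta>0 * \<beta>0 \<in> F" using ac h by auto
  define u where "u = unif powi (- val \<beta>0)"
  have u: "u \<in> F" "u \<noteq> 0" "val u = - val \<beta>0" unfolding u_def by auto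
  define \<beta> where "\<beta> = u * \<beta>0"
  have b0: "\<beta>0 = \<beta> / u" using u by (simp add: \<beta>_def)
  have 1: "\<beta> \<notin> F" using b0F u F_divide b0 by metis
  have "\<beta> * \<beta> = u * u * (\<beta>0 * \<beta>0)" by (simp add: \<beta>_def)
  hence 2: "\<beta> * \<beta> \<in> F" using sq0 u by auto
  have 3: "val \<beta> = 0" using u b0nz by (simp add: \<beta>_def val_mult)
  have 5: "\<exists>a\<in>F. \<exists>c\<in>F. x = a + c * \<beta>" for x
  proof -
    obtain a' c' where x: "a' \<in> F" "c' \<in> F" "x = a' + c' * b" using b(2) by blast
    have "x = (a' + c' * (c / 2)) + (c' / u) * \<beta>"
      using u by (simp add: x \<beta>_def \<beta>0_def algebra_simps)
    thus ?thesis using x ac u by blast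
  qed
  have "s \<beta> * s \<beta> = \<beta> * \<beta>" using s_fixes[OF 2] by (simp add: s_mult)
  hence "(s \<beta> - \<beta>) * (s \<beta> + \<beta>) = 0" by (simp add: algebra_simps)
  hence "s \<beta> = \<beta> \<or> s \<beta> = - \<beta>" by (auto simp: eq_neg_iff_add_eq_0)
  moreover have "s \<beta> \<noteq> \<beta>"
  proof
    assume s: "s \<beta> = \<beta>"
    have "s x = x" for x
    proof -
      obtain a c where "a \<in> F" "c \<in> F" "x = a + c * \<beta>" using 5 by blast
      thus ?thesis by (simp add: s_add s_mult s_fixes s)
    qed
    thus False using s_nontrivial by auto
  qed
  ultimately have 4: "s \<beta> = - \<beta>" by blast
  show ?thesis using that 1 2 3 4 5 by blast
qed

text \<open>If \<open>z + \<beta>\<close> were in \<open>PE 1\<close> for some \<open>z\<close> in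
  \<open>F\<close>, Hensel's lemma would make \<open>\<beta> * \<beta>\<close> a square in
  \<open>F\<close>, hence \<open>\<beta>\<close> an element of \<open>F\<close>. So 1 and
  \<open>\<beta>\<close> stay independent over the residue field of \<open>F\<close>, and valuations
  can be read off the coordinates.\<close>

lemma sqrt_coords:
  assumes \<beta>: "\<beta> \<notin> F" "\<beta> * \<beta> \<in> F" "val \<beta> = 0" and xy: "x \<in> F" "y \<in> F"
  shows "x + y * \<beta> \<in> PE n \<longleftrightarrow> x \<in> PE n \<and> y \<in> PE n"
proof -
  have bnz: "\<beta> \<noteq> 0" using \<beta>(1) by auto
  have bu: "\<beta> \<in> units_E" using \<beta> bnz by (simp add: units_E_iff)
  have core: "z + \<beta> \<notin> PE 1" if z: "z \<in> F" for z
  proof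
    assume a: "z + \<beta> \<in> PE 1"
    have zu: "z \<in> units_E" using units_E_add[of "- \<beta>" "z + \<beta>" 1] a bu by simp
    have "(z + \<beta>) * (z - \<beta>) \<in> PE 1"
      using a zu bu by (intro PE_mult_right) (auto intro: units_E_PE)
    hence "z\<^sup>2 - \<beta> * \<beta> \<in> PE (int 1)" by (simp add: power2_eq_square algebra_simps)
    then obtain x where x: "x \<in> F" "x\<^sup>2 = \<beta> * \<beta>"
      using square_lift[OF \<beta>(2) z zu, of 1] by auto
    have "(x - \<beta>) * (x + \<beta>) = 0" using x(2) by (simp add: power2_eq_square algebra_simps)
    hence "\<beta> = x \<or> \<beta> = - x" by (auto simp: eq_neg_iff_add_eq_0 add.commute)
    thus False using x(1) \<beta>(1) by auto
  qed
  show ?thesis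
  proof
    assume a: "x + y * \<beta> \<in> PE n"
    have y: "y \<in> PE n"
    proof (rule ccontr)
      assume "y \<notin> PE n"
      hence y: "y \<noteq> 0" "val y < n" by (auto simp: PE_iff)
      have "y * (x / y + \<beta>) \<in> PE n" using a y by (simp add: algebra_simps)
      hence "x / y + \<beta> \<in> PE (n - val y)" using y by (simp add: PE_scale)
      hence "x / y + \<beta> \<in> PE 1" by (rule PE_mono) (use y in simp)
      thus False using core xy by blast
    qed
    hence "y * \<beta> \<in> PE n" using bu by (intro PE_mult_right) (auto intro: units_E_PE)
    from PE_diff[OF a this] y show "x \<in> PE n \<and> y \<in> PE n" by simp
  next
    assume "x \<in> PE n \<and> y \<in> PE n"
    thus "x + y * \<beta> \<in> PE n" using bu by (intro PE_add PE_mult_right) (auto intro: units_E_PE)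
  qed
qed

lemma s_s [simp]: "s (s x) = x" and s_fixed_F: "s x = x \<Longrightarrow> x \<in> F"
  and s_PE [simp]: "s x \<in> PE n \<longleftrightarrow> x \<in> PE n"
proof -
  obtain \<beta> where \<beta>: "\<beta> \<notin> F" "\<beta> * \<beta> \<in> F" "val \<beta> = 0" "s \<beta> = - \<beta>"
    "\<And>x. \<exists>a\<in>F. \<exists>c\<in>F. x = a + c * \<beta>" using sqrt_exists by blast
  obtain a c where x: "a \<in> F" "c \<in> F" "x = a + c * \<beta>" using \<beta>(5) by blast
  have sx: "s x = a + (- c) * \<beta>" using x \<beta>(4) by (simp add: s_add s_mult s_fixes)
  show "s (s x) = x" unfolding sx using x \<beta>(4) by (simp add: s_diff s_mult s_fixes)
  show "x \<in> F" if "s x = x"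
  proof -
    have "2 * c * \<beta> = 0" using that sx x(3) by (simp add: algebra_simps)
    hence "c = 0" using \<beta>(1) by auto
    thus ?thesis using x by simp
  qed
  show "s x \<in> PE n \<longleftrightarrow> x \<in> PE n"
    using sqrt_coords[OF \<beta>(1-3) x(1), of "- c" n] sqrt_coords[OF \<beta>(1-3) x(1,2), of n] x(2)
    unfolding sx[symmetric] x(3)[symmetric] by simp
qed

lemma val_s [simp]: "val (s x) = val x"
proof (cases "x = 0")
  case False
  thus ?thesis using s_PE[of x "val x"] s_PE[of x "val (s x)"] by (simp add: PE_iff)
qed simp

lemma s_unit [simp]: "s x \<in> units_E \<longleftrightarrow> x \<in> units_E"
  by (simp add: units_E_iff)

definition Nm :: "'e \<Rightarrow> 'e" where "Nm t = t * s t"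

lemma Nm_F [simp, intro]: "Nm t \<in> F"
  by (rule s_fixed_F) (simp add: Nm_def s_mult mult.commute)

lemma Nm_mult: "Nm (x * y) = Nm x * Nm y" by (simp add: Nm_def s_mult)
lemma Nm_inverse: "Nm (inverse x) = inverse (Nm x)" by (simp add: Nm_def s_inverse)
lemma Nm_zero_iff [simp]: "Nm x = 0 \<longleftrightarrow> x = 0" by (simp add: Nm_def)
lemma Nm_base: "x \<in> F \<Longrightarrow> Nm x = x\<^sup>2" by (simp add: Nm_def s_fixes power2_eq_square)
lemma val_Nm: "x \<noteq> 0 \<Longrightarrow> val (Nm x) = 2 * val x" by (simp add: Nm_def val_mult)
lemma Nm_unit [simp]: "Nm x \<in> units_E \<longleftrightarrow> x \<in> units_E"
  using val_Nm[of x] by (cases "x = 0") (auto simp: units_E_iff)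

lemma E1_unit: "z \<in> E1 \<Longrightarrow> z \<in> units_E"
  using Nm_unit[of z] by (simp add: E1_def Nm_def)

lemma E1_iff: "z \<in> E1 \<longleftrightarrow> Nm z = 1"
  by (simp add: E1_def Nm_def)

lemma E1_s: "z \<in> E1 \<Longrightarrow> inverse (s z) = z"
  using inverse_unique[of "s z" z] by (simp add: E1_def mult.commute)

text \<open>Hilbert 90 is replaced by Hensel's lemma: a norm close to 1 is the square of an element of \<open>F\<close>
  close to 1.\<close>

lemma norm_near_one_decomp:
  assumes "Nm t - 1 \<in> PE (int n)" "n \<ge> 1"
  obtains e v where "e \<in> E1" "v \<in> F" "v - 1 \<in> PE (int n)" "t = e * v"
proof -
  obtain v where v: "v \<in> F" "v\<^sup>2 = Nm t" "v - 1 \<in> PE (int n)"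
    using one_unit_square[OF Nm_F assms] by blast
  have vnz: "v \<noteq> 0" using v(3) near_one_unit[of v "int n"] assms(2) by (auto simp: units_E_iff)
  have "Nm (t / v) = 1"
    using v vnz by (simp add: divide_inverse Nm_mult Nm_inverse Nm_base)
       (metis v(2) power_eq_0_iff right_inverse)
  hence "t / v \<in> E1" by (simp add: E1_iff)
  thus ?thesis using that[of "t / v" v] v vnz by simp
qed

subsection \<open>Finite quotients\<close>

text \<open>Digits in a uniformizer, one at a time. The field \<open>K\<close> is left open because
  the result is needed both for \<open>F\<close> and for the whole type.\<close>

lemma finite_cover:
  assumes L: "nonarch_local_field K val" and u: "unif \<in> K" and ij: "i \<le> j"
  shows "\<exists>Q. finite Q \<and> (\<forall>x\<in>pideal val K i. \<exists>q\<in>Q. x - q \<in> pideal val K j)"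
  using ij
proof (induction j rule: int_ge_induct)
  case base
  show ?case by (intro exI[of _ "{0}"]) auto
next
  case (step j)
  from step.IH obtain Q where Q: "finite Q" "\<forall>x\<in>pideal val K i. \<exists>q\<in>Q. x - q \<in> pideal val K j"
    by (elim exE conjE)
  obtain R where R: "finite R" "R \<subseteq> pideal val K 0"
    "\<forall>x\<in>pideal val K 0. \<exists>r\<in>R. x - r \<in> pideal val K 1"
    using L unfolding nonarch_local_field_def by (elim conjE exE)
  have K: "is_subfield K" using L unfolding nonarch_local_field_def by (elim conjE)
  have pw: "unif powi k \<in> K" for k
  proof -
    have "unif ^ n \<in> K" for n using u K by (induction n) (auto simp: is_subfield_def)
    thus ?thesis using K u by (simp add: power_int_def is_subfield_def)
       (metis K is_subfield_def power_inverse \<open>\<And>n. unif ^ n \<in> K\<close>)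
  qed
  have mK: "x * y \<in> K" if "x \<in> K" "y \<in> K" for x y using K that by (auto simp: is_subfield_def)
  have "\<exists>q\<in>(\<lambda>(q, r). q + unif powi j * r) ` (Q \<times> R). x - q \<in> pideal val K (j + 1)"
    if x: "x \<in> pideal val K i" for x
  proof -
    obtain q where q: "q \<in> Q" "x - q \<in> pideal val K j" using Q(2) x by blast
    define y where "y = unif powi (- j) * (x - q)"
    have "y \<in> PE 0" unfolding y_def using q(2) by (intro PE_mult[of _ "- j" _ j]) (auto simp: pideal_def)
    hence "y \<in> pideal val K 0" using q(2) mK[OF pw[of "- j"], of "x - q"] by (auto simp: pideal_def y_def)
    then obtain r where r: "r \<in> R" "y - r \<in> pideal val K 1" using R(3) by blast
    have eq: "x - (q + unif powi j * r) = unif powi j * (y - r)"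
      by (simp add: y_def algebra_simps power_int_minus)
    have "unif powi j * (y - r) \<in> PE (j + 1)"
      using r(2) by (intro PE_mult[of _ j _ 1]) (auto simp: pideal_def)
    hence "unif powi j * (y - r) \<in> pideal val K (j + 1)"
      using r(2) mK[OF pw[of j], of "y - r"] by (auto simp: pideal_def)
    thus ?thesis using q(1) r(1) eq by force
  qed
  moreover have "finite ((\<lambda>(q, r). q + unif powi j * r) ` (Q \<times> R))" using Q(1) R(1) by blast
  ultimately show ?case by blast
qed

text \<open>A choice of representatives which depends only on the residue class.\<close>

definition frep :: "int \<Rightarrow> 'e \<Rightarrow> 'e" where "frep j x = (SOME z. z \<in> F \<and> z - x \<in> PE j)"
definition erep :: "int \<Rightarrow> 'e \<Rightarrow> 'e" where "erep j x = (SOME z. z - x \<in> PE j)"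
definition reps :: "int \<Rightarrow> int \<Rightarrow> 'e set" where "reps i j = frep j ` PF i"
definition unit_reps :: "nat \<Rightarrow> 'e set" where "unit_reps n = erep (int n) ` units_E"

lemma PE_cong_trans: "x - y \<in> PE j \<Longrightarrow> y - z \<in> PE j \<Longrightarrow> x - z \<in> PE j"
  using PE_add[of "x - y" j "y - z"] by simp

lemma frep: "x \<in> F \<Longrightarrow> frep j x \<in> F \<and> frep j x - x \<in> PE j"
  unfolding frep_def by (rule someI[of _ x]) simp

lemma erep: "erep j x - x \<in> PE j"
  unfolding erep_def by (rule someI[of _ x]) simp

lemma frep_eq_iff: "x \<in> F \<Longrightarrow> y \<in> F \<Longrightarrow> frep j x = frep j y \<longleftrightarrow> x - y \<in> PE j"
proof
  assume "x \<in> F" "y \<in> F" "frep j x = frep j y"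
  thus "x - y \<in> PE j" using frep[of x j] frep[of y j] PE_cong_trans PE_diff_commute by metis
next
  assume "x - y \<in> PE j"
  hence "(z \<in> F \<and> z - x \<in> PE j) = (z \<in> F \<and> z - y \<in> PE j)" for z
    using PE_cong_trans PE_diff_commute by metis
  thus "frep j x = frep j y" by (simp add: frep_def)
qed

lemma erep_eq_iff: "erep j x = erep j y \<longleftrightarrow> x - y \<in> PE j"
proof
  assume "erep j x = erep j y"
  thus "x - y \<in> PE j" using erep[of j x] erep[of j y] PE_cong_trans PE_diff_commute by metis
next
  assume "x - y \<in> PE j"
  hence "(z - x \<in> PE j) = (z - y \<in> PE j)" for z
    using PE_cong_trans PE_diff_commute by metis
  thus "erep j x = erep j y" by (simp add: erep_def)
qed

lemma reps_PF: "i \<le> j \<Longrightarrow> q \<in> reps i j \<Longrightarrow> q \<in> PF i"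
proof -
  assume "i \<le> j" "q \<in> reps i j"
  then obtain x where "x \<in> PF i" "q = frep j x" by (auto simp: reps_def)
  thus ?thesis using frep[of x j] PE_add[of "q - x" i x] \<open>i \<le> j\<close> by (auto simp: PF_iff intro: PE_mono)
qed

lemma frep_reps: "i \<le> j \<Longrightarrow> q \<in> reps i j \<Longrightarrow> frep j q = q"
proof -
  assume "i \<le> j" "q \<in> reps i j"
  then obtain x where "x \<in> PF i" "q = frep j x" by (auto simp: reps_def)
  thus ?thesis using frep[of x j] frep_eq_iff[of q x j] by (simp add: PF_iff)
qed

lemma unit_reps_unit: "n \<ge> 1 \<Longrightarrow> q \<in> unit_reps n \<Longrightarrow> q \<in> units_E"
proof -
  assume n: "n \<ge> 1" and "q \<in> unit_reps n"
  then obtain t where "t \<in> units_E" "q = erep (int n) t" by (auto simp: unit_reps_def)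
  thus ?thesis using units_E_add[OF _ erep[of "int n" t], of t] n by simp
qed

lemma erep_unit_reps: "q \<in> unit_reps n \<Longrightarrow> erep (int n) q = q"
  unfolding unit_reps_def using erep_eq_iff erep by blast

lemma finite_reps [simp]: "i \<le> j \<Longrightarrow> finite (reps i j)"
proof -
  assume "i \<le> j"
  then obtain Q where Q: "finite Q" "\<forall>x\<in>PF i. \<exists>q\<in>Q. x - q \<in> PF j"
    using finite_cover[OF F_local uniformizer(1)] by blast
  have "reps i j \<subseteq> frep j ` Q"
  proof
    fix z assume "z \<in> reps i j"
    then obtain x where x: "x \<in> PF i" "z = frep j x" by (auto simp: reps_def)
    obtain q where q: "q \<in> Q" "x - q \<in> PF j" using Q(2) x by blast
    have "q = x - (x - q)" by simp
    hence "q \<in> F" using x(1) q(2) F_diff by (metis PF_iff)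
    hence "frep j x = frep j q" using x q by (simp add: frep_eq_iff PF_iff)
    thus "z \<in> frep j ` Q" using x q by blast
  qed
  thus ?thesis using Q(1) finite_surj by blast
qed

lemma finite_erep: "finite (erep j ` PE i)"
proof (cases "i \<le> j")
  case True
  then obtain Q where Q: "finite Q" "\<forall>x\<in>PE i. \<exists>q\<in>Q. x - q \<in> PE j"
    using finite_cover[OF E_local UNIV_I] by blast
  have "erep j ` PE i \<subseteq> erep j ` Q" using Q(2) erep_eq_iff by blast
  thus ?thesis using Q(1) finite_surj by blast
next
  case False
  have "erep j x = erep j 0" if "x \<in> PE i" for x
    using that False by (simp add: erep_eq_iff PE_mono)
  hence "erep j ` PE i \<subseteq> {erep j 0}" by blast
  thus ?thesis by (rule finite_subset) simp
qed

lemma finite_unit_reps [simp]: "finite (unit_reps n)"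
proof -
  have "unit_reps n \<subseteq> erep (int n) ` PE 0" by (auto simp: unit_reps_def units_E_PE)
  thus ?thesis by (rule finite_subset) (rule finite_erep)
qed

text \<open>Change of variables in sums over a finite quotient of fractional ideals. Representatives
  need not go to representatives, so \<open>f\<close> has to be periodic.\<close>

lemma sum_reps_affine:
  fixes f :: "'e \<Rightarrow> 'b::comm_monoid_add"
  assumes a: "a \<in> F" "a \<noteq> 0" "b \<in> PF (i + val a)" and ij: "i \<le> j"
    and f: "\<And>x y. x \<in> PF (i + val a) \<Longrightarrow> y \<in> PF (i + val a) \<Longrightarrow> x - y \<in> PE (j + val a) \<Longrightarrow> f x = f y"
  shows "(\<Sum>q\<in>reps i j. f (a * q + b)) = (\<Sum>q\<in>reps (i + val a) (j + val a). f q)"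
proof -
  let ?i = "i + val a" and ?j = "j + val a"
  let ?g = "\<lambda>q. frep ?j (a * q + b)"
  have aff: "a * x + b \<in> PF ?i" if "x \<in> PF i" for x
  proof -
    have "a * x \<in> PE ?i" using that by (intro PE_mult[of a "val a" x i]) (auto simp: PF_iff PE_iff)
    thus ?thesis using that a by (auto simp: PF_iff)
  qed
  have diff: "(a * x + b) - (a * y + b) \<in> PE ?j \<longleftrightarrow> x - y \<in> PE j" for x y
    using PE_scale[of a "x - y" ?j] a by (simp add: algebra_simps)
  have "bij_betw ?g (reps i j) (reps ?i ?j)"
  proof (rule bij_betwI')
    fix x y assume x: "x \<in> reps i j" and y: "y \<in> reps i j"
    have F: "x \<in> PF i" "y \<in> PF i" using reps_PF[OF ij] x y by auto
    show "(?g x = ?g y) = (x = y)"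
      using aff[OF F(1)] aff[OF F(2)] diff[of x y] F frep_reps[OF ij] x y frep_eq_iff[of x y j]
      by (auto simp: frep_eq_iff PF_iff)
  next
    fix x assume "x \<in> reps i j"
    thus "?g x \<in> reps ?i ?j" using aff reps_PF[OF ij] by (auto simp: reps_def)
  next
    fix y assume "y \<in> reps ?i ?j"
    then obtain z where z: "z \<in> PF ?i" "y = frep ?j z" by (auto simp: reps_def)
    let ?x = "(z - b) / a"
    have "a * ?x \<in> PF ?i" using z a by auto
    moreover have xF: "?x \<in> F" using z a by (auto simp: PF_iff)
    moreover have "a * ?x \<in> PF ?i \<longleftrightarrow> ?x \<in> PF (?i - val a)"
      by (rule PF_scale[OF a(2,1) xF])
    ultimately have x: "?x \<in> PF i" by simp
    have "a * frep j ?x + b - z \<in> PE ?j"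
      using diff[of "frep j ?x" ?x] frep[OF xF, of j] a by simp
    hence "y = ?g (frep j ?x)"
      using z aff[of "frep j ?x"] reps_PF[OF ij, of "frep j ?x"] x
      by (auto simp: frep_eq_iff PF_iff PE_diff_commute reps_def)
    thus "\<exists>x\<in>reps i j. y = ?g x" using x by (auto simp: reps_def)
  qed
  hence "(\<Sum>q\<in>reps i j. f (?g q)) = (\<Sum>q\<in>reps ?i ?j. f q)"
    by (rule sum.reindex_bij_betw)
  moreover have "f (?g q) = f (a * q + b)" if "q \<in> reps i j" for q
  proof -
    have A: "a * q + b \<in> PF ?i" using aff reps_PF[OF ij that] by blast
    hence "?g q \<in> PF ?i" using reps_PF[of ?i ?j "?g q"] ij by (auto simp: reps_def)
    with A show ?thesis using frep[of "a * q + b" ?j] by (intro f) (auto simp: PF_iff)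
  qed
  ultimately show ?thesis by simp
qed

lemma sum_unit_reps:
  fixes f :: "'e \<Rightarrow> 'b::comm_monoid_add"
  assumes t: "t \<in> units_E" and n: "n \<ge> 1"
    and f: "\<And>x y. x \<in> units_E \<Longrightarrow> y \<in> units_E \<Longrightarrow> x - y \<in> PE (int n) \<Longrightarrow> f x = f y"
  shows "(\<Sum>q\<in>unit_reps n. f (t * q)) = (\<Sum>q\<in>unit_reps n. f q)"
proof -
  let ?g = "\<lambda>q. erep (int n) (t * q)"
  have tnz: "t \<noteq> 0" "val t = 0" using t by (auto simp: units_E_iff)
  have diff: "t * x - t * y \<in> PE (int n) \<longleftrightarrow> x - y \<in> PE (int n)" for x y
    using PE_scale[of t "x - y"] tnz by (simp add: algebra_simps)
  have inj: "inj_on ?g (unit_reps n)"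
    by (rule inj_onI) (metis diff erep_eq_iff erep_unit_reps)
  have "?g ` unit_reps n \<subseteq> unit_reps n"
    using unit_reps_unit[OF n] t by (auto simp: unit_reps_def)
  hence "bij_betw ?g (unit_reps n) (unit_reps n)"
    using endo_inj_surj[OF finite_unit_reps _ inj] inj by (simp add: bij_betw_def)
  hence "(\<Sum>q\<in>unit_reps n. f (?g q)) = (\<Sum>q\<in>unit_reps n. f q)"
    by (rule sum.reindex_bij_betw)
  moreover have "f (?g q) = f (t * q)" if "q \<in> unit_reps n" for q
  proof (rule f)
    show "t * q \<in> units_E" using unit_reps_unit[OF n that] t by simp
    thus "?g q \<in> units_E" using unit_reps_unit[OF n, of "?g q"] by (auto simp: unit_reps_def)
  qed (rule erep)
  ultimately show ?thesis by simp
qed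

lemma reps_card:
  assumes "i < j" shows "card (reps i j) \<ge> 2"
proof -
  have "frep j 0 \<in> reps i j" "frep j (unif powi i) \<in> reps i j"
    by (auto simp: reps_def PF_iff PE_iff)
  moreover have "frep j (unif powi i) \<noteq> frep j 0"
    using assms by (simp add: frep_eq_iff PE_iff)
  ultimately have "{frep j 0, frep j (unif powi i)} \<subseteq> reps i j"
    "card {frep j 0, frep j (unif powi i)} = 2" by auto
  thus ?thesis using card_mono[OF finite_reps[of i j]] assms by (metis less_imp_le)
qed

lemma unit_reps_nonempty: "unit_reps n \<noteq> {}"
  using units_E_closed(1) by (auto simp: unit_reps_def)

subsection \<open>Norms of units\<close>

text \<open>Counting in the residue field: more than half of the residues are squares, so the set of
  squares meets its image under \<open>x \<mapsto> u + d * x\<close> with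
  \<open>d = \<beta> * \<beta>\<close>. A solution of \<open>x^2 = u + d y^2\<close> says that
  \<open>x + y * \<beta>\<close> has norm \<open>u\<close>.\<close>

lemma norm_mod_P:
  assumes u: "u \<in> units_E" "u \<in> F"
  shows "\<exists>t\<in>units_E. Nm t - u \<in> PE 1"
proof -
  obtain \<beta> where \<beta>: "\<beta> \<notin> F" "\<beta> * \<beta> \<in> F" "val \<beta> = 0" "s \<beta> = - \<beta>" using sqrt_exists by blast
  define d where "d = \<beta> * \<beta>"
  have bnz: "\<beta> \<noteq> 0" using \<beta>(1) by auto
  have d: "d \<in> F" "d \<noteq> 0" "val d = 0" using \<beta> bnz by (auto simp: d_def val_mult)
  let ?R = "reps 0 1" and ?z = "frep 1 0"
  define g where "g x = frep 1 (x\<^sup>2)" for x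
  define h where "h x = frep 1 (u + d * x)" for x
  have fin: "finite ?R" by simp
  have RF: "x \<in> PF 0" if "x \<in> ?R" for x using that reps_PF[of 0 1] by simp
  have Rrep: "frep 1 x = x" if "x \<in> ?R" for x using that frep_reps[of 0 1] by simp
  have zR: "?z \<in> ?R" by (auto simp: reps_def)
  have sqP: "x\<^sup>2 \<in> PF 0" if "x \<in> PF 0" for x
    using that by (auto simp: PF_iff power2_eq_square intro: PE_mult)
  have gR: "g x \<in> ?R" if "x \<in> ?R" for x
    using sqP[OF RF[OF that]] by (auto simp: g_def reps_def)
  have fib: "card {x \<in> ?R - {?z}. g x = y} \<le> 2" for y
  proof (cases "{x \<in> ?R - {?z}. g x = y} = {}")
    case False
    then obtain x0 where x0: "x0 \<in> ?R" "g x0 = y" by auto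
    have "{x \<in> ?R - {?z}. g x = y} \<subseteq> {x0, frep 1 (- x0)}"
    proof
      fix x assume "x \<in> {x \<in> ?R - {?z}. g x = y}"
      hence x: "x \<in> ?R" "g x = g x0" using x0 by auto
      have F: "x \<in> F" "x0 \<in> F" "x \<in> PE 0" "x0 \<in> PE 0" using RF x(1) x0(1) by (auto simp: PF_iff)
      have "x\<^sup>2 - x0\<^sup>2 \<in> PE 1" using x(2) F by (simp add: g_def frep_eq_iff)
      hence P: "(x - x0) * (x + x0) \<in> PE 1" by (simp add: power2_eq_square algebra_simps)
      have "x - x0 \<in> PE 1 \<or> x + x0 \<in> PE 1"
      proof (rule ccontr)
        assume a: "\<not> ?thesis"
        moreover have "x - x0 \<in> PE 0" "x + x0 \<in> PE 0" using F by auto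
        ultimately have "x - x0 \<in> units_E" "x + x0 \<in> units_E" by (auto simp: unit_iff_PE)
        hence "(x - x0) * (x + x0) \<in> units_E" by simp
        thus False using P by (simp add: unit_iff_PE)
      qed
      hence "frep 1 x = frep 1 x0 \<or> frep 1 x = frep 1 (- x0)" using F by (simp add: frep_eq_iff)
      thus "x \<in> {x0, frep 1 (- x0)}" using Rrep x(1) x0(1) by auto
    qed
    hence "card {x \<in> ?R - {?z}. g x = y} \<le> card {x0, frep 1 (- x0)}" by (intro card_mono) auto
    also have "\<dots> \<le> 2" by (simp add: card_insert_if)
    finally show ?thesis .
  next
    case True
    show ?thesis unfolding True by simp
  qed
  define S where "S = g ` ?R"
  define S' where "S' = g ` (?R - {?z})"
  have "?R - {?z} = (\<Union>y\<in>S'. {x \<in> ?R - {?z}. g x = y})" by (auto simp: S'_def)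
  hence "card (?R - {?z}) \<le> (\<Sum>y\<in>S'. card {x \<in> ?R - {?z}. g x = y})"
    using card_UN_le[of S' "\<lambda>y. {x \<in> ?R - {?z}. g x = y}"] fin by (simp add: S'_def)
  also have "\<dots> \<le> (\<Sum>y\<in>S'. 2)" by (intro sum_mono fib)
  finally have c1: "card ?R - 1 \<le> 2 * card S'" using zR by (simp add: card_Diff_singleton)
  have gz: "g ?z = ?z"
  proof -
    have "?z\<^sup>2 \<in> PE 1" using frep[of 0 1] by (auto simp: power2_eq_square intro: PE_mult)
    thus ?thesis using frep[of 0 1] by (simp add: g_def frep_eq_iff)
  qed
  have "?z \<notin> S'"
  proof
    assume "?z \<in> S'"
    then obtain x where "x \<in> ?R - {?z}" "?z = g x" unfolding S'_def by (rule imageE)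
    hence x: "x \<in> ?R" "x \<noteq> ?z" "g x = ?z" by auto
    have F: "x \<in> F" "x \<in> PE 0" using RF x(1) by (auto simp: PF_iff)
    have "x\<^sup>2 \<in> PE 1" using x(3) F by (simp add: g_def frep_eq_iff)
    hence "x \<in> PE 1" using F units_E_closed(5)[of x 2] unit_iff_PE[of x] unit_iff_PE[of "x\<^sup>2"] by auto
    hence "frep 1 x = ?z" using F by (simp add: frep_eq_iff)
    thus False using x Rrep by simp
  qed
  moreover have "S = insert ?z S'"
  proof -
    have "?R = insert ?z (?R - {?z})" using zR by blast
    hence "g ` ?R = g ` insert ?z (?R - {?z})" by (rule arg_cong)
    thus ?thesis unfolding S_def S'_def image_insert gz .
  qed
  ultimately have "card S = card S' + 1" using fin by (simp add: S'_def)
  \<comment> \<open>Zero is a square, and the other \<open>q - 1\<close> residues contribute at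
    least \<open>(q - 1) / 2\<close> further squares.\<close>
  hence c2: "card ?R < 2 * card S" using c1 reps_card[of 0 1] by linarith
  have SR: "S \<subseteq> ?R" using gR by (auto simp: S_def)
  have uP: "u \<in> PE 0" using u by (simp add: units_E_PE)
  have hR: "h x \<in> ?R" if "x \<in> ?R" for x
  proof -
    have "d * x \<in> PE 0" using RF[OF that] d by (intro PE_mult_left) (auto simp: PF_iff PE_iff)
    hence "u + d * x \<in> PF 0" using RF[OF that] d u uP by (auto simp: PF_iff)
    thus ?thesis by (auto simp: h_def reps_def)
  qed
  have "inj_on h ?R"
  proof (rule inj_onI)
    fix x y assume xy: "x \<in> ?R" "y \<in> ?R" "h x = h y"
    have F: "x \<in> F" "y \<in> F" using RF xy by (auto simp: PF_iff)
    have "d * (x - y) \<in> PE 1" using xy(3) F u d by (simp add: h_def frep_eq_iff algebra_simps)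
    hence "x - y \<in> PE 1" using d by (simp add: PE_scale)
    thus "x = y" using F Rrep xy frep_eq_iff[of x y 1] by simp
  qed
  hence "card (h ` S) = card S" using SR by (meson card_image inj_on_subset)
  moreover have "h ` S \<subseteq> ?R" using hR SR by blast
  moreover have "finite S" using SR fin finite_subset by blast
  ultimately have "S \<inter> h ` S \<noteq> {}"
    using c2 SR card_Un_disjoint[of S "h ` S"] card_mono[OF fin, of "S \<union> h ` S"] by auto
  then obtain x y where xy: "x \<in> ?R" "y \<in> ?R" "g x = h (g y)" unfolding S_def by blast
  have F: "x \<in> F" "y \<in> F" "g y \<in> F" using RF xy gR by (auto simp: PF_iff)
  have "x\<^sup>2 - (u + d * g y) \<in> PE 1" using xy(3) F d u unfolding g_def[of x] h_def by (simp add: frep_eq_iff)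
  moreover have "d * (g y - y\<^sup>2) \<in> PE 1" using frep[of "y\<^sup>2" 1] F d by (simp add: PE_scale g_def)
  ultimately have "(x\<^sup>2 - (u + d * g y)) + d * (g y - y\<^sup>2) \<in> PE 1" by (rule PE_add)
  moreover have "(x\<^sup>2 - (u + d * g y)) + d * (g y - y\<^sup>2) = Nm (x + y * \<beta>) - u"
    using F \<beta>(4) by (simp add: Nm_def s_add s_mult s_fixes d_def power2_eq_square algebra_simps)
  ultimately have N: "Nm (x + y * \<beta>) - u \<in> PE 1" by simp
  hence "Nm (x + y * \<beta>) \<in> units_E" using units_E_add[OF u(1) N] by simp
  with N show ?thesis by auto
qed

text \<open>Newton step for the norm: a factor \<open>1 + x\<close> with \<open>x\<close> in
  \<open>F\<close> multiplies the norm by \<open>(1 + x)^2\<close>, and \<open>x\<close> is chosen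
  to cancel the error to first order, leaving \<open>Nm t * (x * x)\<close>.\<close>

lemma norm_surj_mod:
  assumes u: "u \<in> units_E" "u \<in> F"
  shows "\<exists>t\<in>units_E. Nm t - u \<in> PE (int (Suc n))"
proof (induction n)
  case 0
  show ?case using norm_mod_P[OF u] by simp
next
  case (Suc n)
  then obtain t where t: "t \<in> units_E" "Nm t - u \<in> PE (int (Suc n))" by blast
  define x where "x = (u - Nm t) / (2 * Nm t)"
  have Nu: "Nm t \<in> units_E" "Nm t \<noteq> 0" using t by (auto simp: units_E_iff val_Nm)
  have i: "inverse (2 * Nm t) \<in> PE 0" using Nu(1) two_unit by (intro units_E_PE) auto
  have xF: "x \<in> F" using u unfolding x_def by auto
  have xP: "x \<in> PE (int (Suc n))"
    unfolding x_def divide_inverse using t(2) PE_diff_commute i by (intro PE_mult_right) blast+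
  have tx: "2 * Nm t * x = u - Nm t" using Nu(2) by (simp add: x_def)
  have "Nm (t * (1 + x)) = Nm t + 2 * Nm t * x + Nm t * (x * x)"
    unfolding Nm_mult using xF by (simp add: Nm_base power2_eq_square ring_distribs mult.assoc mult.left_commute)
  hence "Nm (t * (1 + x)) - u = Nm t * (x * x)" unfolding tx by simp
  also have "\<dots> \<in> PE (int (Suc (Suc n)))"
    using Nu(1) by (intro PE_mult_left PE_mult[OF xP xP]) (auto intro: units_E_PE)
  finally have "Nm (t * (1 + x)) - u \<in> PE (int (Suc (Suc n)))" .
  moreover have "t * (1 + x) \<in> units_E" using t(1) units_E_add[OF _ xP, of 1] by auto
  ultimately show ?case by blast
qed

end

section \<open>Matrix identities in U(1,1)\<close>

lemma mat2_mult:
  fixes a b c d e f g h :: "'a::field"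
  shows "mat2 a b c d ** mat2 e f g h = mat2 (a*e + b*g) (a*f + b*h) (c*e + d*g) (c*f + d*h)"
  by (simp add: mat2_def matrix_matrix_mult_def vec_eq_iff forall_2 sum_2)

lemma mat2_nth [simp]:
  "mat2 a b c d $ 1 $ 1 = a" "mat2 a b c d $ 1 $ 2 = b"
  "mat2 a b c d $ 2 $ 1 = c" "mat2 a b c d $ 2 $ 2 = d"
  by (simp_all add: mat2_def)

lemma mat2_eq_iff: "mat2 a b c d = mat2 a' b' c' d' \<longleftrightarrow> a = a' \<and> b = b' \<and> c = c' \<and> d = d'"
  by (metis mat2_nth)

lemma mat2_eta: "(g :: 'a::zero^2^2) = mat2 (g$1$1) (g$1$2) (g$2$1) (g$2$2)"
  by (simp add: mat2_def vec_eq_iff forall_2)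

lemma mat2_cases [case_names mat2]:
  obtains a b c d where "(g :: 'a::zero^2^2) = mat2 a b c d"
  using mat2_eta by blast

lemma det_mat2 [simp]: "det (mat2 a b c d) = a * d - b * (c :: 'a::field)"
  by (simp add: det_2)

lemma mat_mat2: "mat z = mat2 z 0 0 (z :: 'a::field)"
  by (simp add: mat2_def mat_def vec_eq_iff forall_2)

lemma transpose_mat2: "transpose (mat2 a b c d) = mat2 a c b d"
  by (simp add: mat2_def transpose_def vec_eq_iff forall_2)

lemma map_matrix_mat2: "f 0 = 0 \<Longrightarrow> map_matrix f (mat2 a b c d) = mat2 (f a) (f b) (f c) (f d)"
  by (simp add: mat2_def map_matrix_def vec_eq_iff forall_2)

lemma invertible_mat2: "invertible (mat2 a b c (d :: 'a::field)) \<longleftrightarrow> a * d - b * c \<noteq> 0"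
  by (simp add: invertible_det_nz)

lemma matrix_inv_unique:
  fixes g :: "'a::field^'n^'n"
  assumes "g ** h = mat 1" shows "matrix_inv g = h"
proof -
  have "h ** g = mat 1" using assms by (simp add: matrix_left_right_inverse)
  hence "g ** matrix_inv g = mat 1 \<and> matrix_inv g ** g = mat 1"
    unfolding matrix_inv_def using assms by (intro someI_ex[of "\<lambda>A'. g ** A' = mat 1 \<and> A' ** g = mat 1"]) blast
  hence "matrix_inv g ** (g ** h) = h" by (simp add: matrix_mul_assoc)
  thus ?thesis using assms by simp
qed

context unramified_quadratic begin

definition Up :: "'e \<Rightarrow> 'e^2^2" where "Up b = mat2 1 b 0 1"
definition Lo :: "'e \<Rightarrow> 'e^2^2" where "Lo c = mat2 1 0 c 1"

lemma torus_mat2: "torus_elt t = mat2 t 0 0 (inverse (s t))" by (simp add: torus_elt_def)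

lemma U11_mat2:
  "mat2 a b c d \<in> U11 \<longleftrightarrow> s a * b = s b * a \<and> s a * d - s b * c = 1 \<and> s d * a - s c * b = 1
     \<and> s d * c = s c * d"
proof -
  have eq: "map_matrix s (mat2 a b c d) ** J ** transpose (mat2 a b c d) =
    mat2 (s a * b - s b * a) (s a * d - s b * c) (s c * b - s d * a) (s c * d - s d * c)"
    by (simp add: map_matrix_mat2 J_def transpose_mat2 mat2_mult)
  have inv: "a * d - b * c \<noteq> 0" if "s a * b = s b * a" "s a * d - s b * c = 1"
  proof
    assume 0: "a * d - b * c = 0"
    have "a = s a * (a * d - b * c)" using that by algebra
    hence a: "a = 0" unfolding 0 by simp
    have "b = s b * (a * d - b * c)" using that by algebra
    hence "b = 0" unfolding 0 by simp

    thus False using that a by simp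
  qed
  show ?thesis
    unfolding U11_def mem_Collect_eq eq invertible_mat2 unfolding J_def mat2_eq_iff using inv
    by (auto simp: algebra_simps)
qed

text \<open>For two by two matrices, conjugating the inverse transpose of \<open>g\<close> by
  \<open>J\<close> gives \<open>g / det g\<close>. So unitarity means that \<open>s\<close> divides
  every entry by the determinant; quotients of entries are then fixed by \<open>s\<close> and lie in
  \<open>F\<close>.\<close>

lemma U11_s_entries:
  assumes "mat2 a b c d \<in> U11"
  defines "D \<equiv> a * d - b * c"
  shows "s a * D = a" "s b * D = b" "s c * D = c" "s d * D = d" "D \<noteq> 0" "D * s D = 1"
proof -
  have e: "s a * b = s b * a" "s a * d - s b * c = 1" "s d * a - s c * b = 1" "s d * c = s c * d"
    using assms by (simp_all add: U11_mat2)
  show 1: "s a * D = a" "s b * D = b" "s c * D = c" "s d * D = d" unfolding D_def using e by algebra+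
  show 2: "D \<noteq> 0" proof
    assume "D = 0"
    hence "a = 0" "b = 0" using 1 by simp_all
    thus False using e(2) by simp
  qed
  have "D * s D = (s a * D) * s d - (s b * D) * s c" by (simp add: D_def s_diff s_mult algebra_simps)
  also have "\<dots> = 1" unfolding 1 using e by (simp add: mult.commute)
  finally show "D * s D = 1" .
qed

lemma det_U11: "g \<in> U11 \<Longrightarrow> det g \<in> E1"
  using U11_s_entries(6) by (cases g rule: mat2_cases) (simp add: E1_def)

lemma map_matrix_mult:
  fixes g h :: "'e^2^2"
  shows "map_matrix s (g ** h) = map_matrix s g ** map_matrix s h"
proof -
  obtain a b c d where g: "g = mat2 a b c d" by (rule mat2_cases)
  obtain a' b' c' d' where h: "h = mat2 a' b' c' d'" by (rule mat2_cases)
  show ?thesis by (simp add: g h map_matrix_mat2 mat2_mult s_add s_mult)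
qed

lemma U11_mult [simp, intro]: "g \<in> U11 \<Longrightarrow> h \<in> U11 \<Longrightarrow> g ** h \<in> U11"
proof -
  assume g: "g \<in> U11" and h: "h \<in> U11"
  have "map_matrix s (g ** h) ** J ** transpose (g ** h) =
    map_matrix s g ** (map_matrix s h ** J ** transpose h) ** transpose g"
    by (simp add: map_matrix_mult matrix_transpose_mul matrix_mul_assoc)
  thus ?thesis using g h by (auto simp: U11_def invertible_mult)
qed

lemma Up_U11 [simp, intro]: "b \<in> F \<Longrightarrow> Up b \<in> U11"
  and Lo_U11 [simp, intro]: "c \<in> F \<Longrightarrow> Lo c \<in> U11"
  and torus_U11 [simp, intro]: "t \<noteq> 0 \<Longrightarrow> torus_elt t \<in> U11"
  and J_U11 [simp, intro]: "J \<in> U11"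
  and one_U11 [simp, intro]: "mat 1 \<in> U11"
  by (simp_all add: Up_def Lo_def torus_mat2 J_def mat_mat2 U11_mat2 s_fixes s_inverse)

lemma torus_E1: "z \<in> E1 \<Longrightarrow> torus_elt z = mat z"
  by (simp add: torus_mat2 mat_mat2 E1_s)

lemma Up_Up: "Up a ** Up b = Up (a + b)"
  and Lo_Lo: "Lo a ** Lo b = Lo (a + b)"
  and torus_torus: "torus_elt a ** torus_elt b = torus_elt (a * b)"
  by (simp_all add: Up_def Lo_def torus_mat2 mat2_mult s_mult add.commute)

lemma torus_Up: "t \<noteq> 0 \<Longrightarrow> torus_elt t ** Up b = Up (Nm t * b) ** torus_elt t"
  and torus_Lo: "t \<noteq> 0 \<Longrightarrow> torus_elt t ** Lo c = Lo (c / Nm t) ** torus_elt t"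
  by (simp_all add: torus_mat2 Up_def Lo_def mat2_mult mat2_eq_iff Nm_def field_simps)

lemma J_Up: "J ** Up b = Lo (- b) ** J"
  and J_Lo: "J ** Lo c = Up (- c) ** J"
  and J_torus: "t \<noteq> 0 \<Longrightarrow> J ** torus_elt t = torus_elt (inverse (s t)) ** J"
  and J_J: "J ** J = torus_elt (- 1)"
  by (simp_all add: J_def Up_def Lo_def torus_mat2 mat2_mult mat2_eq_iff s_inverse)

text \<open>Trades an upper unipotent with large parameter for lower unipotents with small
  parameter; this is how translates with \<open>b\<close> of very negative valuation are
  handled.\<close>

lemma Up_steinberg:
  "b \<in> F \<Longrightarrow> b \<noteq> 0 \<Longrightarrow> Up b = Lo (inverse b) ** (torus_elt b ** (J ** Lo (inverse b)))"
  by (simp add: Up_def Lo_def torus_mat2 J_def mat2_mult mat2_eq_iff s_fixes)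

text \<open>A factorization in which the failure to commute is visible: when \<open>x * c\<close> is
  small, the torus factor is close to 1 and the last factor carries the small parameter
  \<open>x * x * c\<close>.\<close>

lemma Lo_Up:
  assumes "c \<in> F" "x \<in> F" "1 - x * c \<noteq> 0"
  shows "Lo c ** Up x =
    Up x ** (Lo (c / (1 - x * c)) ** (torus_elt (1 - x * c) ** Up (- (x * x * c) / (1 - x * c))))"
proof -
  define D where "D = 1 - x * c"
  have D: "D \<noteq> 0" "D \<in> F" "x * c = 1 - D" using assms by (auto simp: D_def)
  have s: "s D = D" using D by (simp add: s_fixes)
  show ?thesis unfolding D_def[symmetric]
    using D(1) s D(3)
    by (simp add: Up_def Lo_def torus_mat2 mat2_mult mat2_eq_iff field_simps) (intro conjI; algebra)
qed

lemma U11_LDU: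
  assumes g: "mat2 a b c d \<in> U11" and d: "d \<noteq> 0"
  shows "mat2 a b c d = Up (b / d) ** torus_elt (inverse (s d)) ** Lo (c / d)" "b / d \<in> F" "c / d \<in> F"
proof -
  have e: "s a * b = s b * a" "s a * d - s b * c = 1" "s d * a - s c * b = 1" "s d * c = s c * d"
    using g by (simp_all add: U11_mat2)
  note D = U11_s_entries[OF g]
  have "s b * d = b * s d" using D(2,4) by (metis mult.commute mult.left_commute)
  thus "b / d \<in> F" using d by (intro s_fixed_F) (simp add: s_divide field_simps)
  show "c / d \<in> F" using d e(4) by (intro s_fixed_F) (simp add: s_divide field_simps)
  have "a = inverse (s d) + b * c / d"
  proof -
    have "a * (s d * d) = d + b * (c * s d)" using e(3,4) by algebra
    thus ?thesis using d by (simp add: field_simps)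
  qed
  thus "mat2 a b c d = Up (b / d) ** torus_elt (inverse (s d)) ** Lo (c / d)"
    using d by (simp add: Up_def Lo_def torus_mat2 mat2_mult mat2_eq_iff s_inverse)
qed

text \<open>Complements \<open>U11_LDU\<close>: the determinant is nonzero, so \<open>c\<close> or
  \<open>d\<close> is. Where both decompositions apply, the valuations of \<open>c\<close> and
  \<open>d\<close> decide which one gives integral parameters.\<close>

lemma U11_Bruhat:
  assumes g: "mat2 a b c d \<in> U11" and c: "c \<noteq> 0"
  shows "mat2 a b c d = Up (a / c) ** torus_elt (- inverse (s c)) ** J ** Up (d / c)" "a / c \<in> F" "d / c \<in> F"
proof -
  have e: "s a * b = s b * a" "s a * d - s b * c = 1" "s d * a - s c * b = 1" "s d * c = s c * d"
    using g by (simp_all add: U11_mat2)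
  note D = U11_s_entries[OF g]
  have "s a * c = a * s c" using D(1,3) by (metis mult.commute mult.left_commute)
  thus "a / c \<in> F" using c by (intro s_fixed_F) (simp add: s_divide field_simps)
  show "d / c \<in> F" using c e(4) by (intro s_fixed_F) (simp add: s_divide field_simps)
  have "b = - inverse (s c) + a * d / c"
  proof -
    have "b * (s c * c) = a * (d * s c) - c" using e(3,4) by algebra
    thus ?thesis using c by (simp add: field_simps)
  qed
  thus "mat2 a b c d = Up (a / c) ** torus_elt (- inverse (s c)) ** J ** Up (d / c)"
    using c by (simp add: Up_def torus_mat2 J_def mat2_mult mat2_eq_iff s_inverse)
qed

definition inv2 :: "'e^2^2 \<Rightarrow> 'e^2^2" where
  "inv2 g = mat2 (g$2$2 / det g) (- (g$1$2) / det g) (- (g$2$1) / det g) (g$1$1 / det g)"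

lemma inv2:
  assumes "det g \<noteq> 0"
  shows "inv2 g ** g = mat 1" "g ** inv2 g = mat 1"
proof -
  obtain a b c d where g: "g = mat2 a b c d" by (rule mat2_cases)
  show "inv2 g ** g = mat 1" "g ** inv2 g = mat 1"
    using assms unfolding g inv2_def
    by (simp_all add: mat2_mult mat_mat2 mat2_eq_iff diff_divide_distrib[symmetric] mult.commute)
qed

lemma det_U11_nz: "g \<in> U11 \<Longrightarrow> det g \<noteq> 0"
  by (simp add: U11_def invertible_det_nz)

lemma inv2_U11 [simp, intro]: assumes "g \<in> U11" shows "inv2 g \<in> U11"
proof -
  obtain a b c d where g: "g = mat2 a b c d" by (rule mat2_cases)
  define D where "D = a * d - b * c"
  have G: "mat2 a b c d \<in> U11" using assms g by simp
  have e: "s a * b = s b * a" "s a * d - s b * c = 1" "s d * a - s c * b = 1" "s d * c = s c * d"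
    using G by (simp_all add: U11_mat2)
  note D = U11_s_entries[OF G, folded D_def]
  have sD: "s D = inverse D" using D(6) by (metis inverse_unique)
  have "inv2 g = mat2 (d / D) (- b / D) (- c / D) (a / D)" by (simp add: inv2_def g D_def)
  also have "\<dots> = mat2 (s d) (- s b) (- s c) (s a)"
    using D(1-5) by (simp add: mat2_eq_iff field_simps)
  also have "\<dots> \<in> U11"
  proof -
    have "s b * d = b * s d" "s a * c = a * s c" "s b * c = b * s c"
      using D(1-4) by (metis mult.commute mult.left_commute)+
    thus ?thesis using e by (simp add: U11_mat2 mult.commute)
  qed
  finally show ?thesis .
qed

lemma matrix_inv_eq: "det g \<noteq> 0 \<Longrightarrow> matrix_inv g = inv2 g"
  by (rule matrix_inv_unique) (rule inv2)

end

section \<open>The operators of an irreducible admissible representation\<close>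

locale u11_rep = unramified_quadratic F val s unif + vector_space sc
  for F :: "'e::field set" and val :: "'e \<Rightarrow> int" and s :: "'e \<Rightarrow> 'e" and unif :: 'e
    and sc :: "complex \<Rightarrow> 'v::ab_group_add \<Rightarrow> 'v" +
  fixes V :: "'v set" and \<pi> :: "'e^2^2 \<Rightarrow> 'v \<Rightarrow> 'v"
  assumes irr: "irreducible_rep U11 sc V \<pi>" and adm: "admissible_rep U11 sc V \<pi>"
begin

abbreviation u :: "'e \<Rightarrow> 'v \<Rightarrow> 'v" where "u b \<equiv> \<pi> (Up b)"
abbreviation lo :: "'e \<Rightarrow> 'v \<Rightarrow> 'v" where "lo c \<equiv> \<pi> (Lo c)"
abbreviation h :: "'e \<Rightarrow> 'v \<Rightarrow> 'v" where "h t \<equiv> \<pi> (torus_elt t)"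
abbreviation j :: "'v \<Rightarrow> 'v" where "j \<equiv> \<pi> J"

lemma rep: "Defs.representation U11 sc V \<pi>"
  using irr by (simp add: irreducible_rep_def)

lemma V_subspace: "subspace V"
  using rep by (simp add: Defs.representation_def)

lemma V_zero [simp, intro]: "0 \<in> V"
  and V_add [simp, intro]: "x \<in> V \<Longrightarrow> y \<in> V \<Longrightarrow> x + y \<in> V"
  and V_scale [simp, intro]: "x \<in> V \<Longrightarrow> sc c x \<in> V"
  and V_minus [simp, intro]: "x \<in> V \<Longrightarrow> - x \<in> V"
  and V_diff [simp, intro]: "x \<in> V \<Longrightarrow> y \<in> V \<Longrightarrow> x - y \<in> V"
  and V_sum [intro]: "(\<And>i. i \<in> I \<Longrightarrow> f i \<in> V) \<Longrightarrow> sum f I \<in> V"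
  using V_subspace by (auto intro: subspace_0 subspace_add subspace_scale subspace_neg subspace_diff subspace_sum)

lemma pi_V [simp, intro]: "g \<in> U11 \<Longrightarrow> v \<in> V \<Longrightarrow> \<pi> g v \<in> V"
  and pi_add: "g \<in> U11 \<Longrightarrow> v \<in> V \<Longrightarrow> w \<in> V \<Longrightarrow> \<pi> g (v + w) = \<pi> g v + \<pi> g w"
  and pi_scale: "g \<in> U11 \<Longrightarrow> v \<in> V \<Longrightarrow> \<pi> g (sc c v) = sc c (\<pi> g v)"
  and pi_one [simp]: "v \<in> V \<Longrightarrow> \<pi> (mat 1) v = v"
  and pi_mult: "g \<in> U11 \<Longrightarrow> k \<in> U11 \<Longrightarrow> v \<in> V \<Longrightarrow> \<pi> (g ** k) v = \<pi> g (\<pi> k v)"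
  using rep unfolding Defs.representation_def by blast+

lemma pi_zero [simp]: "g \<in> U11 \<Longrightarrow> \<pi> g 0 = 0"
  using pi_scale[of g 0 0] by simp

lemma pi_minus: "g \<in> U11 \<Longrightarrow> v \<in> V \<Longrightarrow> \<pi> g (- v) = - \<pi> g v"
  using pi_scale[of g v "-1"] by simp

lemma pi_diff: "g \<in> U11 \<Longrightarrow> v \<in> V \<Longrightarrow> w \<in> V \<Longrightarrow> \<pi> g (v - w) = \<pi> g v - \<pi> g w"
  using pi_add[of g v "- w"] pi_minus[of g w] by simp

lemma pi_sum: "g \<in> U11 \<Longrightarrow> (\<And>i. i \<in> I \<Longrightarrow> f i \<in> V) \<Longrightarrow> \<pi> g (sum f I) = (\<Sum>i\<in>I. \<pi> g (f i))"
  by (induction I rule: infinite_finite_induct) (auto simp: pi_add V_sum)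

lemma pi_inv: assumes "g \<in> U11" "v \<in> V"
  shows "\<pi> (inv2 g) (\<pi> g v) = v" "\<pi> g (\<pi> (inv2 g) v) = v"
  using assms pi_mult[of "inv2 g" g v] pi_mult[of g "inv2 g" v] inv2[OF det_U11_nz[OF assms(1)]] by simp_all

lemma pi_inj: "g \<in> U11 \<Longrightarrow> v \<in> V \<Longrightarrow> w \<in> V \<Longrightarrow> \<pi> g v = \<pi> g w \<longleftrightarrow> v = w"
  using pi_inv(1) by metis

lemma pi_eq_0: "g \<in> U11 \<Longrightarrow> v \<in> V \<Longrightarrow> \<pi> g v = 0 \<longleftrightarrow> v = 0"
  using pi_inj[of g v 0] by simp

lemma pi_comm:
  assumes "A ** B = C ** D" "A \<in> U11" "B \<in> U11" "C \<in> U11" "D \<in> U11" "v \<in> V"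
  shows "\<pi> A (\<pi> B v) = \<pi> C (\<pi> D v)"
  using assms pi_mult by metis

lemma u_zero [simp]: "v \<in> V \<Longrightarrow> u 0 v = v" and lo_zero [simp]: "v \<in> V \<Longrightarrow> lo 0 v = v"
  and h_one [simp]: "v \<in> V \<Longrightarrow> h 1 v = v"
  using pi_one[of v] by (simp_all add: Up_def Lo_def torus_mat2 mat_mat2)

lemma u_u: "a \<in> F \<Longrightarrow> b \<in> F \<Longrightarrow> v \<in> V \<Longrightarrow> u a (u b v) = u (a + b) v"
  and lo_lo: "a \<in> F \<Longrightarrow> b \<in> F \<Longrightarrow> v \<in> V \<Longrightarrow> lo a (lo b v) = lo (a + b) v"
  and h_h: "a \<noteq> 0 \<Longrightarrow> b \<noteq> 0 \<Longrightarrow> v \<in> V \<Longrightarrow> h a (h b v) = h (a * b) v"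
  and j_j: "v \<in> V \<Longrightarrow> j (j v) = h (- 1) v"
  by (simp_all add: pi_mult[symmetric] Up_Up Lo_Lo torus_torus J_J)

lemma h_u: "t \<noteq> 0 \<Longrightarrow> b \<in> F \<Longrightarrow> v \<in> V \<Longrightarrow> h t (u b v) = u (Nm t * b) (h t v)"
  by (rule pi_comm[OF torus_Up]) auto

lemma h_lo: "t \<noteq> 0 \<Longrightarrow> c \<in> F \<Longrightarrow> v \<in> V \<Longrightarrow> h t (lo c v) = lo (c / Nm t) (h t v)"
  by (rule pi_comm[OF torus_Lo]) auto

lemma j_lo: "c \<in> F \<Longrightarrow> v \<in> V \<Longrightarrow> j (lo c v) = u (- c) (j v)"
  by (rule pi_comm[OF J_Lo]) auto

lemma j_h: "t \<noteq> 0 \<Longrightarrow> v \<in> V \<Longrightarrow> j (h t v) = h (inverse (s t)) (j v)"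
  by (rule pi_comm[OF J_torus]) auto

lemma u_steinberg:
  "b \<in> F \<Longrightarrow> b \<noteq> 0 \<Longrightarrow> v \<in> V \<Longrightarrow> u b v = lo (inverse b) (h b (j (lo (inverse b) v)))"
  by (subst Up_steinberg) (simp_all add: pi_mult)

lemma lo_u:
  assumes "c \<in> F" "x \<in> F" "1 - x * c \<noteq> 0" "v \<in> V"
  shows "lo c (u x v) = u x (lo (c / (1 - x * c)) (h (1 - x * c) (u (- (x * x * c) / (1 - x * c)) v)))"
proof -
  have "1 - x * c \<in> F" "c / (1 - x * c) \<in> F" "- (x * x * c) / (1 - x * c) \<in> F"
    using assms(1,2) by (auto intro!: F_divide F_diff F_minus F_mult)
  thus ?thesis
    using assms pi_mult[of "Lo c" "Up x" v] by (simp add: pi_mult Lo_Up)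
qed

lemma lo_via_j: "c \<in> F \<Longrightarrow> v \<in> V \<Longrightarrow> lo c v = w \<longleftrightarrow> w \<in> V \<and> u (- c) (j v) = j w"
  using j_lo[of c v] pi_inj[of J "lo c v" w] by auto

lemma sum_const: "(\<Sum>i\<in>A. x) = sc (of_nat (card A)) x"
  by (induction A rule: infinite_finite_induct) (auto simp: scale_left_distrib)

subsection \<open>Levels\<close>

text \<open>Equivalently, \<open>v\<close> has no component invariant under the finite quotient of
  \<open>PF (k - 1)\<close> by \<open>PF k\<close>. The vanishing sum expresses this without
  additive characters of \<open>F\<close>.\<close>

definition lev :: "int \<Rightarrow> 'v \<Rightarrow> bool" where
  "lev k v \<longleftrightarrow> v \<in> V \<and> (\<forall>b\<in>PF k. u b v = v) \<and> (\<Sum>b\<in>reps (k - 1) k. u b v) = 0"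

lemma lev_V: "lev k v \<Longrightarrow> v \<in> V" by (simp add: lev_def)
lemma lev_fix: "lev k v \<Longrightarrow> b \<in> PF k \<Longrightarrow> u b v = v" by (simp add: lev_def)

lemma reps_F: "i \<le> k \<Longrightarrow> q \<in> reps i k \<Longrightarrow> q \<in> F"
  using reps_PF PF_in_F by blast

lemma lev_zero [simp, intro]: "lev k 0"
proof -
  have "u b 0 = 0" if "b \<in> reps (k - 1) k" for b
    using that reps_F[of "k - 1" k b] by simp
  thus ?thesis by (simp add: lev_def PF_iff)
qed

lemma u_periodic:
  assumes "\<And>b. b \<in> PF k \<Longrightarrow> u b v = v" "v \<in> V" "x \<in> F" "y \<in> F" "x - y \<in> PE k"
  shows "u x v = u y v"
proof -
  have "u x v = u y (u (x - y) v)" using assms by (simp add: u_u)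
  thus ?thesis using assms by (simp add: PF_iff)
qed

lemma lev_sum_affine:
  assumes v: "lev k v" and a: "a \<in> F" "a \<noteq> 0" and b: "b \<in> PF (k - 1)" and m: "m = k - 1 - val a"
  shows "(\<Sum>q\<in>reps m (m + 1). u (a * q + b) v) = 0"
proof -
  have "(\<Sum>q\<in>reps m (m + 1). u (a * q + b) v) = (\<Sum>q\<in>reps (m + val a) (m + 1 + val a). u q v)"
    by (rule sum_reps_affine[where f = "\<lambda>x. u x v"])
       (use a b m v in \<open>auto simp: lev_def PF_iff intro!: u_periodic[of k v]\<close>)
  also have "\<dots> = 0" using v by (simp add: m lev_def)
  finally show ?thesis .
qed

lemma lev_add: "lev k a \<Longrightarrow> lev k b \<Longrightarrow> lev k (a + b)"
proof -
  assume ab: "lev k a" "lev k b"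
  have "u q (a + b) = u q a + u q b" if "q \<in> F" for q
    using that ab lev_V by (intro pi_add) auto
  moreover from this have "(\<Sum>q\<in>reps (k - 1) k. u q (a + b)) =
      (\<Sum>q\<in>reps (k - 1) k. u q a) + (\<Sum>q\<in>reps (k - 1) k. u q b)"
    unfolding sum.distrib[symmetric] using reps_F[of "k - 1" k] by (intro sum.cong refl) auto
  ultimately show "lev k (a + b)" using ab by (simp add: lev_def PF_iff)
qed

lemma lev_scale: "lev k v \<Longrightarrow> lev k (sc c v)"
  by (auto simp: lev_def pi_scale PF_iff scale_sum_right[symmetric] reps_PF)
     (subst sum.cong[OF refl, of _ _ "\<lambda>b. sc c (u b v)"],
      auto simp: pi_scale scale_sum_right[symmetric] dest: reps_PF[rotated] simp: PF_iff)

lemma lev_u: "lev k v \<Longrightarrow> x \<in> F \<Longrightarrow> lev k (u x v)"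
proof -
  assume v: "lev k v" and x: "x \<in> F"
  have V: "v \<in> V" using v by (rule lev_V)
  have c: "u b (u x v) = u x (u b v)" if "b \<in> F" for b
    using that x V by (simp add: u_u add.commute)
  have "(\<Sum>b\<in>reps (k - 1) k. u b (u x v)) = (\<Sum>b\<in>reps (k - 1) k. u x (u b v))"
    by (intro sum.cong refl c) (auto dest: reps_PF[rotated] simp: PF_iff)
  also have "\<dots> = u x (\<Sum>b\<in>reps (k - 1) k. u b v)"
    using x V by (intro pi_sum[symmetric]) (auto dest: reps_PF[rotated] simp: PF_iff)
  also have "\<dots> = 0" using v x by (simp add: lev_def)
  finally show "lev k (u x v)"
    using v x V c by (auto simp: lev_def PF_iff)
qed

text \<open>Conjugation by \<open>h t\<close> scales the parameter of \<open>u\<close> by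
  \<open>Nm t\<close>, which has valuation \<open>2 * val t\<close>. Hence the torus preserves the
  parity of levels.\<close>

lemma lev_h: "lev k v \<Longrightarrow> t \<noteq> 0 \<Longrightarrow> lev (k + 2 * val t) (h t v)"
proof -
  assume v: "lev k v" and t: "t \<noteq> 0"
  have V: "v \<in> V" using v by (rule lev_V)
  have Nt: "Nm t \<noteq> 0" "inverse (Nm t) \<noteq> 0" "val (inverse (Nm t)) = - 2 * val t"
    using t by (simp_all add: val_inverse val_Nm)
  have c: "u b (h t v) = h t (u (inverse (Nm t) * b) v)" if "b \<in> F" for b
    using that t V by (simp add: h_u mult.assoc[symmetric])
  have f: "u b (h t v) = h t v" if b: "b \<in> PF (k + 2 * val t)" for b
  proof -
    have bF: "b \<in> F" using b by (simp add: PF_iff)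
    have "inverse (Nm t) * b \<in> PF k"
      using b Nt by (subst PF_scale) (auto simp: PF_iff)
    thus ?thesis using v by (simp add: c[OF bF] lev_def)
  qed
  have "(\<Sum>b\<in>reps (k + 2 * val t - 1) (k + 2 * val t). u b (h t v))
      = (\<Sum>b\<in>reps (k + 2 * val t - 1) (k + 2 * val t). h t (u (inverse (Nm t) * b + 0) v))"
    unfolding add_0_right by (intro sum.cong refl c) (auto dest: reps_PF[rotated] simp: PF_iff)
  also have "\<dots> = h t (\<Sum>b\<in>reps (k + 2 * val t - 1) (k + 2 * val t - 1 + 1). u (inverse (Nm t) * b + 0) v)"
    using t V by (subst pi_sum) (auto dest: reps_PF[rotated] simp: PF_iff)
  also have "\<dots> = 0"
    using t Nt by (subst lev_sum_affine[OF v]) auto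
  finally show ?thesis using f V t by (simp add: lev_def)
qed

lemma level_elim:
  fixes M :: "int \<Rightarrow> 'v \<Rightarrow> 'v" and k :: "'i \<Rightarrow> int" and x :: "'i \<Rightarrow> 'v"
  assumes fin: "finite I" and xV: "\<And>n. n \<in> I \<Longrightarrow> x n \<in> V"
    and add: "\<And>K a b. a \<in> V \<Longrightarrow> b \<in> V \<Longrightarrow> M K (a + b) = M K a + M K b" and zero: "\<And>K. M K 0 = 0"
    and kill: "\<And>n. n \<in> I \<Longrightarrow> k n > i \<Longrightarrow> M (k n) (x n) = 0"
    and keep: "\<And>n K. n \<in> I \<Longrightarrow> k n < K \<Longrightarrow> K > i \<Longrightarrow> M K (x n) = x n"
    and stay: "\<And>K. K > i \<Longrightarrow> M K v = v"
    and v: "v = (\<Sum>n\<in>I. x n)"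
  shows "v = (\<Sum>n | n \<in> I \<and> k n \<le> i. x n)"
  using fin xV kill keep v
proof (induction "card I" arbitrary: I rule: less_induct)
  case less
  show ?case
  proof (cases "\<exists>n\<in>I. k n > i")
    case False
    hence "{n. n \<in> I \<and> k n \<le> i} = I" by force
    thus ?thesis using less.prems by simp
  next
    case True
    define K where "K = Max (k ` I)"
    have K: "K \<in> k ` I" "\<And>n. n \<in> I \<Longrightarrow> k n \<le> K"
      using True less.prems(1) by (auto simp: K_def intro: Max_in)
    have Ki: "K > i" using True K(2) by force
    have msum: "M K (sum f A) = (\<Sum>n\<in>A. M K (f n))" if "finite A" "\<And>n. n \<in> A \<Longrightarrow> f n \<in> V" for f :: "'i \<Rightarrow> 'v" and A
      using that by (induction A rule: finite_induct) (auto simp: zero add V_sum)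
    let ?I' = "{n \<in> I. k n < K}"
    have "v = M K v" using stay[OF Ki] by simp
    also have "\<dots> = (\<Sum>n\<in>I. M K (x n))" using less.prems msum by simp
    also have "\<dots> = (\<Sum>n\<in>I. if k n < K then x n else 0)"
      using less.prems K(2) Ki by (intro sum.cong refl) (force simp: not_less intro: antisym)
    also have "\<dots> = (\<Sum>n\<in>?I'. x n)" using less.prems(1) by (simp add: sum.inter_filter[symmetric])
    finally have v': "v = (\<Sum>n\<in>?I'. x n)" .
    have "card ?I' < card I" using K(1) less.prems(1) by (intro psubset_card_mono) auto
    hence "v = (\<Sum>n | n \<in> ?I' \<and> k n \<le> i. x n)"
      using less.prems v' by (intro less.hyps) auto
    also have "{n. n \<in> ?I' \<and> k n \<le> i} = {n. n \<in> I \<and> k n \<le> i}" using Ki by auto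
    finally show ?thesis .
  qed
qed

text \<open>On vectors fixed by \<open>PF K\<close> this is the projection onto those fixed by
  \<open>PF (K - 1)\<close>.\<close>

definition av :: "int \<Rightarrow> 'v \<Rightarrow> 'v" where
  "av K x = sc (inverse (of_nat (card (reps (K - 1) K)))) (\<Sum>b\<in>reps (K - 1) K. u b x)"

lemma av_fix:
  assumes "x \<in> V" "\<And>b. b \<in> PF (K - 1) \<Longrightarrow> u b x = x" shows "av K x = x"
proof -
  have "(\<Sum>b\<in>reps (K - 1) K. u b x) = (\<Sum>b\<in>reps (K - 1) K. x)"
    using assms by (intro sum.cong refl) (auto dest: reps_PF[rotated])
  moreover have "card (reps (K - 1) K) \<noteq> 0" using reps_card[of "K - 1" K] by linarith
  ultimately show ?thesis by (simp add: av_def sum_const)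
qed

lemma av_add: "a \<in> V \<Longrightarrow> b \<in> V \<Longrightarrow> av K (a + b) = av K a + av K b"
proof -
  assume ab: "a \<in> V" "b \<in> V"
  have "(\<Sum>q\<in>reps (K - 1) K. u q (a + b)) = (\<Sum>q\<in>reps (K - 1) K. u q a + u q b)"
    using ab by (intro sum.cong refl) (auto dest: reps_PF[rotated] simp: PF_iff pi_add)
  thus ?thesis by (simp add: av_def sum.distrib scale_right_distrib)
qed

lemma av_zero: "av K 0 = 0"
proof -
  have "(\<Sum>q\<in>reps (K - 1) K. u q 0) = 0"
    by (intro sum.neutral) (auto dest: reps_PF[rotated] simp: PF_iff)
  thus ?thesis by (simp add: av_def)
qed

lemma lev_elim:
  assumes "finite I" "\<And>n. n \<in> I \<Longrightarrow> lev (k n) (x n)" "\<And>b. b \<in> PF i \<Longrightarrow> u b v = v"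
    "v = (\<Sum>n\<in>I. x n)"
  shows "v = (\<Sum>n | n \<in> I \<and> k n \<le> i. x n)"
proof (rule level_elim[where M = av])
  show "av K (x n) = x n" if "n \<in> I" "k n < K" for n K
    using that assms(2)[OF that(1)] PF_mono[of _ "K - 1" "k n"] by (intro av_fix) (auto simp: lev_def)
  show "av K v = v" if "K > i" for K
  proof (rule av_fix)
    show "v \<in> V" unfolding assms(4) using assms(2) lev_V by (intro V_sum) blast
    show "u b v = v" if "b \<in> PF (K - 1)" for b
      using that \<open>K > i\<close> by (intro assms(3) PF_mono[of b "K - 1" i]) auto
  qed
  show "av (k n) (x n) = 0" if "n \<in> I" for n
    using assms(2)[OF that] by (simp add: av_def lev_def)
qed (use assms lev_V in \<open>auto simp: av_add av_zero\<close>)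

text \<open>After \<open>lev_elim\<close>, one more average at level \<open>i\<close> kills
  \<open>v\<close> and the terms of level \<open>i\<close> but fixes the lower terms, so these add
  up to zero.\<close>

lemma lev_elim_eq:
  assumes "finite I" "\<And>n. n \<in> I \<Longrightarrow> lev (k n) (x n)" "lev i v" "v = (\<Sum>n\<in>I. x n)"
  shows "v = (\<Sum>n | n \<in> I \<and> k n = i. x n)"
proof -
  let ?A = "{n. n \<in> I \<and> k n \<le> i}"
  have v: "v = (\<Sum>n\<in>?A. x n)"
    using assms by (intro lev_elim) (auto simp: lev_def)
  have "v = v - av i v" using assms(3) by (simp add: av_def lev_def)
  have msum: "av i (sum f A) = (\<Sum>n\<in>A. av i (f n))" if "finite A" "\<And>n. n \<in> A \<Longrightarrow> f n \<in> V" for f :: "'b \<Rightarrow> 'v" and A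
    using that by (induction A rule: finite_induct) (auto simp: av_zero av_add V_sum)
  have "0 = av i v" using assms(3) by (simp add: av_def lev_def)
  also have "\<dots> = (\<Sum>n\<in>?A. av i (x n))"
    using assms lev_V by (subst v, subst msum) auto
  also have "\<dots> = (\<Sum>n\<in>?A. if k n < i then x n else 0)"
  proof (intro sum.cong refl)
    fix n assume n: "n \<in> ?A"
    show "av i (x n) = (if k n < i then x n else 0)"
    proof (cases "k n < i")
      case True
      thus ?thesis using n assms(2)[of n] av_fix[of "x n" i] PF_mono[of _ "i - 1" "k n"] by (auto simp: lev_def)
    next
      case False
      thus ?thesis using n assms(2)[of n] by (auto simp: av_def lev_def)
    qed
  qed
  also have "\<dots> = (\<Sum>n\<in>{n\<in>?A. k n < i}. x n)" using assms(1) by (intro sum.inter_filter[symmetric]) simp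
  finally have z: "(\<Sum>n\<in>{n\<in>?A. k n < i}. x n) = 0" by simp
  have "(\<Sum>n\<in>{n\<in>?A. k n < i} \<union> {n. n \<in> I \<and> k n = i}. x n) =
      (\<Sum>n\<in>{n\<in>?A. k n < i}. x n) + (\<Sum>n | n \<in> I \<and> k n = i. x n)"
    using assms(1) by (intro sum.union_disjoint) auto
  moreover have "{n\<in>?A. k n < i} \<union> {n. n \<in> I \<and> k n = i} = ?A" by auto
  ultimately have "(\<Sum>n\<in>?A. x n) = (\<Sum>n\<in>{n\<in>?A. k n < i}. x n) + (\<Sum>n | n \<in> I \<and> k n = i. x n)"
    by simp
  thus ?thesis using v z by simp
qed

end

context u11_rep begin

lemma lo_fix_iff: "c \<in> F \<Longrightarrow> v \<in> V \<Longrightarrow> lo c v = v \<longleftrightarrow> u (- c) (j v) = j v"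
  by (simp add: lo_via_j)

lemma lo_periodic:
  assumes "\<And>b. b \<in> PF k \<Longrightarrow> lo b v = v" "v \<in> V" "x \<in> F" "y \<in> F" "x - y \<in> PE k"
  shows "lo x v = lo y v"
proof -
  have "lo x v = lo y (lo (x - y) v)" using assms by (simp add: lo_lo)
  thus ?thesis using assms by (simp add: PF_iff)
qed

end

section \<open>The spaces \<open>Y k\<close> and their translates\<close>

locale u11_rep_level = u11_rep F val s unif sc V \<pi>
  for F :: "'e::field set" and val :: "'e \<Rightarrow> int" and s :: "'e \<Rightarrow> 'e" and unif :: 'e
    and sc :: "complex \<Rightarrow> 'v::ab_group_add \<Rightarrow> 'v" and V :: "'v set" and \<pi> :: "'e^2^2 \<Rightarrow> 'v \<Rightarrow> 'v" +
  fixes l :: nat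
  assumes l_pos: "l \<ge> 1"
begin

lemma near_nz: "t - 1 \<in> PE (int l) \<Longrightarrow> t \<noteq> 0"
  using near_one_unit[of t "int l"] l_pos units_E_nz by auto

text \<open>The bound \<open>l\<close> is that of the diagonal entries in \<open>J_ram l\<close>.
  Only torus elements of \<open>F\<close> occur, since elements of \<open>E1\<close> act through the
  central character, which need not be trivial near 1.\<close>

definition hfix :: "'v \<Rightarrow> bool" where
  "hfix v \<longleftrightarrow> v \<in> V \<and> (\<forall>t\<in>F. t - 1 \<in> PE (int l) \<longrightarrow> h t v = v)"

definition Y :: "int \<Rightarrow> 'v set" where
  "Y k = {v. lev k v \<and> lev (2 * int l + 1 - k) (j v) \<and> hfix v}"

lemma Y_V [intro]: "v \<in> Y k \<Longrightarrow> v \<in> V" by (simp add: Y_def hfix_def)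
lemma Y_lev: "v \<in> Y k \<Longrightarrow> lev k v" by (simp add: Y_def)
lemma Y_lev_j: "v \<in> Y k \<Longrightarrow> lev (2 * int l + 1 - k) (j v)" by (simp add: Y_def)
lemma Y_hfix: "v \<in> Y k \<Longrightarrow> hfix v" by (simp add: Y_def)
lemma Y_h_fix: "v \<in> Y k \<Longrightarrow> t \<in> F \<Longrightarrow> t - 1 \<in> PE (int l) \<Longrightarrow> h t v = v" by (simp add: Y_def hfix_def)
lemma Y_u_fix: "v \<in> Y k \<Longrightarrow> b \<in> PF k \<Longrightarrow> u b v = v"
  by (rule lev_fix[OF Y_lev])

lemma Y_lo_fix: "v \<in> Y k \<Longrightarrow> c \<in> PF (2 * int l + 1 - k) \<Longrightarrow> lo c v = v"
proof -
  assume v: "v \<in> Y k" and c: "c \<in> PF (2 * int l + 1 - k)"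
  have "u (- c) (j v) = j v" by (rule lev_fix[OF Y_lev_j[OF v]]) (use c in simp)
  thus "lo c v = v" using lo_fix_iff[OF PF_in_F[OF c] Y_V[OF v]] by simp
qed

lemma hfix_h: "hfix v \<Longrightarrow> t \<noteq> 0 \<Longrightarrow> hfix (h t v)"
proof -
  assume v: "hfix v" and t: "t \<noteq> 0"
  have "h t' (h t v) = h t v" if t': "t' \<in> F" "t' - 1 \<in> PE (int l)" for t'
  proof -
    have "h t' (h t v) = h t (h t' v)" using t near_nz[OF t'(2)] v by (simp add: h_h mult.commute hfix_def)
    thus ?thesis using v t' by (simp add: hfix_def)
  qed
  thus ?thesis using v t by (simp add: hfix_def)
qed

lemma hfix_j: "hfix v \<Longrightarrow> hfix (j v)"
proof -
  assume v: "hfix v"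
  have "h t (j v) = j v" if t: "t \<in> F" "t - 1 \<in> PE (int l)" for t
  proof -
    have tu: "t \<in> units_E" using near_one_unit[OF t(2)] l_pos by simp
    hence nz: "t \<noteq> 0" by (rule units_E_nz)
    have "inverse t - 1 = (1 - t) * inverse t" using nz by (simp add: field_simps)
    also have "\<dots> \<in> PE (int l)" using t(2) tu PE_diff_commute by (intro PE_mult_right units_E_PE) auto
    finally have "h (inverse t) v = v" using v t by (simp add: hfix_def)
    moreover have "j (h (inverse t) v) = h t (j v)"
      using v nz t by (simp add: j_h hfix_def s_inverse s_fixes)
    ultimately show ?thesis by simp
  qed
  thus ?thesis using v by (simp add: hfix_def)
qed

text \<open>\<open>h t\<close> replaces \<open>x\<close> by \<open>Nm t * x\<close>, a change by
  \<open>x * (t - 1) * (t + 1)\<close>. This lies in \<open>PF k\<close> when \<open>x\<close> is in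
  \<open>PF (k - int l)\<close>, which is where this bound comes from.\<close>

lemma hfix_u:
  assumes v: "hfix v" "\<And>b. b \<in> PF k \<Longrightarrow> u b v = v" and x: "x \<in> PF (k - int l)"
  shows "hfix (u x v)"
proof -
  have V: "v \<in> V" using v(1) by (simp add: hfix_def)
  have xF: "x \<in> F" and xP: "x \<in> PE (k - int l)" using x by (auto simp: PF_iff)
  have "h t (u x v) = u x v" if t: "t \<in> F" "t - 1 \<in> PE (int l)" for t
  proof -
    have hv: "h t v = v" using v(1) t by (simp add: hfix_def)
    have "h t (u x v) = u (Nm t * x) v"
      using t near_nz[OF t(2)] xF V hv by (simp add: h_u)
    also have "\<dots> = u x v"
    proof (rule u_periodic[OF v(2) V])
      have tO: "t \<in> PE 0" using near_one_unit[OF t(2)] l_pos by (intro units_E_PE) simp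
      have "Nm t * x - x = x * ((t - 1) * (t + 1))"
        using t by (simp add: Nm_base power2_eq_square algebra_simps)
      also have "\<dots> \<in> PE k" using t(2) tO by (intro PE_mult[OF xP PE_mult_right]) auto
      finally show "Nm t * x - x \<in> PE k" .
    qed (use xF in auto)
    finally show ?thesis .
  qed
  thus ?thesis using V xF by (simp add: hfix_def)
qed

lemma hfix_add: "hfix a \<Longrightarrow> hfix b \<Longrightarrow> hfix (a + b)" and hfix_scale: "hfix a \<Longrightarrow> hfix (sc c a)"
  using near_nz by (auto simp: hfix_def pi_add pi_scale)

lemma hfix_zero: "hfix 0" using near_nz by (simp add: hfix_def)

lemma hfix_diff: "hfix a \<Longrightarrow> hfix b \<Longrightarrow> hfix (a - b)"
  using hfix_add[of a "sc (- 1) b"] hfix_scale[of b "- 1"] by simp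

lemma hfix_sum: "(\<And>i. i \<in> I \<Longrightarrow> hfix (f i)) \<Longrightarrow> hfix (sum f I)"
  by (induction I rule: infinite_finite_induct) (auto simp: hfix_zero intro: hfix_add)

lemma hfix_lo:
  assumes v: "hfix v" "\<And>c. c \<in> PF k \<Longrightarrow> lo c v = v" and x: "x \<in> PF (k - int l)"
  shows "hfix (lo x v)"
proof -
  have V: "v \<in> V" using v(1) by (simp add: hfix_def)
  have xF: "x \<in> F" using x by (rule PF_in_F)
  have "hfix (u (- x) (j v))"
  proof (rule hfix_u[OF hfix_j[OF v(1)]])
    show "u b (j v) = j v" if "b \<in> PF k" for b
      using lo_fix_iff[of "- b" v] v(2)[of "- b"] that V by (simp add: PF_iff)
    show "- x \<in> PF (k - int l)" using x by simp
  qed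
  hence "hfix (j (lo x v))" using xF V by (simp add: j_lo)
  from hfix_h[OF hfix_j[OF this], of "- 1"] have "hfix (h (- 1) (j (j (lo x v))))" by simp
  thus ?thesis using xF V by (simp add: j_j h_h)
qed

text \<open>\<open>x * c\<close> is in \<open>PE l\<close>, so in \<open>Lo_Up\<close> the torus
  part is in \<open>1 + PF l\<close>, the extra upper parameter is in \<open>PF k\<close>, and
  \<open>c\<close> changes by an element of \<open>PF (2 l + 1 - k)\<close>, the latter by
  \<open>l \<ge> 1\<close>. All three corrections act trivially on \<open>v\<close>.\<close>

lemma lo_u_commute:
  assumes v: "hfix v"
    and fu: "\<And>b. b \<in> PF k \<Longrightarrow> u b v = v"
    and fl: "\<And>c. c \<in> PF (2 * int l + 1 - k) \<Longrightarrow> lo c v = v"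
    and x: "x \<in> PF (k - int l)" and c: "c \<in> PF (2 * int l - k)"
  shows "lo c (u x v) = u x (lo c v)"
proof -
  have V: "v \<in> V" using v by (simp add: hfix_def)
  have F: "x \<in> F" "c \<in> F" using x c by (auto simp: PF_iff)
  have PE: "x \<in> PE (k - int l)" "c \<in> PE (2 * int l - k)" using x c by (auto simp: PF_iff)
  define D where "D = 1 - x * c"
  have p: "x * c \<in> PE (int l)" by (rule PE_mult[OF PE]) simp
  have Du: "D \<in> units_E" using p l_pos by (intro near_one_unit[of _ "int l"]) (auto simp: D_def)
  hence D: "D \<noteq> 0" "inverse D \<in> PE 0" by (auto dest: units_E_nz intro!: units_E_PE)
  have DF: "D \<in> F" using F by (simp add: D_def)
  have "x * (x * c) \<in> PE k" by (rule PE_mult[OF PE(1) p]) simp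
  hence "- (x * (x * c)) * inverse D \<in> PE k" using D(2) by (intro PE_mult_right) simp_all
  hence "- (x * x * c) / D \<in> PF k"
    using F DF by (simp add: PF_iff divide_inverse mult.assoc)
  hence 1: "u (- (x * x * c) / D) v = v" by (rule fu)
  have 2: "h D v = v" using DF p v by (simp add: D_def hfix_def)
  have 3: "lo (c / D) v = lo c v"
  proof (rule lo_periodic[of "2 * int l + 1 - k"])
    have "c / D - c = c * (x * c) * inverse D"
      using D(1) by (simp add: field_simps) (simp add: D_def algebra_simps)
    also have "\<dots> \<in> PE (2 * int l + 1 - k)"
      using l_pos D(2) by (intro PE_mult_right PE_mult[OF PE(2) p]) auto
    finally show "c / D - c \<in> PE (2 * int l + 1 - k)" .
  qed (use F DF fl V in auto)
  show ?thesis
    using lo_u[OF F(2,1) _ V] D(1) 1 2 3 by (simp add: D_def)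
qed

lemma Y_h: assumes v: "v \<in> Y k" and t: "t \<noteq> 0" shows "h t v \<in> Y (k + 2 * val t)"
proof -
  have V: "v \<in> V" using v by (rule Y_V)
  have "lev (2 * int l + 1 - k + 2 * val (inverse (s t))) (h (inverse (s t)) (j v))"
    using Y_lev_j[OF v] t by (intro lev_h) auto
  hence "lev (2 * int l + 1 - (k + 2 * val t)) (j (h t v))"
    using t V by (simp add: j_h val_inverse algebra_simps)
  thus ?thesis using lev_h[OF Y_lev[OF v] t] hfix_h[OF Y_hfix[OF v] t] unfolding Y_def by auto
qed

lemma Y_h_unit: "v \<in> Y k \<Longrightarrow> t \<in> units_E \<Longrightarrow> h t v \<in> Y k"
  using Y_h[of v k t] by (auto simp: units_E_iff)

lemma Y_j: assumes v: "v \<in> Y k" shows "j v \<in> Y (2 * int l + 1 - k)"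
proof -
  have "lev (k + 2 * val (- 1)) (h (- 1) v)" using v by (intro lev_h Y_lev) auto
  hence "lev k (j (j v))" using v by (simp add: j_j Y_V)
  thus ?thesis using v hfix_j[OF Y_hfix[OF v]] by (simp add: Y_def)
qed

text \<open>The level of \<open>j (u x v)\<close> is the point: under \<open>j\<close> the operator
  \<open>u b\<close> becomes \<open>lo (- b)\<close>, which commutes past \<open>u x\<close> for
  \<open>b\<close> in \<open>PF (2 l - k)\<close>, so fixedness and the vanishing average are
  inherited from \<open>v\<close>.\<close>

lemma Y_u: assumes v: "v \<in> Y k" and x: "x \<in> PF (k - int l)" shows "u x v \<in> Y k"
proof -
  have V: "v \<in> V" using v by (rule Y_V)
  have xF: "x \<in> F" using x by (rule PF_in_F)
  let ?k = "2 * int l + 1 - k"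
  note comm = lo_u_commute[OF Y_hfix[OF v] Y_u_fix[OF v] Y_lo_fix[OF v] x]
  have ub: "u b (j (u x v)) = j (u x (lo (- b) v))" if b: "b \<in> PF (?k - 1)" for b
  proof -
    have bF: "b \<in> F" using b by (simp add: PF_iff)
    have "u b (j (u x v)) = j (lo (- b) (u x v))" using bF xF V by (simp add: j_lo)
    also have "lo (- b) (u x v) = u x (lo (- b) v)" using b by (intro comm) simp_all
    finally show ?thesis .
  qed
  have 1: "u b (j (u x v)) = j (u x v)" if b: "b \<in> PF ?k" for b
    using ub[of b] b Y_lo_fix[OF v, of "- b"] PF_mono[OF b, of "?k - 1"] by simp
  have "(\<Sum>b\<in>reps (?k - 1) ?k. lo (- b) v) = 0"
  proof -
    have "j (\<Sum>b\<in>reps (?k - 1) ?k. lo (- b) v) = (\<Sum>b\<in>reps (?k - 1) ?k. j (lo (- b) v))"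
      using V by (intro pi_sum) (auto simp: reps_F[of "?k - 1" ?k])
    also have "\<dots> = (\<Sum>b\<in>reps (?k - 1) ?k. u b (j v))"
      using V reps_F[of "?k - 1" ?k] by (intro sum.cong refl) (simp add: j_lo)
    also have "\<dots> = 0" using Y_lev_j[OF v] by (simp add: lev_def)
    finally show ?thesis using V reps_F[of "?k - 1" ?k]
      by (subst (asm) pi_eq_0) (auto intro!: V_sum)
  qed
  hence "0 = j (u x (\<Sum>b\<in>reps (?k - 1) ?k. lo (- b) v))" using xF by simp
  also have "\<dots> = (\<Sum>b\<in>reps (?k - 1) ?k. j (u x (lo (- b) v)))"
    using V xF reps_F[of "?k - 1" ?k] by (simp add: pi_sum)
  also have "\<dots> = (\<Sum>b\<in>reps (?k - 1) ?k. u b (j (u x v)))"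
    using ub reps_PF[of "?k - 1" ?k] by (intro sum.cong refl) auto
  finally have 2: "lev ?k (j (u x v))" using 1 V xF by (simp add: lev_def)
  have "hfix (u x v)" using Y_hfix[OF v] Y_u_fix[OF v] x by (rule hfix_u)
  thus ?thesis using 2 lev_u[OF Y_lev[OF v] xF] by (simp add: Y_def)
qed

text \<open>\<open>Y_u\<close> seen through \<open>j\<close>, that is with \<open>k\<close> replaced
  by \<open>2 l + 1 - k\<close>; this accounts for the bound \<open>l + 1 - k\<close>.\<close>

lemma Y_lo: assumes v: "v \<in> Y k" and x: "x \<in> PF (int l + 1 - k)" shows "lo x v \<in> Y k"
proof -
  have V: "v \<in> V" using v by (rule Y_V)
  have xF: "x \<in> F" using x by (rule PF_in_F)
  have "- x \<in> PF (2 * int l + 1 - k - int l)" using x PF_minus_iff by (auto intro: PF_mono)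
  from Y_u[OF Y_j[OF v] this] have "u (- x) (j v) \<in> Y (2 * int l + 1 - k)" .
  hence "j (lo x v) \<in> Y (2 * int l + 1 - k)" using V xF by (simp add: j_lo)
  from Y_j[OF this] have "j (j (lo x v)) \<in> Y k" by simp
  hence "h (- 1) (j (j (lo x v))) \<in> Y k" by (rule Y_h_unit) simp
  thus ?thesis using V xF by (simp add: j_j h_h)
qed

text \<open>In the Steinberg relation \<open>inverse b\<close> is small enough for
  \<open>Y_lo\<close>, and then \<open>j\<close> and \<open>h b\<close> lead to the index
  \<open>2 l + 1 - k + 2 * val b\<close>. The bound \<open>k - 1\<close> follows from
  \<open>val b \<le> k - l - 1\<close>.\<close>

lemma Y_bad:
  assumes v: "v \<in> Y k" and b: "b \<in> F" "b \<notin> PF (k - int l)"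
  obtains z k' where "z \<in> Y k'" "k' \<le> k - 1" "u b v = lo (inverse b) z"
proof -
  have b': "b \<noteq> 0" "val b < k - int l" using b by (auto simp: PF_iff PE_iff)
  have "inverse b \<in> PF (int l + 1 - k)" using b b' by (auto simp: PF_iff PE_iff val_inverse)
  hence "h b (j (lo (inverse b) v)) \<in> Y (2 * int l + 1 - k + 2 * val b)"
    using b' v by (intro Y_h Y_j Y_lo)
  moreover have "u b v = lo (inverse b) (h b (j (lo (inverse b) v)))"
    using b b' v by (intro u_steinberg) auto
  ultimately show ?thesis using that b' by force
qed

text \<open>For \<open>b\<close> outside \<open>PF (k - l)\<close>, \<open>Y_bad\<close> gives a
  vector \<open>lo (inverse b) z\<close> with smaller index; \<open>j\<close> turns it into a
  unipotent translate of \<open>j z\<close>, whose level is correspondingly larger.\<close>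

lemma Y_j_level:
  assumes v: "v \<in> Y k" and b: "b \<in> F"
  shows "\<exists>k' \<ge> 2 * int l + 1 - k. lev k' (j (u b v))"
proof (cases "b \<in> PF (k - int l)")
  case True
  thus ?thesis using Y_lev_j[OF Y_u[OF v True]] by blast
next
  case False
  then obtain z k' where z: "z \<in> Y k'" "k' \<le> k - 1" "u b v = lo (inverse b) z"
    using Y_bad[OF v b] by blast
  have "j (u b v) = u (- inverse b) (j z)" using z b by (simp add: j_lo Y_V)
  moreover have "lev (2 * int l + 1 - k') (u (- inverse b) (j z))"
    using z(1) b by (intro lev_u Y_lev_j) auto
  ultimately show ?thesis using z(2) by (intro exI[of _ "2 * int l + 1 - k'"]) auto
qed

text \<open>\<open>h (1 + p)\<close> replaces \<open>b\<close> by \<open>b + 2 b p\<close> up to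
  \<open>b * p * p\<close> in \<open>PF k\<close>, so averaging over the torus amounts to averaging
  \<open>v\<close> over \<open>PF (k - 1)\<close>. Thus \<open>u b v\<close> has a torus level
  \<open>r + 1\<close>, which exceeds \<open>l\<close>.\<close>

lemma bad_T_level:
  assumes v: "v \<in> Y k" and b: "b \<in> F" "b \<notin> PF (k - int l)"
  defines "r \<equiv> k - 1 - val b"
  shows "(\<Sum>p\<in>reps r (r + 1). h (1 + p) (u b v)) = 0"
    and "\<And>t. t \<in> F \<Longrightarrow> t - 1 \<in> PE (r + 1) \<Longrightarrow> h t (u b v) = u b v"
proof -
  have V: "v \<in> V" using v by auto
  have b': "b \<noteq> 0" "val b < k - int l" using b by (auto simp: PF_iff PE_iff)
  have r: "r \<ge> int l" using b' by (simp add: r_def)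
  have hu: "h t (u b v) = u (Nm t * b) v" if "t \<in> F" "t - 1 \<in> PE r" for t
  proof -
    have "t - 1 \<in> PE (int l)" using that r by (auto intro: PE_mono)
    thus ?thesis using that b V near_nz Y_h_fix[OF v, of t] by (simp add: h_u)
  qed
  have bP: "b \<in> PE (val b)" by (simp add: PE_iff)
  have "h (1 + p) (u b v) = u b (u (2 * b * p + 0) v)" if p: "p \<in> PF r" for p
  proof -
    have pF: "p \<in> F" and pP: "p \<in> PE r" using p by (auto simp: PF_iff)
    have "h (1 + p) (u b v) = u (Nm (1 + p) * b) v" using pF pP by (intro hu) auto
    also have "\<dots> = u (b + 2 * b * p) v"
    proof (rule u_periodic[OF Y_u_fix[OF v] V])
      have "Nm (1 + p) * b - (b + 2 * b * p) = b * (p * p)"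
        using pF by (simp add: Nm_base power2_eq_square algebra_simps)
      also have "\<dots> \<in> PE k"
        using r l_pos by (intro PE_mult[OF bP PE_mult[OF pP pP order_refl]]) (simp add: r_def)
      finally show "Nm (1 + p) * b - (b + 2 * b * p) \<in> PE k" .
    qed (use pF b in auto)
    also have "\<dots> = u b (u (2 * b * p + 0) v)" using b pF V by (simp add: u_u)
    finally show ?thesis .
  qed
  hence "(\<Sum>p\<in>reps r (r + 1). h (1 + p) (u b v)) = (\<Sum>p\<in>reps r (r + 1). u b (u (2 * b * p + 0) v))"
    using reps_PF[of r "r + 1"] by (intro sum.cong refl) auto
  also have "\<dots> = u b (\<Sum>p\<in>reps r (r + 1). u (2 * b * p + 0) v)"
    using b V reps_F[of r "r + 1"] by (intro pi_sum[symmetric]) auto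
  also have "(\<Sum>p\<in>reps r (r + 1). u (2 * b * p + 0) v) = 0"
    using b b' by (intro lev_sum_affine[OF Y_lev[OF v]]) (auto simp: val_mult r_def)
  finally show "(\<Sum>p\<in>reps r (r + 1). h (1 + p) (u b v)) = 0" using b by simp
  fix t assume t: "t \<in> F" "t - 1 \<in> PE (r + 1)"
  have tl: "t - 1 \<in> PE r" using t by (auto intro: PE_mono)
  have tO: "t \<in> PE 0" using near_one_unit[OF t(2)] r by (intro units_E_PE) simp
  have "h t (u b v) = u (Nm t * b) v" using t tl by (intro hu)
  also have "\<dots> = u b v"
  proof (rule u_periodic[OF Y_u_fix[OF v] V])
    have "Nm t * b - b = b * ((t - 1) * (t + 1))"
      using t by (simp add: Nm_base power2_eq_square algebra_simps)
    also have "\<dots> \<in> PE k" using t(2) tO by (intro PE_mult[OF bP PE_mult_right]) (auto simp: r_def)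
    finally show "Nm t * b - b \<in> PE k" .
  qed (use b in auto)
  finally show "h t (u b v) = u b v" .
qed

definition ht_av :: "int \<Rightarrow> 'v \<Rightarrow> 'v" where
  "ht_av K x = sc (inverse (of_nat (card (reps (K - 1) K)))) (\<Sum>p\<in>reps (K - 1) K. h (1 + p) x)"

text \<open>Elimination by torus levels: terms with \<open>b\<close> in \<open>PF (k - l)\<close>
  are fixed by all of \<open>1 + PF l\<close>, the other terms have torus level
  \<open>k - val b > l\<close>, and \<open>v\<close> is invariant under every average beyond
  \<open>l\<close>.\<close>

lemma T_elim:
  fixes b :: "'i \<Rightarrow> 'e" and k :: "'i \<Rightarrow> int" and z :: "'i \<Rightarrow> 'v" and r :: "'i \<Rightarrow> complex"
  assumes A: "finite A" "\<And>a. a \<in> A \<Longrightarrow> b a \<in> F" "\<And>a. a \<in> A \<Longrightarrow> z a \<in> Y (k a)"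
    and v: "hfix v" "v = (\<Sum>a\<in>A. sc (r a) (u (b a) (z a)))"
  shows "v = (\<Sum>a | a \<in> A \<and> b a \<in> PF (k a - int l). sc (r a) (u (b a) (z a)))"
proof -
  define \<kappa> where "\<kappa> a = (if b a \<in> PF (k a - int l) then int l else k a - val (b a))" for a
  have one: "1 + p \<noteq> 0" if "p \<in> reps (K - 1) K" "K > int l" for p K
    using reps_PF[OF _ that(1)] that(2) near_nz[of "1 + p"] PE_mono[of p "K - 1" "int l"] by (auto simp: PF_iff)
  have hV: "h (1 + p) x \<in> V" if "p \<in> reps (K - 1) K" "K > int l" "x \<in> V" for p K x
    using one[OF that(1,2)] that(3) by auto
  \<comment> \<open>For \<open>K \<le> l\<close> some \<open>1 + p\<close> might vanish and
    \<open>ht_av\<close> might fail to be additive, so \<open>M\<close> is the identity there; the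
    elimination only uses \<open>K > l\<close>.\<close>
  define M where "M K x = (if K > int l then ht_av K x else x)" for K x
  have V: "u (b a) (z a) \<in> V" if "a \<in> A" for a using A(2,3)[OF that] by auto
  have stay: "M K x = x" if x: "x \<in> V" and K: "K > int l"
    and "\<And>t. t \<in> F \<Longrightarrow> t - 1 \<in> PE (K - 1) \<Longrightarrow> h t x = x" for K x
  proof -
    have "(\<Sum>p\<in>reps (K - 1) K. h (1 + p) x) = (\<Sum>p\<in>reps (K - 1) K. x)"
      using that reps_PF[of "K - 1" K] by (intro sum.cong refl) (auto simp: PF_iff)
    moreover have "card (reps (K - 1) K) \<noteq> 0" using reps_card[of "K - 1" K] by linarith
    ultimately show ?thesis using K by (simp add: M_def ht_av_def sum_const)
  qed
  have "v = (\<Sum>a | a \<in> A \<and> \<kappa> a \<le> int l. sc (r a) (u (b a) (z a)))"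
  proof (rule level_elim[where M = M, OF A(1)])
    show "sc (r a) (u (b a) (z a)) \<in> V" if "a \<in> A" for a using V[OF that] by simp
    show "M K (x + y) = M K x + M K y" if "x \<in> V" "y \<in> V" for K x y
    proof (cases "K > int l")
      case True
      have "(\<Sum>p\<in>reps (K - 1) K. h (1 + p) (x + y)) = (\<Sum>p\<in>reps (K - 1) K. h (1 + p) x + h (1 + p) y)"
        using that one True by (intro sum.cong refl pi_add) auto
      thus ?thesis using True by (simp add: M_def ht_av_def sum.distrib scale_right_distrib)
    qed (simp add: M_def)
    show "M K 0 = 0" for K
    proof (cases "K > int l")
      case True
      have "(\<Sum>p\<in>reps (K - 1) K. h (1 + p) 0) = 0" using one True by (intro sum.neutral) auto
      thus ?thesis by (simp add: M_def ht_av_def)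
    qed (simp add: M_def)
    show "M (\<kappa> a) (sc (r a) (u (b a) (z a))) = 0" if a: "a \<in> A" and "\<kappa> a > int l" for a
    proof -
      have bad: "b a \<notin> PF (k a - int l)" and \<kappa>: "\<kappa> a = k a - 1 - val (b a) + 1"
        using that by (auto simp: \<kappa>_def split: if_splits)
      have "(\<Sum>p\<in>reps (\<kappa> a - 1) (\<kappa> a). h (1 + p) (sc (r a) (u (b a) (z a)))) =
        (\<Sum>p\<in>reps (\<kappa> a - 1) (\<kappa> a). sc (r a) (h (1 + p) (u (b a) (z a))))"
        using V[OF a] one[of _ "\<kappa> a"] that by (intro sum.cong refl pi_scale) auto
      also have "\<dots> = sc (r a) (\<Sum>p\<in>reps (\<kappa> a - 1) (\<kappa> a). h (1 + p) (u (b a) (z a)))"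
        by (rule scale_sum_right[symmetric])
      also have "\<dots> = 0"
        using bad_T_level(1)[OF A(3)[OF a] A(2)[OF a] bad] unfolding \<kappa>
        by (simp only: add_diff_cancel_right' scale_zero_right)
      finally show ?thesis using that(2) by (simp add: M_def ht_av_def)
    qed
    show "M K (sc (r a) (u (b a) (z a))) = sc (r a) (u (b a) (z a))"
      if a: "a \<in> A" and K: "\<kappa> a < K" "K > int l" for a K
    proof (rule stay[OF _ K(2)])
      show "sc (r a) (u (b a) (z a)) \<in> V" using V[OF a] by simp
      fix t assume t: "t \<in> F" "t - 1 \<in> PE (K - 1)"
      hence tl: "t - 1 \<in> PE (int l)" using K(2) by (auto intro: PE_mono)
      have "h t (u (b a) (z a)) = u (b a) (z a)"
      proof (cases "b a \<in> PF (k a - int l)")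
        case True
        thus ?thesis using Y_h_fix[OF Y_u[OF A(3)[OF a] True] t(1) tl] by simp
      next
        case False
        have "k a - 1 - val (b a) + 1 \<le> K - 1" using K(1) False by (simp add: \<kappa>_def)
        from PE_mono[OF t(2) this] show ?thesis
          by (rule bad_T_level(2)[OF A(3)[OF a] A(2)[OF a] False t(1)])
      qed
      thus "h t (sc (r a) (u (b a) (z a))) = sc (r a) (u (b a) (z a))"
        using V[OF a] near_nz[OF tl] by (simp add: pi_scale)
    qed
    show "M K v = v" if "K > int l" for K
      using v(1) that PE_mono[of _ "K - 1" "int l"] by (intro stay) (auto simp: hfix_def)
  qed (rule v(2))
  moreover have "{a. a \<in> A \<and> \<kappa> a \<le> int l} = {a. a \<in> A \<and> b a \<in> PF (k a - int l)}"
    using A(2) by (force simp: \<kappa>_def PF_iff PE_iff)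
  ultimately show ?thesis by simp
qed

subsection \<open>Generation by one vector\<close>

text \<open>Comparing \<open>val c\<close> with \<open>val d\<close> puts \<open>c / d\<close> in
  \<open>PF 1\<close> or \<open>d / c\<close> in \<open>PF 0\<close>, which are the ranges of
  \<open>Y_lo\<close> and \<open>Y_u\<close> at index \<open>l\<close>. The second case passes
  through \<open>j\<close> and gives an index of the other parity, so index \<open>l\<close> comes
  only from the first. The last clause records this for multiplicity one.\<close>

lemma orbit_form:
  assumes y: "y \<in> Y (int l)" and g: "g \<in> U11"
  shows "\<exists>k b z. \<pi> g y = u b z \<and> b \<in> F \<and> z \<in> Y k \<and>
    (k = int l \<longrightarrow> (\<exists>t\<in>units_E. \<exists>c\<in>PF 1. z = h t (lo c y)))"
proof -
  have V: "y \<in> V" using y by auto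
  obtain a b c d where gm: "g = mat2 a b c d" by (rule mat2_cases)
  have G: "mat2 a b c d \<in> U11" using g gm by simp
  show ?thesis
  proof (cases "d \<noteq> 0 \<and> (c = 0 \<or> val c > val d)")
    case True
    hence d: "d \<noteq> 0" by simp
    note dec = U11_LDU[OF G d]
    have c1: "c / d \<in> PF 1" using True dec(3) by (cases "c = 0") (auto simp: PF_iff PE_iff val_divide)
    let ?t = "inverse (s d)" and ?z = "h (inverse (s d)) (lo (c / d) y)"
    have eq: "\<pi> g y = u (b / d) ?z"
      using V d dec unfolding gm dec(1) by (subst pi_mult, auto)+
    have "?z \<in> Y (int l + 2 * val ?t)" using c1 d y by (intro Y_h Y_lo) auto
    moreover have "?t \<in> units_E" if "int l + 2 * val ?t = int l" using that d by (simp add: units_E_iff)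
    ultimately show ?thesis using eq c1 dec(2) by blast
  next
    case False
    hence c: "c \<noteq> 0" and dc: "d = 0 \<or> val d \<ge> val c" using U11_s_entries(5)[OF G] by auto
    note dec = U11_Bruhat[OF G c]
    have d1: "d / c \<in> PF 0" using dc c dec(3) by (cases "d = 0") (auto simp: PF_iff PE_iff val_divide)
    let ?t = "- inverse (s c)" and ?z = "h (- inverse (s c)) (j (u (d / c) y))"
    have eq: "\<pi> g y = u (a / c) ?z"
      using V c dec unfolding gm dec(1) by (subst pi_mult, auto)+
    have "?z \<in> Y (2 * int l + 1 - int l + 2 * val ?t)" using d1 c y by (intro Y_h Y_j Y_u) auto
    moreover have "2 * int l + 1 - int l + 2 * val ?t \<noteq> int l" by presburger
    ultimately show ?thesis using eq dec(2) by blast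
  qed
qed

lemma span_orbit:
  assumes y: "y \<in> V" "y \<noteq> 0" shows "span {\<pi> g y | g. g \<in> U11} = V"
proof -
  let ?O = "{\<pi> g y | g. g \<in> U11}"
  let ?S = "span ?O"
  have sub: "?O \<subseteq> V" using y by auto
  have SV: "?S \<subseteq> V" by (rule span_minimal[OF sub V_subspace])
  have "x \<in> V \<and> \<pi> g x \<in> ?S" if g: "g \<in> U11" and "x \<in> ?S" for g x
    using that(2)
  proof (induction x rule: span_induct_alt)
    case base
    show ?case using g by (simp add: span_zero)
  next
    case (step c x w)
    then obtain k where k: "k \<in> U11" "x = \<pi> k y" by auto
    have xV: "x \<in> V" and wV: "w \<in> V" using k y step by auto
    have "\<pi> g x = \<pi> (g ** k) y" using g k y by (simp add: pi_mult)
    hence "\<pi> g x \<in> ?S" using g k by (intro span_base) blast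
    thus ?case using step g xV wV by (simp add: pi_add pi_scale span_add span_scale)
  qed
  hence "?S = {0} \<or> ?S = V" using irr SV subspace_span unfolding irreducible_rep_def by blast
  moreover have "y \<in> ?S" using pi_one[OF y(1)] one_U11 by (intro span_base) (metis (mono_tags, lifting) mem_Collect_eq)
  ultimately show ?thesis using y by auto
qed

lemma generation:
  assumes y: "y \<in> Y (int l)" "y \<noteq> 0" and v: "v \<in> V"
  shows "\<exists>(A :: 'v set) r b z k. finite A \<and> v = (\<Sum>a\<in>A. sc (r a) (u (b a) (z a))) \<and>
    (\<forall>a\<in>A. b a \<in> F \<and> z a \<in> Y (k a) \<and>
      (k a = int l \<longrightarrow> (\<exists>t\<in>units_E. \<exists>c\<in>PF 1. z a = h t (lo c y))))"
proof -
  have "v \<in> span {\<pi> g y | g. g \<in> U11}" using span_orbit[of y] y v by auto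
  then obtain A r where A: "finite A" "A \<subseteq> {\<pi> g y | g. g \<in> U11}" "v = (\<Sum>a\<in>A. sc (r a) a)"
    unfolding span_explicit by blast
  have "\<forall>a\<in>A. \<exists>k b z. a = u b z \<and> b \<in> F \<and> z \<in> Y k \<and>
    (k = int l \<longrightarrow> (\<exists>t\<in>units_E. \<exists>c\<in>PF 1. z = h t (lo c y)))"
    using A(2) orbit_form[OF y(1)] by force
  then obtain k b z where kbz: "\<forall>a\<in>A. a = u (b a) (z a) \<and> b a \<in> F \<and> z a \<in> Y (k a) \<and>
    (k a = int l \<longrightarrow> (\<exists>t\<in>units_E. \<exists>c\<in>PF 1. z a = h t (lo c y)))"
    by metis
  have "v = (\<Sum>a\<in>A. sc (r a) (u (b a) (z a)))"
    unfolding A(3) using kbz by (intro sum.cong refl) metis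
  thus ?thesis using A(1) kbz by blast
qed

text \<open>Invariance under \<open>u\<close> leaves only terms with \<open>k \<le> 2 l - n\<close>,
  because \<open>m \<le> 2 l - n\<close>. By \<open>Y_j_level\<close> their images under
  \<open>j\<close> have levels above \<open>n\<close>, and invariance of \<open>v\<close> under
  \<open>lo\<close> eliminates all of them.\<close>

lemma no_shallow_vectors:
  assumes y: "y \<in> Y (int l)" "y \<noteq> 0" and v: "v \<in> V"
    and fu: "\<And>b. b \<in> PF m \<Longrightarrow> u b v = v" and fl: "\<And>c. c \<in> PF n \<Longrightarrow> lo c v = v"
    and mn: "m + n \<le> 2 * int l"
  shows "v = 0"
proof -
  obtain A :: "'v set" and r b z k where "finite A \<and> v = (\<Sum>a\<in>A. sc (r a) (u (b a) (z a))) \<and>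
    (\<forall>a\<in>A. b a \<in> F \<and> z a \<in> Y (k a) \<and>
      (k a = int l \<longrightarrow> (\<exists>t\<in>units_E. \<exists>c\<in>PF 1. z a = h t (lo c y))))"
    using generation[OF y v] by blast
  hence A: "finite A" "v = (\<Sum>a\<in>A. sc (r a) (u (b a) (z a)))"
    "\<And>a. a \<in> A \<Longrightarrow> b a \<in> F" "\<And>a. a \<in> A \<Longrightarrow> z a \<in> Y (k a)"
    by blast+
  define i where "i = 2 * int l - n"
  let ?B = "{a. a \<in> A \<and> k a \<le> i}"
  have "v = (\<Sum>a\<in>?B. sc (r a) (u (b a) (z a)))"
  proof (rule lev_elim[OF A(1)])
    show "lev (k a) (sc (r a) (u (b a) (z a)))" if "a \<in> A" for a
      using A(3,4)[OF that] by (intro lev_scale lev_u Y_lev)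
    show "u b v = v" if "b \<in> PF i" for b using that mn by (intro fu) (auto simp: i_def intro: PF_mono)
  qed (rule A(2))
  hence "j v = j (\<Sum>a\<in>?B. sc (r a) (u (b a) (z a)))" by simp
  also have "\<dots> = (\<Sum>a\<in>?B. j (sc (r a) (u (b a) (z a))))"
    using A(3) Y_V[OF A(4)] by (intro pi_sum) auto
  finally have jv: "j v = (\<Sum>a\<in>?B. j (sc (r a) (u (b a) (z a))))" .
  have "\<forall>a\<in>?B. \<exists>k'>n. lev k' (j (sc (r a) (u (b a) (z a))))"
  proof
    fix a assume a: "a \<in> ?B"
    then obtain k' where k': "k' \<ge> 2 * int l + 1 - k a" "lev k' (j (u (b a) (z a)))"
      using Y_j_level[of "z a" "k a" "b a"] A(3,4) by blast
    have "j (sc (r a) (u (b a) (z a))) = sc (r a) (j (u (b a) (z a)))"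
      using A(3,4) a by (intro pi_scale) (auto intro: Y_V)
    thus "\<exists>k'>n. lev k' (j (sc (r a) (u (b a) (z a))))"
      using k' a lev_scale by (intro exI[of _ k']) (auto simp: i_def)
  qed
  then obtain \<kappa> where \<kappa>: "\<And>a. a \<in> ?B \<Longrightarrow> \<kappa> a > n \<and> lev (\<kappa> a) (j (sc (r a) (u (b a) (z a))))"
    by metis
  have "j v = (\<Sum>a | a \<in> ?B \<and> \<kappa> a \<le> n. j (sc (r a) (u (b a) (z a))))"
  proof (rule lev_elim[OF _ _ _ jv])
    show "u c (j v) = j v" if "c \<in> PF n" for c
      using fl[of "- c"] lo_fix_iff[of "- c" v] that v by (auto simp: PF_iff)
  qed (use A(1) \<kappa> in auto)
  also have "\<dots> = 0" using \<kappa> by (intro sum.neutral) force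
  finally show ?thesis using v by (simp add: pi_eq_0)
qed

end

subsection \<open>Eigenvectors\<close>

context u11_rep begin

text \<open>The vector \<open>p(T) x\<close>, written with iterates of a plain function because
  \<open>T\<close> is linear only on a subspace.\<close>

definition pact :: "('v \<Rightarrow> 'v) \<Rightarrow> complex poly \<Rightarrow> 'v \<Rightarrow> 'v" where
  "pact T p x = (\<Sum>i\<le>degree p. sc (coeff p i) ((T ^^ i) x))"

lemma pact_upto: "degree p \<le> n \<Longrightarrow> pact T p x = (\<Sum>i\<le>n. sc (coeff p i) ((T ^^ i) x))"
  unfolding pact_def by (rule sum.mono_neutral_left) (auto simp: coeff_eq_0)

text \<open>Split off a root: if \<open>p = [:- c, 1:] * q\<close> annihilates \<open>x\<close>,
  then either \<open>pact T q x\<close> is an eigenvector for \<open>c\<close>, or \<open>q\<close>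
  annihilates \<open>x\<close> and has smaller degree.\<close>

lemma eigenvector_of_poly:
  assumes W: "subspace W" "\<And>x. x \<in> W \<Longrightarrow> T x \<in> W"
    and lin: "\<And>x y. x \<in> W \<Longrightarrow> y \<in> W \<Longrightarrow> T (x + y) = T x + T y" "\<And>c x. x \<in> W \<Longrightarrow> T (sc c x) = sc c (T x)"
  shows "p \<noteq> 0 \<Longrightarrow> x \<in> W \<Longrightarrow> x \<noteq> 0 \<Longrightarrow> pact T p x = 0 \<Longrightarrow> \<exists>c. \<exists>w\<in>W. w \<noteq> 0 \<and> T w = sc c w"
proof (induction "degree p" arbitrary: p)
  case 0
  then obtain a where "p = [:a:]" using degree_eq_zeroE by metis
  thus ?case using 0 by (auto simp: pact_def)
next
  case (Suc n)
  have "\<not> constant (poly p)" using Suc(2) by (simp add: constant_degree)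
  then obtain c where "poly p c = 0" using fundamental_theorem_of_algebra by blast
  then obtain q where q: "p = [:- c, 1:] * q" by (metis poly_eq_0_iff_dvd dvdE)
  hence q0: "q \<noteq> 0" using Suc.prems by auto
  have dq: "degree p = Suc (degree q)" unfolding q using q0 by (subst degree_mult_eq) auto
  have TW: "(T ^^ i) x \<in> W" for i using Suc.prems W(2) by (induction i) auto
  define y where "y = pact T q x"
  have yW: "y \<in> W" unfolding y_def pact_def using TW W(1) by (intro subspace_sum) (auto intro: subspace_scale)
  have Tsum: "T (sum f I) = (\<Sum>i\<in>I. T (f i))" if "\<And>i. i \<in> I \<Longrightarrow> f i \<in> W" for f :: "nat \<Rightarrow> 'v" and I
    using that lin(2)[of 0 0] W(1)
    by (induction I rule: infinite_finite_induct) (auto simp: lin subspace_0 subspace_sum)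
  have "pact T p x = (\<Sum>i\<le>Suc (degree q). sc (coeff (pCons 0 q) i) ((T ^^ i) x)) -
      sc c (\<Sum>i\<le>Suc (degree q). sc (coeff q i) ((T ^^ i) x))"
    unfolding pact_def dq scale_sum_right sum_subtractf[symmetric]
    by (intro sum.cong refl) (simp add: q scale_left_diff_distrib)
  also have "(\<Sum>i\<le>Suc (degree q). sc (coeff q i) ((T ^^ i) x)) = y"
    unfolding y_def by (rule pact_upto[symmetric]) simp
  also have "(\<Sum>i\<le>Suc (degree q). sc (coeff (pCons 0 q) i) ((T ^^ i) x)) =
      (\<Sum>i\<le>degree q. sc (coeff q i) ((T ^^ Suc i) x))"
    by (subst sum.atMost_Suc_shift) simp
  also have "\<dots> = (\<Sum>i\<le>degree q. T (sc (coeff q i) ((T ^^ i) x)))"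
    using TW by (intro sum.cong refl) (simp add: lin)
  also have "\<dots> = T y" unfolding y_def pact_def using TW W(1) by (intro Tsum[symmetric] subspace_scale)
  finally have eig: "T y = sc c y" using Suc.prems by simp
  show ?case
  proof (cases "y = 0")
    case True
    thus ?thesis using Suc.hyps(1)[of q] Suc.hyps(2) dq q0 Suc.prems by (simp add: y_def)
  next
    case False
    thus ?thesis using eig yW by blast
  qed
qed

text \<open>The iterates of \<open>x\<close> up to exponent \<open>card B\<close> are linearly
  dependent, which gives an annihilating polynomial. Coinciding iterates are treated apart, since
  dependence of a set does not see repetitions; there a difference of two monomials serves.\<close>

lemma eigenvector_exists:
  assumes W: "subspace W" "W \<subseteq> span B" "finite B" "x \<in> W" "x \<noteq> 0" "\<And>x. x \<in> W \<Longrightarrow> T x \<in> W"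
    and lin: "\<And>x y. x \<in> W \<Longrightarrow> y \<in> W \<Longrightarrow> T (x + y) = T x + T y" "\<And>c x. x \<in> W \<Longrightarrow> T (sc c x) = sc c (T x)"
  shows "\<exists>c. \<exists>w\<in>W. w \<noteq> 0 \<and> T w = sc c w"
proof -
  have TW: "(T ^^ i) x \<in> W" for i using W by (induction i) auto
  define f where "f i = (T ^^ i) x" for i
  let ?N = "card B"
  have "\<exists>p. p \<noteq> 0 \<and> pact T p x = 0"
  proof (cases "inj_on f {..?N}")
    case True
    have "dependent (f ` {..?N})"
    proof (rule ccontr)
      assume "independent (f ` {..?N})"
      moreover have "f ` {..?N} \<subseteq> span B" using TW W by (auto simp: f_def)
      ultimately have "card (f ` {..?N}) \<le> card B" using independent_span_bound[OF W(3)] by blast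
      thus False using card_image[OF True] by simp
    qed
    then obtain t a where ta: "finite t" "t \<subseteq> f ` {..?N}" "\<exists>v\<in>t. a v \<noteq> 0" "(\<Sum>v\<in>t. sc (a v) v) = 0"
      unfolding dependent_explicit by blast
    define p where "p = (\<Sum>i\<le>?N. monom (if f i \<in> t then a (f i) else 0) i)"
    have cp: "coeff p i = (if i \<le> ?N \<and> f i \<in> t then a (f i) else 0)" for i
      unfolding p_def coeff_sum coeff_monom by (simp add: sum.delta)
    have p0: "p \<noteq> 0"
    proof
      assume "p = 0"
      obtain i where "i \<le> ?N" "f i \<in> t" "a (f i) \<noteq> 0" using ta(2,3) by auto
      thus False using cp[of i] \<open>p = 0\<close> by simp
    qed
    have "pact T p x = (\<Sum>i\<le>?N. sc (coeff p i) (f i))"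
      unfolding f_def by (rule pact_upto) (auto intro!: degree_le simp: cp)
    also have "\<dots> = (\<Sum>i\<in>{i\<in>{..?N}. f i \<in> t}. sc (a (f i)) (f i))"
      by (subst sum.inter_filter) (auto simp: cp intro!: sum.cong)
    also have "\<dots> = (\<Sum>v\<in>f ` {i\<in>{..?N}. f i \<in> t}. sc (a v) v)"
      by (subst sum.reindex) (auto intro: inj_on_subset[OF True])
    also have "f ` {i\<in>{..?N}. f i \<in> t} = t" using ta(2) by auto
    finally show ?thesis using ta(4) p0 by auto
  next
    case False
    then obtain i k where ik: "i \<noteq> k" "f i = f k" by (auto simp: inj_on_def)
    define p where "p = monom (1::complex) i - monom 1 k"
    have "coeff p i = 1" using ik by (simp add: p_def)
    hence p0: "p \<noteq> 0" by auto
    have "pact T p x = (\<Sum>n\<le>i+k. sc (coeff p n) (f n))"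
      unfolding f_def by (rule pact_upto) (auto intro!: degree_le simp: p_def)
    also have "\<dots> = (\<Sum>n\<le>i+k. sc (coeff (monom (1::complex) i) n) (f n)) - (\<Sum>n\<le>i+k. sc (coeff (monom (1::complex) k) n) (f n))"
      by (simp add: p_def scale_left_diff_distrib sum_subtractf)
    also have "(\<Sum>n\<le>i+k. sc (coeff (monom (1::complex) i) n) (f n)) = (\<Sum>n\<le>i+k. if n = i then f n else 0)"
      by (intro sum.cong) auto
    also have "(\<Sum>n\<le>i+k. sc (coeff (monom (1::complex) k) n) (f n)) = (\<Sum>n\<le>i+k. if n = k then f n else 0)"
      by (intro sum.cong) auto
    finally have "pact T p x = 0" using ik(2) by (simp add: sum.delta)
    thus ?thesis using p0 by blast
  qed
  thus ?thesis using eigenvector_of_poly[OF W(1,6) lin] W(4,5) by blast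
qed

end

subsection \<open>Congruence subgroups and the central character\<close>

context unramified_quadratic begin

text \<open>Principal congruence subgroups, a base of neighbourhoods of 1 in \<open>U11\<close>;
  smoothness and admissibility are used through them.\<close>

definition KN :: "nat \<Rightarrow> ('e^2^2) set" where
  "KN N = {g \<in> U11. \<forall>i k. g $ i $ k - mat 1 $ i $ k \<in> PE (int N)}"

lemma KN_mat2: "mat2 a b c d \<in> KN N \<longleftrightarrow> mat2 a b c d \<in> U11 \<and>
    a - 1 \<in> PE (int N) \<and> b \<in> PE (int N) \<and> c \<in> PE (int N) \<and> d - 1 \<in> PE (int N)"
  by (auto simp: KN_def forall_2 mat_def)

lemma GL2_group: "group (GL2 :: ('e^2^2) monoid)"
proof (rule groupI)
  fix x y z :: "'e^2^2"
  show "\<lbrakk>x \<in> carrier GL2; y \<in> carrier GL2\<rbrakk> \<Longrightarrow> x \<otimes>\<^bsub>GL2\<^esub> y \<in> carrier GL2"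
    by (simp add: GL2_def invertible_mult)
  show "x \<in> carrier GL2 \<Longrightarrow> \<exists>y\<in>carrier GL2. y \<otimes>\<^bsub>GL2\<^esub> x = \<one>\<^bsub>GL2\<^esub>"
    by (auto simp: GL2_def invertible_def)
  show "\<one>\<^bsub>GL2\<^esub> \<in> carrier (GL2 :: ('e^2^2) monoid)"
    by (simp add: GL2_def invertible_det_nz)
  show "x \<otimes>\<^bsub>GL2\<^esub> y \<otimes>\<^bsub>GL2\<^esub> z = x \<otimes>\<^bsub>GL2\<^esub> (y \<otimes>\<^bsub>GL2\<^esub> z)"
    by (simp add: GL2_def matrix_mul_assoc)
  show "\<one>\<^bsub>GL2\<^esub> \<otimes>\<^bsub>GL2\<^esub> x = x" by (simp add: GL2_def)
qed

lemma GL2_inv: "det g \<noteq> 0 \<Longrightarrow> inv\<^bsub>GL2\<^esub> g = inv2 (g :: 'e^2^2)"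
proof (rule group.inv_equality[OF GL2_group])
  assume g: "det g \<noteq> 0"
  show "inv2 g \<otimes>\<^bsub>GL2\<^esub> g = \<one>\<^bsub>GL2\<^esub>" using inv2[OF g] by (simp add: GL2_def)
  show "g \<in> carrier GL2" using g by (simp add: GL2_def invertible_det_nz)
  show "inv2 g \<in> carrier GL2" using inv2[OF g] by (auto simp: GL2_def invertible_def)
qed

lemma subgroup_GL2I:
  assumes "H \<subseteq> {g :: 'e^2^2. det g \<noteq> 0}" "mat 1 \<in> H" "\<And>g h. g \<in> H \<Longrightarrow> h \<in> H \<Longrightarrow> g ** h \<in> H"
    "\<And>g. g \<in> H \<Longrightarrow> inv2 g \<in> H"
  shows "subgroup H GL2"
proof
  show "H \<subseteq> carrier GL2" using assms(1) by (auto simp: GL2_def invertible_det_nz)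
  show "x \<otimes>\<^bsub>GL2\<^esub> y \<in> H" if "x \<in> H" "y \<in> H" for x y using assms(3)[OF that] by (simp add: GL2_def)
  show "\<one>\<^bsub>GL2\<^esub> \<in> H" using assms(2) by (simp add: GL2_def)
  show "inv\<^bsub>GL2\<^esub> x \<in> H" if "x \<in> H" for x using that assms(1,4) GL2_inv[of x] by auto
qed

lemma KN_subgroup:
  assumes N: "N \<ge> 1" shows "subgroup (KN N) GL2"
proof (rule subgroup_GL2I)
  show "KN N \<subseteq> {g. det g \<noteq> 0}" using det_U11_nz by (auto simp: KN_def)
  show "mat 1 \<in> KN N" by (simp add: KN_def)
next
  fix g h assume gh: "g \<in> KN N" "h \<in> KN N"
  obtain a b c d where g: "g = mat2 a b c d" by (rule mat2_cases)
  obtain a' b' c' d' where h: "h = mat2 a' b' c' d'" by (rule mat2_cases)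
  have G: "a - 1 \<in> PE (int N)" "b \<in> PE (int N)" "c \<in> PE (int N)" "d - 1 \<in> PE (int N)" "mat2 a b c d \<in> U11"
    using gh(1) by (auto simp: g KN_mat2)
  have H: "a' - 1 \<in> PE (int N)" "b' \<in> PE (int N)" "c' \<in> PE (int N)" "d' - 1 \<in> PE (int N)" "mat2 a' b' c' d' \<in> U11"
    using gh(2) by (auto simp: h KN_mat2)
  have O: "a' \<in> PE 0" "d' \<in> PE 0" "b' \<in> PE 0" "c' \<in> PE 0"
    using H N near_one_unit[of a' "int N"] near_one_unit[of d' "int N"] by (auto intro: units_E_PE PE_mono)
  have "g ** h \<in> U11" using G(5) H(5) by (simp add: g h)
  moreover have "(a - 1) * a' + b * c' + (a' - 1) \<in> PE (int N)" "(a - 1) * b' + b' + b * d' \<in> PE (int N)"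
    "c * a' + (d - 1) * c' + c' \<in> PE (int N)" "c * b' + (d - 1) * d' + (d' - 1) \<in> PE (int N)"
    using G H O by (auto intro!: PE_add PE_mult_right)
  hence "a * a' + b * c' - 1 \<in> PE (int N)" "a * b' + b * d' \<in> PE (int N)"
    "c * a' + d * c' \<in> PE (int N)" "c * b' + d * d' - 1 \<in> PE (int N)"
    by (simp_all add: algebra_simps)
  ultimately show "g ** h \<in> KN N" by (simp add: g h mat2_mult KN_mat2)
next
  fix g assume g1: "g \<in> KN N"
  obtain a b c d where g: "g = mat2 a b c d" by (rule mat2_cases)
  have G: "a - 1 \<in> PE (int N)" "b \<in> PE (int N)" "c \<in> PE (int N)" "d - 1 \<in> PE (int N)" "mat2 a b c d \<in> U11"
    using g1 by (auto simp: g KN_mat2)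
  define D where "D = a * d - b * c"
  have aO: "a \<in> PE 0" "c \<in> PE 0" "d \<in> PE 0" "b \<in> PE 0"
    using G N near_one_unit[of a "int N"] near_one_unit[of d "int N"] by (auto intro: units_E_PE PE_mono)
  have "D - 1 = (a - 1) * d + (d - 1) - b * c" by (simp add: D_def algebra_simps)
  also have "\<dots> \<in> PE (int N)" using G aO by (intro PE_diff[OF PE_add[OF PE_mult_right] PE_mult_right])
  finally have D1: "D - 1 \<in> PE (int N)" .
  hence Du: "D \<in> units_E" using N near_one_unit by simp
  hence iD: "inverse D \<in> PE 0" "D \<noteq> 0" by (auto intro: units_E_PE dest: units_E_nz)
  have "d - D \<in> PE (int N)" "a - D \<in> PE (int N)"
    using PE_diff[OF G(4) D1] PE_diff[OF G(1) D1] by simp_all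
  hence "(d - D) * inverse D \<in> PE (int N)" "(a - D) * inverse D \<in> PE (int N)"
    using iD(1) by (auto intro: PE_mult_right)
  hence "d / D - 1 \<in> PE (int N)" "a / D - 1 \<in> PE (int N)"
    using iD(2) by (simp_all add: field_simps)
  moreover have "- b / D \<in> PE (int N)" "- c / D \<in> PE (int N)"
    unfolding divide_inverse using G(2,3) iD(1) by (auto intro!: PE_mult_right)
  moreover have "inv2 g = mat2 (d / D) (- b / D) (- c / D) (a / D)" by (simp add: inv2_def g D_def)
  moreover have "inv2 g \<in> U11" using G(5) by (simp add: g)
  ultimately show "inv2 g \<in> KN N" by (simp add: KN_mat2)
qed

lemma KN_open: "N \<ge> 1 \<Longrightarrow> open_subgroup U11 (KN N)"
proof -
  assume N: "N \<ge> 1"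
  have "open_in U11 (KN N)"
    unfolding open_in_def
  proof (intro conjI ballI)
    show "KN N \<subseteq> U11" by (auto simp: KN_def)
    fix g assume g: "g \<in> KN N"
    show "\<exists>n. \<forall>h\<in>U11. (\<forall>i j. h $ i $ j - g $ i $ j \<in> PE n) \<longrightarrow> h \<in> KN N"
    proof (intro exI ballI impI)
      fix h assume "h \<in> U11" "\<forall>i j. h $ i $ j - g $ i $ j \<in> PE (int N)"
      thus "h \<in> KN N" using g PE_cong_trans unfolding KN_def by blast
    qed
  qed
  thus ?thesis using KN_subgroup[OF N] by (simp add: open_subgroup_def)
qed

text \<open>Iwahori factorization: invariance under \<open>KN N\<close> is reduced to the operators
  \<open>u\<close>, \<open>h\<close> and \<open>lo\<close>.\<close>

lemma KN_decomp:
  assumes g: "g \<in> KN N" and N: "N \<ge> 1"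
  obtains b t c where "g = Up b ** torus_elt t ** Lo c" "b \<in> PF (int N)" "c \<in> PF (int N)"
    "t \<in> units_E" "t - 1 \<in> PE (int N)"
proof -
  obtain a b c d where gm: "g = mat2 a b c d" by (rule mat2_cases)
  have G: "b \<in> PE (int N)" "c \<in> PE (int N)" "d - 1 \<in> PE (int N)" "mat2 a b c d \<in> U11"
    using g by (auto simp: gm KN_mat2)
  have du: "d \<in> units_E" using near_one_unit[OF G(3)] N by simp
  hence d: "d \<noteq> 0" "inverse d \<in> PE 0" by (auto dest: units_E_nz intro: units_E_PE)
  note dec = U11_LDU[OF G(4) d(1)]
  have "b / d \<in> PF (int N)" "c / d \<in> PF (int N)"
    using dec(2,3) G(1,2) d(2) by (auto simp: PF_iff divide_inverse intro!: PE_mult_right)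
  moreover have "inverse (s d) \<in> units_E" using du by simp
  moreover have "inverse (s d) - 1 \<in> PE (int N)"
  proof -
    have "inverse (s d) - 1 = s ((1 - d) * inverse d)"
      unfolding s_mult s_diff s_inverse s_one using d(1) by (simp add: left_diff_distrib)
    moreover have "(1 - d) * inverse d \<in> PE (int N)"
      using G(3) d(2) PE_diff_commute by (intro PE_mult_right) auto
    ultimately show ?thesis by simp
  qed
  ultimately show ?thesis using that dec(1) gm by blast
qed

end

context u11_rep begin

lemma V_ne: "V \<noteq> {0}"
  using irr by (simp add: irreducible_rep_def)

lemma smooth:
  assumes v: "v \<in> V" shows "\<exists>N\<ge>1. \<forall>g\<in>KN N. \<pi> g v = v"
proof -
  let ?S = "{g \<in> U11. \<pi> g v = v}"
  have "open_in U11 ?S" using adm v by (simp add: admissible_rep_def smooth_rep_def)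
  hence "\<forall>g\<in>?S. \<exists>n. \<forall>h\<in>U11. (\<forall>i j. h $ i $ j - g $ i $ j \<in> PE n) \<longrightarrow> h \<in> ?S"
    unfolding open_in_def by (rule conjunct2)
  from bspec[OF this, of "mat 1"] v
  obtain n where n: "\<And>g. g \<in> U11 \<Longrightarrow> \<forall>i j. g $ i $ j - mat 1 $ i $ j \<in> PE n \<Longrightarrow> \<pi> g v = v"
    by auto
  have "\<pi> g v = v" if "g \<in> KN (max 1 (nat n))" for g
    using that PE_mono[of _ "int (max 1 (nat n))" n] by (intro n) (auto simp: KN_def)
  thus ?thesis by (intro exI[of _ "max 1 (nat n)"]) auto
qed

lemma invariants_finite_dim:
  assumes "N \<ge> 1" obtains B where "finite B" "invariants (KN N) V \<pi> \<subseteq> span B"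
proof -
  have "finite_dimensional sc (invariants (KN N) V \<pi>)"
    using adm KN_open[OF assms] by (simp add: admissible_rep_def)
  then obtain B where "finite B" "span B = invariants (KN N) V \<pi>" unfolding finite_dimensional_def by blast
  thus ?thesis using that[of B] by simp
qed

lemma invariants_subspace: "H \<subseteq> U11 \<Longrightarrow> subspace (invariants H V \<pi>)"
  by (rule subspaceI) (auto simp: invariants_def pi_add pi_scale subset_iff)

text \<open>\<open>\<pi> (mat z)\<close> commutes with the group, so it preserves the invariants of
  some \<open>KN N\<close>, which are finite dimensional by admissibility. There it has an
  eigenvector, and the whole eigenspace is stable under \<open>U11\<close>.\<close>

lemma schur:
  assumes z: "z \<in> E1" shows "\<exists>!c. \<forall>v\<in>V. \<pi> (mat z) v = sc c v"
proof -
  have zU: "mat z \<in> U11" using z torus_E1[OF z] E1_unit[OF z] units_E_nz torus_U11 by metis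
  have comm: "\<pi> (mat z) (\<pi> g v) = \<pi> g (\<pi> (mat z) v)" if "g \<in> U11" "v \<in> V" for g v
  proof (rule pi_comm)
    obtain a b c d where "g = mat2 a b c d" by (rule mat2_cases)
    thus "mat z ** g = g ** mat z" by (simp add: mat_mat2 mat2_mult mult.commute)
  qed (use that zU in auto)
  obtain v where v: "v \<in> V" "v \<noteq> 0" using V_ne V_zero by blast
  obtain N where N: "N \<ge> 1" "\<forall>g\<in>KN N. \<pi> g v = v" using smooth[OF v(1)] by blast
  let ?W = "invariants (KN N) V \<pi>"
  obtain B where B: "finite B" "?W \<subseteq> span B" using invariants_finite_dim[OF N(1)] by blast
  have KU: "KN N \<subseteq> U11" by (auto simp: KN_def)
  have "\<exists>c. \<exists>w\<in>?W. w \<noteq> 0 \<and> \<pi> (mat z) w = sc c w"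
  proof (rule eigenvector_exists[OF invariants_subspace[OF KU] B(2,1)])
    show "v \<in> ?W" using v N by (simp add: invariants_def)
    show "\<pi> (mat z) x \<in> ?W" if "x \<in> ?W" for x
      using that zU KU comm[symmetric] by (auto simp: invariants_def subset_iff)
  qed (use v zU in \<open>auto simp: invariants_def pi_add pi_scale\<close>)
  then obtain c w where w: "w \<in> V" "w \<noteq> 0" "\<pi> (mat z) w = sc c w" by (auto simp: invariants_def)
  let ?U = "{v \<in> V. \<pi> (mat z) v = sc c v}"
  have "subspace ?U"
    using zU by (intro subspaceI) (auto simp: pi_add pi_scale scale_right_distrib scale_left_commute)
  moreover have "\<forall>g\<in>U11. \<forall>x\<in>?U. \<pi> g x \<in> ?U" by (auto simp: comm pi_scale)
  ultimately have "?U = {0} \<or> ?U = V" using irr unfolding irreducible_rep_def by blast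
  hence "?U = V" using w by blast
  hence ex: "\<forall>v\<in>V. \<pi> (mat z) v = sc c v" by blast
  moreover have "c' = c" if "\<forall>v\<in>V. \<pi> (mat z) v = sc c' v" for c'
    using that ex v by (metis scale_right_imp_eq)
  ultimately show ?thesis by blast
qed

lemma central: "z \<in> E1 \<Longrightarrow> v \<in> V \<Longrightarrow> h z v = sc (central_char sc V \<pi> z) v"
proof -
  assume z: "z \<in> E1" and v: "v \<in> V"
  have "\<forall>v\<in>V. \<pi> (mat z) v = sc (central_char sc V \<pi> z) v"
    unfolding central_char_def by (rule theI'[OF schur[OF z]])
  from bspec[OF this v] show ?thesis by (simp only: torus_E1[OF z])
qed

end

subsection \<open>Projection to a character of the torus\<close>

lemma (in unramified_quadratic) Nm_near_one: "t \<in> units_E \<Longrightarrow> t - 1 \<in> PE n \<Longrightarrow> Nm t - 1 \<in> PE n"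
proof -
  assume t: "t \<in> units_E" "t - 1 \<in> PE n"
  have "Nm t - 1 = (t - 1) * s t + s (t - 1)" by (simp add: Nm_def s_diff algebra_simps)
  also have "\<dots> \<in> PE n" using t by (intro PE_add PE_mult_right) (auto intro: units_E_PE)
  finally show ?thesis .
qed

context u11_rep begin

definition eig :: "('e \<Rightarrow> complex) \<Rightarrow> 'v set" where
  "eig ch = {v \<in> V. \<forall>t\<in>units_E. h t v = sc (ch t) v}"

definition near :: "nat \<Rightarrow> ('e \<Rightarrow> complex) \<Rightarrow> 'v \<Rightarrow> bool" where
  "near n ch x \<longleftrightarrow> x \<in> V \<and> (\<forall>t\<in>units_E. t - 1 \<in> PE (int n) \<longrightarrow> h t x = sc (ch t) x)"

text \<open>An unnormalized projection onto \<open>eig ch\<close>, where it multiplies by the number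
  of representatives. The sum is independent of the representatives on vectors that are
  \<open>near n ch\<close>.\<close>

definition Aop :: "nat \<Rightarrow> ('e \<Rightarrow> complex) \<Rightarrow> 'v \<Rightarrow> 'v" where
  "Aop n ch x = (\<Sum>t\<in>unit_reps n. sc (inverse (ch t)) (h t x))"

text \<open>The two conditions on \<open>ch\<close> determine it on units with norm in
  \<open>1 + PE n\<close>, since these are products of an element of \<open>E1\<close> and an
  element of \<open>F\<close> close to 1.\<close>

definition good :: "nat \<Rightarrow> ('e \<Rightarrow> complex) \<Rightarrow> bool" where
  "good n ch \<longleftrightarrow> unit_char ch \<and> (\<forall>z\<in>E1. ch z = central_char sc V \<pi> z) \<and>
     (\<forall>x\<in>F. x - 1 \<in> PE (int n) \<longrightarrow> ch x = 1)"

lemma eig_V: "x \<in> eig ch \<Longrightarrow> x \<in> V" by (simp add: eig_def)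
lemma near_V: "near n ch x \<Longrightarrow> x \<in> V" by (simp add: near_def)

lemma h_V [simp, intro]: "t \<in> units_E \<Longrightarrow> v \<in> V \<Longrightarrow> h t v \<in> V"
  using units_E_nz by auto

lemma unit_reps_V: "n \<ge> 1 \<Longrightarrow> t \<in> unit_reps n \<Longrightarrow> v \<in> V \<Longrightarrow> h t v \<in> V"
  using unit_reps_unit by auto

lemma Aop_V: "n \<ge> 1 \<Longrightarrow> x \<in> V \<Longrightarrow> Aop n ch x \<in> V"
  unfolding Aop_def by (intro V_sum V_scale unit_reps_V)

lemma Aop_add: "n \<ge> 1 \<Longrightarrow> x \<in> V \<Longrightarrow> y \<in> V \<Longrightarrow> Aop n ch (x + y) = Aop n ch x + Aop n ch y"
proof -
  assume n: "n \<ge> 1" and xy: "x \<in> V" "y \<in> V"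
  have "h t (x + y) = h t x + h t y" if "t \<in> unit_reps n" for t
    using unit_reps_unit[OF n that] xy units_E_nz by (intro pi_add) auto
  thus ?thesis by (simp add: Aop_def scale_right_distrib sum.distrib)
qed

lemma Aop_scale: "n \<ge> 1 \<Longrightarrow> x \<in> V \<Longrightarrow> Aop n ch (sc c x) = sc c (Aop n ch x)"
proof -
  assume n: "n \<ge> 1" and x: "x \<in> V"
  have "h t (sc c x) = sc c (h t x)" if "t \<in> unit_reps n" for t
    using unit_reps_unit[OF n that] x units_E_nz by (intro pi_scale) auto
  thus ?thesis by (simp add: Aop_def scale_sum_right mult.commute)
qed

lemma Aop_zero: "n \<ge> 1 \<Longrightarrow> Aop n ch 0 = 0"
  using Aop_scale[of n 0 ch 0] by simp

lemma Aop_sum: "n \<ge> 1 \<Longrightarrow> (\<And>i. i \<in> I \<Longrightarrow> f i \<in> V) \<Longrightarrow> Aop n ch (sum f I) = (\<Sum>i\<in>I. Aop n ch (f i))"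
  by (induction I rule: infinite_finite_induct) (auto simp: Aop_add Aop_zero V_sum)

lemma Aop_eig: "n \<ge> 1 \<Longrightarrow> x \<in> eig ch \<Longrightarrow> (\<forall>t\<in>units_E. ch t \<noteq> 0) \<Longrightarrow> Aop n ch x = sc (of_nat (card (unit_reps n))) x"
proof -
  assume n: "n \<ge> 1" and x: "x \<in> eig ch" and nz: "\<forall>t\<in>units_E. ch t \<noteq> 0"
  have "Aop n ch x = (\<Sum>t\<in>unit_reps n. x)"
    unfolding Aop_def
  proof (intro sum.cong refl)
    fix t assume "t \<in> unit_reps n"
    hence "t \<in> units_E" by (rule unit_reps_unit[OF n])
    thus "sc (inverse (ch t)) (h t x) = x" using x nz by (simp add: eig_def)
  qed
  thus ?thesis by (simp only: sum_const)
qed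

lemma card_unit_reps: "of_nat (card (unit_reps n)) \<noteq> (0 :: complex)"
  using unit_reps_nonempty[of n] by simp

end

context u11_rep_level begin

lemma Y_subspace: "subspace (Y k)"
proof (rule subspaceI)
  show "0 \<in> Y k" using near_nz by (auto simp: Y_def hfix_def)
next
  fix x y assume xy: "x \<in> Y k" "y \<in> Y k"
  have V: "x \<in> V" "y \<in> V" using xy Y_V by auto
  thus "x + y \<in> Y k" using xy lev_add[of k x y] lev_add[of _ "j x" "j y"] hfix_add[of x y]
    by (simp add: Y_def pi_add)
next
  fix c x assume x: "x \<in> Y k"
  have V: "x \<in> V" using x by auto
  thus "sc c x \<in> Y k" using x lev_scale[of _ _ c] hfix_scale[of x c] by (simp add: Y_def pi_scale)
qed

lemma Y_Aop: "n \<ge> 1 \<Longrightarrow> x \<in> Y k \<Longrightarrow> Aop n ch x \<in> Y k"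
  unfolding Aop_def
  by (intro subspace_sum[OF Y_subspace] subspace_scale[OF Y_subspace] Y_h_unit unit_reps_unit[of n])

end

locale torus_char = u11_rep F val s unif sc V \<pi>
  for F :: "'e::field set" and val :: "'e \<Rightarrow> int" and s :: "'e \<Rightarrow> 'e" and unif :: 'e
    and sc :: "complex \<Rightarrow> 'v::ab_group_add \<Rightarrow> 'v" and V :: "'v set" and \<pi> :: "'e^2^2 \<Rightarrow> 'v \<Rightarrow> 'v" +
  fixes n :: nat and ch :: "'e \<Rightarrow> complex"
  assumes n_pos: "n \<ge> 1" and good: "good n ch"
begin

lemma chi_nz: "t \<in> units_E \<Longrightarrow> ch t \<noteq> 0"
  and chi_mult: "t \<in> units_E \<Longrightarrow> t' \<in> units_E \<Longrightarrow> ch (t * t') = ch t * ch t'"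
  and chi_E1: "z \<in> E1 \<Longrightarrow> ch z = central_char sc V \<pi> z"
  and chi_F: "x \<in> F \<Longrightarrow> x - 1 \<in> PE (int n) \<Longrightarrow> ch x = 1"
  using good unfolding good_def unit_char_def by auto

abbreviation A where "A \<equiv> Aop n ch"

lemma term_periodic:
  assumes x: "near n ch x" and t: "t \<in> units_E" "t' \<in> units_E" "t - t' \<in> PE (int n)"
  shows "sc (inverse (ch t)) (h t x) = sc (inverse (ch t')) (h t' x)"
proof -
  define r where "r = t / t'"
  have nz: "t \<noteq> 0" "t' \<noteq> 0" using t units_E_nz by auto
  have r: "r \<in> units_E" "t = t' * r" using t nz by (auto simp: r_def)
  have "r - 1 = (t - t') * inverse t'" using nz by (simp add: r_def field_simps)
  also have "\<dots> \<in> PE (int n)" using t by (intro PE_mult_right) (auto intro: units_E_PE)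
  finally have "h r x = sc (ch r) x" using x r by (simp add: near_def)
  moreover have "h t x = h t' (h r x)" using r nz units_E_nz near_V[OF x] by (simp add: h_h)
  ultimately have "h t x = sc (ch r) (h t' x)" using nz near_V[OF x] by (simp add: pi_scale)
  thus ?thesis using r t chi_nz[of r] chi_nz[of t'] by (simp add: chi_mult)
qed

lemma A_h: assumes x: "near n ch x" and t0: "t0 \<in> units_E"
  shows "A (h t0 x) = sc (ch t0) (A x)" "h t0 (A x) = sc (ch t0) (A x)"
proof -
  have V: "x \<in> V" using x by (rule near_V)
  let ?f = "\<lambda>t. sc (inverse (ch t)) (h t x)"
  have sh: "(\<Sum>t\<in>unit_reps n. ?f (t0 * t)) = A x"
    unfolding Aop_def by (rule sum_unit_reps[OF t0 n_pos]) (rule term_periodic[OF x])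
  have e: "sc (ch t0) (?f (t0 * t)) = sc (inverse (ch t)) (h (t0 * t) x)" if "t \<in> unit_reps n" for t
    using chi_nz[OF t0] unit_reps_unit[OF n_pos that] t0 by (simp add: chi_mult)
  have "sc (ch t0) (A x) = (\<Sum>t\<in>unit_reps n. sc (inverse (ch t)) (h (t0 * t) x))"
    unfolding sh[symmetric] scale_sum_right by (rule sum.cong[OF refl e])
  note s1 = this
  have "h t (h t0 x) = h (t0 * t) x" if "t \<in> unit_reps n" for t
    using unit_reps_unit[OF n_pos that] t0 units_E_nz V by (simp add: h_h mult.commute)
  thus "A (h t0 x) = sc (ch t0) (A x)" unfolding s1 by (simp add: Aop_def)
  have hh: "h t0 (sc (inverse (ch t)) (h t x)) = sc (inverse (ch t)) (h (t0 * t) x)" if "t \<in> unit_reps n" for t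
    using unit_reps_unit[OF n_pos that] t0 units_E_nz V by (simp add: h_h pi_scale)
  have "h t0 (A x) = (\<Sum>t\<in>unit_reps n. h t0 (sc (inverse (ch t)) (h t x)))"
    unfolding Aop_def using t0 units_E_nz V unit_reps_V[OF n_pos] by (intro pi_sum) auto
  also have "\<dots> = sc (ch t0) (A x)" unfolding s1 by (rule sum.cong[OF refl hh])
  finally show "h t0 (A x) = sc (ch t0) (A x)" .
qed

lemma A_in_eig: "near n ch x \<Longrightarrow> A x \<in> eig ch"
  using A_h(2) Aop_V[OF n_pos near_V] by (simp add: eig_def)

lemma A_on_eig: "x \<in> eig ch \<Longrightarrow> A x = sc (of_nat (card (unit_reps n))) x"
  using chi_nz by (intro Aop_eig n_pos) auto

end

locale level_char = u11_rep_level F val s unif sc V \<pi> l + torus_char F val s unif sc V \<pi> n ch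
  for F :: "'e::field set" and val :: "'e \<Rightarrow> int" and s :: "'e \<Rightarrow> 'e" and unif :: 'e
    and sc :: "complex \<Rightarrow> 'v::ab_group_add \<Rightarrow> 'v" and V :: "'v set" and \<pi> :: "'e^2^2 \<Rightarrow> 'v \<Rightarrow> 'v"
    and l n ch +
  assumes ln: "l \<le> n"
begin

text \<open>In the decomposition \<open>t = e * v\<close> the factor \<open>v\<close> acts trivially
  by \<open>l \<le> n\<close> and \<open>e\<close> acts by the central character; \<open>ch\<close>
  takes the same values on both factors.\<close>

lemma h_norm_one:
  assumes x: "hfix x" and t: "t \<in> units_E" "Nm t - 1 \<in> PE (int n)"
  shows "h t x = sc (ch t) x"
proof -
  have V: "x \<in> V" using x by (simp add: hfix_def)
  obtain e v where ev: "e \<in> E1" "v \<in> F" "v - 1 \<in> PE (int n)" "t = e * v"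
    using norm_near_one_decomp[OF t(2) n_pos] by blast
  have vl: "v - 1 \<in> PE (int l)" using ev(3) ln by (auto intro: PE_mono)
  have u: "e \<in> units_E" "v \<in> units_E"
    using E1_unit[OF ev(1)] near_one_unit[OF ev(3)] n_pos by auto
  have "h t x = h e (h v x)" using u units_E_nz V ev(4) by (simp add: h_h)
  also have "h v x = x" using x ev(2) vl by (simp add: hfix_def)
  also have "h e x = sc (ch e) x" using central[OF ev(1) V] chi_E1[OF ev(1)] by simp
  also have "ch e = ch t" using chi_mult[OF u] chi_F[OF ev(2,3)] ev(4) by simp
  finally show ?thesis .
qed

lemma Y_near: "x \<in> Y k \<Longrightarrow> near n ch x"
  using h_norm_one[OF Y_hfix] Nm_near_one by (simp add: near_def Y_V)

text \<open>A torus element with norm in \<open>1 + PE n\<close> moves \<open>b\<close> by an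
  element of \<open>PF k\<close>. The room this leaves for \<open>b\<close> beyond
  \<open>PF (k - l)\<close> serves characters of larger conductor.\<close>

lemma u_Y_near:
  assumes x: "x \<in> Y k" and b: "b \<in> PF (k - int n)"
  shows "near n ch (u b x)"
proof -
  have bF: "b \<in> F" and bP: "b \<in> PE (k - int n)" using b by (auto simp: PF_iff)
  have "h t (u b x) = sc (ch t) (u b x)" if t: "t \<in> units_E" "t - 1 \<in> PE (int n)" for t
  proof -
    have N: "Nm t - 1 \<in> PE (int n)" by (rule Nm_near_one[OF t])
    have hx: "h t x = sc (ch t) x" using Y_hfix[OF x] t(1) N by (rule h_norm_one)
    have "h t (u b x) = u (Nm t * b) (h t x)" using t bF x units_E_nz by (intro h_u) auto
    also have "\<dots> = sc (ch t) (u (Nm t * b) x)" using hx bF x by (simp add: pi_scale Y_V)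
    also have "u (Nm t * b) x = u b x"
    proof (rule u_periodic[OF Y_u_fix[OF x] Y_V[OF x]])
      have "(Nm t - 1) * b \<in> PE k" using N bP by (rule PE_mult) simp
      thus "Nm t * b - b \<in> PE k" by (simp add: algebra_simps)
    qed (use bF in auto)
    finally show ?thesis .
  qed
  thus ?thesis using x bF by (simp add: near_def Y_V)
qed

text \<open>Averaging \<open>u (- b) A u b x\<close> over \<open>b\<close> leaves only the torus elements acting on \<open>x\<close> through \<open>ch\<close>.\<close>

lemma A_u_nonzero:
  assumes x: "x \<in> Y (int l)" "x \<noteq> 0"
  obtains b where "b \<in> PF (int l - int n)" "A (u b x) \<noteq> 0"
proof -
  have V: "x \<in> V" using x by auto
  let ?m = "int l - int n"
  let ?B = "reps ?m (int l)"
  have mn: "?m \<le> int l" by simp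
  have BF: "b \<in> PF ?m" if "b \<in> ?B" for b using reps_PF[OF mn that] .
  \<comment> \<open>Since \<open>val a < n\<close>, the multiples \<open>a * b\<close> fill
    \<open>PF (l - 1)\<close>, so the sum is invariant under \<open>PF (l - 1)\<close>; a vector of
    level \<open>l\<close> has no such component.\<close>
  have inner0: "(\<Sum>b\<in>?B. u (a * b) y) = 0"
    if y: "y \<in> Y (int l)" and a: "a \<in> F" "a \<in> PE 0" "a \<notin> PE (int n)" for a y
  proof -
    have yV: "y \<in> V" using y by auto
    have a0: "a \<noteq> 0" "val a \<ge> 0" "val a < int n" using a by (auto simp: PE_iff)
    let ?S = "\<Sum>b\<in>?B. u (a * b) y"
    have SV: "?S \<in> V" using BF a yV by (intro V_sum) (auto simp: PF_iff)
    have "u c ?S = ?S" if c: "c \<in> PF (int l - 1)" for c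
    proof -
      have cF: "c \<in> F" using c by (rule PF_in_F)
      have "a * (c / a) \<in> PF (int l - 1)" using c a0 by simp
      hence "c / a \<in> PF (int l - 1 - val a)" using PF_scale[of a "c / a"] a0 a(1) cF by auto
      hence ca: "c / a \<in> PF ?m" using a0 by (auto intro: PF_mono)
      have "u c ?S = (\<Sum>b\<in>?B. u c (u (a * b) y))"
        using cF BF a yV by (intro pi_sum) (auto simp: PF_iff)
      also have "\<dots> = (\<Sum>b\<in>?B. u (a * (1 * b + c / a)) y)"
        using cF BF a a0 yV by (intro sum.cong refl) (auto simp: PF_iff u_u algebra_simps)
      also have "\<dots> = (\<Sum>b\<in>reps (?m + val 1) (int l + val 1). u (a * b) y)"
      proof (rule sum_reps_affine[where f = "\<lambda>b. u (a * b) y"])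
        fix p q assume pq: "p \<in> PF (?m + val 1)" "q \<in> PF (?m + val 1)" "p - q \<in> PE (int l + val 1)"
        have "a * (p - q) \<in> PE (int l)" using pq a by (intro PE_mult_left) auto
        thus "u (a * p) y = u (a * q) y"
          using pq a yV by (intro u_periodic[OF Y_u_fix[OF y]]) (auto simp: PF_iff algebra_simps)
      qed (use ca mn in auto)
      finally show ?thesis by simp
    qed
    hence "(\<Sum>c\<in>reps (int l - 1) (int l). u c ?S) = (\<Sum>c\<in>reps (int l - 1) (int l). ?S)"
      using reps_PF[of "int l - 1" "int l"] by (intro sum.cong refl) auto
    also have "\<dots> = sc (of_nat (card (reps (int l - 1) (int l)))) ?S" by (rule sum_const)
    finally have 1: "(\<Sum>c\<in>reps (int l - 1) (int l). u c ?S) = sc (of_nat (card (reps (int l - 1) (int l)))) ?S" .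
    have "(\<Sum>c\<in>reps (int l - 1) (int l). u c ?S) = (\<Sum>c\<in>reps (int l - 1) (int l). \<Sum>b\<in>?B. u (a * b) (u c y))"
    proof (intro sum.cong refl)
      fix c assume "c \<in> reps (int l - 1) (int l)"
      hence cF: "c \<in> F" using reps_F[of "int l - 1" "int l" c] by simp
      have "u c ?S = (\<Sum>b\<in>?B. u c (u (a * b) y))"
        using cF BF a yV by (intro pi_sum) (auto simp: PF_iff)
      also have "\<dots> = (\<Sum>b\<in>?B. u (a * b) (u c y))"
        using cF BF a yV by (intro sum.cong refl) (auto simp: PF_iff u_u add.commute)
      finally show "u c ?S = (\<Sum>b\<in>?B. u (a * b) (u c y))" .
    qed
    also have "\<dots> = (\<Sum>b\<in>?B. \<Sum>c\<in>reps (int l - 1) (int l). u (a * b) (u c y))" by (rule sum.swap)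
    also have "\<dots> = (\<Sum>b\<in>?B. u (a * b) (\<Sum>c\<in>reps (int l - 1) (int l). u c y))"
      using BF a yV reps_F[of "int l - 1" "int l"] by (intro sum.cong refl pi_sum[symmetric]) (auto simp: PF_iff)
    also have "\<dots> = 0"
      using BF a Y_lev[OF y] by (intro sum.neutral) (auto simp: PF_iff lev_def)
    finally have "sc (of_nat (card (reps (int l - 1) (int l)))) ?S = 0" using 1 by simp
    moreover have "card (reps (int l - 1) (int l)) \<noteq> 0" using reps_card[of "int l - 1" "int l"] by linarith
    ultimately show ?thesis by (simp del: card_eq_0_iff)
  qed
  have "\<exists>b\<in>?B. A (u b x) \<noteq> 0"
  proof (rule ccontr)
    assume "\<not> ?thesis"
    hence z: "A (u b x) = 0" if "b \<in> ?B" for b using that by blast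
    let ?Q = "unit_reps n"
    let ?g = "\<lambda>b t. sc (inverse (ch t)) (u ((Nm t - 1) * b) (h t x))"
    have tb: "u (- b) (sc (inverse (ch t)) (h t (u b x))) = ?g b t" if b: "b \<in> ?B" and t: "t \<in> ?Q" for b t
    proof -
      have bF: "b \<in> F" using BF[OF b] by (rule PF_in_F)
      have tu: "t \<in> units_E" "t \<noteq> 0" using unit_reps_unit[OF n_pos t] units_E_nz by auto
      have "u (- b) (h t (u b x)) = u ((Nm t - 1) * b) (h t x)"
        using bF tu V by (simp add: h_u u_u algebra_simps)
      thus ?thesis using bF tu V by (simp add: pi_scale)
    qed
    have "0 = (\<Sum>b\<in>?B. u (- b) (A (u b x)))" using z BF by (simp add: PF_iff)
    also have "\<dots> = (\<Sum>b\<in>?B. \<Sum>t\<in>?Q. u (- b) (sc (inverse (ch t)) (h t (u b x))))"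
      unfolding Aop_def using BF V unit_reps_V[OF n_pos]
      by (intro sum.cong refl pi_sum) (auto simp: PF_iff)
    also have "\<dots> = (\<Sum>b\<in>?B. \<Sum>t\<in>?Q. ?g b t)" using tb by (intro sum.cong refl) auto
    also have "\<dots> = (\<Sum>t\<in>?Q. \<Sum>b\<in>?B. ?g b t)" by (rule sum.swap)
    \<comment> \<open>\<open>inner0\<close> with \<open>a = Nm t - 1\<close> removes every
      \<open>t\<close> whose norm is not 1 modulo \<open>PE n\<close>. Each remaining
      \<open>t\<close> contributes the same positive multiple of \<open>x\<close>, so nothing can
      cancel.\<close>
    also have "\<dots> = (\<Sum>t\<in>?Q. if Nm t - 1 \<in> PE (int n) then sc (of_nat (card ?B)) x else 0)"
    proof (intro sum.cong refl)
      fix t assume "t \<in> ?Q"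
      hence tu: "t \<in> units_E" "t \<noteq> 0" using unit_reps_unit[OF n_pos] units_E_nz by auto
      have hY: "h t x \<in> Y (int l)" using x(1) tu(1) by (rule Y_h_unit)
      show "(\<Sum>b\<in>?B. ?g b t) = (if Nm t - 1 \<in> PE (int n) then sc (of_nat (card ?B)) x else 0)"
      proof (cases "Nm t - 1 \<in> PE (int n)")
        case True
        have "h t x = sc (ch t) x" using Y_hfix[OF x(1)] tu(1) True by (rule h_norm_one)
        moreover have "u ((Nm t - 1) * b) (h t x) = h t x" if "b \<in> ?B" for b
        proof (rule Y_u_fix[OF hY])
          have "(Nm t - 1) * b \<in> PE (int l)" using True BF[OF that] by (intro PE_mult[of _ "int n" b ?m]) (auto simp: PF_iff)
          thus "(Nm t - 1) * b \<in> PF (int l)" using BF[OF that] by (auto simp: PF_iff)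
        qed
        ultimately have "(\<Sum>b\<in>?B. ?g b t) = (\<Sum>b\<in>?B. x)"
          using chi_nz[OF tu(1)] by (intro sum.cong refl) simp
        thus ?thesis using True by (simp only: sum_const if_True)
      next
        case False
        have "Nm t - 1 \<in> PE 0" using tu by (intro PE_diff) (auto intro: units_E_PE)
        hence "(\<Sum>b\<in>?B. u ((Nm t - 1) * b) (h t x)) = 0" using False by (intro inner0[OF hY]) auto
        thus ?thesis using False by (simp only: scale_sum_right[symmetric] if_False scale_zero_right)
      qed
    qed
    also have "\<dots> = (\<Sum>t\<in>{t\<in>?Q. Nm t - 1 \<in> PE (int n)}. sc (of_nat (card ?B)) x)"
      by (rule sum.inter_filter[symmetric]) simp
    also have "\<dots> = sc (of_nat (card {t\<in>?Q. Nm t - 1 \<in> PE (int n)})) (sc (of_nat (card ?B)) x)" by (rule sum_const)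
    finally have "of_nat (card {t\<in>?Q. Nm t - 1 \<in> PE (int n)}) * of_nat (card ?B) = (0::complex)"
      using x(2) by (simp del: of_nat_eq_0_iff card_eq_0_iff)
    moreover have "card ?B \<noteq> 0"
      using reps_card[of ?m "int l"] n_pos by linarith
    moreover have "erep (int n) 1 \<in> {t\<in>?Q. Nm t - 1 \<in> PE (int n)}"
    proof -
      have e: "erep (int n) 1 - 1 \<in> PE (int n)" by (rule erep)
      hence "erep (int n) 1 \<in> units_E" using near_one_unit n_pos by simp
      hence "Nm (erep (int n) 1) - 1 \<in> PE (int n)" using e by (rule Nm_near_one)
      thus ?thesis by (auto simp: unit_reps_def)
    qed
    ultimately show False by auto
  qed
  thus ?thesis using that BF by blast
qed

end

subsection \<open>Multiplicity one\<close>

context unramified_quadratic begin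

text \<open>The group \<open>Ib\<close> is the Iwahori subgroup of \<open>U11\<close>, and \<open>iota\<close> an anti-involution of it which
  preserves every double coset of the integral torus that supports an intertwining operator.\<close>

definition Ib :: "('e^2^2) set" where
  "Ib = {Up b ** torus_elt t ** Lo (unif * c) | b t c. b \<in> PF 0 \<and> t \<in> units_E \<and> c \<in> PF 0}"

definition iota :: "'e^2^2 \<Rightarrow> 'e^2^2" where
  "iota g = mat2 (g$1$1) (g$2$1 / unif) (unif * g$1$2) (g$2$2)"

lemma unif_PE [simp]: "unif * x \<in> PE n \<longleftrightarrow> x \<in> PE (n - 1)"
  using PE_scale[of unif x n] uniformizer by simp

lemma div_unif_PE [simp]: "x / unif \<in> PE n \<longleftrightarrow> x \<in> PE (n + 1)"
  using unif_PE[of "x / unif" "n + 1"] by (simp del: unif_PE)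

lemma unif_F [simp]: "unif \<in> F" by (rule uniformizer)

lemma LTU_mat2: "t \<noteq> 0 \<Longrightarrow> Up b ** torus_elt t ** Lo c = mat2 (t + b * c / s t) (b / s t) (c / s t) (1 / s t)"
  by (simp add: Up_def torus_mat2 Lo_def mat2_mult divide_inverse mult.commute mult.left_commute)

lemma Ib_mat2: "mat2 a b c d \<in> Ib \<longleftrightarrow>
  mat2 a b c d \<in> U11 \<and> a \<in> PE 0 \<and> b \<in> PE 0 \<and> c \<in> PE 1 \<and> d \<in> units_E"
proof
  assume "mat2 a b c d \<in> Ib"
  then obtain b' t c' where g: "b' \<in> PF 0" "t \<in> units_E" "c' \<in> PF 0"
    "mat2 a b c d = Up b' ** torus_elt t ** Lo (unif * c')" by (auto simp: Ib_def)
  have t: "t \<noteq> 0" "inverse (s t) \<in> units_E" using g(2) units_E_nz by auto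
  have "mat2 a b c d \<in> U11" using g t by (auto simp: PF_iff)
  moreover have "a = t + b' * (unif * c') * inverse (s t)" "b = b' * inverse (s t)"
    "c = unif * c' * inverse (s t)" "d = inverse (s t)"
    using g(4) LTU_mat2[OF t(1)] by (auto simp: mat2_eq_iff divide_inverse)
  moreover have "b' * (unif * c') \<in> PE 0" by (rule PE_mult_left) (use g PE_mono[of c' 0 "- 1"] in \<open>auto simp: PF_iff\<close>)
  moreover have i: "inverse (s t) \<in> PE 0" "t \<in> PE 0" using g t units_E_PE by auto
  moreover have "unif * c' * inverse (s t) \<in> PE 1" by (rule PE_mult_right[OF _ i(1)]) (use g in \<open>simp add: PF_iff\<close>)
  moreover have "b' * inverse (s t) \<in> PE 0" by (rule PE_mult_right[OF _ i(1)]) (use g in \<open>simp add: PF_iff\<close>)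
  ultimately show "mat2 a b c d \<in> U11 \<and> a \<in> PE 0 \<and> b \<in> PE 0 \<and> c \<in> PE 1 \<and> d \<in> units_E"
    using t PE_add[OF i(2) PE_mult_right[of "b' * (unif * c')" 0 "inverse (s t)"]] by simp
next
  assume g: "mat2 a b c d \<in> U11 \<and> a \<in> PE 0 \<and> b \<in> PE 0 \<and> c \<in> PE 1 \<and> d \<in> units_E"
  hence d: "d \<noteq> 0" "inverse d \<in> PE 0" "d \<in> units_E" by (auto dest: units_E_nz intro: units_E_PE)
  have G: "mat2 a b c d \<in> U11" using g by blast
  note dec = U11_LDU[OF G d(1)]
  have "b / d \<in> PF 0" using dec(2) g d by (auto simp: PF_iff divide_inverse intro!: PE_mult_right)
  moreover have "c / d / unif \<in> PF 0"
  proof -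
    have "c / d \<in> PE 1" using g d by (simp add: divide_inverse PE_mult_right)
    thus ?thesis unfolding PF_iff using F_divide[OF dec(3) unif_F] div_unif_PE[of "c / d" 0]
      by (simp del: divide_divide_eq_left div_unif_PE)
  qed
  moreover have "mat2 a b c d = Up (b / d) ** torus_elt (inverse (s d)) ** Lo (unif * (c / d / unif))"
    using dec(1) by simp
  moreover have "inverse (s d) \<in> units_E" using d by simp
  ultimately show "mat2 a b c d \<in> Ib" unfolding Ib_def by blast
qed

lemma Ib_U11: assumes "g \<in> Ib" shows "g \<in> U11"
proof -
  obtain a b c d where "g = mat2 a b c d" by (rule mat2_cases)
  thus ?thesis using assms by (simp add: Ib_mat2)
qed

lemma Ib_mult: "g \<in> Ib \<Longrightarrow> h \<in> Ib \<Longrightarrow> g ** h \<in> Ib"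
proof -
  assume gh: "g \<in> Ib" "h \<in> Ib"
  obtain a b c d where g: "g = mat2 a b c d" by (rule mat2_cases)
  obtain a' b' c' d' where h: "h = mat2 a' b' c' d'" by (rule mat2_cases)
  have G: "a \<in> PE 0" "b \<in> PE 0" "c \<in> PE 1" "d \<in> units_E" "d \<in> PE 0" and
    H: "a' \<in> PE 0" "b' \<in> PE 0" "c' \<in> PE 1" "d' \<in> units_E" "d' \<in> PE 0"
    using gh by (auto simp: g h Ib_mat2 intro: units_E_PE)
  have "g ** h \<in> U11" using gh Ib_U11 by blast
  moreover have "a * a' + b * c' \<in> PE 0" "a * b' + b * d' \<in> PE 0"
    using G H by (auto intro!: PE_add PE_mult_left intro: PE_mono)
  moreover have "c * a' + d * c' \<in> PE 1"
    using G H by (intro PE_add PE_mult_left[of d] PE_mult_right[of c]) auto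
  moreover have "d * d' + c * b' \<in> units_E"
    using G H by (intro units_E_add[of _ _ 1] PE_mult_right[of c]) auto
  ultimately show ?thesis by (simp add: g h mat2_mult Ib_mat2 add.commute)
qed

lemma torus_Ib: "t \<in> units_E \<Longrightarrow> torus_elt t \<in> Ib"
proof -
  assume t: "t \<in> units_E"
  have "torus_elt t = Up 0 ** torus_elt t ** Lo (unif * 0)" by (simp add: Up_def Lo_def torus_mat2 mat2_mult)
  thus ?thesis using t unfolding Ib_def by blast
qed

text \<open>\<open>iota\<close> is transposition followed by conjugation with the diagonal matrix of
  entries 1 and \<open>unif\<close>, so it reverses products.\<close>

lemma iota_mult: "iota (g ** h) = iota h ** iota g"
proof -
  obtain a b c d where g: "g = mat2 a b c d" by (rule mat2_cases)
  obtain a' b' c' d' where h: "h = mat2 a' b' c' d'" by (rule mat2_cases)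
  show ?thesis by (simp add: g h iota_def mat2_mult mat2_eq_iff field_simps)
qed

lemma iota_LTU: "t \<noteq> 0 \<Longrightarrow> iota (Up b ** torus_elt t ** Lo (unif * c)) = Up c ** torus_elt t ** Lo (unif * b)"
  by (simp add: LTU_mat2 iota_def mat2_eq_iff mult.commute mult.left_commute)

lemma iota_torus: "iota (torus_elt t) = torus_elt t"
  by (simp add: iota_def torus_mat2)

lemma iota_Ib: "g \<in> Ib \<Longrightarrow> iota g \<in> Ib"
proof -
  assume "g \<in> Ib"
  then obtain b t c where "b \<in> PF 0" "t \<in> units_E" "c \<in> PF 0" "g = Up b ** torus_elt t ** Lo (unif * c)"
    by (auto simp: Ib_def)
  moreover from this have "iota g = Up c ** torus_elt t ** Lo (unif * b)" using iota_LTU units_E_nz by blast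
  ultimately show ?thesis unfolding Ib_def by blast
qed

end

locale level_char_eq = level_char F val s unif sc V \<pi> l l ch
  for F :: "'e::field set" and val :: "'e \<Rightarrow> int" and s :: "'e \<Rightarrow> 'e" and unif :: 'e
    and sc :: "complex \<Rightarrow> 'v::ab_group_add \<Rightarrow> 'v" and V :: "'v set" and \<pi> :: "'e^2^2 \<Rightarrow> 'v \<Rightarrow> 'v"
    and l ch
begin

definition Yc :: "int \<Rightarrow> 'v set" where "Yc k = Y k \<inter> eig ch"

lemma lo_sum_affine:
  assumes y: "y \<in> Y k" and a: "a \<in> F" "a \<noteq> 0" and m: "m = 2 * int l - k - val a"
  shows "(\<Sum>q\<in>reps m (m + 1). lo (a * q) y) = 0"
proof -
  have V: "y \<in> V" using y by auto
  have F: "q \<in> F" if "q \<in> reps m (m + 1)" for q using reps_F[OF _ that] by simp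
  have "j (\<Sum>q\<in>reps m (m + 1). lo (a * q) y) = (\<Sum>q\<in>reps m (m + 1). j (lo (a * q) y))"
    using F a V by (intro pi_sum) auto
  also have "\<dots> = (\<Sum>q\<in>reps m (m + 1). u ((- a) * q + 0) (j y))"
    using F a V by (intro sum.cong refl) (auto simp: j_lo)
  also have "\<dots> = 0" using a by (intro lev_sum_affine[OF Y_lev_j[OF y]]) (auto simp: m)
  finally show ?thesis using F a V by (subst (asm) pi_eq_0) (auto intro!: V_sum)
qed

context
  fixes y assumes y: "y \<in> Yc (int l)"
begin

lemma y_Y: "y \<in> Y (int l)" and y_eig: "y \<in> eig ch" and y_V: "y \<in> V"
  using y by (auto simp: Yc_def)

text \<open>By the Iwahori factorization and because \<open>y\<close> is an eigenvector of the
  torus, \<open>D\<close> determines \<open>A (\<pi> g y)\<close> for all \<open>g\<close> in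
  \<open>Ib\<close>. Invariance under \<open>iota\<close> becomes symmetry of \<open>D\<close> in
  its two arguments.\<close>

definition D :: "'e \<Rightarrow> 'e \<Rightarrow> 'v" where "D b c = A (u b (lo (unif * c) y))"

lemma lo_y: "c \<in> PF 0 \<Longrightarrow> lo (unif * c) y \<in> Y (int l)"
  by (rule Y_lo[OF y_Y]) (auto simp: PF_iff)

lemma u_lo_y: "b \<in> PF 0 \<Longrightarrow> c \<in> PF 0 \<Longrightarrow> u b (lo (unif * c) y) \<in> Y (int l)"
  by (rule Y_u[OF lo_y]) auto

text \<open>Insert \<open>h t\<close> under \<open>A\<close>: on the outside it gives the factor
  \<open>ch t\<close>, and moved inwards to \<open>y\<close> it gives the same factor while scaling
  \<open>b\<close> by \<open>Nm t\<close> and \<open>c\<close> by its inverse.\<close>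

lemma D_torus:
  assumes b: "b \<in> PF 0" "c \<in> PF 0" and t: "t \<in> units_E"
  shows "D (b * Nm t) (c / Nm t) = D b c"
proof -
  have F: "b \<in> F" "c \<in> F" and t0: "t \<noteq> 0" using b t units_E_nz by (auto simp: PF_iff)
  let ?z = "u (b * Nm t) (lo (unif * (c / Nm t)) y)"
  have zV: "?z \<in> V" using F y_V by auto
  have "h t (u b (lo (unif * c) y)) = u (Nm t * b) (lo (unif * c / Nm t) (h t y))"
    using F t0 y_V by (simp add: h_u h_lo)
  also have "\<dots> = sc (ch t) ?z"
    using F t0 t y_V y_eig by (simp add: eig_def pi_scale mult.commute)
  finally have "A (h t (u b (lo (unif * c) y))) = A (sc (ch t) ?z)" by simp
  hence "sc (ch t) (D b c) = sc (ch t) (A ?z)"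
    using A_h(1)[OF Y_near[OF u_lo_y[OF b]] t] Aop_scale[OF n_pos zV] by (simp add: D_def)
  thus ?thesis using chi_nz[OF t] by (simp add: D_def)
qed

lemma D_periodic:
  assumes "b \<in> PF 0" "c \<in> PF 0" "b' \<in> PF 0" "c' \<in> PF 0" "b - b' \<in> PE (int l)" "c - c' \<in> PE (int l)"
  shows "D b c = D b' c'"
proof -
  have F: "b \<in> F" "c \<in> F" "b' \<in> F" "c' \<in> F" using assms by (auto simp: PF_iff)
  have "unif * (c - c') \<in> PE (int l + 1)" using assms by simp
  hence "lo (unif * c) y = lo (unif * c') y"
    using F y_V by (intro lo_periodic[OF Y_lo_fix[OF y_Y]]) (auto simp: algebra_simps)
  moreover have "u b (lo (unif * c') y) = u b' (lo (unif * c') y)"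
    using F assms y_V by (intro u_periodic[OF Y_u_fix[OF lo_y]]) auto
  ultimately show ?thesis by (simp add: D_def)
qed

text \<open>\<open>a * p\<close> runs through \<open>PF (l - 1)\<close> modulo \<open>PF l\<close>,
  and the inner vector has level \<open>l\<close>. \<open>D_sum_right\<close> is the same statement
  for the level of \<open>j y\<close>.\<close>

lemma D_sum_left:
  assumes b: "b \<in> PF 0" "c \<in> PF 0" "a \<in> F" "a \<noteq> 0" "val a \<ge> 0" and m: "m = int l - 1 - val a"
  shows "(\<Sum>p\<in>reps m (m + 1). D (b + a * p) c) = 0"
proof -
  have F: "b \<in> F" "c \<in> F" and pF: "p \<in> F" if "p \<in> reps m (m + 1)" for p
    using b reps_F[OF _ that] by (auto simp: PF_iff)
  have F: "b \<in> F" "c \<in> F" using b by (auto simp: PF_iff)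
  let ?z = "lo (unif * c) y"
  have z: "?z \<in> Y (int l)" "?z \<in> V" using lo_y b by auto
  have "(\<Sum>p\<in>reps m (m + 1). D (b + a * p) c) = (\<Sum>p\<in>reps m (m + 1). A (u b (u (a * p + 0) ?z)))"
    using F pF b z by (intro sum.cong refl) (auto simp: D_def u_u)
  also have "\<dots> = A (\<Sum>p\<in>reps m (m + 1). u b (u (a * p + 0) ?z))"
    using F pF b z by (intro Aop_sum[OF n_pos, symmetric]) auto
  also have "(\<Sum>p\<in>reps m (m + 1). u b (u (a * p + 0) ?z)) = u b (\<Sum>p\<in>reps m (m + 1). u (a * p + 0) ?z)"
    using F pF b z by (intro pi_sum[symmetric]) auto
  also have "(\<Sum>p\<in>reps m (m + 1). u (a * p + 0) ?z) = 0"
    using b by (intro lev_sum_affine[OF Y_lev[OF z(1)]]) (auto simp: m)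
  finally show ?thesis using F by (simp add: Aop_zero[OF n_pos])
qed

lemma D_sum_right:
  assumes b: "b \<in> PF 0" "c \<in> PF 0" "a \<in> F" "a \<noteq> 0" "val a \<ge> 0" and m: "m = int l - 1 - val a"
  shows "(\<Sum>p\<in>reps m (m + 1). D b (c + a * p)) = 0"
proof -
  have F: "b \<in> F" "c \<in> F" using b by (auto simp: PF_iff)
  have pF: "p \<in> F" if "p \<in> reps m (m + 1)" for p using reps_F[OF _ that] by auto
  let ?w = "\<lambda>p. lo (unif * a * p) y"
  have w: "?w p \<in> V" if "p \<in> F" for p using that b y_V by auto
  have "(\<Sum>p\<in>reps m (m + 1). D b (c + a * p)) = (\<Sum>p\<in>reps m (m + 1). A (u b (lo (unif * c) (?w p))))"
    using F pF b y_V by (intro sum.cong refl) (auto simp: D_def lo_lo algebra_simps)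
  also have "\<dots> = A (\<Sum>p\<in>reps m (m + 1). u b (lo (unif * c) (?w p)))"
    using F pF b w by (intro Aop_sum[OF n_pos, symmetric]) auto
  also have "(\<Sum>p\<in>reps m (m + 1). u b (lo (unif * c) (?w p))) = u b (lo (unif * c) (\<Sum>p\<in>reps m (m + 1). ?w p))"
    using F pF b w by (simp add: pi_sum)
  also have "(\<Sum>p\<in>reps m (m + 1). ?w p) = 0"
    using b uniformizer by (intro lo_sum_affine[OF y_Y]) (auto simp: m val_mult)
  finally show ?thesis using F by (simp add: Aop_zero[OF n_pos])
qed

lemma sum_const_zero:
  assumes "(\<Sum>p\<in>reps m (m + 1). x) = 0" shows "x = (0 :: 'v)"
proof -
  have "card (reps m (m + 1)) \<noteq> 0" using reps_card[of m "m + 1"] by linarith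
  thus ?thesis using assms by (simp add: sum_const del: card_eq_0_iff)
qed

text \<open>Let \<open>t = 1 + p\<close> with \<open>p\<close> in \<open>PF r\<close>,
  \<open>r = l - 1 - val b\<close>. By \<open>D_torus\<close> it replaces \<open>b\<close> by
  \<open>b + 2 b p\<close> modulo \<open>PF l\<close>, with error \<open>b * p * p\<close>, and
  leaves \<open>c\<close> unchanged modulo \<open>PF l\<close> because \<open>val c > val b\<close>.
  Averaging over \<open>p\<close> gives zero by the sum rules.\<close>

lemma D_unequal_zero:
  assumes b: "b \<in> PF 0" "b \<noteq> 0" "val b < int l - 1" and c: "c \<in> PF (val b + 1)"
  shows "D b c = 0" "D c b = 0"
proof -
  define r where "r = int l - 1 - val b"
  have r: "r \<ge> 1" using b by (simp add: r_def)
  have v0: "val b \<ge> 0" using b by (auto simp: PF_iff PE_iff)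
  have bF: "b \<in> F" and bP: "b \<in> PE (val b)" using b by (auto simp: PF_iff PE_iff)
  have cF: "c \<in> F" and cP: "c \<in> PE (val b + 1)" using c by (auto simp: PF_iff)
  have c0: "c \<in> PF 0" using c v0 by (auto intro: PF_mono)
  have p: "1 + p \<in> units_E \<and> b + 2 * b * p \<in> PF 0 \<and> b * Nm (1 + p) - (b + 2 * b * p) \<in> PE (int l) \<and>
      b * Nm (1 + p) \<in> PF 0" if p: "p \<in> reps r (r + 1)" for p
  proof -
    have pP: "p \<in> PE r" "p \<in> F" using reps_PF[OF _ p] by (auto simp: PF_iff)
    have p0: "p \<in> PE 0" using pP r by (auto intro: PE_mono)
    have unit: "1 + p \<in> units_E" using pP r by (intro near_one_unit[of _ r]) auto
    have "b * (2 * p) \<in> PE 0" using b p0 by (intro PE_mult_left) (auto simp: PF_iff)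
    hence 2: "b + 2 * b * p \<in> PF 0" using b pP by (auto simp: PF_iff algebra_simps)
    have "b * Nm (1 + p) - (b + 2 * b * p) = b * (p * p)"
      using pP by (simp add: Nm_base power2_eq_square algebra_simps)
    also have "\<dots> \<in> PE (int l)"
      using r by (intro PE_mult[OF bP PE_mult[OF pP(1) pP(1) order_refl]]) (simp add: r_def)
    finally have 3: "b * Nm (1 + p) - (b + 2 * b * p) \<in> PE (int l)" .
    have "Nm (1 + p) \<in> PE 0" using unit by (intro units_E_PE) simp
    hence "b * Nm (1 + p) \<in> PF 0" using b by (auto simp: PF_iff intro!: PE_mult_left)
    thus ?thesis using unit 2 3 by blast
  qed
  have near: "x * c - c \<in> PE (int l) \<and> x * c \<in> PF 0"
    if x: "x \<in> F" "x - 1 \<in> PE r" for x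
  proof -
    have "(x - 1) * c \<in> PE (int l)" using x(2) cP by (rule PE_mult) (simp add: r_def)
    moreover have "x \<in> PE 0" using near_one_unit[OF x(2)] r by (intro units_E_PE)
    ultimately show ?thesis using c0 x by (auto simp: PF_iff algebra_simps intro!: PE_mult_right)
  qed
  have Np: "Nm (1 + p) - 1 \<in> PE r \<and> inverse (Nm (1 + p)) - 1 \<in> PE r" if q: "p \<in> reps r (r + 1)" for p
  proof -
    have pP: "p \<in> PE r" using reps_PF[OF _ q] by (auto simp: PF_iff)
    have unit: "1 + p \<in> units_E" using p[OF q] by blast
    have 1: "Nm (1 + p) - 1 \<in> PE r" using unit pP by (intro Nm_near_one) auto
    have nu: "Nm (1 + p) \<in> units_E" using unit by simp
    have "inverse (Nm (1 + p)) - 1 = (1 - Nm (1 + p)) * inverse (Nm (1 + p))"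
      using units_E_nz[OF nu] by (simp add: left_diff_distrib)
    also have "\<dots> \<in> PE r" using 1 nu PE_diff_commute by (intro PE_mult_right units_E_PE) auto
    finally show ?thesis using 1 by blast
  qed
  have "D b c = D (b + 2 * b * p) c" if q: "p \<in> reps r (r + 1)" for p
  proof -
    have "D b c = D (b * Nm (1 + p)) (c / Nm (1 + p))"
      using p[OF q] b c0 by (intro D_torus[symmetric]) auto
    also have "\<dots> = D (b + 2 * b * p) c"
      using p[OF q] near[of "inverse (Nm (1 + p))"] Np[OF q] c0
      by (intro D_periodic) (auto simp: divide_inverse mult.commute)
    finally show ?thesis .
  qed
  hence "(\<Sum>p\<in>reps r (r + 1). D b c) = (\<Sum>p\<in>reps r (r + 1). D (b + 2 * b * p) c)"
    by (rule sum.cong[OF refl])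
  also have "\<dots> = 0" using b bF c0 v0 by (intro D_sum_left) (auto simp: val_mult r_def)
  finally show "D b c = 0" by (rule sum_const_zero)
  have "D c b = D c (b + 2 * b * p)" if q: "p \<in> reps r (r + 1)" for p
  proof -
    have "D c b = D (c * Nm (inverse (1 + p))) (b / Nm (inverse (1 + p)))"
      using p[OF q] b c0 by (intro D_torus[symmetric]) auto
    also have "\<dots> = D (inverse (Nm (1 + p)) * c) (b * Nm (1 + p))"
      by (simp add: Nm_inverse mult.commute divide_inverse)
    also have "\<dots> = D c (b + 2 * b * p)"
      using p[OF q] near[of "inverse (Nm (1 + p))"] Np[OF q] c0 by (intro D_periodic) auto
    finally show ?thesis .
  qed
  hence "(\<Sum>p\<in>reps r (r + 1). D c b) = (\<Sum>p\<in>reps r (r + 1). D c (b + 2 * b * p))"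
    by (rule sum.cong[OF refl])
  also have "\<dots> = 0" using b bF c0 v0 by (intro D_sum_right) (auto simp: val_mult r_def)
  finally show "D c b = 0" by (rule sum_const_zero)
qed

text \<open>Units are norms modulo \<open>PE 1\<close>, so \<open>D p 0\<close> has the same value
  for all \<open>p\<close> of valuation \<open>l - 1\<close>, and likewise \<open>D 0 p\<close>. The
  sum rules express both values through \<open>D 0 0\<close> by the same equation.\<close>

lemma D_top_sym:
  assumes b: "b \<in> PF 0" "b \<noteq> 0" "val b = int l - 1"
  shows "D b 0 = D 0 b"
proof -
  let ?R = "reps (int l - 1) (int l)" and ?z = "frep (int l) 0"
  have bF: "b \<in> F" using b by (simp add: PF_iff)
  have fin: "finite ?R" by simp
  have zR: "?z \<in> ?R" by (auto simp: reps_def)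
  have R0: "p \<in> PF 0" if "p \<in> ?R" for p
    using reps_PF[OF _ that] l_pos by (auto intro: PF_mono)
  have z0: "?z - 0 \<in> PE (int l)" using frep[of 0 "int l"] by simp
  have eq: "D p 0 = D b 0 \<and> D 0 p = D 0 b" if p: "p \<in> ?R - {?z}" for p
  proof -
    have pP: "p \<in> PF (int l - 1)" "p \<in> F" using reps_PF[of "int l - 1" "int l" p] p by (auto simp: PF_iff)
    have "p \<notin> PE (int l)"
    proof
      assume "p \<in> PE (int l)"
      hence "frep (int l) p = ?z" using pP by (simp add: frep_eq_iff)
      thus False using p frep_reps[of "int l - 1" "int l" p] by auto
    qed
    hence pv: "p \<noteq> 0" "val p = int l - 1" using pP by (auto simp: PF_iff PE_iff)
    have "p / b \<in> units_E" "p / b \<in> F" using b pv pP bF by (auto simp: units_E_iff val_divide)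
    then obtain t where t: "t \<in> units_E" "Nm t - p / b \<in> PE (int (Suc 0))" using norm_surj_mod by blast
    have "b * (Nm t - p / b) \<in> PE (int l)" using t(2) b by (intro PE_mult[of b "int l - 1" _ 1]) (auto simp: PE_iff)
    hence 1: "b * Nm t - p \<in> PE (int l)" using b by (simp add: algebra_simps)
    have bN: "b * Nm t \<in> PF 0" using b t units_E_PE[of "Nm t"] by (auto simp: PF_iff intro!: PE_mult_left)
    have p0: "p \<in> PF 0" using R0 p by blast
    have "D b 0 = D (b * Nm t) (0 / Nm t)" using b t by (intro D_torus[symmetric]) auto
    also have "\<dots> = D p 0" using 1 bN p0 by (intro D_periodic) auto
    finally have A: "D b 0 = D p 0" .
    have "D 0 b = D (0 * Nm (inverse t)) (b / Nm (inverse t))" using b t by (intro D_torus[symmetric]) auto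
    also have "\<dots> = D 0 (b * Nm t)" by (simp add: Nm_inverse divide_inverse)
    also have "\<dots> = D 0 p" using 1 bN p0 by (intro D_periodic) auto
    finally show ?thesis using A by simp
  qed
  have lm: "(int l - 1) + 1 = int l" by simp
  have "0 = (\<Sum>p\<in>?R. D (0 + 1 * p) 0)"
    using D_sum_left[of 0 0 1 "int l - 1"] unfolding lm by simp
  also have "\<dots> = D ?z 0 + (\<Sum>p\<in>?R - {?z}. D p 0)" using sum.remove[OF fin zR, of "\<lambda>p. D p 0"] by simp
  also have "(\<Sum>p\<in>?R - {?z}. D p 0) = (\<Sum>p\<in>?R - {?z}. D b 0)" using eq by (intro sum.cong refl) auto
  also have "D ?z 0 = D 0 0" using z0 R0[OF zR] by (intro D_periodic) auto
  finally have 1: "D 0 0 + (\<Sum>p\<in>?R - {?z}. D b 0) = 0" by simp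
  have "0 = (\<Sum>p\<in>?R. D 0 (0 + 1 * p))"
    using D_sum_right[of 0 0 1 "int l - 1"] unfolding lm by simp
  also have "\<dots> = D 0 ?z + (\<Sum>p\<in>?R - {?z}. D 0 p)" using sum.remove[OF fin zR, of "\<lambda>p. D 0 p"] by simp
  also have "(\<Sum>p\<in>?R - {?z}. D 0 p) = (\<Sum>p\<in>?R - {?z}. D 0 b)" using eq by (intro sum.cong refl) auto
  also have "D 0 ?z = D 0 0" using z0 R0[OF zR] by (intro D_periodic) auto
  finally have 2: "D 0 0 + (\<Sum>p\<in>?R - {?z}. D 0 b) = 0" by simp
  have "D 0 0 + (\<Sum>p\<in>?R - {?z}. D b 0) = D 0 0 + (\<Sum>p\<in>?R - {?z}. D 0 b)" using 1 2 by simp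
  hence "sc (of_nat (card (?R - {?z}))) (D b 0) = sc (of_nat (card (?R - {?z}))) (D 0 b)"
    by (simp only: sum_const add_left_cancel)
  moreover have "card (?R - {?z}) \<noteq> 0" using zR reps_card[of "int l - 1" "int l"] by (simp add: card_Diff_singleton)
  ultimately show ?thesis by (simp del: card_eq_0_iff)
qed

text \<open>For equal valuations choose \<open>t\<close> with \<open>Nm t\<close> close to
  \<open>c / b\<close>: then \<open>D_torus\<close> exchanges the arguments modulo
  \<open>PF l\<close>. For different valuations both sides vanish or reduce to
  \<open>D_top_sym\<close>; arguments in \<open>PF l\<close> count as zero.\<close>

lemma D_sym:
  assumes b: "b \<in> PF 0" and c: "c \<in> PF 0"
  shows "D b c = D c b"
proof -
  have lt: "D b c = D c b" if b: "b \<in> PF 0" "b \<notin> PE (int l)" and c: "c \<in> PF 0" "c \<in> PE (val b + 1)" for b c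
  proof -
    have b': "b \<noteq> 0" "val b \<le> int l - 1" using b by (auto simp: PE_iff)
    show ?thesis
    proof (cases "val b = int l - 1")
      case True
      hence cl: "c \<in> PE (int l)" using c by simp
      have "D b c = D b 0" "D c b = D 0 b" using b c cl by (auto intro!: D_periodic)
      thus ?thesis using D_top_sym[OF b(1) b'(1) True] by simp
    next
      case False
      thus ?thesis using D_unequal_zero[of b c] b b' c by (simp add: PF_iff)
    qed
  qed
  show ?thesis
  proof (cases "b \<in> PE (int l)"; cases "c \<in> PE (int l)")
    assume "b \<in> PE (int l)" "c \<in> PE (int l)"
    hence "D b c = D 0 0" "D c b = D 0 0" using b c by (auto intro!: D_periodic)
    thus ?thesis by simp
  next
    assume bl: "b \<in> PE (int l)" and cl: "c \<notin> PE (int l)"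
    hence "b \<in> PE (val c + 1)" by (auto simp: PE_iff)
    thus ?thesis using lt[of c b] b c cl by simp
  next
    assume bl: "b \<notin> PE (int l)" and cl: "c \<in> PE (int l)"
    hence "c \<in> PE (val b + 1)" by (auto simp: PE_iff)
    thus ?thesis using lt[of b c] b c bl by simp
  next
    assume bl: "b \<notin> PE (int l)" and cl: "c \<notin> PE (int l)"
    hence nz: "b \<noteq> 0" "c \<noteq> 0" by auto
    consider "val b < val c" | "val c < val b" | "val b = val c" by linarith
    thus ?thesis
    proof cases
      case 1
      hence "c \<in> PE (val b + 1)" by (auto simp: PE_iff)
      thus ?thesis using lt[of b c] b c bl by simp
    next
      case 2
      hence "b \<in> PE (val c + 1)" by (auto simp: PE_iff)
      thus ?thesis using lt[of c b] b c cl by simp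
    next
      case 3
      have F: "b \<in> F" "c \<in> F" "b \<in> PE 0" using b c by (auto simp: PF_iff)
      have "c / b \<in> units_E" "c / b \<in> F" using 3 nz F by (auto simp: units_E_iff val_divide)
      then obtain t where t: "t \<in> units_E" "Nm t - c / b \<in> PE (int (Suc (l - 1)))" using norm_surj_mod by blast
      have l1: "Suc (l - 1) = l" using l_pos by simp
      have "b * (Nm t - c / b) \<in> PE (int l)" using t(2) F unfolding l1 by (intro PE_mult_left)
      hence 1: "b * Nm t - c \<in> PE (int l)" using nz by (simp add: algebra_simps)
      have Nu: "Nm t \<in> units_E" "inverse (Nm t) \<in> PE 0" "Nm t \<in> PE 0" "Nm t \<noteq> 0"
        using t by (auto intro!: units_E_PE dest: units_E_nz)
      have "(c - b * Nm t) * inverse (Nm t) \<in> PE (int l)" using 1 Nu PE_diff_commute by (intro PE_mult_right) auto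
      hence 2: "c / Nm t - b \<in> PE (int l)" using Nu by (simp add: field_simps)
      have "D b c = D (b * Nm t) (c / Nm t)" using b c t by (intro D_torus[symmetric])
      also have "\<dots> = D c b"
        using 1 2 b c Nu by (intro D_periodic) (auto simp: PF_iff divide_inverse intro!: PE_mult_right)
      finally show ?thesis .
    qed
  qed
qed

text \<open>\<open>iota\<close> exchanges the unipotent parameters \<open>b\<close> and
  \<open>c\<close>, so the claim is \<open>D b (c / Nm t) = D c (b / Nm t)\<close>: apply
  \<open>D_sym\<close>, then \<open>D_torus\<close>.\<close>

lemma A_iota: assumes g: "g \<in> Ib" shows "A (\<pi> g y) = A (\<pi> (iota g) y)"
proof -
  have form: "A (\<pi> (Up b ** torus_elt t ** Lo (unif * c)) y) = sc (ch t) (D b (c / Nm t))"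
    if b: "b \<in> PF 0" "c \<in> PF 0" and t: "t \<in> units_E" for b t c
  proof -
    have F: "b \<in> F" "c \<in> F" and t0: "t \<noteq> 0" using that units_E_nz by (auto simp: PF_iff)
    have "\<pi> (Up b ** torus_elt t ** Lo (unif * c)) y = u b (h t (lo (unif * c) y))"
      using F t0 y_V by (simp add: pi_mult)
    also have "\<dots> = sc (ch t) (u b (lo (unif * (c / Nm t)) y))"
      using F t0 t y_V y_eig by (simp add: h_lo eig_def pi_scale)
    finally show ?thesis using F y_V by (simp add: D_def Aop_scale[OF n_pos])
  qed
  obtain b t c where btc: "b \<in> PF 0" "t \<in> units_E" "c \<in> PF 0" "g = Up b ** torus_elt t ** Lo (unif * c)"
    using g by (auto simp: Ib_def)
  have Nu: "Nm t \<noteq> 0" "inverse (Nm t) \<in> PE 0" using btc(2) by (auto intro!: units_E_PE dest: units_E_nz)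
  have cN: "c / Nm t \<in> PF 0" using btc(3) Nu by (auto simp: PF_iff divide_inverse intro!: PE_mult_right)
  have "D b (c / Nm t) = D (c / Nm t) b" using btc(1) cN by (rule D_sym)
  also have "\<dots> = D (c / Nm t * Nm t) (b / Nm t)" using cN btc(1,2) by (rule D_torus[symmetric])
  finally have "D b (c / Nm t) = D c (b / Nm t)" using Nu by simp
  moreover have "iota g = Up c ** torus_elt t ** Lo (unif * b)" using btc iota_LTU units_E_nz by blast
  ultimately show ?thesis using form[OF btc(1,3,2)] form[OF btc(3,1,2)] btc(4) by simp
qed

lemma Ib_Y: assumes g: "g \<in> Ib" shows "\<pi> g y \<in> Y (int l)"
proof -
  obtain b t c where btc: "b \<in> PF 0" "t \<in> units_E" "c \<in> PF 0" "g = Up b ** torus_elt t ** Lo (unif * c)"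
    using g by (auto simp: Ib_def)
  have "\<pi> g y = u b (h t (lo (unif * c) y))"
    using btc units_E_nz y_V by (simp add: pi_mult PF_iff)
  also have "\<dots> \<in> Y (int l)" using btc by (intro Y_u Y_h_unit lo_y) auto
  finally show ?thesis .
qed

lemma A_Ib_Yc: "g \<in> Ib \<Longrightarrow> A (\<pi> g y) \<in> Yc (int l)"
  unfolding Yc_def using Y_Aop[OF n_pos Ib_Y] A_in_eig[OF Y_near[OF Ib_Y]] by blast

end

text \<open>Expand the inner \<open>A\<close> as a sum over torus elements and apply
  \<open>A_iota\<close> to each product \<open>g ** torus_elt t ** k\<close>. This reverses the
  order of the factors; then \<open>iota\<close> is removed from each factor, once on
  \<open>y\<close> and once on \<open>A (\<pi> g y)\<close>.\<close>

lemma A_commute: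
  assumes y: "y \<in> Yc (int l)" and g: "g \<in> Ib" and k: "k \<in> Ib"
  shows "A (\<pi> g (A (\<pi> k y))) = A (\<pi> k (A (\<pi> g y)))"
proof -
  have V: "y \<in> V" using y by (auto simp: Yc_def)
  have expand: "A (\<pi> g (A (\<pi> k y))) = (\<Sum>t\<in>unit_reps l. sc (inverse (ch t)) (A (\<pi> (g ** torus_elt t ** k) y)))"
    if g: "g \<in> Ib" and k: "k \<in> Ib" for g k
  proof -
    have U: "g \<in> U11" "k \<in> U11" using g k Ib_U11 by auto
    have t: "t \<in> units_E" "t \<noteq> 0" if "t \<in> unit_reps l" for t
      using unit_reps_unit[OF n_pos that] units_E_nz by auto
    have "\<pi> g (A (\<pi> k y)) = (\<Sum>t\<in>unit_reps l. \<pi> g (sc (inverse (ch t)) (h t (\<pi> k y))))"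
      unfolding Aop_def using U V t by (intro pi_sum) auto
    also have "\<dots> = (\<Sum>t\<in>unit_reps l. sc (inverse (ch t)) (\<pi> (g ** torus_elt t ** k) y))"
      using U V t by (intro sum.cong refl) (simp add: pi_scale pi_mult)
    finally have "A (\<pi> g (A (\<pi> k y))) = A (\<Sum>t\<in>unit_reps l. sc (inverse (ch t)) (\<pi> (g ** torus_elt t ** k) y))"
      by simp
    also have "\<dots> = (\<Sum>t\<in>unit_reps l. A (sc (inverse (ch t)) (\<pi> (g ** torus_elt t ** k) y)))"
      using U V t by (intro Aop_sum n_pos) auto
    also have "\<dots> = (\<Sum>t\<in>unit_reps l. sc (inverse (ch t)) (A (\<pi> (g ** torus_elt t ** k) y)))"
      using U V t by (intro sum.cong refl Aop_scale n_pos) auto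
    finally show ?thesis .
  qed
  have "A (\<pi> g (A (\<pi> k y))) = (\<Sum>t\<in>unit_reps l. sc (inverse (ch t)) (A (\<pi> (iota k ** torus_elt t ** iota g) y)))"
    unfolding expand[OF g k]
  proof (intro sum.cong refl arg_cong[of _ _ "sc _"])
    fix t assume "t \<in> unit_reps l"
    hence "torus_elt t \<in> Ib" using unit_reps_unit[OF n_pos] torus_Ib by blast
    hence "g ** torus_elt t ** k \<in> Ib" using g k Ib_mult by blast
    from A_iota[OF y this] show "A (\<pi> (g ** torus_elt t ** k) y) = A (\<pi> (iota k ** torus_elt t ** iota g) y)"
      by (simp add: iota_mult iota_torus matrix_mul_assoc)
  qed
  also have "\<dots> = A (\<pi> (iota k) (A (\<pi> (iota g) y)))" by (rule expand[symmetric]) (use g k iota_Ib in auto)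
  also have "A (\<pi> (iota g) y) = A (\<pi> g y)" by (rule A_iota[OF y g, symmetric])
  also have "A (\<pi> (iota k) (A (\<pi> g y))) = A (\<pi> k (A (\<pi> g y)))"
    by (rule A_iota[OF A_Ib_Yc[OF y g] k, symmetric])
  finally show ?thesis .
qed

text \<open>Since \<open>y'\<close> has level exactly \<open>l\<close> and satisfies
  \<open>hfix\<close>, the two eliminations keep only terms of index \<open>l\<close> with
  \<open>b\<close> in \<open>PF 0\<close>. By the last clause of \<open>generation\<close> these are
  translates of \<open>y\<close> by elements of \<open>Ib\<close>.\<close>

lemma A_span:
  assumes y: "y \<in> Yc (int l)" "y \<noteq> 0" and y': "y' \<in> Yc (int l)"
  shows "\<exists>(B :: 'v set) r g. finite B \<and> (\<forall>a\<in>B. g a \<in> Ib) \<and> y' = (\<Sum>a\<in>B. sc (r a) (A (\<pi> (g a) y)))"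
proof -
  have yY: "y \<in> Y (int l)" "y \<in> V" and y'Y: "y' \<in> Y (int l)" "y' \<in> V" "y' \<in> eig ch"
    using y y' by (auto simp: Yc_def)
  obtain B :: "'v set" and r b z k where "finite B \<and> y' = (\<Sum>a\<in>B. sc (r a) (u (b a) (z a))) \<and>
    (\<forall>a\<in>B. b a \<in> F \<and> z a \<in> Y (k a) \<and>
      (k a = int l \<longrightarrow> (\<exists>t\<in>units_E. \<exists>c\<in>PF 1. z a = h t (lo c y))))"
    using generation[OF yY(1) y(2) y'Y(2)] by blast
  hence B: "finite B" "y' = (\<Sum>a\<in>B. sc (r a) (u (b a) (z a)))"
    "\<And>a. a \<in> B \<Longrightarrow> b a \<in> F" "\<And>a. a \<in> B \<Longrightarrow> z a \<in> Y (k a)"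
    "\<And>a. a \<in> B \<Longrightarrow> k a = int l \<Longrightarrow> (\<exists>t\<in>units_E. \<exists>c\<in>PF 1. z a = h t (lo c y))"
    by blast+
  let ?B1 = "{a. a \<in> B \<and> k a = int l}"
  have e1: "y' = (\<Sum>a\<in>?B1. sc (r a) (u (b a) (z a)))"
  proof (rule lev_elim_eq[OF B(1)])
    show "lev (k a) (sc (r a) (u (b a) (z a)))" if "a \<in> B" for a
      using B(3,4)[OF that] by (intro lev_scale lev_u Y_lev)
  qed (rule Y_lev[OF y'Y(1)], rule B(2))
  let ?B2 = "{a. a \<in> ?B1 \<and> b a \<in> PF (k a - int l)}"
  have e2: "y' = (\<Sum>a\<in>?B2. sc (r a) (u (b a) (z a)))"
  proof (rule T_elim[OF _ _ _ Y_hfix[OF y'Y(1)] e1])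
    show "z a \<in> Y (k a)" if "a \<in> ?B1" for a using that B(4)[of a] by blast
  qed (use B(1,3) in auto)
  have "\<forall>a\<in>?B2. \<exists>g. g \<in> Ib \<and> u (b a) (z a) = \<pi> g y"
  proof
    fix a assume a: "a \<in> ?B2"
    then obtain t c where tc: "t \<in> units_E" "c \<in> PF 1" "z a = h t (lo c y)" using B(5) by blast
    have F: "b a \<in> PF 0" "b a \<in> F" "c \<in> F" "t \<noteq> 0" using a tc units_E_nz by (auto simp: PF_iff)
    have "c / unif \<in> PF 0" using F tc(2) by (simp add: PF_iff)
    hence "Up (b a) ** torus_elt t ** Lo (unif * (c / unif)) \<in> Ib" using F tc unfolding Ib_def by blast
    moreover have "\<pi> (Up (b a) ** torus_elt t ** Lo (unif * (c / unif))) y = u (b a) (z a)"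
      using F tc(3) yY(2) by (simp add: pi_mult)
    ultimately show "\<exists>g. g \<in> Ib \<and> u (b a) (z a) = \<pi> g y" by metis
  qed
  from bchoice[OF this] obtain g where g: "\<And>a. a \<in> ?B2 \<Longrightarrow> g a \<in> Ib \<and> u (b a) (z a) = \<pi> (g a) y"
    by blast
  let ?q = "of_nat (card (unit_reps l)) :: complex"
  have gV: "\<pi> (g a) y \<in> V" if "a \<in> ?B2" for a using g[OF that] Ib_U11 yY(2) by auto
  have e3: "y' = (\<Sum>a\<in>?B2. sc (r a) (\<pi> (g a) y))"
    by (rule trans[OF e2]) (use g in \<open>auto intro!: sum.cong\<close>)
  have "sc ?q y' = A y'" by (rule A_on_eig[OF y'Y(3), symmetric])
  also have "\<dots> = A (\<Sum>a\<in>?B2. sc (r a) (\<pi> (g a) y))" by (rule arg_cong[OF e3])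
  also have "\<dots> = (\<Sum>a\<in>?B2. A (sc (r a) (\<pi> (g a) y)))"
    using gV by (intro Aop_sum n_pos) auto
  also have "\<dots> = (\<Sum>a\<in>?B2. sc (r a) (A (\<pi> (g a) y)))"
    using gV by (intro sum.cong refl Aop_scale n_pos) auto
  finally have "sc (inverse ?q) (sc ?q y') = sc (inverse ?q) (\<Sum>a\<in>?B2. sc (r a) (A (\<pi> (g a) y)))" by simp
  hence e4: "y' = (\<Sum>a\<in>?B2. sc (inverse ?q * r a) (A (\<pi> (g a) y)))"
    using card_unit_reps[of l] by (simp add: scale_sum_right del: of_nat_eq_0_iff card_eq_0_iff)
  have "finite ?B2" "\<forall>a\<in>?B2. g a \<in> Ib" using B(1) g by auto
  with e4 show ?thesis by (intro exI conjI)
qed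

lemma Yc_subspace: "subspace (Yc k)"
proof -
  have "subspace (eig ch)"
    using units_E_nz by (intro subspaceI) (auto simp: eig_def pi_add pi_scale scale_right_distrib scale_left_commute)
  thus ?thesis unfolding Yc_def using Y_subspace by (intro subspace_inter)
qed

text \<open>For \<open>N > l\<close> so large that \<open>ch\<close> is trivial on
  \<open>1 + PE N\<close>, all of \<open>Yc l\<close> is fixed by \<open>KN N\<close>, and
  admissibility applies.\<close>

lemma Yc_finite: obtains B where "finite B" "Yc (int l) \<subseteq> span B"
proof -
  obtain n0 where n0: "\<forall>x\<in>U_E n0. ch x = 1" using good by (auto simp: good_def unit_char_def)
  define N where "N = max (l + 1) n0"
  have N: "N \<ge> 1" "N \<ge> l + 1" "N \<ge> n0" by (auto simp: N_def)
  have ch1: "ch t = 1" if "t \<in> units_E" "t - 1 \<in> PE (int N)" for t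
  proof (cases "n0 = 0")
    case True
    thus ?thesis using n0 that by (simp add: U_E_def)
  next
    case False
    hence "t \<in> U_E n0" using that N by (auto simp: U_E_iff intro: PE_mono)
    thus ?thesis using n0 by blast
  qed
  have "\<pi> g y = y" if y: "y \<in> Yc (int l)" and g: "g \<in> KN N" for y g
  proof -
    have yY: "y \<in> Y (int l)" "y \<in> V" "y \<in> eig ch" using y by (auto simp: Yc_def)
    obtain b t c where d: "g = Up b ** torus_elt t ** Lo c" "b \<in> PF (int N)" "c \<in> PF (int N)"
      "t \<in> units_E" "t - 1 \<in> PE (int N)" using KN_decomp[OF g N(1)] by metis
    have "lo c y = y" using d N by (intro Y_lo_fix[OF yY(1)]) (auto intro: PF_mono)
    moreover have "h t y = y" using yY(3) d ch1 by (simp add: eig_def)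
    moreover have "u b y = y" using d N by (intro Y_u_fix[OF yY(1)]) (auto intro: PF_mono)
    ultimately show ?thesis using d units_E_nz yY by (simp add: pi_mult PF_iff)
  qed
  hence "Yc (int l) \<subseteq> invariants (KN N) V \<pi>" by (auto simp: invariants_def Yc_def)
  moreover obtain B where "finite B" "invariants (KN N) V \<pi> \<subseteq> span B"
    using invariants_finite_dim[OF N(1)] by blast
  ultimately show ?thesis using that[of B] by blast
qed

text \<open>For \<open>g\<close> in \<open>Ib\<close> the operator \<open>A (\<pi> g v)\<close> has
  an eigenvector \<open>w\<close> in the finite dimensional space \<open>Yc l\<close>. The images of
  \<open>w\<close> under the commuting operators span \<open>Yc l\<close>, so the operator is a
  scalar, and \<open>A_span\<close> applied to \<open>y\<close> yields a line.\<close>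

theorem multiplicity_one:
  assumes y: "y \<in> Yc (int l)" "y \<noteq> 0" and y': "y' \<in> Yc (int l)"
  shows "\<exists>c. y' = sc c y"
proof -
  obtain B where B: "finite B" "Yc (int l) \<subseteq> span B" using Yc_finite by blast
  have lin1: "A (\<pi> g (v + w)) = A (\<pi> g v) + A (\<pi> g w)" if "g \<in> Ib" "v \<in> V" "w \<in> V" for g v w
    using that Ib_U11 by (simp add: pi_add Aop_add[OF n_pos])
  have lin2: "A (\<pi> g (sc c v)) = sc c (A (\<pi> g v))" if "g \<in> Ib" "v \<in> V" for g v c
    using that Ib_U11 by (simp add: pi_scale Aop_scale[OF n_pos])
  have asum: "A (\<pi> g (\<Sum>a\<in>I. sc (r a) (f a))) = (\<Sum>a\<in>I. sc (r a) (A (\<pi> g (f a))))"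
    if "g \<in> Ib" "\<And>a. a \<in> I \<Longrightarrow> f a \<in> V" for g f r and I :: "'v set"
    using that by (induction I rule: infinite_finite_induct) (auto simp: lin1 lin2 V_sum Ib_U11 Aop_zero[OF n_pos])
  have YV: "v \<in> V" if "v \<in> Yc (int l)" for v using that by (auto simp: Yc_def)
  have scalar: "\<exists>c. \<forall>v\<in>Yc (int l). A (\<pi> g v) = sc c v" if g: "g \<in> Ib" for g
  proof -
    have "\<exists>c. \<exists>w\<in>Yc (int l). w \<noteq> 0 \<and> A (\<pi> g w) = sc c w"
      by (rule eigenvector_exists[OF Yc_subspace B(2,1) y(1,2)]) (use lin1[OF g] lin2[OF g] YV A_Ib_Yc[OF _ g] in auto)
    then obtain c w where w: "w \<in> Yc (int l)" "w \<noteq> 0" "A (\<pi> g w) = sc c w" by blast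
    have "A (\<pi> g v) = sc c v" if v: "v \<in> Yc (int l)" for v
    proof -
      obtain I :: "'v set" and r k where I: "finite I" "\<forall>a\<in>I. k a \<in> Ib" "v = (\<Sum>a\<in>I. sc (r a) (A (\<pi> (k a) w)))"
        using A_span[OF w(1,2) v] by blast
      have AV: "A (\<pi> (k a) w) \<in> V" if "a \<in> I" for a using A_Ib_Yc[OF w(1)] I(2) that YV by blast
      have "A (\<pi> g v) = (\<Sum>a\<in>I. sc (r a) (A (\<pi> g (A (\<pi> (k a) w)))))"
        unfolding I(3) by (rule asum[OF g AV])
      also have "\<dots> = (\<Sum>a\<in>I. sc (r a) (A (\<pi> (k a) (A (\<pi> g w)))))"
        using I(2) A_commute[OF w(1) g] by (intro sum.cong refl) auto
      also have "\<dots> = (\<Sum>a\<in>I. sc c (sc (r a) (A (\<pi> (k a) w))))"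
        using I(2) lin2[OF _ YV[OF w(1)]] w(3)
        by (intro sum.cong refl) (auto simp: mult.commute)
      also have "\<dots> = sc c v" unfolding I(3) by (rule scale_sum_right[symmetric])
      finally show ?thesis .
    qed
    thus ?thesis by blast
  qed
  obtain I :: "'v set" and r g where I: "finite I" "\<forall>a\<in>I. g a \<in> Ib" "y' = (\<Sum>a\<in>I. sc (r a) (A (\<pi> (g a) y)))"
    using A_span[OF y y'] by blast
  have "\<forall>a\<in>I. \<exists>c. A (\<pi> (g a) y) = sc c y" using scalar I(2) y(1) by blast
  then obtain c where c: "\<And>a. a \<in> I \<Longrightarrow> A (\<pi> (g a) y) = sc (c a) y" by metis
  have "y' = (\<Sum>a\<in>I. sc (r a * c a) y)" unfolding I(3) using c by (intro sum.cong refl) auto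
  also have "\<dots> = sc (\<Sum>a\<in>I. r a * c a) y" by (rule scale_sum_left[symmetric])
  finally show ?thesis by blast
qed

end

section \<open>The dual character and the transformation law under \<open>Kbar m\<close>\<close>

context unramified_quadratic begin

lemma inverse_near_one: "t - 1 \<in> PE n \<Longrightarrow> t \<in> units_E \<Longrightarrow> inverse t - 1 \<in> PE n"
proof -
  assume t: "t - 1 \<in> PE n" "t \<in> units_E"
  have "inverse t - 1 = (1 - t) * inverse t" using units_E_nz[OF t(2)] by (simp add: left_diff_distrib)
  also have "\<dots> \<in> PE n" using t PE_diff_commute by (intro PE_mult_right units_E_PE) auto
  finally show ?thesis .
qed

lemma s_near_one: "s t - 1 \<in> PE n \<longleftrightarrow> t - 1 \<in> PE n"
  using s_PE[of "t - 1" n] by (simp add: s_diff)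

text \<open>\<open>\<eta>\<close> is evaluated at the lower right entry of a matrix, which is
  \<open>inverse (s t)\<close> for \<open>torus_elt t\<close>. Conjugation by \<open>J\<close> also
  turns \<open>ch\<close> into \<open>dual ch\<close>.\<close>

definition dual :: "('e \<Rightarrow> complex) \<Rightarrow> 'e \<Rightarrow> complex" where "dual ch t = ch (inverse (s t))"

lemma dual_dual [simp]: "dual (dual ch) = ch"
  by (simp add: dual_def fun_eq_iff s_inverse)

lemma unit_char_one: "unit_char ch \<Longrightarrow> ch 1 = 1"
  using units_E_closed(1) unfolding unit_char_def by (metis mult_cancel_right1 mult_1)

lemma unit_char_near_one:
  assumes "unit_char ch" obtains N where "N \<ge> 1" "\<And>t. t - 1 \<in> PE (int N) \<Longrightarrow> ch t = 1"
proof -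
  obtain n where n: "\<forall>x\<in>U_E n. ch x = 1" using assms unfolding unit_char_def by blast
  have "ch t = 1" if t: "t - 1 \<in> PE (int (max 1 n))" for t
  proof (cases "n = 0")
    case True
    have "t \<in> units_E" using near_one_unit[OF t] by simp
    thus ?thesis using n True by (simp add: U_E_def)
  next
    case False
    have "t - 1 \<in> PE (int n)" using t by (rule PE_mono) simp
    thus ?thesis using n False by (simp add: U_E_iff)
  qed
  thus ?thesis by (intro that[of "max 1 n"]) auto
qed

lemma unit_char_dual: assumes ch: "unit_char ch" shows "unit_char (dual ch)"
proof -
  obtain N where N: "N \<ge> 1" "\<And>t. t - 1 \<in> PE (int N) \<Longrightarrow> ch t = 1"
    using unit_char_near_one[OF ch] by blast
  have "dual ch x = 1" if "x \<in> U_E N" for x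
  proof -
    have "x - 1 \<in> PE (int N)" using that N(1) by (simp add: U_E_iff)
    hence "s x - 1 \<in> PE (int N)" "s x \<in> units_E" using near_one_unit[of x "int N"] N(1) s_near_one by auto
    hence "inverse (s x) - 1 \<in> PE (int N)" by (rule inverse_near_one)
    thus ?thesis using N(2) by (simp add: dual_def)
  qed
  moreover have "dual ch (x * y) = dual ch x * dual ch y" if "x \<in> units_E" "y \<in> units_E" for x y
  proof -
    have "ch (inverse (s x) * inverse (s y)) = ch (inverse (s x)) * ch (inverse (s y))"
      using ch that unfolding unit_char_def by simp
    thus ?thesis by (simp add: dual_def s_mult)
  qed
  moreover have "dual ch x \<noteq> 0" if "x \<in> units_E" for x
    using ch that unfolding unit_char_def dual_def by simp
  ultimately show ?thesis unfolding unit_char_def by blast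
qed

end

context u11_rep begin

lemma good_dual: assumes g: "good n ch" and n: "n \<ge> 1" shows "good n (dual ch)"
  unfolding good_def
proof (intro conjI ballI impI)
  show "unit_char (dual ch)" using g unit_char_dual by (simp add: good_def)
  show "dual ch z = central_char sc V \<pi> z" if "z \<in> E1" for z
    using g that E1_s[OF that] by (simp add: dual_def good_def)
  show "dual ch x = 1" if "x \<in> F" "x - 1 \<in> PE (int n)" for x
    using g that inverse_near_one[of x "int n"] near_one_unit[OF that(2)] n
    by (simp add: dual_def good_def s_fixes)
qed

lemma eig_j: "v \<in> eig ch \<Longrightarrow> j v \<in> eig (dual ch)"
  unfolding eig_def
proof (intro CollectI conjI ballI; elim CollectE conjE)
  fix t assume v: "v \<in> V" "\<forall>t\<in>units_E. h t v = sc (ch t) v" and t: "t \<in> units_E"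
  have nz: "inverse (s t) \<noteq> 0" "inverse (s t) \<in> units_E" using t units_E_nz by auto
  have "h t (j v) = j (h (inverse (s t)) v)" using nz v(1) by (simp add: j_h s_inverse)
  also have "\<dots> = j (sc (ch (inverse (s t))) v)" using v(2) nz(2) by simp
  also have "\<dots> = sc (dual ch t) (j v)" using v(1) by (simp add: pi_scale dual_def)
  finally show "h t (j v) = sc (dual ch t) (j v)" .
qed auto

lemma eig_h: "v \<in> eig ch \<Longrightarrow> t \<noteq> 0 \<Longrightarrow> h t v \<in> eig ch"
  unfolding eig_def
proof (intro CollectI conjI ballI; elim CollectE conjE)
  fix t' assume v: "v \<in> V" "\<forall>t\<in>units_E. h t v = sc (ch t) v" and t: "t \<noteq> 0" "t' \<in> units_E"
  have "h t' (h t v) = h t (h t' v)" using v(1) t units_E_nz by (simp add: h_h mult.commute)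
  also have "\<dots> = sc (ch t') (h t v)" using v t by (simp add: pi_scale)
  finally show "h t' (h t v) = sc (ch t') (h t v)" .
qed auto

definition W :: "('e \<Rightarrow> complex) \<Rightarrow> int \<Rightarrow> 'v set" where
  "W ch m = {v \<in> eig ch. (\<forall>b\<in>PF 0. u b v = v) \<and> (\<forall>c\<in>PF m. lo c v = v)}"

text \<open>For \<open>m \<ge> 1\<close> the entry \<open>d\<close> is a unit on
  \<open>Kbar m\<close>, so \<open>U11_LDU\<close> has integral parameters and \<open>\<eta>\<close>
  is seen only by the torus factor.\<close>

lemma eta_space_eq_W:
  assumes m: "m \<ge> 1" and ch: "unit_char \<eta>"
  shows "eta_space sc V \<pi> \<eta> m = W (dual \<eta>) (int m)"
proof (intro equalityI subsetI)
  fix v assume "v \<in> eta_space sc V \<pi> \<eta> m"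
  hence v: "v \<in> V" "\<And>g. g \<in> Kbar m \<Longrightarrow> \<pi> g v = sc (\<eta> (g $ 2 $ 2)) v"
    using m by (auto simp: eta_space_def)
  have K: "mat2 a b c d \<in> Kbar m" if "mat2 a b c d \<in> U11" "a \<in> PE 0" "b \<in> PE 0" "c \<in> PE (int m)" "d \<in> PE 0"
    "a * d - b * c \<in> units_E" for a b c d
    using that PE_mono[of c "int m" 0] by (auto simp: Kbar_def GL2_OE_def forall_2)
  have "u b v = v" if "b \<in> PF 0" for b
    using v(2)[OF K[of 1 b 0 1]] that Up_U11[of b] unit_char_one[OF ch] by (simp add: Up_def PF_iff)
  moreover have "lo c v = v" if "c \<in> PF (int m)" for c
    using v(2)[OF K[of 1 0 c 1]] that Lo_U11[of c] unit_char_one[OF ch] by (simp add: Lo_def PF_iff)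
  moreover have "h t v = sc (dual \<eta> t) v" if t: "t \<in> units_E" for t
  proof -
    have "inverse (s t) \<in> units_E" using t by simp
    hence "t \<in> PE 0" "inverse (s t) \<in> PE 0" "t * inverse (s t) \<in> units_E" using t units_E_PE by auto
    thus ?thesis using v(2)[OF K[of t 0 0 "inverse (s t)"]] torus_U11[of t] units_E_nz[OF t]
      by (simp add: torus_mat2 dual_def)
  qed
  ultimately show "v \<in> W (dual \<eta>) (int m)" using v(1) by (simp add: W_def eig_def)
next
  fix v assume "v \<in> W (dual \<eta>) (int m)"
  hence v: "v \<in> V" "\<And>t. t \<in> units_E \<Longrightarrow> h t v = sc (dual \<eta> t) v"
    "\<And>b. b \<in> PF 0 \<Longrightarrow> u b v = v" "\<And>c. c \<in> PF (int m) \<Longrightarrow> lo c v = v"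
    by (auto simp: W_def eig_def)
  have "\<pi> g v = sc (\<eta> (g $ 2 $ 2)) v" if g: "g \<in> Kbar m" for g
  proof -
    obtain a b c d where gm: "g = mat2 a b c d" by (rule mat2_cases)
    have G: "mat2 a b c d \<in> U11" "a \<in> PE 0" "b \<in> PE 0" "c \<in> PE (int m)" "d \<in> PE 0" "a * d - b * c \<in> units_E"
      using g m by (auto simp: gm Kbar_def GL2_OE_def forall_2)
    have "b * c \<in> PE 1" using G m by (intro PE_mult[of b 0 c "int m"]) auto
    hence "a * d \<in> units_E" using units_E_add[OF G(6), of "b * c" 1] by simp
    hence du: "d \<in> units_E"
      using G(2,5) unit_iff_PE[of d] unit_iff_PE[of "a * d"] PE_mult_left[of a d 1] by auto
    hence d: "d \<noteq> 0" "inverse d \<in> PE 0" by (auto dest: units_E_nz intro: units_E_PE)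
    note dec = U11_LDU[OF G(1) d(1)]
    have 1: "b / d \<in> PF 0" "c / d \<in> PF (int m)"
      using G d dec by (auto simp: PF_iff divide_inverse intro!: PE_mult_right)
    have "\<pi> g v = u (b / d) (h (inverse (s d)) (lo (c / d) v))"
      unfolding gm dec(1) using dec(2,3) d v(1) by (simp add: pi_mult)
    also have "\<dots> = u (b / d) (sc (dual \<eta> (inverse (s d))) v)" using v(2,4) 1 du by simp
    also have "\<dots> = sc (dual \<eta> (inverse (s d))) v" using v(1,3) 1 dec(2) by (simp add: pi_scale)
    also have "dual \<eta> (inverse (s d)) = \<eta> d" by (simp add: dual_def s_inverse)
    finally show ?thesis by (simp add: gm)
  qed
  thus "v \<in> eta_space sc V \<pi> \<eta> m" using v(1) m by (simp add: eta_space_def)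
qed

end

subsection \<open>Conductors\<close>

locale main_rep = u11_rep_level F val s unif sc V \<pi> l
  for F :: "'e::field set" and val :: "'e \<Rightarrow> int" and s :: "'e \<Rightarrow> 'e" and unif :: 'e
    and sc :: "complex \<Rightarrow> 'v::ab_group_add \<Rightarrow> 'v" and V :: "'v set" and \<pi> :: "'e^2^2 \<Rightarrow> 'v \<Rightarrow> 'v"
    and l +
  assumes Y_ne: "\<exists>y\<in>Y (int l). y \<noteq> 0"
begin

lemma no_shallow:
  assumes "v \<in> V" "\<And>b. b \<in> PF m \<Longrightarrow> u b v = v" "\<And>c. c \<in> PF n \<Longrightarrow> lo c v = v" "m + n \<le> 2 * int l"
  shows "v = 0"
  using Y_ne no_shallow_vectors[OF _ _ assms] by blast

lemma level_charI: "good n ch \<Longrightarrow> l \<le> n \<Longrightarrow> level_char F val s unif sc V \<pi> l n ch"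
  using l_pos by unfold_locales auto

lemma level_char_eqI: "good l ch \<Longrightarrow> level_char_eq F val s unif sc V \<pi> l ch"
  unfolding level_char_eq_def by (rule level_charI) auto

text \<open>With \<open>n = l\<close>, \<open>A_u_nonzero\<close> yields \<open>b\<close> in
  \<open>PF 0\<close>, and such \<open>u b\<close> preserve \<open>Y l\<close>; so the projected
  vector stays in \<open>Y l\<close>.\<close>

lemma Ye_base:
  assumes g: "good l ch"
  shows "\<exists>y\<in>Y (int l) \<inter> eig ch. y \<noteq> 0 \<and> (\<forall>y'\<in>Y (int l) \<inter> eig ch. \<exists>c. y' = sc c y)"
proof -
  interpret level_char_eq F val s unif sc V \<pi> l ch by (rule level_char_eqI[OF g])
  obtain x where x: "x \<in> Y (int l)" "x \<noteq> 0" using Y_ne by blast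
  obtain b where b: "b \<in> PF (int l - int l)" "A (u b x) \<noteq> 0" using A_u_nonzero[OF x] by blast
  have uY: "u b x \<in> Y (int l)" using x(1) b(1) by (rule Y_u)
  have "A (u b x) \<in> Yc (int l)" using Y_Aop[OF n_pos uY] A_in_eig[OF Y_near[OF uY]] unfolding Yc_def by blast
  thus ?thesis using multiplicity_one[OF _ b(2)] b(2) unfolding Yc_def by blast
qed

text \<open>Transport from index \<open>l\<close>: powers of \<open>unif\<close> in the torus shift
  the index by even numbers. The other parity is reached through \<open>j\<close>, which replaces
  \<open>ch\<close> by \<open>dual ch\<close>, so \<open>Ye_base\<close> is needed for both
  characters.\<close>

lemma Ye_dim1:
  assumes g: "good l ch"
  shows "\<exists>y\<in>Y k \<inter> eig ch. y \<noteq> 0 \<and> (\<forall>y'\<in>Y k \<inter> eig ch. \<exists>c. y' = sc c y)"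
proof (cases "even (k - int l)")
  case True
  then obtain i where i: "k = int l + 2 * i" by (metis evenE add.commute diff_add_cancel)
  obtain y where y: "y \<in> Y (int l) \<inter> eig ch" "y \<noteq> 0" "\<forall>y'\<in>Y (int l) \<inter> eig ch. \<exists>c. y' = sc c y"
    using Ye_base[OF g] by blast
  let ?t = "unif powi i"
  have t: "?t \<noteq> 0" "val ?t = i" "inverse ?t \<noteq> 0" "val (inverse ?t) = - i"
    using val_inverse[of ?t] by auto
  have yV: "y \<in> V" using y(1) Y_V by blast
  have 1: "h ?t y \<in> Y k \<inter> eig ch" using y(1) Y_h[of y "int l" ?t] eig_h[of y ch ?t] t i by simp
  have 2: "h ?t y \<noteq> 0" using y(2) yV t pi_eq_0[OF torus_U11[OF t(1)]] by blast
  have 3: "\<exists>c. y' = sc c (h ?t y)" if y': "y' \<in> Y k \<inter> eig ch" for y'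
  proof -
    have V': "y' \<in> V" using y' Y_V by blast
    have "h (inverse ?t) y' \<in> Y (int l) \<inter> eig ch"
      using y' Y_h[of y' k "inverse ?t"] eig_h[of y' ch "inverse ?t"] t i by simp
    then obtain c where c: "h (inverse ?t) y' = sc c y" using y(3) by blast
    have "y' = h ?t (h (inverse ?t) y')" using V' t(1,3) by (simp add: h_h)
    also have "\<dots> = sc c (h ?t y)" unfolding c using yV t by (simp add: pi_scale)
    finally show ?thesis by blast
  qed
  show ?thesis using 1 2 3 by blast
next
  case False
  then obtain i where i: "k = int l + 1 + 2 * i" by (metis oddE add.commute add.left_commute diff_add_cancel)
  have g': "good l (dual ch)" using good_dual[OF g l_pos] .
  obtain y where y: "y \<in> Y (int l) \<inter> eig (dual ch)" "y \<noteq> 0" "\<forall>y'\<in>Y (int l) \<inter> eig (dual ch). \<exists>c. y' = sc c y"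
    using Ye_base[OF g'] by blast
  let ?t = "unif powi i"
  have t: "?t \<noteq> 0" "val ?t = i" "inverse ?t \<noteq> 0" "val (inverse ?t) = - i"
    using val_inverse[of ?t] by auto
  have yV: "y \<in> V" using y(1) Y_V by blast
  have jy: "j y \<in> Y (int l + 1) \<inter> eig ch" using Y_j[of y "int l"] eig_j[of y "dual ch"] y(1) by simp
  have 1: "h ?t (j y) \<in> Y k \<inter> eig ch" using jy Y_h[of "j y" "int l + 1" ?t] eig_h[of "j y" ch ?t] t i by simp
  have 2: "h ?t (j y) \<noteq> 0" using y(2) yV t pi_eq_0[OF torus_U11[OF t(1)]] pi_eq_0[OF J_U11] by blast
  have 3: "\<exists>c. y' = sc c (h ?t (j y))" if y': "y' \<in> Y k \<inter> eig ch" for y'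
  proof -
    have V': "y' \<in> V" using y' Y_V by blast
    let ?x = "h (inverse ?t) y'"
    have x: "?x \<in> Y (int l + 1) \<inter> eig ch"
      using y' Y_h[of y' k "inverse ?t"] eig_h[of y' ch "inverse ?t"] t i by simp
    have xV: "?x \<in> V" using x Y_V by blast
    have "j ?x \<in> Y (int l) \<inter> eig (dual ch)" using Y_j[of ?x "int l + 1"] eig_j[of ?x ch] x by simp
    then obtain c where c: "j ?x = sc c y" using y(3) by blast
    have "h (- 1) ?x = sc c (j y)" using arg_cong[OF c, of j] xV yV by (simp add: j_j pi_scale)
    moreover have "h (- 1) ?x = sc (ch (- 1)) ?x" using x unfolding eig_def by simp
    ultimately have e: "sc (ch (- 1)) ?x = sc c (j y)" by simp
    have "ch (- 1) \<noteq> 0" using g unfolding good_def unit_char_def by simp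
    hence "?x = sc (inverse (ch (- 1))) (sc (ch (- 1)) ?x)" by simp
    hence x2: "?x = sc (inverse (ch (- 1)) * c) (j y)" unfolding e by simp
    have "y' = h ?t ?x" using V' t(1,3) by (simp add: h_h)
    also have "\<dots> = sc (inverse (ch (- 1)) * c) (h ?t (j y))" using arg_cong[OF x2, of "h ?t"] yV t by (simp add: pi_scale)
    finally show ?thesis by blast
  qed
  show ?thesis using 1 2 3 by blast
qed

text \<open>The torus elimination comes first, so that the surviving translates lie in
  \<open>Y k\<close> and their images under \<open>j\<close> have level exactly
  \<open>2 l + 1 - k\<close>. Then invariance under \<open>u\<close> gives \<open>k \<le> 0\<close>,
  the projection moves the terms into \<open>eig ch\<close>, and invariance under \<open>lo\<close>
  gives the lower bound for \<open>k\<close>.\<close>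

lemma W_decomp:
  assumes g: "good l ch" and v: "v \<in> W ch m"
  shows "v \<in> span (\<Union>k\<in>{2 * int l + 1 - m..0}. Y k \<inter> eig ch)"
proof -
  interpret level_char_eq F val s unif sc V \<pi> l ch by (rule level_char_eqI[OF g])
  obtain y where y: "y \<in> Y (int l)" "y \<noteq> 0" using Y_ne by blast
  have vV: "v \<in> V" and veig: "v \<in> eig ch" and vu: "\<And>b. b \<in> PF 0 \<Longrightarrow> u b v = v"
    and vl: "\<And>c. c \<in> PF m \<Longrightarrow> lo c v = v" using v by (auto simp: W_def eig_def)
  have vh: "hfix v"
    unfolding hfix_def
  proof (intro conjI ballI impI vV)
    fix t assume t: "t \<in> F" "t - 1 \<in> PE (int l)"
    have "t \<in> units_E" using near_one_unit[OF t(2)] l_pos by simp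
    thus "h t v = v" using veig chi_F[OF t] by (simp add: eig_def)
  qed
  obtain B :: "'v set" and r b z k where "finite B \<and> v = (\<Sum>a\<in>B. sc (r a) (u (b a) (z a))) \<and>
    (\<forall>a\<in>B. b a \<in> F \<and> z a \<in> Y (k a) \<and>
      (k a = int l \<longrightarrow> (\<exists>t\<in>units_E. \<exists>c\<in>PF 1. z a = h t (lo c y))))"
    using generation[OF y vV] by blast
  hence B: "finite B" "v = (\<Sum>a\<in>B. sc (r a) (u (b a) (z a)))"
    "\<And>a. a \<in> B \<Longrightarrow> b a \<in> F" "\<And>a. a \<in> B \<Longrightarrow> z a \<in> Y (k a)"
    by blast+
  let ?B1 = "{a. a \<in> B \<and> b a \<in> PF (k a - int l)}"
  have e1: "v = (\<Sum>a\<in>?B1. sc (r a) (u (b a) (z a)))"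
    by (rule T_elim[OF B(1,3,4) vh B(2)])
  have zY: "u (b a) (z a) \<in> Y (k a)" if "a \<in> ?B1" for a using that B(4)[of a] by (intro Y_u) auto
  let ?B2 = "{a. a \<in> ?B1 \<and> k a \<le> 0}"
  have e2: "v = (\<Sum>a\<in>?B2. sc (r a) (u (b a) (z a)))"
  proof (rule lev_elim[OF _ _ vu e1])
    show "lev (k a) (sc (r a) (u (b a) (z a)))" if "a \<in> ?B1" for a using lev_scale[OF Y_lev[OF zY[OF that]]] .
  qed (use B(1) in auto)
  let ?q = "of_nat (card (unit_reps l)) :: complex"
  define x where "x a = sc (inverse ?q * r a) (A (u (b a) (z a)))" for a
  have xY: "x a \<in> Y (k a) \<inter> eig ch" if a: "a \<in> ?B2" for a
  proof -
    have z: "u (b a) (z a) \<in> Y (k a)" using zY a by blast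
    have "A (u (b a) (z a)) \<in> Yc (k a)"
      using Y_Aop[OF n_pos z] A_in_eig[OF Y_near[OF z]] unfolding Yc_def by blast
    thus ?thesis using subspace_scale[OF Yc_subspace] unfolding Yc_def x_def by blast
  qed
  have "sc ?q v = A v" by (rule A_on_eig[OF veig, symmetric])
  also have "\<dots> = A (\<Sum>a\<in>?B2. sc (r a) (u (b a) (z a)))" by (rule arg_cong[OF e2])
  also have "\<dots> = (\<Sum>a\<in>?B2. A (sc (r a) (u (b a) (z a))))"
    using zY Y_V by (intro Aop_sum n_pos) blast
  also have "\<dots> = (\<Sum>a\<in>?B2. sc (r a) (A (u (b a) (z a))))"
    using zY Y_V by (intro sum.cong refl Aop_scale n_pos) blast
  finally have "sc (inverse ?q) (sc ?q v) = sc (inverse ?q) (\<Sum>a\<in>?B2. sc (r a) (A (u (b a) (z a))))" by simp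
  hence e3: "v = (\<Sum>a\<in>?B2. x a)"
    using card_unit_reps[of l] by (simp add: x_def scale_sum_right del: of_nat_eq_0_iff card_eq_0_iff)
  have xV: "x a \<in> V" if "a \<in> ?B2" for a using xY[OF that] Y_V by blast
  have j3: "j v = (\<Sum>a\<in>?B2. j (x a))" by (rule trans[OF arg_cong[OF e3, of j] pi_sum]) (use xV in auto)
  let ?B3 = "{a. a \<in> ?B2 \<and> 2 * int l + 1 - k a \<le> m}"
  have "j v = (\<Sum>a\<in>?B3. j (x a))"
  proof (rule lev_elim[OF _ _ _ j3])
    show "lev (2 * int l + 1 - k a) (j (x a))" if "a \<in> ?B2" for a using xY[OF that] Y_lev_j by blast
    show "u c (j v) = j v" if "c \<in> PF m" for c
      using vl[of "- c"] lo_fix_iff[of "- c" v] that vV by (auto simp: PF_iff)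
  qed (use B(1) in auto)
  also have "\<dots> = j (\<Sum>a\<in>?B3. x a)" using xV by (intro pi_sum[symmetric]) auto
  finally have "v = (\<Sum>a\<in>?B3. x a)" using pi_inj[OF J_U11 vV, of "\<Sum>a\<in>?B3. x a"] xV V_sum[of ?B3 x] by auto
  moreover have "(\<Sum>a\<in>?B3. x a) \<in> span (\<Union>k\<in>{2 * int l + 1 - m..0}. Y k \<inter> eig ch)"
  proof (intro span_sum span_base)
    fix a assume "a \<in> ?B3"
    thus "x a \<in> (\<Union>k\<in>{2 * int l + 1 - m..0}. Y k \<inter> eig ch)" using xY[of a] by auto
  qed
  ultimately show ?thesis by simp
qed

text \<open>One vector for each index in an interval of \<open>m - 2 l\<close> integers; vectors of
  different levels are independent by \<open>lev_elim_eq\<close>.\<close>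

theorem W_dim:
  assumes g: "good l ch"
  shows "finite_dimensional sc (W ch m) \<and> int (dim (W ch m)) = max (m - 2 * int l) 0"
proof -
  let ?I = "{2 * int l + 1 - m..0}"
  have "\<forall>k. \<exists>y. y \<in> Y k \<inter> eig ch \<and> y \<noteq> 0 \<and> (\<forall>y'\<in>Y k \<inter> eig ch. \<exists>c. y' = sc c y)"
    using Ye_dim1[OF g] by blast
  then obtain y where y: "\<And>k. y k \<in> Y k \<inter> eig ch" "\<And>k. y k \<noteq> 0"
    "\<And>k y'. y' \<in> Y k \<inter> eig ch \<Longrightarrow> \<exists>c. y' = sc c (y k)" by metis
  have lev: "lev k (y k)" for k using y(1) Y_lev by blast
  have Wsub: "subspace (W ch m)"
    using units_E_nz by (intro subspaceI)
      (auto simp: W_def eig_def pi_add pi_scale scale_right_distrib scale_left_commute PF_iff)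
  have yW: "y k \<in> W ch m" if "k \<in> ?I" for k
  proof -
    have k: "k \<le> 0" "2 * int l + 1 - k \<le> m" using that by auto
    have yk: "y k \<in> Y k" "y k \<in> eig ch" using y(1) by auto
    have "u b (y k) = y k" if "b \<in> PF 0" for b using Y_u_fix[OF yk(1) PF_mono[OF that k(1)]] .
    moreover have "lo c (y k) = y k" if "c \<in> PF m" for c using Y_lo_fix[OF yk(1) PF_mono[OF that k(2)]] .
    ultimately show ?thesis using yk(2) by (simp add: W_def)
  qed
  have eq: "W ch m = span (y ` ?I)"
  proof
    show "span (y ` ?I) \<subseteq> W ch m" using yW by (intro span_minimal Wsub) blast
    have "(\<Union>k\<in>?I. Y k \<inter> eig ch) \<subseteq> span (y ` ?I)"
    proof
      fix x assume "x \<in> (\<Union>k\<in>?I. Y k \<inter> eig ch)"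
      then obtain k where k: "k \<in> ?I" "x \<in> Y k \<inter> eig ch" by blast
      obtain c where "x = sc c (y k)" using y(3)[OF k(2)] by blast
      moreover have "y k \<in> span (y ` ?I)" using k(1) by (intro span_base imageI)
      ultimately show "x \<in> span (y ` ?I)" by (simp only: span_scale)
    qed
    hence "span (\<Union>k\<in>?I. Y k \<inter> eig ch) \<subseteq> span (y ` ?I)" by (intro span_minimal subspace_span)
    thus "W ch m \<subseteq> span (y ` ?I)" using W_decomp[OF g] by blast
  qed
  have inj: "inj_on y ?I"
  proof (rule inj_onI, rule ccontr)
    fix k k' assume "y k = y k'" "k \<noteq> k'"
    have "y k = (\<Sum>n | n \<in> {k'} \<and> n = k. y n)"
    proof (rule lev_elim_eq[where k = "\<lambda>n. n"])
      show "lev k (y k)" by (rule lev)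
    qed (use lev \<open>y k = y k'\<close> in auto)
    also have "{n. n \<in> {k'} \<and> n = k} = {}" using \<open>k \<noteq> k'\<close> by auto
    finally show False using y(2)[of k] by simp
  qed
  have ind: "independent (y ` ?I)"
  proof (rule independent_if_scalars_zero)
    show "finite (y ` ?I)" by simp
    fix f x assume z: "(\<Sum>x\<in>y ` ?I. sc (f x) x) = 0" and x: "x \<in> y ` ?I"
    then obtain k where k: "k \<in> ?I" "x = y k" by blast
    have z': "0 = (\<Sum>n\<in>?I. sc (f (y n)) (y n))" using z sum.reindex[OF inj, of "\<lambda>x. sc (f x) x"] by (simp add: o_def)
    have "0 = (\<Sum>n | n \<in> ?I \<and> n = k. sc (f (y n)) (y n))"
      by (rule lev_elim_eq[where k = "\<lambda>n. n", OF _ _ _ z']) (use lev lev_scale in auto)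
    also have "{n. n \<in> ?I \<and> n = k} = {k}" using k(1) by auto
    finally have "sc (f (y k)) (y k) = 0" by simp
    thus "f x = 0" using y(2)[of k] k(2) by simp
  qed
  have "dim (W ch m) = card (y ` ?I)" unfolding eq by (rule dim_span_eq_card_independent[OF ind])
  also have "\<dots> = card ?I" by (rule card_image[OF inj])
  also have "int \<dots> = max (m - 2 * int l) 0" by simp
  finally have "int (dim (W ch m)) = max (m - 2 * int l) 0" .
  moreover have "finite_dimensional sc (W ch m)"
    unfolding finite_dimensional_def eq by (intro exI[of _ "y ` ?I"]) simp
  ultimately show ?thesis by blast
qed

lemma eta_space_zero:
  assumes \<eta>: "unit_char \<eta>" and m: "m \<le> 2 * l"
  shows "eta_space sc V \<pi> \<eta> m = {0}"
proof (cases "m \<ge> 1")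
  case True
  have "v = 0" if "v \<in> W (dual \<eta>) (int m)" for v
    using that m by (intro no_shallow[of v 0 "int m"]) (auto simp: W_def eig_def)
  moreover have "0 \<in> W (dual \<eta>) (int m)" using units_E_nz by (auto simp: W_def eig_def PF_iff)
  ultimately show ?thesis using eta_space_eq_W[OF True \<eta>] by blast
next
  case False
  have "v = 0" if v: "v \<in> V" "\<forall>k\<in>SL2_OF. \<forall>t\<in>units_E. \<pi> (k ** torus_elt t) v = sc (\<eta> (inverse (s t))) v" for v
  proof (rule no_shallow[of v 0 0])
    have 1: "\<pi> k v = v" if "k \<in> SL2_OF" for k
    proof -
      have "torus_elt 1 = mat 1" by (simp add: torus_mat2 mat_mat2)
      hence "\<pi> k v = sc (\<eta> (inverse (s 1))) v" using v(2) that by (metis matrix_mul_rid units_E_closed(1))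
      thus ?thesis using unit_char_one[OF \<eta>] by simp
    qed
    show "u b v = v" if "b \<in> PF 0" for b
      using that by (intro 1) (auto simp: SL2_OF_def Up_def forall_2 PF_iff)
    show "lo b v = v" if "b \<in> PF 0" for b
      using that by (intro 1) (auto simp: SL2_OF_def Lo_def forall_2 PF_iff)
  qed (use v in auto)
  moreover have "k \<in> U11" if "k \<in> SL2_OF" for k
  proof -
    obtain a b c d where k: "k = mat2 a b c d" by (rule mat2_cases)
    show ?thesis using that by (auto simp: k SL2_OF_def forall_2 PF_iff U11_mat2 s_fixes algebra_simps)
  qed
  ultimately show ?thesis using False units_E_nz by (auto simp: eta_space_def)
qed

lemma conj_alpha_Up: "matrix_inv \<alpha> ** Up b ** \<alpha> = Up (b / unif)"
  and conj_alpha_Lo: "matrix_inv \<alpha> ** Lo c ** \<alpha> = Lo (unif * c)"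
  and alpha_inv_inv: "matrix_inv (matrix_inv \<alpha>) = \<alpha>"
proof -
  have 1: "matrix_inv \<alpha> = mat2 (inverse unif) 0 0 1"
    by (rule matrix_inv_unique) (simp add: \<alpha>_def mat2_mult mat_mat2)
  show "matrix_inv \<alpha> ** Up b ** \<alpha> = Up (b / unif)" "matrix_inv \<alpha> ** Lo c ** \<alpha> = Lo (unif * c)"
    unfolding 1 by (simp_all add: \<alpha>_def Up_def Lo_def mat2_mult divide_inverse mult.commute)
  show "matrix_inv (matrix_inv \<alpha>) = \<alpha>"
    unfolding 1 by (rule matrix_inv_unique) (simp add: \<alpha>_def mat2_mult mat_mat2)
qed

text \<open>Conjugation by \<open>\<alpha>\<close> changes the exponents of invariance under
  \<open>u\<close> and \<open>lo\<close> from \<open>0, m\<close> to \<open>- 1, m + 1\<close>, and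
  \<open>no_shallow\<close> depends only on their sum.\<close>

lemma eta_space'_zero:
  assumes \<eta>: "unit_char \<eta>" and m: "m \<le> 2 * l"
  shows "v \<in> eta_space' sc V \<pi> \<eta> m \<Longrightarrow> v = 0"
proof -
  assume v: "v \<in> eta_space' sc V \<pi> \<eta> m"
  have div: "b = unif * b / unif" for b by simp
  show "v = 0"
  proof (cases "m \<ge> 1")
    case True
    hence v': "v \<in> V" "\<And>g. g \<in> Kbar' m \<Longrightarrow> \<pi> g v = sc (\<eta> (g $ 2 $ 2)) v"
      using v by (auto simp: eta_space'_def)
    have conj: "matrix_inv \<alpha> ** g ** \<alpha> \<in> Kbar' m" if "g \<in> Kbar m" for g
      using that by (auto simp: Kbar'_def conjugate_by_def alpha_inv_inv)
    show "v = 0"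
    proof (rule no_shallow[OF v'(1), of "- 1" "int m + 1"])
      fix b assume b: "b \<in> PF (- 1)"
      have F: "b \<in> F" using b by (rule PF_in_F)
      have "Up (unif * b) \<in> Kbar m"
        using b Up_U11[of "unif * b"] by (simp add: Kbar_def GL2_OE_def Up_def forall_2 PF_iff)
      from conj[OF this] have "Up b \<in> Kbar' m" by (simp add: conj_alpha_Up)
      from v'(2)[OF this] show "u b v = v"
        using unit_char_one[OF \<eta>] by (simp add: Up_def)
    next
      fix c assume c: "c \<in> PF (int m + 1)"
      have F: "c / unif \<in> F" using c by (simp add: PF_iff)
      have "Lo (c / unif) \<in> Kbar m"
        using c Lo_U11[OF F] PE_mono[of c "int m + 1" 1] by (simp add: Kbar_def GL2_OE_def Lo_def forall_2 PF_iff)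
      from conj[OF this] have "Lo c \<in> Kbar' m" by (simp add: conj_alpha_Lo)
      from v'(2)[OF this] show "lo c v = v"
        using unit_char_one[OF \<eta>] by (simp add: Lo_def)
    qed (use m in auto)
  next
    case False
    hence m0: "m = 0" by simp
    show "v = 0"
    proof (cases "\<forall>x\<in>units_F. \<eta> x = 1")
      case True
      hence v': "v \<in> V" "\<And>k t. k \<in> SL2_OF \<Longrightarrow> t \<in> units_E \<Longrightarrow>
          \<pi> (matrix_inv \<alpha> ** (k ** torus_elt t) ** \<alpha>) v = sc (\<eta> (inverse (s t))) v"
        using v m0 by (auto simp: eta_space'_def)
      have "torus_elt 1 = mat 1" by (simp add: torus_mat2 mat_mat2)
      hence v1: "\<pi> (matrix_inv \<alpha> ** k ** \<alpha>) v = v" if "k \<in> SL2_OF" for k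
        using v'(2)[OF that units_E_closed(1)] unit_char_one[OF \<eta>] by simp
      show "v = 0"
      proof (rule no_shallow[OF v'(1), of "- 1" 1])
        fix b assume b: "b \<in> PF (- 1)"
        have "Up (unif * b) \<in> SL2_OF" using b by (simp add: SL2_OF_def Up_def forall_2 PF_iff)
        from v1[OF this] show "u b v = v" by (simp add: conj_alpha_Up)
      next
        fix c assume c: "c \<in> PF 1"
        have "Lo (c / unif) \<in> SL2_OF" using c by (simp add: SL2_OF_def Lo_def forall_2 PF_iff)
        from v1[OF this] show "lo c v = v" by (simp add: conj_alpha_Lo)
      qed (use l_pos in auto)
    next
      case False
      thus "v = 0" using v m0 unfolding eta_space'_def if_not_P[OF False] by simp
    qed
  qed
qed

text \<open>\<open>\<pi>\<close> is unconstrained off \<open>U11\<close>, so even for the zero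
  vector it has to be checked that the conjugated groups lie in \<open>U11\<close>.\<close>

lemma eta_space'_0: "0 \<in> eta_space' sc V \<pi> \<eta> m"
proof -
  have inv: "matrix_inv \<alpha> = mat2 (inverse unif) 0 0 1"
    by (rule matrix_inv_unique) (simp add: \<alpha>_def mat2_mult mat_mat2)
  have U: "matrix_inv \<alpha> ** g ** \<alpha> \<in> U11" if g: "g \<in> U11" for g
  proof -
    obtain a b c d where gm: "g = mat2 a b c d" by (rule mat2_cases)
    have "s unif = unif" by (simp add: s_fixes)
    thus ?thesis using g unfolding gm inv
      by (simp add: \<alpha>_def mat2_mult U11_mat2 s_mult s_inverse s_divide field_simps)
  qed
  have SL: "k \<in> U11" if "k \<in> SL2_OF" for k
  proof -
    obtain a b c d where k: "k = mat2 a b c d" by (rule mat2_cases)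
    show ?thesis using that by (auto simp: k SL2_OF_def forall_2 PF_iff U11_mat2 s_fixes algebra_simps)
  qed
  have "\<pi> g 0 = 0" if "g \<in> Kbar' m" for g
    using that U by (intro pi_zero) (auto simp: Kbar'_def conjugate_by_def alpha_inv_inv Kbar_def)
  moreover have "\<pi> (matrix_inv \<alpha> ** (k ** torus_elt t) ** \<alpha>) 0 = 0" if "k \<in> SL2_OF" "t \<in> units_E" for k t
    using U[OF U11_mult[OF SL[OF that(1)] torus_U11[OF units_E_nz[OF that(2)]]]] by (rule pi_zero)
  ultimately show ?thesis unfolding eta_space'_def by simp
qed

text \<open>Ensures that the minimum in \<open>eta_conductor\<close> is attained for every extension
  of the central character, also for one of large conductor. Enlarging \<open>n\<close> makes it
  \<open>good\<close>, at the price of a translate \<open>u b y\<close> outside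
  \<open>Y l\<close>.\<close>

lemma eta_space_exists:
  assumes \<eta>: "unit_char \<eta>" "\<forall>z\<in>E1. \<eta> z = central_char sc V \<pi> z"
  shows "\<exists>m. eta_space sc V \<pi> \<eta> m \<noteq> {0}"
proof -
  obtain N where N: "N \<ge> 1" "\<And>t. t - 1 \<in> PE (int N) \<Longrightarrow> \<eta> t = 1" using unit_char_near_one[OF \<eta>(1)] by blast
  define n where "n = max l N"
  have "\<eta> x = 1" if "x - 1 \<in> PE (int n)" for x
    using that PE_mono[of "x - 1" "int n" "int N"] N(2) by (simp add: n_def)
  hence "good n \<eta>" using \<eta> by (simp add: good_def)
  hence g: "good n (dual \<eta>)" using N(1) by (intro good_dual) (auto simp: n_def)
  interpret level_char F val s unif sc V \<pi> l n "dual \<eta>" by (rule level_charI[OF g]) (simp add: n_def)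
  obtain y where y: "y \<in> Y (int l)" "y \<noteq> 0" using Y_ne by blast
  obtain b where b: "b \<in> PF (int l - int n)" "A (u b y) \<noteq> 0" using A_u_nonzero[OF y] by blast
  define x where "x = A (u b y)"
  have x: "x \<in> eig (dual \<eta>)" "x \<in> V" "x \<noteq> 0"
    unfolding x_def using A_in_eig[OF u_Y_near[OF y(1) b(1)]] eig_V b(2) by auto
  obtain M where M: "M \<ge> 1" "\<forall>g\<in>KN M. \<pi> g x = x" using smooth[OF x(2)] by blast
  have ux: "u b x = x" if "b \<in> PF (int M)" for b
    using M(2) that Up_U11[of b] by (auto simp: Up_def KN_mat2 PF_iff)
  have lx: "lo b x = x" if "b \<in> PF (int M)" for b
    using M(2) that Lo_U11[of b] by (auto simp: Lo_def KN_mat2 PF_iff)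
  \<comment> \<open>The norm of \<open>?t\<close> has valuation \<open>- 2 * M\<close>, so the
    translate is fixed by \<open>u\<close> on \<open>PF (- M)\<close>, which contains
    \<open>PF 0\<close>, and by \<open>lo\<close> on \<open>PF (3 * M)\<close>.\<close>
  let ?t = "unif powi (- int M)"
  have t: "?t \<noteq> 0" "val (Nm ?t) = - 2 * int M" "Nm ?t \<noteq> 0" using val_Nm[of ?t] by auto
  have "u b (h ?t x) = h ?t x" if b: "b \<in> PF 0" for b
  proof -
    have bF: "b / Nm ?t \<in> F" using b by (auto simp: PF_iff)
    have "Nm ?t * (b / Nm ?t) \<in> PF 0" using b t by simp
    hence "b / Nm ?t \<in> PF (0 - val (Nm ?t))" using PF_scale[OF t(3) Nm_F bF] by blast
    hence "b / Nm ?t \<in> PF (int M)" using t(2) by (auto intro: PF_mono)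
    hence "h ?t (u (b / Nm ?t) x) = h ?t x" using ux by simp
    thus ?thesis using bF t x(2) by (simp add: h_u)
  qed
  moreover have "lo c (h ?t x) = h ?t x" if c: "c \<in> PF (int (3 * M))" for c
  proof -
    have cF: "c \<in> F" using c by (rule PF_in_F)
    have "Nm ?t * c \<in> PF (int M)" using c t cF by (subst PF_scale) auto
    hence "h ?t (lo (Nm ?t * c) x) = h ?t x" using lx by simp
    thus ?thesis using cF t x(2) by (simp add: h_lo)
  qed
  moreover have "h ?t x \<in> eig (dual \<eta>)" using x(1) t(1) by (rule eig_h)
  ultimately have "h ?t x \<in> W (dual \<eta>) (int (3 * M))" by (simp add: W_def)
  hence "h ?t x \<in> eta_space sc V \<pi> \<eta> (3 * M)" using eta_space_eq_W[OF _ \<eta>(1), of "3 * M"] M(1) by simp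
  moreover have "h ?t x \<noteq> 0" using x t by (simp add: pi_eq_0)
  ultimately show ?thesis by blast
qed

text \<open>It covers every competitor in the minimum that defines \<open>conductor\<close>, so a
  single \<open>good\<close> character attaining the bound determines that minimum.\<close>

lemma eta_conductor_ge:
  assumes \<eta>: "unit_char \<eta>" "\<forall>z\<in>E1. \<eta> z = central_char sc V \<pi> z"
  shows "eta_conductor sc V \<pi> \<eta> \<ge> 2 * l + 1"
proof (rule ccontr)
  let ?P = "\<lambda>m. eta_space sc V \<pi> \<eta> m \<noteq> {0} \<or> eta_space' sc V \<pi> \<eta> m \<noteq> {0}"
  assume "\<not> ?thesis"
  hence le: "eta_conductor sc V \<pi> \<eta> \<le> 2 * l" by simp
  have "\<exists>m. ?P m" using eta_space_exists[OF \<eta>] by blast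
  hence P: "?P (eta_conductor sc V \<pi> \<eta>)" unfolding eta_conductor_def by (rule LeastI_ex)
  have "x \<in> eta_space' sc V \<pi> \<eta> (eta_conductor sc V \<pi> \<eta>) \<longleftrightarrow> x \<in> {0}" for x
    using eta_space'_zero[OF \<eta>(1) le, of x] eta_space'_0[of \<eta>] by auto
  hence "eta_space' sc V \<pi> \<eta> (eta_conductor sc V \<pi> \<eta>) = {0}" by (intro equalityI subsetI) simp_all
  thus False using P eta_space_zero[OF \<eta>(1) le] by simp
qed

lemma eta_space_dim:
  assumes g: "good l \<eta>"
  shows "finite_dimensional sc (eta_space sc V \<pi> \<eta> m) \<and>
    int (dim (eta_space sc V \<pi> \<eta> m)) = max (int m - 2 * int l) 0"
proof (cases "m \<ge> 1")
  case True
  have "unit_char \<eta>" using g by (simp add: good_def)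
  thus ?thesis using W_dim[OF good_dual[OF g l_pos], of "int m"] eta_space_eq_W[OF True] by simp
next
  case False
  have "eta_space sc V \<pi> \<eta> m = {0}" using g False by (intro eta_space_zero) (auto simp: good_def)
  moreover have "finite_dimensional sc {0}" unfolding finite_dimensional_def by (intro exI[of _ "{}"]) simp
  moreover have "dim {0} = 0" using dim_eq_card_independent[OF independent_empty] dim_span[of "{}"] by simp
  ultimately show ?thesis using False by simp
qed

lemma eta_conductor_eq:
  assumes g: "good l \<eta>"
  shows "eta_conductor sc V \<pi> \<eta> = 2 * l + 1"
proof (rule antisym)
  have "int (dim (eta_space sc V \<pi> \<eta> (2 * l + 1))) = 1" using eta_space_dim[OF g, of "2 * l + 1"] by simp
  moreover have "dim {0} = 0" using dim_eq_card_independent[OF independent_empty] dim_span[of "{}"] by simp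
  ultimately have "eta_space sc V \<pi> \<eta> (2 * l + 1) \<noteq> {0}" by (metis of_nat_0 zero_neq_one)
  thus "eta_conductor sc V \<pi> \<eta> \<le> 2 * l + 1" unfolding eta_conductor_def by (intro Least_le) blast
  show "2 * l + 1 \<le> eta_conductor sc V \<pi> \<eta>" using g by (intro eta_conductor_ge) (auto simp: good_def)
qed

lemma conductor_eq:
  assumes g: "good l \<eta>"
  shows "conductor sc V \<pi> = 2 * l + 1"
  unfolding conductor_def
proof (rule Least_equality)
  show "\<exists>\<eta>. unit_char \<eta> \<and> (\<forall>z\<in>E1. \<eta> z = central_char sc V \<pi> z) \<and> 2 * l + 1 = eta_conductor sc V \<pi> \<eta>"
    using g eta_conductor_eq[OF g] by (intro exI[of _ \<eta>]) (auto simp: good_def)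
next
  fix n assume "\<exists>\<eta>. unit_char \<eta> \<and> (\<forall>z\<in>E1. \<eta> z = central_char sc V \<pi> z) \<and> n = eta_conductor sc V \<pi> \<eta>"
  then obtain \<eta>' where "unit_char \<eta>'" "\<forall>z\<in>E1. \<eta>' z = central_char sc V \<pi> z" "n = eta_conductor sc V \<pi> \<eta>'"
    by blast
  thus "2 * l + 1 \<le> n" using eta_conductor_ge by simp
qed

end

subsection \<open>Very cuspidal representations\<close>

context unramified_quadratic begin

lemma SL2F_mat2: "mat2 a b c d \<in> SL2F \<longleftrightarrow> a \<in> F \<and> b \<in> F \<and> c \<in> F \<and> d \<in> F \<and> a * d - b * c = 1"
  by (auto simp: SL2F_def forall_2)

lemma GL2F_mat2: "mat2 a b c d \<in> GL2F \<longleftrightarrow> a \<in> F \<and> b \<in> F \<and> c \<in> F \<and> d \<in> F \<and> a * d - b * c \<noteq> 0"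
  by (auto simp: GL2F_def forall_2)

lemma SL2F_U11: "g \<in> SL2F \<Longrightarrow> g \<in> U11"
proof -
  assume g: "g \<in> SL2F"
  obtain a b c d where gm: "g = mat2 a b c d" by (rule mat2_cases)
  show ?thesis using g by (auto simp: gm SL2F_mat2 U11_mat2 s_fixes algebra_simps)
qed

lemma SL2F_elts: "b \<in> F \<Longrightarrow> Up b \<in> SL2F" "b \<in> F \<Longrightarrow> Lo b \<in> SL2F" "J \<in> SL2F"
  "t \<in> F \<Longrightarrow> t \<noteq> 0 \<Longrightarrow> torus_elt t \<in> SL2F" "mat 1 \<in> SL2F"
  by (auto simp: Up_def Lo_def J_def torus_mat2 mat_mat2 SL2F_mat2 s_fixes)

lemma inv2_mat2: "inv2 (mat2 a b c d) =
    mat2 (d / (a * d - b * c)) (- b / (a * d - b * c)) (- c / (a * d - b * c)) (a / (a * d - b * c))"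
  by (simp add: inv2_def)

lemma GL2F_mult: "g \<in> GL2F \<Longrightarrow> h \<in> GL2F \<Longrightarrow> g ** h \<in> GL2F"
proof -
  assume gh: "g \<in> GL2F" "h \<in> GL2F"
  obtain a b c d where g: "g = mat2 a b c d" by (rule mat2_cases)
  obtain a' b' c' d' where h: "h = mat2 a' b' c' d'" by (rule mat2_cases)
  have "det (g ** h) \<noteq> 0" using gh by (simp add: det_mul GL2F_def)
  thus ?thesis using gh by (auto simp: GL2F_def g h mat2_mult forall_2)
qed

lemma GL2F_inv: "g \<in> GL2F \<Longrightarrow> inv2 g \<in> GL2F"
proof -
  assume gh: "g \<in> GL2F"
  obtain a b c d where g: "g = mat2 a b c d" by (rule mat2_cases)
  have "det g \<noteq> 0" using gh by (simp add: GL2F_def)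
  hence "det (inv2 g) * det g = 1" using inv2(1)[of g] by (metis det_mul det_I)
  hence "det (inv2 g) \<noteq> 0" by auto
  thus ?thesis using gh by (auto simp: GL2F_def g inv2_mat2 forall_2)
qed

lemma iwahori_mat2: "mat2 a b c d \<in> iwahori \<longleftrightarrow>
  a \<in> units_F \<and> b \<in> PF 0 \<and> c \<in> PF 1 \<and> d \<in> units_F"
proof -
  have "a \<in> units_E \<and> d \<in> units_E \<longleftrightarrow> a * d - b * c \<in> units_E"
    if "a \<in> PE 0" "b \<in> PE 0" "c \<in> PE 1" "d \<in> PE 0"
  proof -
    have bc: "b * c \<in> PE 1" using that by (intro PE_mult_left)
    show ?thesis
    proof
      assume "a \<in> units_E \<and> d \<in> units_E"
      thus "a * d - b * c \<in> units_E" using units_E_add[of "a * d" "- (b * c)" 1] bc by simp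
    next
      assume "a * d - b * c \<in> units_E"
      hence "a * d \<in> units_E" using units_E_add[of "a * d - b * c" "b * c" 1] bc by simp
      thus "a \<in> units_E \<and> d \<in> units_E"
        using that unit_iff_PE PE_mult_left[of a d 1] PE_mult_right[of a 1 d] by blast
    qed
  qed
  thus ?thesis using units_E_PE PE_mono[of c 1 0]
    by (auto simp: iwahori_def GL2_OF_def forall_2 units_F_iff PF_iff)
qed

lemma NI_I:
  assumes "g \<in> GL2F" "\<And>h. h \<in> iwahori \<Longrightarrow> g ** h ** inv2 g \<in> iwahori"
    "\<And>h. h \<in> iwahori \<Longrightarrow> inv2 g ** h ** g \<in> iwahori"
  shows "g \<in> iwahori_normalizer"
proof -
  have dg: "det g \<noteq> 0" using assms(1) by (simp add: GL2F_def)
  note i = inv2[OF dg]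
  have "conjugate_by g iwahori = iwahori"
    unfolding conjugate_by_def matrix_inv_eq[OF dg]
  proof (intro equalityI subsetI)
    fix h assume h: "h \<in> iwahori"
    have "g ** (inv2 g ** h ** g) ** inv2 g = (g ** inv2 g) ** h ** (g ** inv2 g)"
      by (simp only: matrix_mul_assoc)
    hence "h = g ** (inv2 g ** h ** g) ** inv2 g" by (simp add: i)
    thus "h \<in> (\<lambda>h. g ** h ** inv2 g) ` iwahori" using assms(3)[OF h] by blast
  qed (use assms(2) in blast)
  thus ?thesis using assms(1) by (simp add: iwahori_normalizer_def)
qed

lemma NI_mult:
  assumes g: "g \<in> iwahori_normalizer" and h: "h \<in> iwahori_normalizer" shows "g ** h \<in> iwahori_normalizer"
proof -
  have gl: "g \<in> GL2F" "h \<in> GL2F" and gI: "conjugate_by g iwahori = iwahori" "conjugate_by h iwahori = iwahori"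
    using g h by (auto simp: iwahori_normalizer_def)
  have d: "det g \<noteq> 0" "det h \<noteq> 0" using gl by (auto simp: GL2F_def)
  have "(g ** h) ** (inv2 h ** inv2 g) = g ** (h ** inv2 h) ** inv2 g" by (simp only: matrix_mul_assoc)
  hence "(g ** h) ** (inv2 h ** inv2 g) = mat 1" using inv2 d by simp
  hence "matrix_inv (g ** h) = inv2 h ** inv2 g" by (rule matrix_inv_unique)
  hence "conjugate_by (g ** h) iwahori = conjugate_by g (conjugate_by h iwahori)"
    using d by (simp add: conjugate_by_def matrix_inv_eq image_image matrix_mul_assoc)
  thus ?thesis using gI GL2F_mult[OF gl] by (simp add: iwahori_normalizer_def)
qed

lemma NI_diag:
  assumes a: "a \<in> F" "d \<in> F" "a \<noteq> 0" "d \<noteq> 0" "val a = val d"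
  shows "mat2 a 0 0 d \<in> iwahori_normalizer"
proof (rule NI_I)
  show "mat2 a 0 0 d \<in> GL2F" using a by (simp add: GL2F_mat2)
  define e where "e = a / d"
  have e: "e \<in> PE 0" "inverse e \<in> PE 0" "e \<in> F" "e \<noteq> 0"
    using a by (auto simp: e_def PE_iff val_divide val_inverse)
  fix h assume h: "h \<in> iwahori"
  obtain p q r t where hm: "h = mat2 p q r t" by (rule mat2_cases)
  have H: "p \<in> units_F" "q \<in> PF 0" "r \<in> PF 1" "t \<in> units_F" using h by (auto simp: hm iwahori_mat2)
  have E: "e * q \<in> PF 0" "inverse e * q \<in> PF 0" "e * r \<in> PF 1" "inverse e * r \<in> PF 1"
    using H(2,3) e by (auto simp: PF_iff PE_mult_left)
  have "mat2 a 0 0 d ** h ** inv2 (mat2 a 0 0 d) = mat2 p (e * q) (inverse e * r) t"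
    using a by (simp add: hm inv2_mat2 mat2_mult mat2_eq_iff e_def)
  thus "mat2 a 0 0 d ** h ** inv2 (mat2 a 0 0 d) \<in> iwahori" using H E by (simp add: iwahori_mat2)
  have "inv2 (mat2 a 0 0 d) ** h ** mat2 a 0 0 d = mat2 p (inverse e * q) (e * r) t"
    using a by (simp add: hm inv2_mat2 mat2_mult mat2_eq_iff e_def)
  thus "inv2 (mat2 a 0 0 d) ** h ** mat2 a 0 0 d \<in> iwahori" using H E by (simp add: iwahori_mat2)
qed

text \<open>Conjugation by \<open>Pi\<close> exchanges the groups of \<open>Up\<close> on
  \<open>PF 0\<close> and \<open>Lo\<close> on \<open>PF 1\<close>; its determinant has odd
  valuation.\<close>

definition Pi :: "'e^2^2" where "Pi = mat2 0 1 unif 0"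

lemma Pi_inv: "inv2 Pi = mat2 0 (1 / unif) 1 0"
  by (simp add: Pi_def inv2_mat2)

lemma Pi_GL2F: "Pi \<in> GL2F" by (simp add: Pi_def GL2F_mat2)

lemma Pi_NI: "Pi \<in> iwahori_normalizer" "inv2 Pi \<in> iwahori_normalizer"
proof -
  have c: "Pi ** h ** inv2 Pi \<in> iwahori \<and> inv2 Pi ** h ** Pi \<in> iwahori" if h: "h \<in> iwahori" for h
  proof -
    obtain p q r t where hm: "h = mat2 p q r t" by (rule mat2_cases)
    have H: "p \<in> units_F" "q \<in> PF 0" "r \<in> PF 1" "t \<in> units_F" using h by (auto simp: hm iwahori_mat2)
    have "Pi ** h ** inv2 Pi = mat2 t (r / unif) (unif * q) p" "inv2 Pi ** h ** Pi = mat2 t (r / unif) (unif * q) p"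
      unfolding Pi_inv by (simp_all add: hm Pi_def mat2_mult mat2_eq_iff)
    thus ?thesis using H by (simp add: iwahori_mat2 PF_iff)
  qed
  have ii: "inv2 (inv2 Pi) = Pi" unfolding Pi_inv by (simp add: inv2_mat2 Pi_def)
  show "Pi \<in> iwahori_normalizer" using c by (intro NI_I Pi_GL2F) auto
  show "inv2 Pi \<in> iwahori_normalizer" using c by (intro NI_I GL2F_inv Pi_GL2F) (auto simp: ii)
qed

lemma iwahori_NI: "g \<in> iwahori \<Longrightarrow> g \<in> iwahori_normalizer"
proof (rule NI_I)
  assume g: "g \<in> iwahori"
  obtain a b c d where gm: "g = mat2 a b c d" by (rule mat2_cases)
  have G: "a \<in> units_F" "b \<in> PF 0" "c \<in> PF 1" "d \<in> units_F" using g by (auto simp: gm iwahori_mat2)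
  have mult: "x ** y \<in> iwahori" if x: "x \<in> iwahori" and y: "y \<in> iwahori" for x y
  proof -
    obtain a b c d where xm: "x = mat2 a b c d" by (rule mat2_cases)
    obtain a' b' c' d' where ym: "y = mat2 a' b' c' d'" by (rule mat2_cases)
    have X: "a \<in> units_E" "b \<in> PE 0" "c \<in> PE 1" "d \<in> units_E" "a \<in> PE 0" "d \<in> PE 0" "a \<in> F" "b \<in> F" "c \<in> F" "d \<in> F"
      using x by (auto simp: xm iwahori_mat2 units_F_iff PF_iff units_E_PE)
    have Y: "a' \<in> units_E" "b' \<in> PE 0" "c' \<in> PE 1" "d' \<in> units_E" "a' \<in> PE 0" "d' \<in> PE 0" "a' \<in> F" "b' \<in> F" "c' \<in> F" "d' \<in> F"
      using y by (auto simp: ym iwahori_mat2 units_F_iff PF_iff units_E_PE)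
    have "a * a' + b * c' \<in> units_E" "d * d' + c * b' \<in> units_E"
      using X Y by (auto intro!: units_E_add[of _ _ 1] intro: PE_mult_left PE_mult_right)
    moreover have "a * b' + b * d' \<in> PE 0" "c * a' + d * c' \<in> PE 1"
      using PE_add[OF PE_mult_left[of a b' 0] PE_mult_left[of b d' 0]]
        PE_add[OF PE_mult_right[of c 1 a'] PE_mult_left[of d c' 1]] X Y by auto
    ultimately show ?thesis using X Y
      by (simp add: xm ym mat2_mult iwahori_mat2 units_F_iff PF_iff add.commute)
  qed
  have D: "a * d - b * c \<in> units_E" "a * d - b * c \<in> F"
    using g units_F_iff by (auto simp: gm iwahori_def GL2_OF_def)
  have Dn: "a * d - b * c \<noteq> 0" "inverse (a * d - b * c) \<in> PE 0"
    using D by (auto dest: units_E_nz intro: units_E_PE)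
  have i: "inv2 g \<in> iwahori"
    unfolding gm inv2_mat2 iwahori_mat2 using G D Dn(2)
    by (auto simp: units_F_iff PF_iff divide_inverse intro!: PE_mult_right)
  show "g \<in> GL2F" using G Dn by (auto simp: gm GL2F_mat2 units_F_iff PF_iff)
  show "g ** h ** inv2 g \<in> iwahori" if "h \<in> iwahori" for h using mult g i that by blast
  show "inv2 g ** h ** g \<in> iwahori" if "h \<in> iwahori" for h using mult g i that by blast
qed

lemma J_ram_iwahori: "l \<ge> 1 \<Longrightarrow> g \<in> J_ram l \<Longrightarrow> g \<in> iwahori"
proof -
  assume l: "l \<ge> 1" and "g \<in> J_ram l"
  then obtain a b c d where g: "g = mat2 (1 + a) b c (1 + d)" "a \<in> PF (int l)" "b \<in> PF (int l)"
    "c \<in> PF (int l + 1)" "d \<in> PF (int l)" by (auto simp: J_ram_def)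
  have "1 + a \<in> units_F" "1 + d \<in> units_F"
    using g l near_one_unit[of "1 + a" "int l"] near_one_unit[of "1 + d" "int l"] by (auto simp: units_F_iff PF_iff)
  moreover have "b \<in> PF 0" "c \<in> PF 1" using g(3,4) by (auto intro: PF_mono)
  ultimately show ?thesis by (simp add: g(1) iwahori_mat2)
qed

lemma Up_iwahori: "b \<in> PF 0 \<Longrightarrow> Up b \<in> iwahori" and Lo_iwahori: "c \<in> PF 1 \<Longrightarrow> Lo c \<in> iwahori"
  by (auto simp: Up_def Lo_def iwahori_mat2 units_F_iff)

text \<open>Every determinant occurs on the Iwahori normalizer: diagonal matrices with entries of
  equal valuation give the even valuations, and \<open>Pi\<close> supplies the odd ones.\<close>

lemma GL2F_decomp:
  assumes g: "g \<in> GL2F" obtains h n where "h \<in> iwahori_normalizer" "n \<in> SL2F" "g = h ** n"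
proof -
  have dF: "det g \<in> F" "det g \<noteq> 0"
  proof -
    obtain a b c d where "g = mat2 a b c d" by (rule mat2_cases)
    thus "det g \<in> F" "det g \<noteq> 0" using g by (auto simp: GL2F_mat2)
  qed
  have "\<exists>h\<in>iwahori_normalizer. det h = det g"
  proof (cases "even (val (det g))")
    case True
    then obtain k where k: "val (det g) = 2 * k" by blast
    let ?z = "unif powi k"
    have "val (det g / ?z) = val ?z" using k dF by (simp add: val_divide)
    hence "mat2 (det g / ?z) 0 0 ?z \<in> iwahori_normalizer" using dF by (intro NI_diag) auto
    moreover have "det (mat2 (det g / ?z) 0 0 ?z) = det g" by simp
    ultimately show ?thesis by blast
  next
    case False
    then obtain k where k: "val (det g) = 2 * k + 1" by (metis oddE)
    let ?z = "unif powi k"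
    let ?w = "- det g / unif / ?z"
    have w: "?w \<noteq> 0" "?w \<in> F" using dF by auto
    have "val ?w = val ?z" using k dF uniformizer by (simp add: val_divide val_mult)
    hence "mat2 ?w 0 0 ?z \<in> iwahori_normalizer" using w by (intro NI_diag) auto
    hence "mat2 ?w 0 0 ?z ** Pi \<in> iwahori_normalizer" using Pi_NI by (intro NI_mult)
    moreover have "det (mat2 ?w 0 0 ?z ** Pi) = det g" by (simp add: det_mul Pi_def)
    ultimately show ?thesis by blast
  qed
  then obtain h where h: "h \<in> iwahori_normalizer" "det h = det g" by blast
  have hG: "h \<in> GL2F" using h by (simp add: iwahori_normalizer_def)
  have dh: "det h \<noteq> 0" using h dF by simp
  have "det (inv2 h) * det h = 1" using inv2(1)[OF dh] by (metis det_mul det_I)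
  hence "det (inv2 h ** g) = 1" using h(2) by (simp add: det_mul)
  moreover have "inv2 h ** g \<in> GL2F" using GL2F_mult[OF GL2F_inv[OF hG] g] .
  ultimately have "inv2 h ** g \<in> SL2F" by (simp add: GL2F_def SL2F_def)
  moreover have "g = h ** (inv2 h ** g)" using inv2(2)[OF dh] by (simp add: matrix_mul_assoc)
  ultimately show ?thesis using that h(1) by blast
qed

end

context u11_rep begin

lemma lev_sum: "(\<And>i. i \<in> I \<Longrightarrow> lev k (f i)) \<Longrightarrow> lev k (sum f I)"
  by (induction I rule: infinite_finite_induct) (auto intro: lev_add)

lemma u_sum_invariant:
  assumes x: "x \<in> V" "\<And>b. b \<in> PF K \<Longrightarrow> u b x = x" and c: "c \<in> PF (K - 1)"
  shows "u c (\<Sum>b\<in>reps (K - 1) K. u b x) = (\<Sum>b\<in>reps (K - 1) K. u b x)"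
proof -
  have F: "b \<in> F" if "b \<in> reps (K - 1) K" for b using reps_F[OF _ that] by simp
  have cF: "c \<in> F" using c by (rule PF_in_F)
  have "u c (\<Sum>b\<in>reps (K - 1) K. u b x) = (\<Sum>b\<in>reps (K - 1) K. u c (u b x))"
    using F cF x(1) by (intro pi_sum) auto
  also have "\<dots> = (\<Sum>b\<in>reps (K - 1) K. u (1 * b + c) x)"
    using F cF x(1) by (intro sum.cong refl) (auto simp: u_u add.commute)
  also have "\<dots> = (\<Sum>b\<in>reps (K - 1 + val 1) (K + val 1). u b x)"
    using c x by (intro sum_reps_affine[where f = "\<lambda>b. u b x"]) (auto simp: PF_iff intro: u_periodic[OF x(2,1)])
  finally show ?thesis by simp
qed

lemma av_V: "x \<in> V \<Longrightarrow> av K x \<in> V"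
  unfolding av_def using reps_F[of "K - 1" K] by (intro V_scale V_sum) auto

lemma av_invariant:
  assumes x: "x \<in> V" "\<And>b. b \<in> PF K \<Longrightarrow> u b x = x" and c: "c \<in> PF (K - 1)"
  shows "u c (av K x) = av K x"
proof -
  have "(\<Sum>b\<in>reps (K - 1) K. u b x) \<in> V" using x(1) reps_F[of "K - 1" K] by (intro V_sum) auto
  thus ?thesis unfolding av_def using u_sum_invariant[OF assms] c by (simp add: pi_scale PF_iff)
qed

lemma lev_diff_av:
  assumes x: "x \<in> V" "\<And>b. b \<in> PF K \<Longrightarrow> u b x = x"
  shows "lev K (x - av K x)"
proof -
  let ?S = "\<lambda>x. \<Sum>b\<in>reps (K - 1) K. u b x"
  let ?q = "of_nat (card (reps (K - 1) K)) :: complex"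
  have F: "b \<in> F" if "b \<in> reps (K - 1) K" for b using reps_F[OF _ that] by simp
  have q: "?q \<noteq> 0" using reps_card[of "K - 1" K] by auto
  have a: "av K x \<in> V" by (rule av_V[OF x(1)])
  have d: "u b (x - av K x) = u b x - u b (av K x)" if "b \<in> F" for b using that x a by (intro pi_diff) auto
  have "u b (x - av K x) = x - av K x" if b: "b \<in> PF K" for b
    using d[OF PF_in_F[OF b]] x(2)[OF b] av_invariant[OF x PF_mono[OF b]] by simp
  moreover have "?S (x - av K x) = 0"
  proof -
    have "?S (x - av K x) = ?S x - ?S (av K x)"
      unfolding sum_subtractf[symmetric] using d F by (intro sum.cong refl) auto
    also have "?S (av K x) = (\<Sum>b\<in>reps (K - 1) K. av K x)"
      using reps_PF[of "K - 1" K] by (intro sum.cong refl av_invariant[OF x]) auto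
    also have "\<dots> = ?S x" unfolding sum_const using q by (simp add: av_def)
    finally show ?thesis by simp
  qed
  ultimately show ?thesis using x(1) a by (simp add: lev_def)
qed

end

locale very_cuspidal = unramified_quadratic F val s unif
  for F :: "'e::field set" and val :: "'e \<Rightarrow> int" and s :: "'e \<Rightarrow> 'e" and unif :: 'e +
  fixes l :: nat and X :: "(nat \<Rightarrow> complex) set" and \<sigma> :: "'e^2^2 \<Rightarrow> (nat \<Rightarrow> complex) \<Rightarrow> nat \<Rightarrow> complex"
  assumes vc: "very_cuspidal_ram l X \<sigma>"
begin

lemma l1: "l \<ge> 1"
  using vc by (simp add: very_cuspidal_ram_def)

lemma rX: "Defs.representation iwahori_normalizer scale_vec X \<sigma>"
  using vc by (simp add: very_cuspidal_ram_def irreducible_rep_def)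

sublocale X: vector_space scale_vec
  by unfold_locales (auto simp: scale_vec_def algebra_simps fun_eq_iff)

lemma X_subspace: "X.subspace X"
  using rX by (simp add: Defs.representation_def)

lemma sigma_X: "g \<in> iwahori_normalizer \<Longrightarrow> x \<in> X \<Longrightarrow> \<sigma> g x \<in> X"
  and sigma_add: "g \<in> iwahori_normalizer \<Longrightarrow> x \<in> X \<Longrightarrow> y \<in> X \<Longrightarrow> \<sigma> g (x + y) = \<sigma> g x + \<sigma> g y"
  and sigma_scale: "g \<in> iwahori_normalizer \<Longrightarrow> x \<in> X \<Longrightarrow> \<sigma> g (scale_vec c x) = scale_vec c (\<sigma> g x)"
  and sigma_one: "x \<in> X \<Longrightarrow> \<sigma> (mat 1) x = x"
  and sigma_mult: "g \<in> iwahori_normalizer \<Longrightarrow> h \<in> iwahori_normalizer \<Longrightarrow> x \<in> X \<Longrightarrow> \<sigma> (g ** h) x = \<sigma> g (\<sigma> h x)"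
  using rX unfolding Defs.representation_def by blast+

lemma sigma_zero: "g \<in> iwahori_normalizer \<Longrightarrow> \<sigma> g 0 = 0"
  using sigma_scale[of g 0 0] X.subspace_0[OF X_subspace] by simp

lemma sigma_sum:
  "g \<in> iwahori_normalizer \<Longrightarrow> (\<And>i. i \<in> I \<Longrightarrow> f i \<in> X) \<Longrightarrow> \<sigma> g (sum f I) = (\<Sum>i\<in>I. \<sigma> g (f i))"
  by (induction I rule: infinite_finite_induct)
     (auto simp: sigma_zero sigma_add X.subspace_sum[OF X_subspace])

lemma J_ram_NI: "g \<in> J_ram l \<Longrightarrow> g \<in> iwahori_normalizer"
  using J_ram_iwahori[OF l1] iwahori_NI by blast

lemma sigma_J: "g \<in> J_ram l \<Longrightarrow> x \<in> X \<Longrightarrow> \<sigma> g x = x"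
  using vc by (simp add: very_cuspidal_ram_def)

lemma no_invariants:
  assumes "x \<in> X" "\<And>b. b \<in> PF (int l - 1) \<Longrightarrow> \<sigma> (Up b) x = x" shows "x = 0"
proof -
  have "x \<in> invariants {mat2 1 b 0 1 | b. b \<in> PF (int l - 1)} X \<sigma>"
    using assms by (auto simp: invariants_def Up_def)
  thus ?thesis using vc by (simp add: very_cuspidal_ram_def)
qed

lemma Up_J: "b \<in> PF (int l) \<Longrightarrow> Up b \<in> J_ram l"
proof -
  assume "b \<in> PF (int l)"
  hence "mat2 (1 + 0) b 0 (1 + 0) \<in> J_ram l" unfolding J_ram_def by blast
  thus ?thesis by (simp add: Up_def)
qed

lemma Lo_J: "c \<in> PF (int l + 1) \<Longrightarrow> Lo c \<in> J_ram l"
proof -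
  assume "c \<in> PF (int l + 1)"
  hence "mat2 (1 + 0) 0 c (1 + 0) \<in> J_ram l" unfolding J_ram_def by blast
  thus ?thesis by (simp add: Lo_def)
qed

lemma Up_NI: "b \<in> PF 0 \<Longrightarrow> Up b \<in> iwahori_normalizer" and Lo_NI: "c \<in> PF 1 \<Longrightarrow> Lo c \<in> iwahori_normalizer"
  using Up_iwahori Lo_iwahori iwahori_NI by blast+

text \<open>The sum is invariant under \<open>PF (l - 1)\<close>, hence zero for a very cuspidal
  representation.\<close>

lemma sum_Up_zero:
  assumes x: "x \<in> X" shows "(\<Sum>b\<in>reps (int l - 1) (int l). \<sigma> (Up b) x) = 0"
proof (rule no_invariants)
  let ?R = "reps (int l - 1) (int l)"
  have P0: "b \<in> PF 0" if "b \<in> PF (int l - 1)" for b using PF_mono[OF that] l1 by simp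
  have R: "b \<in> PF 0" if "b \<in> ?R" for b using reps_PF[OF _ that] P0 by simp
  show "(\<Sum>b\<in>?R. \<sigma> (Up b) x) \<in> X"
    using R Up_NI x sigma_X by (intro X.subspace_sum[OF X_subspace]) auto
  fix c assume c: "c \<in> PF (int l - 1)"
  have "\<sigma> (Up c) (\<Sum>b\<in>?R. \<sigma> (Up b) x) = (\<Sum>b\<in>?R. \<sigma> (Up c) (\<sigma> (Up b) x))"
    using R Up_NI P0[OF c] x sigma_X by (intro sigma_sum) auto
  also have "\<dots> = (\<Sum>b\<in>?R. \<sigma> (Up (1 * b + c)) x)"
    using R Up_NI P0[OF c] x by (intro sum.cong refl) (auto simp: sigma_mult[symmetric] Up_Up add.commute)
  also have "\<dots> = (\<Sum>b\<in>reps (int l - 1 + val 1) (int l + val 1). \<sigma> (Up b) x)"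
  proof (rule sum_reps_affine[where f = "\<lambda>b. \<sigma> (Up b) x"])
    fix p q assume pq: "p \<in> PF (int l - 1 + val 1)" "q \<in> PF (int l - 1 + val 1)" "p - q \<in> PE (int l + val 1)"
    have d: "p - q \<in> PF (int l)" using pq by (auto simp: PF_iff)
    have "Up p = Up q ** Up (p - q)" by (simp add: Up_Up)
    hence "\<sigma> (Up p) x = \<sigma> (Up q) (\<sigma> (Up (p - q)) x)"
      using sigma_mult[OF Up_NI J_ram_NI[OF Up_J[OF d]] x, of q] P0[of q] pq by simp
    thus "\<sigma> (Up p) x = \<sigma> (Up q) x" using sigma_J[OF Up_J[OF d] x] by simp
  qed (use c in auto)
  finally show "\<sigma> (Up c) (\<Sum>b\<in>?R. \<sigma> (Up b) x) = (\<Sum>b\<in>?R. \<sigma> (Up b) x)" by simp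
qed

text \<open>Conjugation by \<open>Pi\<close> turns \<open>Lo\<close> on \<open>PF l\<close> into
  \<open>Up\<close> on \<open>PF (l - 1)\<close>, where very cuspidality applies. The sign is chosen
  so that \<open>j\<close> turns \<open>lo (- c)\<close> into \<open>u c\<close>.\<close>

lemma sum_Lo_zero:
  assumes x: "x \<in> X" shows "(\<Sum>c\<in>reps (int l) (int l + 1). \<sigma> (Lo (- c)) x) = 0"
proof -
  let ?R = "reps (int l) (int l + 1)" and ?R' = "reps (int l - 1) (int l)"
  have RF: "c \<in> PF 1" "c \<in> F" if "c \<in> ?R" for c
  proof -
    have "c \<in> PF (int l)" using reps_PF[OF _ that] by simp
    thus "c \<in> PF 1" "c \<in> F" using PF_mono[of c "int l" 1] l1 by (auto simp: PF_iff)
  qed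
  have "\<sigma> Pi (\<Sum>c\<in>?R. \<sigma> (Lo (- c)) x) = (\<Sum>c\<in>?R. \<sigma> Pi (\<sigma> (Lo (- c)) x))"
    using RF Lo_NI x sigma_X Pi_NI by (intro sigma_sum) auto
  also have "\<dots> = (\<Sum>c\<in>?R. \<sigma> (Up ((- inverse unif) * c + 0)) (\<sigma> Pi x))"
  proof (intro sum.cong refl)
    fix c assume c: "c \<in> ?R"
    have "- inverse unif * c \<in> PF 0" using RF[OF c] by (auto simp: PF_iff divide_inverse[symmetric] mult.commute)
    moreover have "Pi ** Lo (- c) = Up ((- inverse unif) * c + 0) ** Pi"
      by (simp add: Pi_def Lo_def Up_def mat2_mult field_simps uniformizer(2))
    ultimately show "\<sigma> Pi (\<sigma> (Lo (- c)) x) = \<sigma> (Up ((- inverse unif) * c + 0)) (\<sigma> Pi x)"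
      using sigma_mult[OF Pi_NI(1) Lo_NI[of "- c"] x] sigma_mult[OF Up_NI Pi_NI(1) x, of "- inverse unif * c"] RF[OF c]
      by simp
  qed
  also have "\<dots> = (\<Sum>c\<in>reps (int l + val (- inverse unif)) (int l + 1 + val (- inverse unif)). \<sigma> (Up c) (\<sigma> Pi x))"
  proof (rule sum_reps_affine[where f = "\<lambda>b. \<sigma> (Up b) (\<sigma> Pi x)"])
    have v: "val (inverse unif) = - 1" "val (- inverse unif) = - 1" using uniformizer val_inverse[of unif] by simp_all
    fix p q assume pq: "p \<in> PF (int l + val (- inverse unif))" "q \<in> PF (int l + val (- inverse unif))"
      "p - q \<in> PE (int l + 1 + val (- inverse unif))"
    have d: "p - q \<in> PF (int l)" using pq by (auto simp: PF_iff v)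
    have q0: "q \<in> PF 0" using PF_mono[OF pq(2)] l1 by (simp add: v)
    have PX: "\<sigma> Pi x \<in> X" using x Pi_NI sigma_X by blast
    have "Up p = Up q ** Up (p - q)" by (simp add: Up_Up)
    hence "\<sigma> (Up p) (\<sigma> Pi x) = \<sigma> (Up q) (\<sigma> (Up (p - q)) (\<sigma> Pi x))"
      using sigma_mult[OF Up_NI[OF q0] J_ram_NI[OF Up_J[OF d]] PX] by simp
    thus "\<sigma> (Up p) (\<sigma> Pi x) = \<sigma> (Up q) (\<sigma> Pi x)" using sigma_J[OF Up_J[OF d] PX] by simp
  qed auto
  also have "\<dots> = 0" using sum_Up_zero[of "\<sigma> Pi x"] x Pi_NI sigma_X uniformizer by (simp add: val_inverse)
  finally have z: "\<sigma> Pi (\<Sum>c\<in>?R. \<sigma> (Lo (- c)) x) = 0" .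
  have SX: "(\<Sum>c\<in>?R. \<sigma> (Lo (- c)) x) \<in> X"
    using RF Lo_NI x sigma_X by (intro X.subspace_sum[OF X_subspace]) auto
  have dP: "det Pi \<noteq> 0" by (simp add: Pi_def)
  have "(\<Sum>c\<in>?R. \<sigma> (Lo (- c)) x) = \<sigma> (inv2 Pi) (\<sigma> Pi (\<Sum>c\<in>?R. \<sigma> (Lo (- c)) x))"
    using sigma_mult[OF Pi_NI(2,1) SX] inv2(1)[OF dP] sigma_one[OF SX] by simp
  also have "\<dots> = 0" unfolding z by (rule sigma_zero[OF Pi_NI(2)])
  finally show ?thesis .
qed

end

section \<open>From the inducing representation to a nonzero vector of \<open>Y l\<close>\<close>

context u11_rep_level begin

lemma J1_closed:
  assumes "g \<in> SL2F \<inter> J_ram l" "k \<in> SL2F \<inter> J_ram l" shows "g ** k \<in> SL2F \<inter> J_ram l"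
proof -
  obtain a b c d where g: "g = mat2 (1 + a) b c (1 + d)" "a \<in> PF (int l)" "b \<in> PF (int l)"
    "c \<in> PF (int l + 1)" "d \<in> PF (int l)" using assms(1) by (auto simp: J_ram_def)
  obtain a' b' c' d' where k: "k = mat2 (1 + a') b' c' (1 + d')" "a' \<in> PF (int l)" "b' \<in> PF (int l)"
    "c' \<in> PF (int l + 1)" "d' \<in> PF (int l)" using assms(2) by (auto simp: J_ram_def)
  have m: "x * y \<in> PF (int l + 1)" if "x \<in> PF (int l)" "y \<in> PF (int l)" for x y
    using that l_pos by (intro PF_mult[OF that]) simp
  have m1: "x * y \<in> PF (int l + 1)" if "x \<in> PF (int l)" "y \<in> PF (int l + 1)" for x y
    using that l_pos by (intro PF_mult[OF that]) simp
  have m2: "x * y \<in> PF (int l + 1)" if "x \<in> PF (int l + 1)" "y \<in> PF (int l)" for x y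
    using that l_pos by (intro PF_mult[OF that]) simp
  have dn: "x \<in> PF (int l)" if "x \<in> PF (int l + 1)" for x using PF_mono[OF that] by simp
  have "g ** k = mat2 (1 + (a + a' + a * a' + b * c')) (b' + a * b' + b + b * d')
    (c + c * a' + c' + d * c') (1 + (d + d' + d * d' + c * b'))"
    by (simp add: g k mat2_mult mat2_eq_iff algebra_simps)
  moreover have "a + a' + a * a' + b * c' \<in> PF (int l)" "b' + a * b' + b + b * d' \<in> PF (int l)"
    "c + c * a' + c' + d * c' \<in> PF (int l + 1)" "d + d' + d * d' + c * b' \<in> PF (int l)"
    using g k m[of a a'] m1[of b c'] m[of a b'] m[of b d'] m2[of c a'] m1[of d c'] m[of d d'] m2[of c b'] dn
    by (auto intro!: PF_add)
  ultimately have "g ** k \<in> J_ram l" unfolding J_ram_def by blast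
  moreover have "det (g ** k) = 1" using assms by (simp add: det_mul SL2F_def)
  moreover have "g ** k \<in> GL2F" using assms by (intro GL2F_mult) (auto simp: SL2F_def GL2F_def)
  ultimately show ?thesis by (auto simp: SL2F_def GL2F_def)
qed

text \<open>Two elements with the same residues modulo \<open>PE N\<close> differ on the right by an
  element of \<open>KN N\<close>, which fixes \<open>x\<close>. Summing over the orbit then replaces
  integration over the group.\<close>

lemma J1_orbit_finite:
  assumes x: "x \<in> V" shows "finite ((\<lambda>k. \<pi> k x) ` (SL2F \<inter> J_ram l))"
proof -
  obtain N where N: "N \<ge> 1" "\<forall>g\<in>KN N. \<pi> g x = x" using smooth[OF x] by blast
  let ?J = "SL2F \<inter> J_ram l"
  define code where "code k = (erep (int N) (k$1$1), erep (int N) (k$1$2), erep (int N) (k$2$1), erep (int N) (k$2$2))"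
    for k :: "'e^2^2"
  have O: "k$i$j' \<in> PE 0" if "k \<in> ?J" for k i j'
  proof -
    have "k \<in> iwahori" using J_ram_iwahori[OF l_pos] that by blast
    thus ?thesis by (auto simp: iwahori_def GL2_OF_def PF_iff)
  qed
  have eq: "\<pi> k x = \<pi> k' x" if k: "k \<in> ?J" "k' \<in> ?J" and c: "code k = code k'" for k k'
  proof -
    obtain a b c d where km: "k = mat2 a b c d" by (rule mat2_cases)
    obtain a' b' c' d' where km': "k' = mat2 a' b' c' d'" by (rule mat2_cases)
    have det1: "a * d - b * c = 1" "a' * d' - b' * c' = 1" using k by (auto simp: km km' SL2F_mat2)
    have df: "a - a' \<in> PE (int N)" "b - b' \<in> PE (int N)" "c - c' \<in> PE (int N)" "d - d' \<in> PE (int N)"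
      using c by (auto simp: code_def km km' erep_eq_iff)
    have O': "a' \<in> PE 0" "b' \<in> PE 0" "c' \<in> PE 0" "d' \<in> PE 0"
      using O[OF k(2), of 1 1] O[OF k(2), of 1 2] O[OF k(2), of 2 1] O[OF k(2), of 2 2] by (auto simp: km')
    have U: "k \<in> U11" "k' \<in> U11" using k SL2F_U11 by auto
    have i: "inv2 k' = mat2 d' (- b') (- c') a'" using det1 by (simp add: km' inv2_mat2)
    have e: "d' * a - b' * c - 1 = d' * (a - a') - b' * (c - c')"
      "d' * b - b' * d = d' * (b - b') - b' * (d - d')"
      "a' * c - c' * a = a' * (c - c') - c' * (a - a')"
      "a' * d - c' * b - 1 = a' * (d - d') - c' * (b - b')"
      using det1 by (simp_all add: algebra_simps)
    have "d' * a - b' * c - 1 \<in> PE (int N)" "d' * b - b' * d \<in> PE (int N)"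
      "a' * c - c' * a \<in> PE (int N)" "a' * d - c' * b - 1 \<in> PE (int N)"
      unfolding e using df O' by (auto intro!: PE_diff[OF PE_mult_left PE_mult_left])
    moreover have "inv2 k' ** k = mat2 (d' * a - b' * c) (d' * b - b' * d) (a' * c - c' * a) (a' * d - c' * b)"
      unfolding i km by (simp add: mat2_mult)
    moreover have "inv2 k' ** k \<in> U11" using U by blast
    ultimately have "inv2 k' ** k \<in> KN N" by (simp add: KN_mat2)
    hence "\<pi> (inv2 k') (\<pi> k x) = x" using N(2) U x pi_mult[of "inv2 k'" k x] by simp
    thus ?thesis using pi_inv(2)[of k' "\<pi> k x"] U x by simp
  qed
  have "code ` ?J \<subseteq> (erep (int N) ` PE 0) \<times> (erep (int N) ` PE 0) \<times> (erep (int N) ` PE 0) \<times> (erep (int N) ` PE 0)"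
    using O by (auto simp: code_def)
  hence fin: "finite (code ` ?J)" by (rule finite_subset) (intro finite_cartesian_product finite_erep)
  have "(\<lambda>k. \<pi> k x) ` ?J \<subseteq> (\<lambda>c. \<pi> (SOME k. k \<in> ?J \<and> code k = c) x) ` (code ` ?J)"
  proof
    fix w assume "w \<in> (\<lambda>k. \<pi> k x) ` ?J"
    then obtain k where k: "k \<in> ?J" "w = \<pi> k x" by blast
    define k' where "k' = (SOME k'. k' \<in> ?J \<and> code k' = code k)"
    have k': "k' \<in> ?J \<and> code k' = code k"
      unfolding k'_def by (rule someI[of "\<lambda>k'. k' \<in> ?J \<and> code k' = code k" k]) (use k in blast)
    have "w = \<pi> k' x" unfolding k(2) using k' by (intro eq[OF k(1)]) auto
    thus "w \<in> (\<lambda>c. \<pi> (SOME k. k \<in> ?J \<and> code k = c) x) ` (code ` ?J)"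
      unfolding k'_def using k(1) by (intro image_eqI[of _ _ "code k"] imageI)
  qed
  thus ?thesis using fin finite_surj by blast
qed

text \<open>Evaluation at the identity turns the embedding of \<open>U\<close> into the compactly induced representation
  into an equivariant map \<open>ev\<close> to the inducing representation. The orbit sum makes a vector fixed by
  the intersection of \<open>SL2F\<close> and \<open>J_ram l\<close>; subtracting averages then gives the two level conditions,
  and none of these steps changes \<open>ev\<close> up to a nonzero scalar.\<close>

lemma Y_nonzero_of_functional:
  assumes vc: "very_cuspidal F val s unif l X \<sigma>"
    and U: "U \<subseteq> V" "subspace U" "\<And>k x. k \<in> SL2F \<Longrightarrow> x \<in> U \<Longrightarrow> \<pi> k x \<in> U"
    and ev: "\<And>x. x \<in> U \<Longrightarrow> ev x \<in> X" "\<And>x y. x \<in> U \<Longrightarrow> y \<in> U \<Longrightarrow> ev (x + y) = ev x + ev y"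
      "\<And>c x. x \<in> U \<Longrightarrow> ev (sc c x) = scale_vec c (ev x)"
      "\<And>k x. k \<in> SL2F \<Longrightarrow> k \<in> iwahori_normalizer \<Longrightarrow> x \<in> U \<Longrightarrow> ev (\<pi> k x) = \<sigma> k (ev x)"
    and x: "x \<in> U" "ev x \<noteq> 0"
  shows "\<exists>y\<in>Y (int l). y \<noteq> 0"
proof -
  interpret vc: very_cuspidal F val s unif l X \<sigma> by (rule vc)
  let ?J = "SL2F \<inter> J_ram l"
  have ev0: "ev 0 = 0" using ev(3)[OF x(1), of 0] by (simp add: scale_vec_def fun_eq_iff)
  have evsum: "ev (sum f I) = (\<Sum>i\<in>I. ev (f i))" if "\<And>i. i \<in> I \<Longrightarrow> f i \<in> U" for f :: "'i \<Rightarrow> 'v" and I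
    using that by (induction I rule: infinite_finite_induct) (auto simp: ev0 ev(2) subspace_sum[OF U(2)])
  have xV: "x \<in> V" using x(1) U(1) by blast
  define O1 where "O1 = (\<lambda>k. \<pi> k x) ` ?J"
  have finO: "finite O1" unfolding O1_def by (rule J1_orbit_finite[OF xV])
  have OU: "O1 \<subseteq> U" using U(3) x(1) by (auto simp: O1_def)
  have one: "mat 1 \<in> ?J" using vc.Up_J[of 0] SL2F_elts(5) by (simp add: Up_def mat_mat2)
  have Ox: "x \<in> O1" unfolding O1_def using one pi_one[OF xV] by (metis (no_types, lifting) image_eqI)
  define y1 where "y1 = \<Sum>O1"
  have y1U: "y1 \<in> U" unfolding y1_def using OU by (intro subspace_sum[OF U(2)]) blast
  have y1V: "y1 \<in> V" using y1U U(1) by blast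
  have y1fix: "\<pi> k y1 = y1" if k: "k \<in> ?J" for k
  proof -
    have kU: "k \<in> U11" using k SL2F_U11 by blast
    have OV: "O1 \<subseteq> V" using OU U(1) by blast
    have inj: "inj_on (\<pi> k) O1" using OV pi_inj[OF kU] by (auto intro!: inj_onI)
    have "\<pi> k ` O1 \<subseteq> O1"
    proof
      fix w assume "w \<in> \<pi> k ` O1"
      then obtain k' where k': "k' \<in> ?J" "w = \<pi> k (\<pi> k' x)" unfolding O1_def by blast
      have "w = \<pi> (k ** k') x" using k' kU xV SL2F_U11 by (simp add: pi_mult)
      thus "w \<in> O1" unfolding O1_def using J1_closed[OF k k'(1)] by blast
    qed
    hence im: "\<pi> k ` O1 = O1" using endo_inj_surj[OF finO _ inj] by blast
    have "\<pi> k y1 = (\<Sum>w\<in>O1. \<pi> k w)" unfolding y1_def using OV by (intro pi_sum[OF kU]) blast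
    also have "\<dots> = \<Sum>(\<pi> k ` O1)" using sum.reindex[OF inj, of "\<lambda>w. w"] by simp
    finally show ?thesis unfolding im y1_def .
  qed
  have evO: "ev w = ev x" if w: "w \<in> O1" for w
  proof -
    obtain k where k: "k \<in> ?J" "w = \<pi> k x" using w unfolding O1_def by blast
    thus ?thesis using ev(4)[of k x] vc.J_ram_NI[of k] vc.sigma_J[of k "ev x"] x(1) ev(1) by simp
  qed
  have "ev y1 = (\<Sum>w\<in>O1. ev x)" unfolding y1_def using OU evO by (subst evsum) auto
  also have "\<dots> = scale_vec (of_nat (card O1)) (ev x)"
  proof (rule ext)
    fix i
    have "(\<Sum>w\<in>O1. ev x) i = (\<Sum>w\<in>O1. ev x i)"
      using finO by (induction O1 rule: finite_induct) auto
    thus "(\<Sum>w\<in>O1. ev x) i = scale_vec (of_nat (card O1)) (ev x) i" by (simp add: scale_vec_def)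
  qed
  finally have evy1: "ev y1 = scale_vec (of_nat (card O1)) (ev x)" .
  have "card O1 \<noteq> 0" using finO Ox by auto
  hence evy1nz: "ev y1 \<noteq> 0" unfolding evy1 using x(2) by (simp add: vc.X.scale_eq_0_iff)
  have u1: "u b y1 = y1" if "b \<in> PF (int l)" for b
    using y1fix[of "Up b"] vc.Up_J[OF that] SL2F_elts(1)[of b] that by (simp add: PF_iff)
  have l1: "lo c y1 = y1" if "c \<in> PF (int l + 1)" for c
    using y1fix[of "Lo c"] vc.Lo_J[OF that] SL2F_elts(2)[of c] that by (simp add: PF_iff)
  have h1: "hfix y1"
    unfolding hfix_def
  proof (intro conjI ballI impI y1V)
    fix t assume t: "t \<in> F" "t - 1 \<in> PE (int l)"
    have tu: "t \<in> units_E" using near_one_unit[OF t(2)] l_pos by simp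
    have "t - 1 \<in> PF (int l)" "inverse t - 1 \<in> PF (int l)"
      using t inverse_near_one[OF t(2) tu] by (auto simp: PF_iff)
    hence "mat2 (1 + (t - 1)) 0 0 (1 + (inverse t - 1)) \<in> J_ram l" unfolding J_ram_def by blast
    hence "torus_elt t \<in> ?J" using t(1) units_E_nz[OF tu] SL2F_elts(4) by (simp add: torus_mat2 s_fixes)
    thus "h t y1 = y1" by (rule y1fix)
  qed
  have P0: "b \<in> PF 0" if "b \<in> PF (int l - 1)" for b using PF_mono[OF that] l_pos by simp
  have P1: "b \<in> PF 1" if "b \<in> PF (int l)" for b using PF_mono[OF that] l_pos by simp
  let ?R = "reps (int l - 1) (int l)" and ?S = "reps (int l) (int l + 1)"
  have R: "b \<in> PF (int l - 1)" if "b \<in> ?R" for b using reps_PF[OF _ that] by simp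
  have S: "b \<in> PF (int l)" if "b \<in> ?S" for b using reps_PF[OF _ that] by simp
  let ?z = "av (int l) y1"
  have uU: "u b w \<in> U" if "b \<in> F" "w \<in> U" for b w using U(3) SL2F_elts(1) that by blast
  have loU: "lo b w \<in> U" if "b \<in> F" "w \<in> U" for b w using U(3) SL2F_elts(2) that by blast
  have sumU: "(\<Sum>b\<in>?R. u b y1) \<in> U" using R uU y1U PF_in_F by (intro subspace_sum[OF U(2)]) blast
  have zU: "?z \<in> U" unfolding av_def using sumU by (intro subspace_scale[OF U(2)])
  have evz: "ev ?z = 0"
  proof -
    have "ev (\<Sum>b\<in>?R. u b y1) = (\<Sum>b\<in>?R. ev (u b y1))"
      using R uU y1U PF_in_F by (intro evsum) blast
    also have "\<dots> = (\<Sum>b\<in>?R. \<sigma> (Up b) (ev y1))"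
      using R P0 vc.Up_NI SL2F_elts(1) PF_in_F y1U by (intro sum.cong refl ev(4)) blast+
    also have "\<dots> = 0" by (rule vc.sum_Up_zero[OF ev(1)[OF y1U]])
    finally show ?thesis unfolding av_def using ev(3)[OF sumU] by simp
  qed
  define y2 where "y2 = y1 - ?z"
  have y2U: "y2 \<in> U" unfolding y2_def by (rule subspace_diff[OF U(2) y1U zU])
  have y2V: "y2 \<in> V" using y2U U(1) by blast
  have evdiff: "ev (a - b) = ev a - ev b" if "a \<in> U" "b \<in> U" for a b
    using ev(2)[OF that(1) subspace_scale[OF U(2) that(2)], of "- 1"] ev(3)[OF that(2), of "- 1"]
    by (simp add: scale_vec_def fun_eq_iff)
  have evy2: "ev y2 = ev y1" unfolding y2_def using evdiff[OF y1U zU] evz by simp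
  have lev2: "lev (int l) y2" unfolding y2_def by (rule lev_diff_av[OF y1V u1])
  have hz: "hfix ?z"
    unfolding av_def
  proof (intro hfix_scale hfix_sum)
    fix b assume "b \<in> ?R"
    hence "b \<in> PF (int l - int l)" using R P0 by simp
    from hfix_u[OF h1 u1 this] show "hfix (u b y1)" .
  qed
  have h2: "hfix y2" unfolding y2_def by (rule hfix_diff[OF h1 hz])
  have lu1: "lo c (u b y1) = u b (lo c y1)" if "b \<in> PF 0" "c \<in> PF (int l)" for b c
  proof (rule lo_u_commute[OF h1, of "int l"])
    show "lo c y1 = y1" if "c \<in> PF (2 * int l + 1 - int l)" for c using that by (intro l1) simp
  qed (use u1 that in auto)
  have l2: "lo c y2 = y2" if c: "c \<in> PF (int l + 1)" for c
  proof -
    have cl: "c \<in> PF (int l)" using PF_mono[OF c] by simp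
    have cF: "c \<in> F" using c by (rule PF_in_F)
    have "lo c (\<Sum>b\<in>?R. u b y1) = (\<Sum>b\<in>?R. lo c (u b y1))"
      using R cF y1V by (intro pi_sum) (auto simp: PF_iff)
    also have "\<dots> = (\<Sum>b\<in>?R. u b y1)" using R P0 lu1[OF _ cl] l1[OF c] by (intro sum.cong refl) auto
    finally have "lo c ?z = ?z"
      unfolding av_def using sumU U(1) cF by (subst pi_scale) auto
    thus ?thesis unfolding y2_def using l1[OF c] cF y1V zU U(1) by (subst pi_diff) auto
  qed
  have u2: "u b y2 = y2" if "b \<in> PF (int l)" for b by (rule lev_fix[OF lev2 that])
  have lu2: "lo c (u b y2) = u b (lo c y2)" if "b \<in> PF 0" "c \<in> PF (int l)" for b c
  proof (rule lo_u_commute[OF h2, of "int l"])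
    show "lo c y2 = y2" if "c \<in> PF (2 * int l + 1 - int l)" for c using that by (intro l2) simp
  qed (use u2 that in auto)
  have ju2: "u b (j y2) = j y2" if "b \<in> PF (int l + 1)" for b
    using lo_fix_iff[of "- b" y2] l2[of "- b"] that y2V by (simp add: PF_iff)
  \<comment> \<open>Chosen so that \<open>j z2\<close> is the average of \<open>j y2\<close> at
    level \<open>l + 1\<close>. It is written with \<open>lo\<close> because \<open>ev\<close> is
    equivariant only under elements of the Iwahori normalizer, to which \<open>J\<close> does not
    belong.\<close>
  define z2 where "z2 = sc (inverse (of_nat (card ?S))) (\<Sum>c\<in>?S. lo (- c) y2)"
  have sumU2: "(\<Sum>c\<in>?S. lo (- c) y2) \<in> U"
    using S loU y2U PF_in_F F_minus by (intro subspace_sum[OF U(2)]) blast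
  have z2U: "z2 \<in> U" unfolding z2_def using sumU2 by (intro subspace_scale[OF U(2)])
  have z2V: "z2 \<in> V" using z2U U(1) by blast
  have jz2: "j z2 = av (int l + 1) (j y2)"
  proof -
    have "j (\<Sum>c\<in>?S. lo (- c) y2) = (\<Sum>c\<in>?S. j (lo (- c) y2))"
      using S y2V by (intro pi_sum) (auto simp: PF_iff)
    also have "\<dots> = (\<Sum>c\<in>?S. u c (j y2))" using S y2V by (intro sum.cong refl) (auto simp: PF_iff j_lo)
    finally show ?thesis unfolding z2_def av_def using sumU2 U(1) by (subst pi_scale) auto
  qed
  have evz2: "ev z2 = 0"
  proof -
    have "ev (\<Sum>c\<in>?S. lo (- c) y2) = (\<Sum>c\<in>?S. ev (lo (- c) y2))"
      using S loU y2U PF_in_F F_minus by (intro evsum) blast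
    also have "\<dots> = (\<Sum>c\<in>?S. \<sigma> (Lo (- c)) (ev y2))"
    proof (intro sum.cong refl ev(4) y2U)
      fix c assume "c \<in> ?S"
      hence "- c \<in> PF 1" "- c \<in> F" using P1[OF S] by (auto simp: PF_iff)
      thus "Lo (- c) \<in> SL2F" "Lo (- c) \<in> iwahori_normalizer" using SL2F_elts(2) vc.Lo_NI by auto
    qed
    also have "\<dots> = 0" by (rule vc.sum_Lo_zero[OF ev(1)[OF y2U]])
    finally show ?thesis unfolding z2_def using ev(3)[OF sumU2] by simp
  qed
  define y3 where "y3 = y2 - z2"
  have y3U: "y3 \<in> U" unfolding y3_def by (rule subspace_diff[OF U(2) y2U z2U])
  have "ev y3 = ev y1" unfolding y3_def using evdiff[OF y2U z2U] evz2 evy2 by simp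
  hence nz: "y3 \<noteq> 0" using evy1nz ev0 by auto
  have "j y3 = j y2 - av (int l + 1) (j y2)" unfolding y3_def using y2V z2V jz2 by (simp add: pi_diff)
  hence lev3': "lev (int l + 1) (j y3)" using lev_diff_av[of "j y2" "int l + 1"] ju2 y2V by simp
  \<comment> \<open>The second subtraction must preserve the level already reached: on
    \<open>y2\<close>, \<open>lo\<close> on \<open>PF l\<close> commutes with \<open>u\<close> on
    \<open>PF 0\<close>.\<close>
  have "lev (int l) (lo (- c) y2)" if c: "c \<in> ?S" for c
  proof -
    have cP: "- c \<in> PF (int l)" "- c \<in> F" using S[OF c] by (auto simp: PF_iff)
    have V: "lo (- c) y2 \<in> V" using cP y2V by auto
    have "u b (lo (- c) y2) = lo (- c) y2" if "b \<in> PF (int l)" for b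
    proof -
      have "b \<in> PF 0" using PF_mono[OF that] by simp
      from lu2[OF this cP(1)] show ?thesis using u2[OF that] by simp
    qed
    moreover have "(\<Sum>b\<in>?R. u b (lo (- c) y2)) = 0"
    proof -
      have "(\<Sum>b\<in>?R. u b (lo (- c) y2)) = (\<Sum>b\<in>?R. lo (- c) (u b y2))"
        using R P0 lu2[OF _ cP(1)] by (intro sum.cong refl) auto
      also have "\<dots> = lo (- c) (\<Sum>b\<in>?R. u b y2)"
        using R cP y2V by (intro pi_sum[symmetric]) (auto simp: PF_iff)
      also have "\<dots> = 0" using lev2 cP by (simp add: lev_def)
      finally show ?thesis .
    qed
    ultimately show ?thesis using V by (simp add: lev_def)
  qed
  hence "lev (int l) z2" unfolding z2_def by (intro lev_scale lev_sum)
  from lev_add[OF lev2 lev_scale[OF this, of "- 1"]] have lev3: "lev (int l) y3" unfolding y3_def by simp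
  have hz2: "hfix z2"
    unfolding z2_def
  proof (intro hfix_scale hfix_sum)
    fix c assume "c \<in> ?S"
    hence "- c \<in> PF (int l + 1 - int l)" using P1[OF S] by simp
    from hfix_lo[OF h2 l2 this] show "hfix (lo (- c) y2)" .
  qed
  have "hfix y3" unfolding y3_def by (rule hfix_diff[OF h2 hz2])
  hence "y3 \<in> Y (int l)" using lev3 lev3' by (simp add: Y_def)
  thus ?thesis using nz by blast
qed

text \<open>A function in the image of \<open>U\<close> may vanish at the identity.
  \<open>GL2F_decomp\<close> moves a point of its support into \<open>SL2F\<close>, and a
  translation within \<open>U\<close> moves it on to the identity.\<close>

lemma Y_nonzero:
  assumes vc: "very_cuspidal_ram l X \<sigma>"
    and U: "U \<subseteq> V" "irreducible_rep SL2F sc U \<pi>"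
    and T: "embedding SL2F sc U \<pi> scale_fun (cInd GL2F iwahori_normalizer X \<sigma>) right_translation T"
  shows "\<exists>y\<in>Y (int l). y \<noteq> 0"
proof -
  interpret vc: very_cuspidal F val s unif l X \<sigma> by unfold_locales (rule vc)
  have rU: "Defs.representation SL2F sc U \<pi>" and Une: "U \<noteq> {0}" using U(2) by (auto simp: irreducible_rep_def)
  have sub: "subspace U" and stab: "\<And>k x. k \<in> SL2F \<Longrightarrow> x \<in> U \<Longrightarrow> \<pi> k x \<in> U"
    using rU by (auto simp: Defs.representation_def)
  have TC: "T x \<in> cInd GL2F iwahori_normalizer X \<sigma>" if "x \<in> U" for x using T that by (auto simp: embedding_def)
  have Tadd: "T (x + y) = T x + T y" if "x \<in> U" "y \<in> U" for x y using T that by (auto simp: embedding_def)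
  have Tsc: "T (sc c x) = scale_fun c (T x)" if "x \<in> U" for c x using T that by (auto simp: embedding_def)
  have Tpi: "T (\<pi> k x) = right_translation k (T x)" if "k \<in> SL2F" "x \<in> U" for k x using T that by (auto simp: embedding_def)
  have Tinj: "inj_on T U" using T by (simp add: embedding_def)
  have off: "T x g = 0" if "x \<in> U" "g \<notin> GL2F" for x g using TC[OF that(1)] that(2) by (auto simp: cInd_def)
  have inX: "T x g \<in> X" if "x \<in> U" "g \<in> GL2F" for x g using TC[OF that(1)] that(2) by (auto simp: cInd_def)
  have equi: "T x (k ** g) = \<sigma> k (T x g)" if "x \<in> U" "k \<in> iwahori_normalizer" "g \<in> GL2F" for x k g
    using TC[OF that(1)] that(2,3) by (auto simp: cInd_def)
  have oneG: "mat 1 \<in> GL2F" by (simp add: mat_mat2 GL2F_mat2)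
  obtain x0 where x0: "x0 \<in> U" "x0 \<noteq> 0" using Une subspace_0[OF sub] by blast
  have "T 0 = 0" using Tsc[OF x0(1), of 0] by (simp add: scale_fun_def scale_vec_def fun_eq_iff)
  hence "T x0 \<noteq> 0" using inj_onD[OF Tinj _ x0(1) subspace_0[OF sub]] x0(2) by auto
  then obtain g where g: "T x0 g \<noteq> 0" by (auto simp: fun_eq_iff)
  hence gG: "g \<in> GL2F" using off[OF x0(1)] by blast
  obtain k n where kn: "k \<in> iwahori_normalizer" "n \<in> SL2F" "g = k ** n" using GL2F_decomp[OF gG] by blast
  have nG: "n \<in> GL2F" using kn(2) by (auto simp: SL2F_def GL2F_def)
  have "T x0 n \<noteq> 0"
  proof
    assume "T x0 n = 0"
    hence "T x0 g = \<sigma> k 0" using equi[OF x0(1) kn(1) nG] kn(3) by simp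
    thus False using g vc.sigma_zero[OF kn(1)] by simp
  qed
  hence x: "\<pi> n x0 \<in> U" "T (\<pi> n x0) (mat 1) \<noteq> 0"
    using stab[OF kn(2) x0(1)] Tpi[OF kn(2) x0(1)] by (simp_all add: right_translation_def)
  show ?thesis
  proof (rule Y_nonzero_of_functional[OF _ U(1) sub stab, of X \<sigma> "\<lambda>x. T x (mat 1)"])
    show "very_cuspidal F val s unif l X \<sigma>" by unfold_locales
    show "T (\<pi> k x) (mat 1) = \<sigma> k (T x (mat 1))"
      if "k \<in> SL2F" "k \<in> iwahori_normalizer" "x \<in> U" for k x
      using Tpi[OF that(1,3)] equi[OF that(3,2) oneG] by (simp add: right_translation_def)
    show "T (sc c x) (mat 1) = scale_vec c (T x (mat 1))" if "x \<in> U" for c x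
      using Tsc[OF that] by (simp add: scale_fun_def)
  qed (use x Tadd inX oneG in auto)
qed

end

lemma (in u11_rep) ramified_level:
  assumes "ramified_U11 sc V \<pi>"
  shows "\<exists>l. main_rep F val s unif sc V \<pi> l"
proof -
  obtain U where U: "U \<subseteq> V" "ramified_SL2F sc U \<pi>" using assms by (auto simp: ramified_U11_def)
  obtain W :: "('e^2^2 \<Rightarrow> nat \<Rightarrow> complex) set" and \<rho> T where W: "ramified_GL2F scale_fun W \<rho>"
    "embedding SL2F sc U \<pi> scale_fun W \<rho> T"
    using U(2) unfolding ramified_SL2F_def by blast
  have irrU: "irreducible_rep SL2F sc U \<pi>" using U(2) by (simp add: ramified_SL2F_def supercuspidal_def)
  obtain l X \<sigma> T' where vc: "very_cuspidal_ram l X \<sigma>"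
    and T': "embedding GL2F scale_fun W \<rho> scale_fun (cInd GL2F iwahori_normalizer X \<sigma>) right_translation T'"
    using W(1) unfolding ramified_GL2F_def by blast
  have SG: "SL2F \<subseteq> GL2F" by (auto simp: SL2F_def GL2F_def)
  have comp: "embedding SL2F sc U \<pi> scale_fun (cInd GL2F iwahori_normalizer X \<sigma>) right_translation (\<lambda>x. T' (T x))"
    unfolding embedding_def
  proof (intro conjI ballI allI)
    have TU: "T x \<in> W" if "x \<in> U" for x using W(2) that by (auto simp: embedding_def)
    show "(\<lambda>x. T' (T x)) ` U \<subseteq> cInd GL2F iwahori_normalizer X \<sigma>"
      using T' TU by (auto simp: embedding_def)
    have "inj_on T' W" "inj_on T U" using T' W(2) by (auto simp: embedding_def)
    thus "inj_on (\<lambda>x. T' (T x)) U" using TU by (intro inj_onI) (metis inj_onD)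
    fix x y g c assume x: "x \<in> U"
    show "T' (T (sc c x)) = scale_fun c (T' (T x))" using T' W(2) TU[OF x] x by (simp add: embedding_def)
    show "T' (T (x + y)) = T' (T x) + T' (T y)" if "y \<in> U"
      using T' W(2) TU[OF x] TU[OF that] x that by (simp add: embedding_def)
    show "T' (T (\<pi> g x)) = right_translation g (T' (T x))" if "g \<in> SL2F"
      using T' W(2) TU[OF x] x that SG by (auto simp: embedding_def)
  qed
  interpret u11_rep_level F val s unif sc V \<pi> l
    using vc by unfold_locales (simp add: very_cuspidal_ram_def)
  have "main_rep F val s unif sc V \<pi> l"
    by unfold_locales (rule Y_nonzero[OF vc U(1) irrU comp])
  thus ?thesis by blast
qed

subsection \<open>Depth\<close>

context unramified_quadratic begin

lemma U11_subset_GL2: "U11 \<subseteq> {g. det g \<noteq> 0}"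
  using det_U11_nz by blast

lemma character_U11_one: "character_U11 \<xi> \<Longrightarrow> \<xi> (mat 1) = 1"
  unfolding character_U11_def using one_U11 by (metis matrix_mul_lid mult_cancel_right1)

lemma character_U11_mult: "character_U11 \<xi> \<Longrightarrow> g \<in> U11 \<Longrightarrow> k \<in> U11 \<Longrightarrow> \<xi> (g ** k) = \<xi> g * \<xi> k"
  and character_U11_nz: "character_U11 \<xi> \<Longrightarrow> g \<in> U11 \<Longrightarrow> \<xi> g \<noteq> 0"
  by (simp_all add: character_U11_def)

lemma character_U11_inv2:
  assumes "character_U11 \<xi>" "g \<in> U11" shows "\<xi> (inv2 g) * \<xi> g = 1"
  using character_U11_mult[OF assms(1) inv2_U11[OF assms(2)] assms(2)] inv2(1)[OF det_U11_nz[OF assms(2)]]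
    character_U11_one[OF assms(1)] by simp

lemma character_U11_near_one:
  assumes "character_U11 \<xi>" obtains N where "N \<ge> 1" "\<And>g. g \<in> KN N \<Longrightarrow> \<xi> g = 1"
proof -
  have "\<xi> (mat 1) = 1" by (rule character_U11_one[OF assms])
  then obtain n where n: "\<forall>h\<in>U11. (\<forall>i j. h $ i $ j - mat 1 $ i $ j \<in> PE n) \<longrightarrow> \<xi> h = 1"
    using assms unfolding character_U11_def open_in_def by force
  have "\<xi> g = 1" if "g \<in> KN (max 1 (nat n))" for g
  proof -
    have "g $ i $ j - mat 1 $ i $ j \<in> PE n" for i j
      using that by (intro PE_mono[of _ "int (max 1 (nat n))" n]) (auto simp: KN_def)
    thus ?thesis using n that by (simp add: KN_def)
  qed
  thus ?thesis by (intro that[of "max 1 (nat n)"]) auto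
qed

text \<open>Unipotent elements are commutators with torus elements.\<close>

lemma character_U11_Up:
  assumes \<xi>: "character_U11 \<xi>" and b: "b \<in> F" shows "\<xi> (Up b) = 1"
proof -
  define q where "q = Nm unif"
  have q: "q - 1 \<noteq> 0" "q \<in> F" using val_Nm[of unif] uniformizer by (auto simp: q_def)
  define a where "a = b / (q - 1)"
  have a: "a \<in> F" using b q by (simp add: a_def)
  have "torus_elt unif ** Up a = Up (q * a) ** torus_elt unif" unfolding q_def by (rule torus_Up) simp
  hence "\<xi> (torus_elt unif) * \<xi> (Up a) = \<xi> (Up (q * a)) * \<xi> (torus_elt unif)"
    using character_U11_mult[OF \<xi>] a q by (metis F_mult Up_U11 torus_U11 unif_nz)
  hence 1: "\<xi> (Up (q * a)) = \<xi> (Up a)" using character_U11_nz[OF \<xi> torus_U11[OF unif_nz]] by simp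
  have "Up b ** Up a = Up (q * a)" using q(1) by (simp add: Up_Up a_def field_simps)
  hence "\<xi> (Up b) * \<xi> (Up a) = \<xi> (Up a)" using 1 character_U11_mult[OF \<xi> Up_U11[OF b] Up_U11[OF a]] by simp
  thus ?thesis using character_U11_nz[OF \<xi> Up_U11[OF a]] by simp
qed

lemma character_U11_Lo:
  assumes \<xi>: "character_U11 \<xi>" and c: "c \<in> F" shows "\<xi> (Lo c) = 1"
proof -
  have "\<xi> J * \<xi> (Up (- c)) = \<xi> (Lo c) * \<xi> J"
    using character_U11_mult[OF \<xi> J_U11 Up_U11[of "- c"]] character_U11_mult[OF \<xi> Lo_U11[OF c] J_U11]
      J_Up[of "- c"] c by (metis F_minus minus_minus)
  thus ?thesis using character_U11_Up[OF \<xi>, of "- c"] character_U11_nz[OF \<xi> J_U11] c by simp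
qed

lemma moy_prasad_subset:
  assumes "subgroup H GL2"
    and "\<And>t. t \<noteq> 0 \<Longrightarrow> t = 1 \<or> of_int (val (t - 1)) \<ge> r \<Longrightarrow> torus_elt t \<in> H"
    and "\<And>b. b \<in> F \<Longrightarrow> b = 0 \<or> of_int (val b) + x \<ge> r \<Longrightarrow> Up b \<in> H"
    and "\<And>c. c \<in> F \<Longrightarrow> c = 0 \<or> of_int (val c) - x \<ge> r \<Longrightarrow> Lo c \<in> H"
  shows "moy_prasad x r \<subseteq> H"
  unfolding moy_prasad_def
  by (rule group.generate_subgroup_incl[OF GL2_group _ assms(1)]) (use assms(2-4) in \<open>auto simp: Up_def Lo_def\<close>)

lemma U11_subgroup: "subgroup U11 GL2"
  by (rule subgroup_GL2I[OF U11_subset_GL2]) auto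

lemma moy_prasad_plus_U11: "moy_prasad_plus x r \<subseteq> U11"
  unfolding moy_prasad_plus_def by (intro UN_least moy_prasad_subset U11_subgroup) auto

text \<open>The least integer \<open>n\<close> with \<open>n + x > r\<close> is the floor of
  \<open>r - x\<close> plus 1.\<close>

lemma Up_moy_prasad_plus:
  assumes b: "b \<in> PF (\<lfloor>r - x\<rfloor> + 1)" shows "Up b \<in> moy_prasad_plus x r"
proof -
  define t where "t = (if b = 0 then r + 1 else of_int (val b) + x)"
  have "t > r" using b floor_less_iff[of "r - x" "val b"] by (auto simp: t_def PF_iff PE_iff)
  moreover have "Up b \<in> moy_prasad x t"
    unfolding moy_prasad_def using b by (intro generate.incl) (auto simp: t_def Up_def PF_iff)
  ultimately show ?thesis unfolding moy_prasad_plus_def by blast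
qed

lemma Lo_moy_prasad_plus:
  assumes c: "c \<in> PF (\<lfloor>r + x\<rfloor> + 1)" shows "Lo c \<in> moy_prasad_plus x r"
proof -
  define t where "t = (if c = 0 then r + 1 else of_int (val c) - x)"
  have "t > r" using c floor_less_iff[of "r + x" "val c"] by (auto simp: t_def PF_iff PE_iff)
  moreover have "Lo c \<in> moy_prasad x t"
    unfolding moy_prasad_def using c by (intro generate.incl) (auto simp: t_def Lo_def PF_iff)
  ultimately show ?thesis unfolding moy_prasad_plus_def by blast
qed

lemma KN_Up: "b \<in> PF (int N) \<Longrightarrow> Up b \<in> KN N" and KN_Lo: "b \<in> PF (int N) \<Longrightarrow> Lo b \<in> KN N"
  using Up_U11[of b] Lo_U11[of b] by (auto simp: PF_iff Up_def Lo_def KN_mat2)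

lemma KN_torus: "t - 1 \<in> PE (int N) \<Longrightarrow> N \<ge> 1 \<Longrightarrow> torus_elt t \<in> KN N"
  using near_one_unit[of t "int N"] inverse_near_one[of "s t" "int N"] s_near_one[of t] torus_U11[of t] units_E_nz[of t]
  by (auto simp: torus_mat2 KN_mat2)

lemma moy_prasad_plus_KN:
  assumes "N \<ge> 1" shows "moy_prasad_plus 0 (real N) \<subseteq> KN N"
  unfolding moy_prasad_plus_def
proof (intro UN_least moy_prasad_subset KN_subgroup[OF assms])
  fix r assume r: "r \<in> {real N<..}"
  have PE: "y \<in> PE (int N)" if "y = 0 \<or> r \<le> real_of_int (val y)" for y
    using that r by (auto simp: PE_iff)
  show "torus_elt t \<in> KN N" if "t = 1 \<or> r \<le> real_of_int (val (t - 1))" for t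
    using that PE[of "t - 1"] KN_torus[OF _ assms] by auto
  show "Up b \<in> KN N" if "b \<in> F" "b = 0 \<or> r \<le> real_of_int (val b) + 0" for b
    using that PE[of b] by (intro KN_Up) (simp add: PF_iff)
  show "Lo b \<in> KN N" if "b \<in> F" "b = 0 \<or> r \<le> real_of_int (val b) - 0" for b
    using that PE[of b] by (intro KN_Lo) (simp add: PF_iff)
qed

lemma conjugate_by_one: "conjugate_by (mat 1 :: 'e^2^2) H = H"
proof -
  have "matrix_inv (mat 1 :: 'e^2^2) = mat 1" by (rule matrix_inv_unique) simp
  thus ?thesis by (simp add: conjugate_by_def)
qed

text \<open>Pigeonhole in the finite residue field; it shows that the minimum defining
  \<open>residue_char\<close> exists.\<close>

lemma of_nat_in_PE_1: "\<exists>p > 0. of_nat p \<in> pideal val F 1"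
proof -
  have "range (\<lambda>n. frep 1 (of_nat n)) \<subseteq> reps 0 1" by (auto simp: reps_def PF_iff)
  hence "finite (range (\<lambda>n. frep 1 (of_nat n)))" by (rule finite_subset) simp
  hence "\<not> inj (\<lambda>n :: nat. frep 1 (of_nat n))" using range_inj_infinite by blast
  then obtain m n :: nat where mn: "m \<noteq> n" "frep 1 (of_nat m) = frep 1 (of_nat n)" by (auto simp: inj_def)
  define a b where "a = max m n" and "b = min m n"
  have ab: "b < a" "frep 1 (of_nat a) = frep 1 (of_nat b)"
    using mn by (auto simp: a_def b_def max_def min_def)
  have "of_nat a - of_nat b \<in> PE 1" using ab(2) by (simp add: frep_eq_iff)
  hence "of_nat (a - b) \<in> pideal val F 1" using ab(1) by (simp add: PF_iff of_nat_diff)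
  thus ?thesis using ab(1) by (intro exI[of _ "a - b"]) simp
qed

lemma residue_char_PE: "of_nat (residue_char F val) \<in> PE 1"
  using LeastI_ex[OF of_nat_in_PE_1] unfolding residue_char_def by (simp add: PF_iff)

lemma power_near_one: "e - 1 \<in> PE n \<Longrightarrow> e \<in> units_E \<Longrightarrow> e ^ k - 1 \<in> PE n"
proof (induction k)
  case (Suc k)
  have "e ^ Suc k - 1 = e * (e ^ k - 1) + (e - 1)" by (simp add: algebra_simps)
  also have "\<dots> \<in> PE n" using Suc units_E_PE[of e] by (intro PE_add PE_mult_left) auto
  finally show ?case .
qed simp

text \<open>With \<open>p\<close> the residue characteristic, \<open>a^p - 1\<close> is
  \<open>a - 1\<close> times a sum of \<open>p\<close> powers of \<open>a\<close>, each congruent to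
  1; that sum is congruent to \<open>p\<close>, hence in \<open>PE 1\<close>. Each
  \<open>p\<close>-th power gains one step.\<close>

lemma power_residue_char_near_one:
  assumes e: "e - 1 \<in> PE (int n)" and n: "n \<ge> 1"
  shows "e ^ (residue_char F val ^ k) - 1 \<in> PE (int (n + k))"
proof (induction k)
  case (Suc k)
  let ?p = "residue_char F val"
  define a where "a = e ^ (?p ^ k)"
  have a: "a - 1 \<in> PE (int (n + k))" using Suc by (simp add: a_def)
  have au: "a \<in> units_E" using near_one_unit[OF a] n by simp
  have "(\<Sum>i<?p. a ^ i) = (\<Sum>i<?p. a ^ i - 1) + of_nat ?p" by (simp add: sum_subtractf)
  moreover have "(\<Sum>i<?p. a ^ i - 1) \<in> PE 1"
    using power_near_one[OF PE_mono[OF a] au] n by (intro PE_sum) simp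
  ultimately have "(\<Sum>i<?p. a ^ i) \<in> PE 1" using residue_char_PE by auto
  hence "(a - 1) * (\<Sum>i<?p. a ^ i) \<in> PE (int (n + Suc k))" by (rule PE_mult[OF a]) simp
  hence "a ^ ?p - 1 \<in> PE (int (n + Suc k))" by (simp add: power_diff_1_eq)
  thus ?case by (simp add: a_def power_mult[symmetric] mult.commute)
qed (use e in simp)

lemma unit_char_mult: "unit_char ch \<Longrightarrow> x \<in> units_E \<Longrightarrow> y \<in> units_E \<Longrightarrow> ch (x * y) = ch x * ch y"
  by (simp add: unit_char_def)

lemma unit_char_power: "unit_char ch \<Longrightarrow> x \<in> units_E \<Longrightarrow> ch (x ^ k) = ch x ^ k"
  by (induction k) (simp_all add: unit_char_one unit_char_mult)

text \<open>The entries of \<open>g\<close> may have negative valuation, so the precision exceeds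
  \<open>n\<close> by the bound \<open>k\<close> on their denominators.\<close>

lemma det_near:
  assumes g: "g \<in> U11"
  shows "\<exists>m. \<forall>h\<in>U11. (\<forall>i j. h $ i $ j - g $ i $ j \<in> PE m) \<longrightarrow> det h / det g - 1 \<in> PE (int n)"
proof -
  obtain a b c d where gm: "g = mat2 a b c d" by (rule mat2_cases)
  define D where "D = a * d - b * c"
  define k where "k = Max {0, - val a, - val b, - val c, - val d}"
  have k: "k \<ge> 0" "a \<in> PE (- k)" "b \<in> PE (- k)" "c \<in> PE (- k)" "d \<in> PE (- k)"
  proof -
    have fin: "finite {0, - val a, - val b, - val c, - val d}" by simp
    have le: "x \<in> {0, - val a, - val b, - val c, - val d} \<Longrightarrow> x \<le> k" for x
      unfolding k_def by (rule Max_ge[OF fin])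
    show "k \<ge> 0" "a \<in> PE (- k)" "b \<in> PE (- k)" "c \<in> PE (- k)" "d \<in> PE (- k)"
      using le[of 0] le[of "- val a"] le[of "- val b"] le[of "- val c"] le[of "- val d"] by (auto simp: PE_iff)
  qed
  have Du: "D \<in> units_E" using E1_unit[OF det_U11[OF g]] by (simp add: gm D_def)
  have "det h / D - 1 \<in> PE (int n)" if h: "h \<in> U11" "\<forall>i j. h $ i $ j - g $ i $ j \<in> PE (int n + k)" for h
  proof -
    obtain a' b' c' d' where hm: "h = mat2 a' b' c' d'" by (rule mat2_cases)
    have df: "a' - a \<in> PE (int n + k)" "b' - b \<in> PE (int n + k)" "c' - c \<in> PE (int n + k)" "d' - d \<in> PE (int n + k)"
      using h(2)[rule_format, of 1 1] h(2)[rule_format, of 1 2] h(2)[rule_format, of 2 1] h(2)[rule_format, of 2 2]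
      by (simp_all add: hm gm)
    have m: "x * y \<in> PE (int n)" if "x \<in> PE (int n + k)" "y \<in> PE (- k)" for x y
      by (rule PE_mult[OF that]) simp
    have m': "x * y \<in> PE (int n)" if "x \<in> PE (int n + k)" "y \<in> PE (int n + k)" for x y
      by (rule PE_mult[OF that]) (use k in simp)
    have "det h - D = ((a' - a) * d + (d' - d) * a + (a' - a) * (d' - d)) - ((b' - b) * c + (c' - c) * b + (b' - b) * (c' - c))"
      by (simp add: hm D_def algebra_simps)
    also have "\<dots> \<in> PE (int n)"
      by (intro PE_diff PE_add m[OF df(1) k(5)] m[OF df(4) k(2)] m'[OF df(1,4)] m[OF df(2) k(4)] m[OF df(3) k(3)] m'[OF df(2,3)])
    finally have "(det h - D) * inverse D \<in> PE (int n)" using Du by (intro PE_mult_right) (auto intro: units_E_PE)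
    thus ?thesis using units_E_nz[OF Du] by (simp add: left_diff_distrib divide_inverse)
  qed
  thus ?thesis by (intro exI[of _ "int n + k"]) (simp add: gm D_def)
qed

lemma character_U11_det:
  assumes ch: "unit_char ch" shows "character_U11 (\<lambda>g. inverse (ch (det g)) ^ k)"
  unfolding character_U11_def
proof (intro conjI ballI)
  have du: "det g \<in> units_E" if "g \<in> U11" for g using E1_unit[OF det_U11[OF that]] .
  show "inverse (ch (det g)) ^ k \<noteq> 0" if "g \<in> U11" for g
    using ch du[OF that] by (simp add: unit_char_def)
  show "inverse (ch (det (g ** h))) ^ k = inverse (ch (det g)) ^ k * inverse (ch (det h)) ^ k"
    if "g \<in> U11" "h \<in> U11" for g h
    using unit_char_mult[OF ch du[OF that(1)] du[OF that(2)]] by (simp add: det_mul power_mult_distrib)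
  obtain N where N: "N \<ge> 1" "\<And>t. t - 1 \<in> PE (int N) \<Longrightarrow> ch t = 1" using unit_char_near_one[OF ch] by blast
  show "open_in U11 {g \<in> U11. inverse (ch (det g)) ^ k = 1}"
    unfolding open_in_def
  proof (intro conjI ballI)
    fix g assume g: "g \<in> {g \<in> U11. inverse (ch (det g)) ^ k = 1}"
    hence gU: "g \<in> U11" by simp
    obtain m where m: "\<forall>h\<in>U11. (\<forall>i j. h $ i $ j - g $ i $ j \<in> PE m) \<longrightarrow> det h / det g - 1 \<in> PE (int N)"
      using det_near[OF gU] by blast
    have "ch (det h) = ch (det g)" if h: "h \<in> U11" "\<forall>i j. h $ i $ j - g $ i $ j \<in> PE m" for h
    proof -
      have "det h / det g - 1 \<in> PE (int N)" using m h by blast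
      hence "ch (det h / det g) = 1" by (rule N(2))
      moreover have "ch (det h / det g * det g) = ch (det h / det g) * ch (det g)"
        using du[OF h(1)] du[OF gU] by (intro unit_char_mult[OF ch]) auto
      ultimately show ?thesis using units_E_nz[OF du[OF gU]] by simp
    qed
    hence "h \<in> {g \<in> U11. inverse (ch (det g)) ^ k = 1}"
      if "h \<in> U11" "\<forall>i j. h $ i $ j - g $ i $ j \<in> PE m" for h
      using g that by (metis (mono_tags, lifting) mem_Collect_eq)
    thus "\<exists>n. \<forall>h\<in>U11. (\<forall>i j. h $ i $ j - g $ i $ j \<in> PE n) \<longrightarrow> h \<in> {g \<in> U11. inverse (ch (det g)) ^ k = 1}"
      by (intro exI[of _ m] ballI impI)
  qed auto
qed

end

text \<open>\<open>moy_prasad\<close> is given by generators; as the stabilizer is a subgroup,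
  invariance need only be checked on them.\<close>

lemma (in u11_rep) twist_stabilizer:
  assumes \<xi>: "character_U11 \<xi>" and v: "v \<in> V"
  shows "subgroup {g \<in> U11. sc (\<xi> g) (\<pi> g v) = v} GL2"
proof (rule subgroup_GL2I)
  show "{g \<in> U11. sc (\<xi> g) (\<pi> g v) = v} \<subseteq> {g. det g \<noteq> 0}" using U11_subset_GL2 by blast
  show "mat 1 \<in> {g \<in> U11. sc (\<xi> g) (\<pi> g v) = v}" using v character_U11_one[OF \<xi>] by simp
  show "g ** k \<in> {g \<in> U11. sc (\<xi> g) (\<pi> g v) = v}"
    if "g \<in> {g \<in> U11. sc (\<xi> g) (\<pi> g v) = v}" "k \<in> {g \<in> U11. sc (\<xi> g) (\<pi> g v) = v}" for g k
  proof -
    have g: "g \<in> U11" "sc (\<xi> g) (\<pi> g v) = v" and k: "k \<in> U11" "sc (\<xi> k) (\<pi> k v) = v" using that by auto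
    have "sc (\<xi> (g ** k)) (\<pi> (g ** k) v) = sc (\<xi> g) (\<pi> g (sc (\<xi> k) (\<pi> k v)))"
      using g(1) k(1) v by (simp add: character_U11_mult[OF \<xi>] pi_mult pi_scale)
    thus ?thesis using g k by simp
  qed
  show "inv2 g \<in> {g \<in> U11. sc (\<xi> g) (\<pi> g v) = v}" if "g \<in> {g \<in> U11. sc (\<xi> g) (\<pi> g v) = v}" for g
  proof -
    have g: "g \<in> U11" "sc (\<xi> g) (\<pi> g v) = v" using that by auto
    have "sc (\<xi> (inv2 g)) (\<pi> (inv2 g) v) = sc (\<xi> (inv2 g)) (\<pi> (inv2 g) (sc (\<xi> g) (\<pi> g v)))"
      using g(2) by simp
    also have "\<dots> = sc (\<xi> (inv2 g) * \<xi> g) v" using g(1) v by (simp add: pi_scale pi_inv(1))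
    also have "\<dots> = v" using character_U11_inv2[OF \<xi> g(1)] by simp
    finally show ?thesis using g(1) by simp
  qed
qed

context main_rep begin

text \<open>Characters of \<open>U11\<close> are trivial on unipotents, so a twist does not affect
  invariance under \<open>u\<close> and \<open>lo\<close>. Moving the vector back by
  \<open>g\<close>, \<open>no_shallow\<close> applies at every point \<open>x\<close> of the
  apartment.\<close>

lemma depth_twist_lower:
  assumes \<xi>: "character_U11 \<xi>" and g: "g \<in> U11"
    and ne: "invariants (conjugate_by g (moy_prasad_plus x r)) V (\<lambda>g v. sc (\<xi> g) (\<pi> g v)) \<noteq> {0}"
  shows "real l - 1 / 2 \<le> r"
proof -
  have mi: "matrix_inv g = inv2 g" by (rule matrix_inv_eq[OF det_U11_nz[OF g]])
  have "0 \<in> invariants (conjugate_by g (moy_prasad_plus x r)) V (\<lambda>g v. sc (\<xi> g) (\<pi> g v))"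
    using g moy_prasad_plus_U11[of x r] by (auto simp: invariants_def conjugate_by_def mi subset_iff)
  then obtain v where v: "v \<in> V" "v \<noteq> 0"
    and fixed: "\<forall>k\<in>conjugate_by g (moy_prasad_plus x r). sc (\<xi> k) (\<pi> k v) = v"
    using ne unfolding invariants_def by blast
  define v' where "v' = \<pi> (inv2 g) v"
  have v': "v' \<in> V" "v' \<noteq> 0" using v g by (simp_all add: v'_def pi_eq_0)
  have inv: "\<pi> k v' = v'" if k: "k \<in> moy_prasad_plus x r" "\<xi> k = 1" for k
  proof -
    have kU: "k \<in> U11" using k moy_prasad_plus_U11 by blast
    have "g ** k ** inv2 g \<in> conjugate_by g (moy_prasad_plus x r)"
      using k(1) by (auto simp: conjugate_by_def mi)
    hence 1: "sc (\<xi> (g ** k ** inv2 g)) (\<pi> (g ** k ** inv2 g) v) = v" using fixed by blast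
    have "\<xi> (g ** k ** inv2 g) = 1"
      using character_U11_inv2[OF \<xi> g] g kU k(2) by (simp add: character_U11_mult[OF \<xi>] mult.commute)
    with 1 have "\<pi> g (\<pi> k v') = v" using g kU v(1) by (simp add: v'_def pi_mult)
    hence "\<pi> (inv2 g) (\<pi> g (\<pi> k v')) = v'" by (simp add: v'_def)
    thus ?thesis using pi_inv(1)[OF g, of "\<pi> k v'"] kU v'(1) by simp
  qed
  have "u b v' = v'" if b: "b \<in> PF (\<lfloor>r - x\<rfloor> + 1)" for b
    using inv[OF Up_moy_prasad_plus[OF b]] character_U11_Up[OF \<xi>, of b] b by (simp add: PF_iff)
  moreover have "lo c v' = v'" if c: "c \<in> PF (\<lfloor>r + x\<rfloor> + 1)" for c
    using inv[OF Lo_moy_prasad_plus[OF c]] character_U11_Lo[OF \<xi>, of c] c by (simp add: PF_iff)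
  \<comment> \<open>The two floors add up to at most \<open>2 * r\<close>, and the two exponents to
    at least \<open>2 l + 1\<close>; hence the half-integer \<open>l - 1/2\<close>.\<close>
  ultimately have "\<not> (\<lfloor>r - x\<rfloor> + 1) + (\<lfloor>r + x\<rfloor> + 1) \<le> 2 * int l"
    using no_shallow[OF v'(1)] v'(2) by blast
  thus ?thesis by linarith
qed

text \<open>The infimum in \<open>depth\<close> says nothing about an empty set. A deep congruence
  subgroup fixes a given vector and lies in the kernel of \<open>\<xi>\<close>.\<close>

lemma depth_twist_nonempty:
  assumes \<xi>: "character_U11 \<xi>"
  shows "\<exists>r\<ge>0. \<exists>g\<in>U11. \<exists>x. invariants (conjugate_by g (moy_prasad_plus x r)) V (\<lambda>g v. sc (\<xi> g) (\<pi> g v)) \<noteq> {0}"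
proof -
  obtain y where y: "y \<in> Y (int l)" "y \<noteq> 0" using Y_ne by blast
  have yV: "y \<in> V" using y(1) by (simp add: Y_def hfix_def)
  obtain N1 where N1: "N1 \<ge> 1" "\<And>g. g \<in> KN N1 \<Longrightarrow> \<xi> g = 1" using character_U11_near_one[OF \<xi>] by blast
  obtain N2 where N2: "N2 \<ge> 1" "\<forall>g\<in>KN N2. \<pi> g y = y" using smooth[OF yV] by blast
  have M1: "max N1 N2 \<ge> 1" using N1(1) by (simp add: le_max_iff_disj)
  have sub: "KN (max N1 N2) \<subseteq> KN N" if "N \<le> max N1 N2" for N
    using that unfolding KN_def by (auto intro: PE_mono[of _ "int (max N1 N2)"])
  have "y \<in> invariants (conjugate_by (mat 1) (moy_prasad_plus 0 (real (max N1 N2)))) V (\<lambda>g v. sc (\<xi> g) (\<pi> g v))"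
    unfolding invariants_def conjugate_by_one
  proof (intro CollectI conjI ballI yV)
    fix g assume "g \<in> moy_prasad_plus 0 (real (max N1 N2))"
    hence "g \<in> KN (max N1 N2)" using moy_prasad_plus_KN[OF M1] by blast
    hence "g \<in> KN N1" "g \<in> KN N2" using sub[of N1] sub[of N2] by auto
    thus "sc (\<xi> g) (\<pi> g y) = y" using N1(2) N2(2) by simp
  qed
  hence "invariants (conjugate_by (mat 1) (moy_prasad_plus 0 (real (max N1 N2)))) V (\<lambda>g v. sc (\<xi> g) (\<pi> g v)) \<noteq> {0}"
    using y(2) by blast
  thus ?thesis using one_U11 of_nat_0_le_iff by blast
qed

lemma depth_twist_ge: "character_U11 \<xi> \<Longrightarrow> real l - 1 / 2 \<le> depth V (\<lambda>g v. sc (\<xi> g) (\<pi> g v))"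
  unfolding depth_def
proof (rule cInf_greatest)
  assume \<xi>: "character_U11 \<xi>"
  show "{r. 0 \<le> r \<and> (\<exists>g\<in>U11. \<exists>x. invariants (conjugate_by g (moy_prasad_plus x r)) V
      (\<lambda>g v. sc (\<xi> g) (\<pi> g v)) \<noteq> {0})} \<noteq> {}"
    using depth_twist_nonempty[OF \<xi>] by blast
  show "real l - 1 / 2 \<le> r" if "r \<in> {r. 0 \<le> r \<and> (\<exists>g\<in>U11. \<exists>x. invariants
      (conjugate_by g (moy_prasad_plus x r)) V (\<lambda>g v. sc (\<xi> g) (\<pi> g v)) \<noteq> {0})}" for r
    using that depth_twist_lower[OF \<xi>] by blast
qed

text \<open>The twist cancels the central character on the one-units \<open>e\<close> of \<open>E1\<close>: the determinant of \<open>mat e\<close> is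
  \<open>e\<^sup>2\<close>, and \<open>\<eta> e\<close> has order dividing a power \<open>M\<close> of the odd residue characteristic, so that
  \<open>- (M + 1) / 2\<close>-th powers of \<open>(\<eta> e)\<^sup>2\<close> are inverses of \<open>\<eta> e\<close>.\<close>

lemma depth_twist_exists:
  assumes \<eta>: "unit_char \<eta>" "\<forall>z\<in>E1. \<eta> z = central_char sc V \<pi> z"
  shows "\<exists>\<xi>. character_U11 \<xi> \<and> depth V (\<lambda>g v. sc (\<xi> g) (\<pi> g v)) \<le> real l - 1 / 2"
proof -
  obtain N where N: "N \<ge> 1" "\<And>t. t - 1 \<in> PE (int N) \<Longrightarrow> \<eta> t = 1" using unit_char_near_one[OF \<eta>(1)] by blast
  define M where "M = residue_char F val ^ N"
  define k where "k = (M + 1) div 2"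
  have "odd M" using odd_residue_char by (simp add: M_def)
  hence k: "2 * k = M + 1" by (simp add: k_def)
  define \<xi> :: "'e^2^2 \<Rightarrow> complex" where "\<xi> g = inverse (\<eta> (det g)) ^ k" for g
  have \<xi>: "character_U11 \<xi>" unfolding \<xi>_def by (rule character_U11_det[OF \<eta>(1)])
  obtain y where y: "y \<in> Y (int l)" "y \<noteq> 0" using Y_ne by blast
  have yV: "y \<in> V" and hy: "hfix y" using y(1) by (simp_all add: Y_def hfix_def)
  have uy: "u b y = y" if "b \<in> PF (int l)" for b using y(1) that by (simp add: Y_def lev_def)
  have ly: "lo c y = y" if "c \<in> PF (int l + 1)" for c
  proof -
    have "- c \<in> PF (int l + 1)" using that by simp
    hence "u (- c) (j y) = j y" using y(1) by (simp add: Y_def lev_def)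
    thus ?thesis using lo_via_j[of c y y] that yV by (simp add: PF_iff)
  qed
  have ty: "sc (\<xi> (torus_elt t)) (h t y) = y" if t: "t - 1 \<in> PE (int l)" for t
  proof -
    have tu: "t \<in> units_E" using near_one_unit[OF t] l_pos by simp
    have "Nm t - 1 \<in> PE (int l)" by (rule Nm_near_one[OF tu t])
    then obtain e v where ev: "e \<in> E1" "v \<in> F" "v - 1 \<in> PE (int l)" "t = e * v"
      using norm_near_one_decomp[OF _ l_pos] by blast
    have eu: "e \<in> units_E" by (rule E1_unit[OF ev(1)])
    have vu: "v \<in> units_E" using near_one_unit[OF ev(3)] l_pos by simp
    have nz: "e \<noteq> 0" "v \<noteq> 0" using eu vu units_E_nz by auto
    have "e - 1 = inverse v * (t - 1) + (inverse v - 1)" using nz by (simp add: ev(4) field_simps)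
    also have "\<dots> \<in> PE (int l)" using t vu inverse_near_one[OF ev(3) vu]
      by (intro PE_add PE_mult_left) (auto intro: units_E_PE)
    finally have e1: "e - 1 \<in> PE (int l)" .
    \<comment> \<open>\<open>N\<close> successive powers by the residue characteristic gain
      \<open>N\<close> steps beyond \<open>l\<close>.\<close>
    have "e ^ M - 1 \<in> PE (int N)"
      using PE_mono[OF power_residue_char_near_one[OF e1 l_pos, of N]] by (simp add: M_def)
    hence eM: "\<eta> e ^ M = 1" using N(2) unit_char_power[OF \<eta>(1) eu] by metis
    have enz: "\<eta> e \<noteq> 0" using \<eta>(1) eu by (simp add: unit_char_def)
    have "s v = v" by (rule s_fixes[OF ev(2)])
    hence "det (torus_elt t) = e * (v * inverse v) * inverse (s e)"
      by (simp add: torus_mat2 ev(4) s_mult inverse_mult_distrib)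
    hence "det (torus_elt t) = e ^ 2" using nz E1_s[OF ev(1)] by (simp add: power2_eq_square)
    hence "\<xi> (torus_elt t) = inverse (\<eta> e ^ 2) ^ k" by (simp add: \<xi>_def unit_char_power[OF \<eta>(1) eu])
    also have "\<dots> = inverse (\<eta> e ^ (2 * k))" by (simp add: power_inverse power_mult)
    also have "\<dots> = inverse (\<eta> e)" unfolding k using eM by simp
    finally have 1: "\<xi> (torus_elt t) * \<eta> e = 1" using enz by simp
    have "h v y = y" using hy ev(2,3) by (simp add: hfix_def)
    hence "h t y = h e y" using h_h[OF nz yV] by (simp add: ev(4))
    also have "\<dots> = sc (\<eta> e) y" using central[OF ev(1) yV] \<eta>(2) ev(1) by simp
    finally show ?thesis using 1 by simp
  qed
  \<comment> \<open>The point 1/2 is the midpoint of an alcove. Strictly beyond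
    \<open>l - 1/2\<close> the conditions there become \<open>val b \<ge> l\<close>,
    \<open>val c \<ge> l + 1\<close> and \<open>val (t - 1) \<ge> l\<close>, which match the
    invariance of \<open>y\<close>.\<close>
  have "y \<in> invariants (conjugate_by (mat 1) (moy_prasad_plus (1 / 2) (real l - 1 / 2))) V (\<lambda>g v. sc (\<xi> g) (\<pi> g v))"
    unfolding invariants_def conjugate_by_one
  proof (intro CollectI conjI ballI yV)
    fix g assume "g \<in> moy_prasad_plus (1 / 2) (real l - 1 / 2)"
    then obtain r where r: "r > real l - 1 / 2" "g \<in> moy_prasad (1 / 2) r" unfolding moy_prasad_plus_def by blast
    have "moy_prasad (1 / 2) r \<subseteq> {g \<in> U11. sc (\<xi> g) (\<pi> g y) = y}"
    proof (rule moy_prasad_subset[OF twist_stabilizer[OF \<xi> yV]])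
      fix t :: 'e assume t: "t \<noteq> 0" "t = 1 \<or> r \<le> real_of_int (val (t - 1))"
      have "t - 1 \<in> PE (int l)" using t(2) r(1) by (auto simp: PE_iff)
      from ty[OF this] show "torus_elt t \<in> {g \<in> U11. sc (\<xi> g) (\<pi> g y) = y}" using t(1) by simp
    next
      fix b assume b: "b \<in> F" "b = 0 \<or> r \<le> real_of_int (val b) + 1 / 2"
      have "b \<in> PF (int l)" using b r(1) by (auto simp: PF_iff PE_iff)
      thus "Up b \<in> {g \<in> U11. sc (\<xi> g) (\<pi> g y) = y}" using uy character_U11_Up[OF \<xi> b(1)] b(1) by simp
    next
      fix b assume b: "b \<in> F" "b = 0 \<or> r \<le> real_of_int (val b) - 1 / 2"
      have "b \<in> PF (int l + 1)" using b r(1) by (auto simp: PF_iff PE_iff)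
      thus "Lo b \<in> {g \<in> U11. sc (\<xi> g) (\<pi> g y) = y}" using ly character_U11_Lo[OF \<xi> b(1)] b(1) by simp
    qed
    thus "sc (\<xi> g) (\<pi> g y) = y" using r(2) by blast
  qed
  hence ne: "invariants (conjugate_by (mat 1) (moy_prasad_plus (1 / 2) (real l - 1 / 2))) V
    (\<lambda>g v. sc (\<xi> g) (\<pi> g v)) \<noteq> {0}" using y(2) by blast
  have "depth V (\<lambda>g v. sc (\<xi> g) (\<pi> g v)) \<le> real l - 1 / 2"
    unfolding depth_def
  proof (rule cInf_lower)
    have "real l - 1 / 2 \<ge> 0" using l_pos by simp
    thus "real l - 1 / 2 \<in> {r. 0 \<le> r \<and> (\<exists>g\<in>U11. \<exists>x. invariants (conjugate_by g (moy_prasad_plus x r)) V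
      (\<lambda>g v. sc (\<xi> g) (\<pi> g v)) \<noteq> {0})}" using ne one_U11 by blast
    show "bdd_below {r. 0 \<le> r \<and> (\<exists>g\<in>U11. \<exists>x. invariants (conjugate_by g (moy_prasad_plus x r)) V
      (\<lambda>g v. sc (\<xi> g) (\<pi> g v)) \<noteq> {0})}" by (rule bdd_belowI[of _ 0]) simp
  qed
  thus ?thesis using \<xi> by blast
qed

lemma min_depth_eq:
  assumes \<eta>: "unit_char \<eta>" "\<forall>z\<in>E1. \<eta> z = central_char sc V \<pi> z"
  shows "min_depth sc V \<pi> = real l - 1 / 2"
proof -
  obtain \<xi> where \<xi>: "character_U11 \<xi>" "depth V (\<lambda>g v. sc (\<xi> g) (\<pi> g v)) \<le> real l - 1 / 2"
    using depth_twist_exists[OF \<eta>] by blast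
  let ?D = "{depth V (\<lambda>g v. sc (\<xi> g) (\<pi> g v)) | \<xi>. character_U11 \<xi>}"
  have lb: "real l - 1 / 2 \<le> d" if "d \<in> ?D" for d using that depth_twist_ge by blast
  have mem: "depth V (\<lambda>g v. sc (\<xi> g) (\<pi> g v)) \<in> ?D" using \<xi>(1) by blast
  have "min_depth sc V \<pi> \<le> depth V (\<lambda>g v. sc (\<xi> g) (\<pi> g v))"
    unfolding min_depth_def by (rule cInf_lower[OF mem]) (rule bdd_belowI[OF lb])
  moreover have "real l - 1 / 2 \<le> min_depth sc V \<pi>"
    unfolding min_depth_def by (rule cInf_greatest) (use mem lb in blast)+
  ultimately show ?thesis using \<xi>(2) by simp
qed

lemma goodI:
  assumes \<eta>: "unit_char \<eta>" "\<forall>z\<in>E1. \<eta> z = central_char sc V \<pi> z" and c: "char_conductor_F \<eta> \<le> l"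
  shows "good l \<eta>"
proof -
  let ?P = "\<lambda>n. \<forall>x\<in>U_F n. \<eta> x = 1"
  obtain N where N: "N \<ge> 1" "\<And>t. t - 1 \<in> PE (int N) \<Longrightarrow> \<eta> t = 1" using unit_char_near_one[OF \<eta>(1)] by blast
  have "?P N" using N by (simp add: U_F_iff)
  hence P: "?P (char_conductor_F \<eta>)" unfolding char_conductor_F_def by (rule LeastI)
  have "\<eta> x = 1" if x: "x \<in> F" "x - 1 \<in> PE (int l)" for x
  proof (cases "char_conductor_F \<eta> = 0")
    case True
    have "x \<in> U_F 0" using x near_one_unit[OF x(2)] l_pos by (simp add: U_F_def units_F_iff)
    thus ?thesis using P True by simp
  next
    case False
    have "x - 1 \<in> PE (int (char_conductor_F \<eta>))" using PE_mono[OF x(2)] c by simp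
    thus ?thesis using P False x(1) by (simp add: U_F_iff)
  qed
  thus ?thesis using \<eta> by (simp add: good_def)
qed

end

theorem theorem4p3p1:
  fixes F :: "'e::field set" and val :: "'e \<Rightarrow> int" and s :: "'e \<Rightarrow> 'e" and unif :: 'e
    and sc :: "complex \<Rightarrow> 'v::ab_group_add \<Rightarrow> 'v" and V :: "'v set"
    and \<pi> :: "'e^2^2 \<Rightarrow> 'v \<Rightarrow> 'v" and \<eta> :: "'e \<Rightarrow> complex"
  assumes "unramified_quadratic F val s unif"
    and "vector_space sc"
    and "unramified_quadratic.ramified_U11 F val s sc V \<pi>"
    and "unramified_quadratic.unit_char val \<eta>"
    and "\<forall>z \<in> unramified_quadratic.E1 s. \<eta> z = unramified_quadratic.central_char sc V \<pi> z"
    and "real (unramified_quadratic.char_conductor_F F val \<eta>)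
           \<le> unramified_quadratic.min_depth F val s sc V \<pi> + 1 / 2"
  shows "unramified_quadratic.conductor F val s unif sc V \<pi>
           = unramified_quadratic.eta_conductor F val s unif sc V \<pi> \<eta>
       \<and> real (unramified_quadratic.conductor F val s unif sc V \<pi>)
           = 2 * unramified_quadratic.min_depth F val s sc V \<pi> + 2
       \<and> (\<forall>m. finite_dimensional sc (unramified_quadratic.eta_space F val s sc V \<pi> \<eta> m)
           \<and> int (vector_space.dim sc (unramified_quadratic.eta_space F val s sc V \<pi> \<eta> m))
             = max (int m - int (unramified_quadratic.conductor F val s unif sc V \<pi>) + 1) 0)"
proof -
  interpret unramified_quadratic F val s unif by fact
  interpret vector_space sc by fact
  have "supercuspidal U11 sc V \<pi>" using assms(3) by (simp add: ramified_U11_def)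
  hence "u11_rep F val s unif sc V \<pi>" by unfold_locales (simp_all add: supercuspidal_def)
  then obtain l where "main_rep F val s unif sc V \<pi> l" using u11_rep.ramified_level assms(3) by blast
  then interpret main_rep F val s unif sc V \<pi> l .
  \<comment> \<open>The depth has to be known first: only then does the hypothesis on the conductor
    of \<open>\<eta>\<close> become the bound \<open>l\<close> required by
    \<open>goodI\<close>.\<close>
  have d: "min_depth sc V \<pi> = real l - 1 / 2" by (rule min_depth_eq[OF assms(4,5)])
  have g: "good l \<eta>" using assms(6) d by (intro goodI[OF assms(4,5)]) simp
  show ?thesis
    using conductor_eq[OF g] eta_conductor_eq[OF g] eta_space_dim[OF g] d by simp
qed

end
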